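(* Let $n\ge 2$, $N\ge 1$, and let $\mathcal F^*_{(1)^N}$ be the graded tensor product of $N$ copies of the formal evaluation module associated with the fundamental $n$-dimensional representation $\pi$ of $\mathfrak{sl}_n$. As graded vector spaces and $\mathfrak{sl}_n$-modules, $$\mathcal F^*_{(1)^N}\simeq\bigoplus_{\mu\vdash N,\ \ell(\mu)\le n}\pi_\mu\otimes M_{\mu,(1)^N},$$ where $M_{\mu,(1)^N}$ is the graded multiplicity space of the irreducible $S_N$-representation $W_\mu$ in the quotient ring $R_N$.
   Context: Let $\pi=\mathbb C^n$ be the fundamental $\mathfrak{sl}_n(\mathbb C)$-module of highest weight $\omega_1$, with standard basis $v_0,\dots,v_{n-1}$, $v_0$ the highest weight vector; $\mathfrak n_-\subset\mathfrak{sl}_n$ is the subalgebra of strictly lower triangular matrices. For a partition $\mu$ with $\ell(\mu)\le n$ parts, $\pi_\mu$ is the irreducible $\mathfrak{sl}_n$-module of highest weight $\sum_{i=1}^{n-1}(\mu_i-\mu_{i+1})\omega_i$. Graded tensor product of formal evaluation modules. Let $V_N(\mathcal Z)=\pi^{\otimes N}\otimes\mathbb C[z_1,\dots,z_N]$ with $z_i$ formal variables, on which $x\otimes f(t)\in\mathfrak{sl}_n\otimes\mathbb C[t]$ acts as $\sum_{i=1}^N x^{(i)}f(z_i)$, where $x^{(i)}$ is $x$ acting on the $i$-th tensor factor. Let $w_0=(v_0\otimes\cdots\otimes v_0)\otimes 1$ and $\mathcal F_N=U(\mathfrak n_-\otimes\mathbb C[t])w_0$, graded by homogeneous degree in the $z_i$: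 $\mathcal F_N=\bigoplus_m\mathcal F_N^{(m)}$, and $\mathcal F_N^{(\le m)}=\bigoplus_{m'\le m}\mathcal F_N^{(m')}$. Put $\widetilde{\mathcal F}_N^{(m)}=\big(\mathbb C[z_1,\dots,z_N]\cdot\mathcal F_N^{(\le m-1)}\big)\cap\mathcal F_N^{(m)}$ and $\mathcal F^*_{(1)^N}=\bigoplus_{m\ge0}\mathcal F_N^{(m)}/\widetilde{\mathcal F}_N^{(m)}$, with $m$ the grading. The $\mathfrak{sl}_n$-action is the one induced from $V_N(\mathcal Z)$, via the identification of $\mathcal F_N^{(m)}/\widetilde{\mathcal F}_N^{(m)}$ with the degree-$m$ part of $\mathbb C[z_1,\dots,z_N]\cdot\mathcal F_N^{(\le m)}$ modulo the degree-$m$ part of $\mathbb C[z_1,\dots,z_N]\cdot\mathcal F_N^{(\le m-1)}$, both of which are $\mathfrak{sl}_n$-stable. The ring $R_N$. $R_N=\mathbb C[z_1,\dots,z_N]/J_N$, where $J_N$ is the ideal generated by the elementary symmetric polynomials $E_1,\dots,E_N$ in $z_1,\dots,z_N$. It is graded by degree in the $z_i$ and $S_N$ acts by permuting variables. $R_N\simeq\bigoplus_{\lambda\vdash N}W_\lambda\otimes M_{\lambda,(1)^N}$, with $W_\lambda$ the irreducible Specht module over $\mathbb C$ ($W_{(N)}$ trivial) and $M_{\lambda,(1)^N}$ graded vector spaces. *)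

theory Defs
  imports
    "HOL-Library.Poly_Mapping"
    "HOL-Combinatorics.Permutations"
    "HOL-Algebra.QuotRing"
    "Jordan_Normal_Form.VS_Connect"
begin

text \<open>The HOL-Algebra notions, as opposed to those of \<open>HOL.Modules\<close>.\<close>

abbreviation mspan :: "('a, 'r) ring_scheme \<Rightarrow> ('a, 'v, 'z) module_scheme \<Rightarrow> 'v set \<Rightarrow> 'v set" where
  "mspan \<equiv> LinearCombinations.module.span"

abbreviation linear_maps :: "(complex, 'v, 'y) module_scheme \<Rightarrow> (complex, 'w, 'z) module_scheme
    \<Rightarrow> ('v \<Rightarrow> 'w) set" where
  "linear_maps V W \<equiv> LinearCombinations.module_hom class_ring V W"

section \<open>Complex vector spaces with a family of operators\<close>

text \<open>
  The vector space structure is that of the module records of HOL-Algebra over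
  \<open>class_ring :: complex ring\<close>. The fields \<open>mult\<close> and \<open>one\<close>, inherited from the record
  type of rings, play no role.
\<close>

record ('x, 'v) rep = "(complex, 'v) module" +
  act :: "'x \<Rightarrow> 'v \<Rightarrow> 'v"

definition mk_rep :: "'v set \<Rightarrow> 'v \<Rightarrow> ('v \<Rightarrow> 'v \<Rightarrow> 'v) \<Rightarrow> (complex \<Rightarrow> 'v \<Rightarrow> 'v)
    \<Rightarrow> ('x \<Rightarrow> 'v \<Rightarrow> 'v) \<Rightarrow> ('x, 'v) rep" where
  "mk_rep C z p s a =
     \<lparr>carrier = C, mult = undefined, one = undefined, zero = z, add = p, smult = s, act = a\<rparr>"

definition equivariant :: "'x set \<Rightarrow> ('x, 'v) rep \<Rightarrow> ('x, 'w) rep \<Rightarrow> ('v \<Rightarrow> 'w) \<Rightarrow> bool" where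
  "equivariant X V W f \<longleftrightarrow> (\<forall>x\<in>X. \<forall>v\<in>carrier V. f (act V x v) = act W x (f v))"

definition quot_rep :: "('x, 'v) rep \<Rightarrow> 'v set \<Rightarrow> ('x, 'v set) rep" where
  "quot_rep V H = mk_rep (a_rcosets\<^bsub>V\<^esub> H) H (set_add V)
     (\<lambda>c Q. \<Union>v\<in>Q. H +>\<^bsub>V\<^esub> (c \<odot>\<^bsub>V\<^esub> v))
     (\<lambda>x Q. \<Union>v\<in>Q. H +>\<^bsub>V\<^esub> act V x v)"

definition direct_sum_rep :: "'i set \<Rightarrow> ('i \<Rightarrow> ('x, 'v) rep) \<Rightarrow> ('x, 'i \<Rightarrow> 'v) rep" where
  "direct_sum_rep I V = mk_rep
     {f \<in> (\<Pi>\<^sub>E i\<in>I. carrier (V i)). finite {i\<in>I. f i \<noteq> \<zero>\<^bsub>V i\<^esub>}}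
     (\<lambda>i\<in>I. \<zero>\<^bsub>V i\<^esub>)
     (\<lambda>f g. \<lambda>i\<in>I. f i \<oplus>\<^bsub>V i\<^esub> g i)
     (\<lambda>c f. \<lambda>i\<in>I. c \<odot>\<^bsub>V i\<^esub> f i)
     (\<lambda>x f. \<lambda>i\<in>I. act (V i) x (f i))"

text \<open>The linear extension of a map between bases.\<close>

definition reindex :: "('a \<Rightarrow> 'b) \<Rightarrow> ('a \<Rightarrow>\<^sub>0 'c::comm_monoid_add) \<Rightarrow> 'b \<Rightarrow>\<^sub>0 'c" where
  "reindex f p = (\<Sum>k\<in>Poly_Mapping.keys p. Poly_Mapping.single (f k) (Poly_Mapping.lookup p k))"

text \<open>The vector space with basis \<open>S\<close>, with operators given by their effect on the basis.\<close>

definition free_rep :: "'a set \<Rightarrow> ('x \<Rightarrow> 'a \<Rightarrow> 'a) \<Rightarrow> ('x, 'a \<Rightarrow>\<^sub>0 complex) rep" where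
  "free_rep S a = mk_rep {p. Poly_Mapping.keys p \<subseteq> S} 0 (+)
     (\<lambda>c. Poly_Mapping.map ((*) c)) (\<lambda>x. reindex (a x))"

text \<open>
  \<open>V \<otimes> M\<close>, with the operators acting on the first factor: the free vector space on
  \<open>carrier V \<times> carrier M\<close> modulo the bilinearity relations.
\<close>

definition bilinear_relations :: "('x, 'v) rep \<Rightarrow> (complex, 'w, 'z) module_scheme
    \<Rightarrow> (('v \<times> 'w) \<Rightarrow>\<^sub>0 complex) set" where
  "bilinear_relations V M =
     (let e = (\<lambda>v w. Poly_Mapping.single (v, w) (1::complex)) in
       {e (v \<oplus>\<^bsub>V\<^esub> v') w - e v w - e v' w | v v' w.
          v \<in> carrier V \<and> v' \<in> carrier V \<and> w \<in> carrier M} \<union>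
       {e v (w \<oplus>\<^bsub>M\<^esub> w') - e v w - e v w' | v w w'.
          v \<in> carrier V \<and> w \<in> carrier M \<and> w' \<in> carrier M} \<union>
       {e (c \<odot>\<^bsub>V\<^esub> v) w - Poly_Mapping.single (v, w) c | c v w.
          v \<in> carrier V \<and> w \<in> carrier M} \<union>
       {e v (c \<odot>\<^bsub>M\<^esub> w) - Poly_Mapping.single (v, w) c | c v w.
          v \<in> carrier V \<and> w \<in> carrier M})"

definition tensor_rep :: "('x, 'v) rep \<Rightarrow> (complex, 'w, 'z) module_scheme
    \<Rightarrow> ('x, (('v \<times> 'w) \<Rightarrow>\<^sub>0 complex) set) rep" where
  "tensor_rep V M =
     (let T = free_rep (carrier V \<times> carrier M) (\<lambda>x (v, w). (act V x v, w))
      in quot_rep T (mspan class_ring T (bilinear_relations V M)))"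

definition hom_space :: "'x set \<Rightarrow> ('x, 'v) rep \<Rightarrow> ('x, 'w) rep \<Rightarrow> (complex, 'v \<Rightarrow> 'w) module" where
  "hom_space X V W =
     \<lparr>carrier = {f \<in> linear_maps V W \<inter> extensional (carrier V). equivariant X V W f},
      mult = undefined, one = undefined,
      zero = (\<lambda>v\<in>carrier V. \<zero>\<^bsub>W\<^esub>),
      add = (\<lambda>f g. \<lambda>v\<in>carrier V. f v \<oplus>\<^bsub>W\<^esub> g v),
      smult = (\<lambda>c f. \<lambda>v\<in>carrier V. c \<odot>\<^bsub>W\<^esub> f v)\<rparr>"


section \<open>Modules over the Lie algebra of traceless matrices\<close>

definition sl :: "nat \<Rightarrow> complex mat set" where
  "sl n = {x \<in> carrier_mat n n. (\<Sum>i<n. x $$ (i, i)) = 0}"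

definition sl_lower :: "nat \<Rightarrow> complex mat set" where
  "sl_lower n = {x \<in> sl n. \<forall>i<n. \<forall>j<n. i \<le> j \<longrightarrow> x $$ (i, j) = 0}"

definition sl_upper :: "nat \<Rightarrow> complex mat set" where
  "sl_upper n = {x \<in> sl n. \<forall>i<n. \<forall>j<n. j \<le> i \<longrightarrow> x $$ (i, j) = 0}"

definition sl_diag :: "nat \<Rightarrow> complex mat set" where
  "sl_diag n = {x \<in> sl n. diagonal_mat x}"

definition sl_module :: "nat \<Rightarrow> (complex mat, 'v) rep \<Rightarrow> bool" where
  "sl_module n V \<longleftrightarrow> vectorspace class_ring V \<and>
     (\<forall>x\<in>sl n. act V x \<in> linear_maps V V) \<and>
     (\<forall>x\<in>sl n. \<forall>y\<in>sl n. \<forall>v\<in>carrier V. act V (x + y) v = act V x v \<oplus>\<^bsub>V\<^esub> act V y v) \<and>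
     (\<forall>c. \<forall>x\<in>sl n. \<forall>v\<in>carrier V. act V (c \<cdot>\<^sub>m x) v = c \<odot>\<^bsub>V\<^esub> act V x v) \<and>
     (\<forall>x\<in>sl n. \<forall>y\<in>sl n. \<forall>v\<in>carrier V.
        act V (x * y - y * x) v = act V x (act V y v) \<ominus>\<^bsub>V\<^esub> act V y (act V x v))"

definition irreducible_sl_module :: "nat \<Rightarrow> (complex mat, 'v) rep \<Rightarrow> bool" where
  "irreducible_sl_module n V \<longleftrightarrow> sl_module n V \<and> carrier V \<noteq> {\<zero>\<^bsub>V\<^esub>} \<and>
     (\<forall>H. subspace class_ring H V \<and> (\<forall>x\<in>sl n. \<forall>v\<in>H. act V x v \<in> H)
        \<longrightarrow> H = {\<zero>\<^bsub>V\<^esub>} \<or> H = carrier V)"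

text \<open>For an irreducible module, a highest weight vector generates the module.\<close>

definition has_highest_weight :: "nat \<Rightarrow> (complex mat, 'v) rep \<Rightarrow> (complex mat \<Rightarrow> complex) \<Rightarrow> bool" where
  "has_highest_weight n V wt \<longleftrightarrow> (\<exists>v\<in>carrier V. v \<noteq> \<zero>\<^bsub>V\<^esub> \<and>
     (\<forall>x\<in>sl_upper n. act V x v = \<zero>\<^bsub>V\<^esub>) \<and>
     (\<forall>h\<in>sl_diag n. act V h v = wt h \<odot>\<^bsub>V\<^esub> v))"

definition fundamental_weight :: "nat \<Rightarrow> complex mat \<Rightarrow> complex" where
  "fundamental_weight i h = (\<Sum>j<i. h $$ (j, j))"

definition sl_isomorphic :: "nat \<Rightarrow> (complex mat, 'v) rep \<Rightarrow> (complex mat, 'w) rep \<Rightarrow> bool" where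
  "sl_isomorphic n V W \<longleftrightarrow> sl_module n V \<and> sl_module n W \<and>
     (\<exists>f \<in> linear_maps V W.
        bij_betw f (carrier V) (carrier W) \<and> equivariant (sl n) V W f)"

text \<open>A graded module is the family of its homogeneous components.\<close>

definition graded_sl_isomorphic ::
    "nat \<Rightarrow> (nat \<Rightarrow> (complex mat, 'v) rep) \<Rightarrow> (nat \<Rightarrow> (complex mat, 'w) rep) \<Rightarrow> bool" where
  "graded_sl_isomorphic n V W \<longleftrightarrow> (\<forall>m. sl_isomorphic n (V m) (W m))"


section \<open>Partitions\<close>

definition partitions :: "nat \<Rightarrow> nat list set" where
  "partitions N = {\<mu>. sorted_wrt (\<ge>) \<mu> \<and> 0 \<notin> set \<mu> \<and> sum_list \<mu> = N}"

text \<open>The parts are numbered from 1, and \<open>part \<mu> i = 0\<close> beyond the length of \<open>\<mu>\<close>.\<close>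

definition part :: "nat list \<Rightarrow> nat \<Rightarrow> nat" where
  "part \<mu> i = (if 1 \<le> i \<and> i \<le> length \<mu> then \<mu> ! (i - 1) else 0)"

definition partition_weight :: "nat \<Rightarrow> nat list \<Rightarrow> complex mat \<Rightarrow> complex" where
  "partition_weight n \<mu> h =
     (\<Sum>i=1..n-1. (of_nat (part \<mu> i) - of_nat (part \<mu> (Suc i))) * fundamental_weight i h)"


section \<open>Specht modules\<close>

text \<open>
  A tableau of shape \<open>\<mu>\<close> is a bijective filling of the cells with the numbers \<open>0, \<dots>, |\<mu>| - 1\<close>;
  its tabloid is the list of its rows, each taken as a set.
\<close>

definition diagram :: "nat list \<Rightarrow> (nat \<times> nat) set" where
  "diagram \<mu> = {(i, j). i < length \<mu> \<and> j < \<mu> ! i}"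

definition tableaux :: "nat list \<Rightarrow> (nat \<times> nat \<Rightarrow> nat) set" where
  "tableaux \<mu> = {t. bij_betw t (diagram \<mu>) {..<sum_list \<mu>}}"

definition tabloid :: "nat list \<Rightarrow> (nat \<times> nat \<Rightarrow> nat) \<Rightarrow> nat set list" where
  "tabloid \<mu> t = map (\<lambda>i. t ` {(i, j) | j. j < \<mu> ! i}) [0..<length \<mu>]"

definition column_stabilizer :: "nat list \<Rightarrow> (nat \<times> nat \<Rightarrow> nat) \<Rightarrow> (nat \<Rightarrow> nat) set" where
  "column_stabilizer \<mu> t = {\<sigma>. \<sigma> permutes {..<sum_list \<mu>} \<and>
     (\<forall>(i, j)\<in>diagram \<mu>. \<exists>i'. (i', j) \<in> diagram \<mu> \<and> \<sigma> (t (i, j)) = t (i', j))}"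

definition polytabloid :: "nat list \<Rightarrow> (nat \<times> nat \<Rightarrow> nat) \<Rightarrow> nat set list \<Rightarrow>\<^sub>0 complex" where
  "polytabloid \<mu> t =
     (\<Sum>\<sigma>\<in>column_stabilizer \<mu> t. Poly_Mapping.single (tabloid \<mu> (\<sigma> \<circ> t)) (of_int (sign \<sigma>)))"

definition tabloid_rep :: "nat list \<Rightarrow> (nat \<Rightarrow> nat, nat set list \<Rightarrow>\<^sub>0 complex) rep" where
  "tabloid_rep \<mu> = free_rep (tabloid \<mu> ` tableaux \<mu>) (\<lambda>\<sigma>. map (image \<sigma>))"

definition specht :: "nat list \<Rightarrow> (nat \<Rightarrow> nat, nat set list \<Rightarrow>\<^sub>0 complex) rep" where
  "specht \<mu> = (tabloid_rep \<mu>)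
     \<lparr>carrier := mspan class_ring (tabloid_rep \<mu>) (polytabloid \<mu> ` tableaux \<mu>)\<rparr>"


section \<open>The ring $R_N$ and its multiplicity spaces\<close>

text \<open>
  The variables $z_1, \dots, z_N$ are numbered \<open>0, \<dots>, N - 1\<close>. The type \<open>zpoly\<close> has
  infinitely many variables; \<open>zpoly_ring N\<close> is the subring of polynomials in the first \<open>N\<close>.
\<close>

type_synonym zpoly = "(nat \<Rightarrow>\<^sub>0 nat) \<Rightarrow>\<^sub>0 complex"

definition zconst :: "complex \<Rightarrow> zpoly" where
  "zconst c = Poly_Mapping.single 0 c"

definition zvar :: "nat \<Rightarrow> zpoly" where
  "zvar i = Poly_Mapping.single (Poly_Mapping.single i 1) 1"

definition zpoly_ring :: "nat \<Rightarrow> zpoly ring" where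
  "zpoly_ring N =
     class_ring\<lparr>carrier := {p. \<forall>k\<in>Poly_Mapping.keys p. Poly_Mapping.keys k \<subseteq> {..<N}}\<rparr>"

definition zhom :: "nat \<Rightarrow> zpoly set" where
  "zhom m = {p. \<forall>k\<in>Poly_Mapping.keys p.
     (\<Sum>i\<in>Poly_Mapping.keys k. Poly_Mapping.lookup k i) = m}"

definition zpoly_rep :: "nat \<Rightarrow> (nat \<Rightarrow> nat, zpoly) rep" where
  "zpoly_rep N = mk_rep (carrier (zpoly_ring N)) 0 (+) (\<lambda>c p. zconst c * p)
     (\<lambda>\<sigma>. reindex (reindex \<sigma>))"

definition elem_sym :: "nat \<Rightarrow> nat \<Rightarrow> zpoly" where
  "elem_sym N k = (\<Sum>S | S \<subseteq> {..<N} \<and> card S = k. \<Prod>i\<in>S. zvar i)"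

definition J :: "nat \<Rightarrow> zpoly set" where
  "J N = Idl\<^bsub>zpoly_ring N\<^esub> (elem_sym N ` {1..N})"

text \<open>The homogeneous component of degree \<open>m\<close> of $R_N$, as a representation of $S_N$.\<close>

definition R_deg :: "nat \<Rightarrow> nat \<Rightarrow> (nat \<Rightarrow> nat, zpoly set) rep" where
  "R_deg N m = (quot_rep (zpoly_rep N) (J N))
     \<lparr>carrier := (\<lambda>p. J N +>\<^bsub>zpoly_ring N\<^esub> p) ` (carrier (zpoly_ring N) \<inter> zhom m)\<rparr>"

text \<open>
  The degree \<open>m\<close> part of the multiplicity space $M_{\mu,(1)^N}$ of \<open>specht \<mu>\<close> in $R_N$, namely
  $\mathrm{Hom}_{S_N}(W_\mu, R_N^{(m)})$.
\<close>

definition multiplicity_space :: "nat \<Rightarrow> nat list \<Rightarrow> nat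
    \<Rightarrow> (complex, (nat set list \<Rightarrow>\<^sub>0 complex) \<Rightarrow> zpoly set) module" where
  "multiplicity_space N \<mu> m = hom_space {\<sigma>. \<sigma> permutes {..<N}} (specht \<mu>) (R_deg N m)"


section \<open>The graded tensor product\<close>

text \<open>
  The basis vector $v_{a_1} \otimes \dots \otimes v_{a_N}$ of $\pi^{\otimes N}$ is encoded as the
  list \<open>[a\<^sub>1, \<dots>, a\<^sub>N]\<close>, so that $V_N(\mathcal Z)$ is the free module on these words over the
  polynomial ring.
\<close>

type_synonym zvec = "nat list \<Rightarrow>\<^sub>0 zpoly"

definition V_carrier :: "nat \<Rightarrow> nat \<Rightarrow> zvec set" where
  "V_carrier n N = {v.
     (\<forall>w\<in>Poly_Mapping.keys v. length w = N \<and> set w \<subseteq> {..<n}) \<and>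
     (\<forall>w. Poly_Mapping.lookup v w \<in> carrier (zpoly_ring N))}"

definition zscale :: "zpoly \<Rightarrow> zvec \<Rightarrow> zvec" where
  "zscale p = Poly_Mapping.map ((*) p)"

text \<open>\<open>site_act x i\<close> applies the matrix \<open>x\<close> to the tensor factor \<open>i\<close> (counted from 0).\<close>

definition site_act :: "complex mat \<Rightarrow> nat \<Rightarrow> zvec \<Rightarrow> zvec" where
  "site_act x i v = (\<Sum>w\<in>Poly_Mapping.keys v. \<Sum>b<dim_row x.
     Poly_Mapping.single (w[i := b]) (zconst (x $$ (b, w ! i)) * Poly_Mapping.lookup v w))"

text \<open>The action of $x \otimes f(t)$; the scalar factor is $f(z_i)$.\<close>

definition current_act :: "nat \<Rightarrow> complex mat \<Rightarrow> complex poly \<Rightarrow> zvec \<Rightarrow> zvec" where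
  "current_act N x f v = (\<Sum>i<N. zscale (poly (map_poly zconst f) (zvar i)) (site_act x i v))"

definition V_rep :: "nat \<Rightarrow> nat \<Rightarrow> (complex mat, zvec) rep" where
  "V_rep n N = mk_rep (V_carrier n N) 0 (+) (\<lambda>c. zscale (zconst c)) (\<lambda>x. current_act N x 1)"

definition V_zmodule :: "nat \<Rightarrow> nat \<Rightarrow> (zpoly, zvec) module" where
  "V_zmodule n N = \<lparr>carrier = V_carrier n N, mult = undefined, one = undefined,
     zero = 0, add = (+), smult = zscale\<rparr>"

definition V_deg :: "nat \<Rightarrow> nat \<Rightarrow> nat \<Rightarrow> zvec set" where
  "V_deg n N m = {v \<in> V_carrier n N. \<forall>w. Poly_Mapping.lookup v w \<in> zhom m}"

definition w0 :: "nat \<Rightarrow> zvec" where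
  "w0 N = Poly_Mapping.single (replicate N 0) 1"

text \<open>$U(\mathfrak n_- \otimes \mathbb C[t]) w_0$ is spanned by the iterated actions on $w_0$.\<close>

definition F :: "nat \<Rightarrow> nat \<Rightarrow> zvec set" where
  "F n N = mspan class_ring (V_rep n N)
     {foldr (\<lambda>(x, f). current_act N x f) us (w0 N) | us. set us \<subseteq> sl_lower n \<times> UNIV}"

definition F_deg :: "nat \<Rightarrow> nat \<Rightarrow> nat \<Rightarrow> zvec set" where
  "F_deg n N m = F n N \<inter> V_deg n N m"

text \<open>\<open>F_below n N m\<close> is $\mathcal F_N^{(\le m-1)}$, which is zero for \<open>m = 0\<close>.\<close>

definition F_below :: "nat \<Rightarrow> nat \<Rightarrow> nat \<Rightarrow> zvec set" where
  "F_below n N m = {(\<Sum>k<m. u k) | u. \<forall>k<m. u k \<in> F_deg n N k}"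

text \<open>\<open>ZF_below n N m\<close> is $\mathbb C[z_1, \dots, z_N] \cdot \mathcal F_N^{(\le m-1)}$.\<close>

definition ZF_below :: "nat \<Rightarrow> nat \<Rightarrow> nat \<Rightarrow> zvec set" where
  "ZF_below n N m = mspan (zpoly_ring N) (V_zmodule n N) (F_below n N m)"

definition F_tilde :: "nat \<Rightarrow> nat \<Rightarrow> nat \<Rightarrow> zvec set" where
  "F_tilde n N m = ZF_below n N m \<inter> F_deg n N m"

text \<open>
  The quotient of the degree \<open>m\<close> part \<open>A\<close> of
  $\mathbb C[z_1, \dots, z_N] \cdot \mathcal F_N^{(\le m)}$ by the degree \<open>m\<close> part \<open>X\<close> of
  $\mathbb C[z_1, \dots, z_N] \cdot \mathcal F_N^{(\le m-1)}$, with the action of $\mathfrak{sl}_n$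
  induced from $V_N(\mathcal Z)$.
\<close>

definition ZF_quot :: "nat \<Rightarrow> nat \<Rightarrow> nat \<Rightarrow> (complex mat, zvec set) rep" where
  "ZF_quot n N m =
     (let A = ZF_below n N (Suc m) \<inter> V_deg n N m; X = ZF_below n N m \<inter> V_deg n N m
      in quot_rep ((V_rep n N)\<lparr>carrier := A\<rparr>) X)"

text \<open>
  The degree \<open>m\<close> component of the graded tensor product. \<open>F_deg n N m\<close> itself is not stable under
  $\mathfrak{sl}_n$; the action is transported along the identification with \<open>ZF_quot n N m\<close>, which
  sends a coset \<open>Q\<close> of \<open>F_tilde n N m\<close> to the coset \<open>X + Q\<close> (where \<open>X\<close>, the zero element of
  \<open>ZF_quot n N m\<close>, meets \<open>F_deg n N m\<close> in \<open>F_tilde n N m\<close>), and whose inverse intersects a coset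
  of \<open>X\<close> with \<open>F_deg n N m\<close>.
\<close>

definition graded_tensor_product :: "nat \<Rightarrow> nat \<Rightarrow> nat \<Rightarrow> (complex mat, zvec set) rep" where
  "graded_tensor_product n N m =
     (quot_rep ((V_rep n N)\<lparr>carrier := F_deg n N m\<rparr>) (F_tilde n N m))
     \<lparr>act := \<lambda>x Q. F_deg n N m \<inter>
        act (ZF_quot n N m) x (\<zero>\<^bsub>ZF_quot n N m\<^esub> <+>\<^bsub>V_rep n N\<^esub> Q)\<rparr>"

end

theory Submission
  imports Defs
begin

text \<open>
  Both the symmetric group and the current algebra act on $\pi^{\otimes N} \otimes \mathbb C[z_1, \dots, z_N]$,
  and the two actions commute, so that everything generated from the invariant vector $w_0$ is invariant.
  Conversely every invariant of degree \<open>m\<close> lies in \<open>F_deg n N m\<close> up to polynomial multiples of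
  elements of lower degree, and it is a combination of such multiples exactly when its coefficients lie in \<open>J N\<close>.
  Hence the degree \<open>m\<close> component of the graded tensor product is that of $(\pi^{\otimes N} \otimes R_N)^{S_N}$,
  where $R_N$ is realized by the polynomials orthogonal to the ideal \<open>J N\<close> for the Hermitian form in which the
  monomials are orthonormal.

  This space carries a Hermitian form for which the adjoint of a matrix acts as the adjoint operator. It is
  therefore the orthogonal sum of the submodules generated by its highest weight vectors, and it remains to count
  these. The coefficients of a highest weight vector of weight \<open>\<mu>\<close> are functions on the words of content
  \<open>\<mu>\<close>, that is, on the tabloids of shape \<open>\<mu>\<close>. Being killed by the raising operators is the
  description of the Specht module as an intersection of kernels, so pairing with such a vector identifies the
  highest weight vectors with the equivariant maps from the Specht module to $R_N$.
\<close>

text \<open>The modules \<open>\<pi> \<mu>\<close> are known only through irreducibility and their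
  highest weight, so a map out of one of them cannot be written down: it is generated as a graph,
  and the Hermitian form on the target shows that the graph is single-valued. That highest weight
  vectors account for everything rests on one fact: no nonzero stable subspace is orthogonal to all
  of them. Cosets carry no evident form, which is why each of them is replaced by its harmonic
  representative.

  A lowering operator multiplies by a power of a variable only at a position whose letter it
  increases, so it never puts an exponent on a letter 0. Products with power sums supply the missing
  terms; this is where polynomial multiples of elements of lower degree become unavoidable.

  The kernel description of the Specht module rests on leading words. That of a highest weight
  function is a ballot word, and each ballot word of content \<open>\<mu>\<close> is the leading
  word, with coefficient 1, of a polytabloid.\<close>

abbreviation cf :: "('a \<Rightarrow>\<^sub>0 'b::zero) \<Rightarrow> 'a \<Rightarrow> 'b" where
  "cf \<equiv> Poly_Mapping.lookup"

section \<open>Modules over the complex numbers\<close>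

text \<open>An injective additive map into a type that is already a vector space reflects the module
  axioms, so that only closure is left to check on the record. Additive inverses are obtained as
  multiples by -1.\<close>

lemma module_class_ringI:
  fixes W :: "(complex, 'w, 'z) module_scheme" and s :: "complex \<Rightarrow> 'b::ab_group_add \<Rightarrow> 'b"
  assumes vs: "vector_space s"
    and inj: "inj_on \<theta> (carrier W)"
    and z: "\<zero>\<^bsub>W\<^esub> \<in> carrier W" "\<theta> \<zero>\<^bsub>W\<^esub> = 0"
    and a: "\<And>x y. x \<in> carrier W \<Longrightarrow> y \<in> carrier W \<Longrightarrow> x \<oplus>\<^bsub>W\<^esub> y \<in> carrier W"
           "\<And>x y. x \<in> carrier W \<Longrightarrow> y \<in> carrier W \<Longrightarrow> \<theta> (x \<oplus>\<^bsub>W\<^esub> y) = \<theta> x + \<theta> y"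
    and m: "\<And>c x. x \<in> carrier W \<Longrightarrow> c \<odot>\<^bsub>W\<^esub> x \<in> carrier W"
           "\<And>c x. x \<in> carrier W \<Longrightarrow> \<theta> (c \<odot>\<^bsub>W\<^esub> x) = s c (\<theta> x)"
  shows "Module.module class_ring W"
proof -
  interpret vector_space s by fact
  have eq: "x = y" if "x \<in> carrier W" "y \<in> carrier W" "\<theta> x = \<theta> y" for x y
    using inj that by (auto dest: inj_onD)
  show ?thesis
  proof (rule moduleI)
    show "cring (class_ring :: complex ring)" by (rule class_cring.cring_axioms)
    show "abelian_group W"
    proof (rule abelian_groupI)
      fix x assume x: "x \<in> carrier W"
      have "(-1) \<odot>\<^bsub>W\<^esub> x \<in> carrier W" "(-1) \<odot>\<^bsub>W\<^esub> x \<oplus>\<^bsub>W\<^esub> x = \<zero>\<^bsub>W\<^esub>"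
        using x by (auto intro!: eq simp: a m z)
      then show "\<exists>y\<in>carrier W. y \<oplus>\<^bsub>W\<^esub> x = \<zero>\<^bsub>W\<^esub>" by blast
    qed (auto intro!: eq simp: a z algebra_simps)
  qed (auto intro!: eq simp: a m scale_left_distrib scale_right_distrib)
qed

lemma vectorspace_class_ringI:
  assumes "Module.module (class_ring :: complex ring) W"
  shows "vectorspace class_ring W"
  using assms class_field unfolding vectorspace_def by blast

lemma sl_add: "x \<in> sl n \<Longrightarrow> y \<in> sl n \<Longrightarrow> x + y \<in> sl n"
  by (auto simp: sl_def sum.distrib)

lemma sl_smult: "x \<in> sl n \<Longrightarrow> c \<cdot>\<^sub>m x \<in> sl n"
  by (auto simp: sl_def sum_distrib_left[symmetric])

lemma sl_commutator: 
  assumes "x \<in> sl n" "y \<in> sl n" shows "x * y - y * x \<in> sl n"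
proof -
  have x: "x \<in> carrier_mat n n" and y: "y \<in> carrier_mat n n" using assms by (auto simp: sl_def)
  have "(\<Sum>i<n. (x * y) $$ (i, i)) = (\<Sum>i<n. \<Sum>j<n. x $$ (i, j) * y $$ (j, i))"
    using x y by (auto simp: scalar_prod_def lessThan_atLeast0 intro!: sum.cong)
  also have "\<dots> = (\<Sum>j<n. \<Sum>i<n. x $$ (i, j) * y $$ (j, i))" by (rule sum.swap)
  also have "\<dots> = (\<Sum>i<n. (y * x) $$ (i, i))"
    using x y by (auto simp: scalar_prod_def lessThan_atLeast0 mult.commute intro!: sum.cong)
  finally show ?thesis using x y by (auto simp: sl_def sum_subtractf)
qed

text \<open>The laws of the Lie algebra action are reflected along \<open>\<theta>\<close> as well.
  They are demanded of \<open>A\<close> only on the image of \<open>\<theta>\<close>, because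
  \<open>current_act\<close> is known to obey them only on \<open>V_carrier\<close>.\<close>

lemma sl_module_transport:
  fixes W :: "(complex mat, 'w) rep" and s :: "complex \<Rightarrow> 'b::ab_group_add \<Rightarrow> 'b"
  assumes vs: "vector_space s"
    and inj: "inj_on \<theta> (carrier W)"
    and z: "\<zero>\<^bsub>W\<^esub> \<in> carrier W" "\<theta> \<zero>\<^bsub>W\<^esub> = 0"
    and a: "\<And>x y. x \<in> carrier W \<Longrightarrow> y \<in> carrier W \<Longrightarrow> x \<oplus>\<^bsub>W\<^esub> y \<in> carrier W"
           "\<And>x y. x \<in> carrier W \<Longrightarrow> y \<in> carrier W \<Longrightarrow> \<theta> (x \<oplus>\<^bsub>W\<^esub> y) = \<theta> x + \<theta> y"
    and m: "\<And>c x. x \<in> carrier W \<Longrightarrow> c \<odot>\<^bsub>W\<^esub> x \<in> carrier W"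
           "\<And>c x. x \<in> carrier W \<Longrightarrow> \<theta> (c \<odot>\<^bsub>W\<^esub> x) = s c (\<theta> x)"
    and act: "\<And>g x. g \<in> sl n \<Longrightarrow> x \<in> carrier W \<Longrightarrow> act W g x \<in> carrier W"
             "\<And>g x. g \<in> sl n \<Longrightarrow> x \<in> carrier W \<Longrightarrow> \<theta> (act W g x) = A g (\<theta> x)"
    and A: "\<And>g u v. g \<in> sl n \<Longrightarrow> u \<in> \<theta> ` carrier W \<Longrightarrow> v \<in> \<theta> ` carrier W \<Longrightarrow> A g (u + v) = A g u + A g v"
           "\<And>g c u. g \<in> sl n \<Longrightarrow> u \<in> \<theta> ` carrier W \<Longrightarrow> A g (s c u) = s c (A g u)"
           "\<And>g h u. g \<in> sl n \<Longrightarrow> h \<in> sl n \<Longrightarrow> u \<in> \<theta> ` carrier W \<Longrightarrow> A (g + h) u = A g u + A h u"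
           "\<And>g c u. g \<in> sl n \<Longrightarrow> u \<in> \<theta> ` carrier W \<Longrightarrow> A (c \<cdot>\<^sub>m g) u = s c (A g u)"
           "\<And>g h u. g \<in> sl n \<Longrightarrow> h \<in> sl n \<Longrightarrow> u \<in> \<theta> ` carrier W \<Longrightarrow> A (g * h - h * g) u = A g (A h u) - A h (A g u)"
  shows "sl_module n W"
proof -
  have M: "Module.module class_ring W" by (rule module_class_ringI[OF vs inj z a m])
  interpret W: Module.module class_ring W by (rule M)
  interpret vector_space s by fact
  have eq: "x = y" if "x \<in> carrier W" "y \<in> carrier W" "\<theta> x = \<theta> y" for x y
    using inj that by (auto dest: inj_onD)
  have neg: "\<theta> (\<ominus>\<^bsub>W\<^esub> x) = - \<theta> x" if x: "x \<in> carrier W" for x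
  proof -
    have "\<theta> (\<ominus>\<^bsub>W\<^esub> x \<oplus>\<^bsub>W\<^esub> x) = 0" using x by (simp add: W.M.l_neg z)
    then show ?thesis using x by (simp add: a add_eq_0_iff2)
  qed
  have minus: "\<theta> (x \<ominus>\<^bsub>W\<^esub> y) = \<theta> x - \<theta> y" if "x \<in> carrier W" "y \<in> carrier W" for x y
    using that by (simp add: a_minus_def a neg)
  have lin: "act W g \<in> linear_maps W W" if g: "g \<in> sl n" for g
    unfolding LinearCombinations.module_hom_def
  proof (intro CollectI conjI allI impI Pi_I)
    fix x y c assume "x \<in> carrier W \<and> y \<in> carrier W"
    then show "act W g (x \<oplus>\<^bsub>W\<^esub> y) = act W g x \<oplus>\<^bsub>W\<^esub> act W g y"
      using g by (intro eq) (simp_all add: act a A)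
  next
    fix c x assume "c \<in> carrier (class_ring :: complex ring) \<and> x \<in> carrier W"
    then show "act W g (c \<odot>\<^bsub>W\<^esub> x) = c \<odot>\<^bsub>W\<^esub> act W g x"
      using g by (intro eq) (simp_all add: act m A)
  qed (simp add: act g)
  show ?thesis
    unfolding sl_module_def
  proof (intro conjI ballI allI lin vectorspace_class_ringI[OF M])
    fix x y v assume *: "x \<in> sl n" "y \<in> sl n" "v \<in> carrier W"
    show "act W (x + y) v = act W x v \<oplus>\<^bsub>W\<^esub> act W y v"
      using * by (intro eq) (simp_all add: act a A sl_add)
    show "act W (x * y - y * x) v = act W x (act W y v) \<ominus>\<^bsub>W\<^esub> act W y (act W x v)"
      using * by (intro eq) (simp_all add: act minus A sl_commutator W.M.minus_closed)
  next
    fix c x v assume *: "x \<in> sl n" "v \<in> carrier W"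
    show "act W (c \<cdot>\<^sub>m x) v = c \<odot>\<^bsub>W\<^esub> act W x v"
      using * by (intro eq) (simp_all add: act m A sl_smult)
  qed
qed

text \<open>Both modules are compared with one set \<open>T\<close> and one family of operators
  \<open>A\<close>; the isomorphism is \<open>f\<close> followed by the inverse of
  \<open>g\<close>.\<close>

lemma sl_isomorphic_via:
  assumes U: "sl_module n U" and W: "sl_module n W"
    and f: "bij_betw f (carrier U) T" and g: "bij_betw g (carrier W) T"
    and fa: "\<And>x y. x \<in> carrier U \<Longrightarrow> y \<in> carrier U \<Longrightarrow> f (x \<oplus>\<^bsub>U\<^esub> y) = f x + f y"
    and ga: "\<And>x y. x \<in> carrier W \<Longrightarrow> y \<in> carrier W \<Longrightarrow> g (x \<oplus>\<^bsub>W\<^esub> y) = g x + g y"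
    and fs: "\<And>c x. x \<in> carrier U \<Longrightarrow> f (c \<odot>\<^bsub>U\<^esub> x) = s c (f x)"
    and gs: "\<And>c x. x \<in> carrier W \<Longrightarrow> g (c \<odot>\<^bsub>W\<^esub> x) = s c (g x)"
    and fact: "\<And>h x. h \<in> sl n \<Longrightarrow> x \<in> carrier U \<Longrightarrow> f (act U h x) = A h (f x)"
    and gact: "\<And>h x. h \<in> sl n \<Longrightarrow> x \<in> carrier W \<Longrightarrow> g (act W h x) = A h (g x)"
  shows "sl_isomorphic n U W"
proof -
  interpret U: vectorspace class_ring U using U by (simp add: sl_module_def)
  interpret W: vectorspace class_ring W using W by (simp add: sl_module_def)
  define \<phi> where "\<phi> x = inv_into (carrier W) g (f x)" for x
  have bij: "bij_betw \<phi> (carrier U) (carrier W)"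
    using bij_betw_trans[OF f bij_betw_inv_into[OF g]] by (simp add: \<phi>_def[abs_def] comp_def)
  have mem: "\<phi> x \<in> carrier W" if "x \<in> carrier U" for x
    using bij that by (auto simp: bij_betw_def)
  have g\<phi>: "g (\<phi> x) = f x" if "x \<in> carrier U" for x
    unfolding \<phi>_def using f g that by (metis bij_betw_apply bij_betw_inv_into_right)
  have eqI: "y = y'" if "y \<in> carrier W" "y' \<in> carrier W" "g y = g y'" for y y'
    using g that by (auto simp: bij_betw_def dest: inj_onD)
  have Uact: "act U h x \<in> carrier U" if "h \<in> sl n" "x \<in> carrier U" for h x
    using U that by (auto simp: sl_module_def LinearCombinations.module_hom_def)
  have Wact: "act W h x \<in> carrier W" if "h \<in> sl n" "x \<in> carrier W" for h x
    using W that by (auto simp: sl_module_def LinearCombinations.module_hom_def)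
  have "\<phi> \<in> linear_maps U W"
    unfolding LinearCombinations.module_hom_def
  proof (intro CollectI conjI allI impI Pi_I)
    fix x y assume "x \<in> carrier U \<and> y \<in> carrier U"
    then show "\<phi> (x \<oplus>\<^bsub>U\<^esub> y) = \<phi> x \<oplus>\<^bsub>W\<^esub> \<phi> y"
      by (intro eqI) (simp_all add: g\<phi> fa ga mem)
  next
    fix c x assume "c \<in> carrier (class_ring :: complex ring) \<and> x \<in> carrier U"
    then show "\<phi> (c \<odot>\<^bsub>U\<^esub> x) = c \<odot>\<^bsub>W\<^esub> \<phi> x"
      by (intro eqI) (simp_all add: g\<phi> fs gs mem)
  qed (simp add: mem)
  moreover have "equivariant (sl n) U W \<phi>"
    unfolding equivariant_def
  proof (intro ballI)
    fix h x assume "h \<in> sl n" "x \<in> carrier U"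
    then show "\<phi> (act U h x) = act W h (\<phi> x)"
      by (intro eqI) (simp_all add: g\<phi> fact gact mem Uact Wact)
  qed
  ultimately show ?thesis using U W bij unfolding sl_isomorphic_def by blast
qed

section \<open>Spans and quotients of records with concrete operations\<close>

lemma mspan_eqI:
  assumes M: "Module.module R V" and S: "S \<subseteq> carrier V"
    and N: "LinearCombinations.submodule R N V" "S \<subseteq> N"
    and least: "\<And>N'. LinearCombinations.submodule R N' V \<Longrightarrow> S \<subseteq> N' \<Longrightarrow> N \<subseteq> N'"
  shows "mspan R V S = N"
proof -
  interpret Module.module R V by fact
  show ?thesis
    using span_is_subset[OF N(2) N(1)] least[OF span_is_submodule[OF S] in_own_span[OF S]] by blast
qed

text \<open>Records whose operations are those of the element type. For them the span of HOL-Algebra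
  is the one of \<open>vector_space\<close>, whose induction rules carry most of the arguments
  below.\<close>

locale concrete_space = vector_space s
  for s :: "complex \<Rightarrow> 'a::ab_group_add \<Rightarrow> 'a" +
  fixes V :: "(complex, 'a, 'z) module_scheme"
  assumes V0: "\<zero>\<^bsub>V\<^esub> = 0" and Vadd: "add V = (+)" and Vsmult: "smult V = s"
    and Vsub: "subspace (carrier V)"
begin

lemma module_V: "Module.module class_ring V"
  by (rule module_class_ringI[where \<theta> = "\<lambda>x. x" and s = s])
    (use Vsub in \<open>auto simp: V0 Vadd Vsmult vector_space_axioms subspace_def\<close>)

lemma mspan_eq: "S \<subseteq> carrier V \<Longrightarrow> mspan class_ring V S = span S"
proof (rule mspan_eqI[OF module_V])
  assume S: "S \<subseteq> carrier V"
  have "span S \<subseteq> carrier V" using S Vsub by (rule span_minimal)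
  then show "LinearCombinations.submodule class_ring (span S) V"
    unfolding LinearCombinations.submodule_def
    by (auto simp: module_V V0 Vadd Vsmult span_add span_zero span_scale)
  fix N' assume "LinearCombinations.submodule class_ring N' V" "S \<subseteq> N'"
  then show "span S \<subseteq> N'"
    by (intro span_minimal) (auto simp: LinearCombinations.submodule_def subspace_def V0 Vadd Vsmult)
qed (auto intro: span_base)

end

text \<open>Cosets of the kernel of a linear map are its fibers. A quotient is thus indexed by the
  values of the map, and its operations become operations on values, without a choice of
  representatives.\<close>

definition fiber :: "'a set \<Rightarrow> ('a \<Rightarrow> 'b) \<Rightarrow> 'b \<Rightarrow> 'a set" where
  "fiber C \<beta> t = {x \<in> C. \<beta> x = t}"

locale linear_quotient =
  fixes V :: "('x, 'a::ab_group_add) rep" and s :: "complex \<Rightarrow> 'a \<Rightarrow> 'a"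
    and \<beta> :: "'a \<Rightarrow> 'b::ab_group_add" and s' :: "complex \<Rightarrow> 'b \<Rightarrow> 'b"
  assumes conc: "concrete_space s V"
    and \<beta>_add: "x \<in> carrier V \<Longrightarrow> y \<in> carrier V \<Longrightarrow> \<beta> (x + y) = \<beta> x + \<beta> y"
    and \<beta>_scale: "x \<in> carrier V \<Longrightarrow> \<beta> (s c x) = s' c (\<beta> x)"
begin

interpretation concrete_space s V by (rule conc)

abbreviation "fib \<equiv> fiber (carrier V) \<beta>"

lemma closed: "0 \<in> carrier V" "x \<in> carrier V \<Longrightarrow> y \<in> carrier V \<Longrightarrow> x + y \<in> carrier V"
  "x \<in> carrier V \<Longrightarrow> s c x \<in> carrier V" "x \<in> carrier V \<Longrightarrow> - x \<in> carrier V"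
  "x \<in> carrier V \<Longrightarrow> y \<in> carrier V \<Longrightarrow> x - y \<in> carrier V"
  using Vsub subspace_neg[OF Vsub] subspace_diff[OF Vsub] by (auto simp: subspace_def)

lemma \<beta>_diff: "x \<in> carrier V \<Longrightarrow> y \<in> carrier V \<Longrightarrow> \<beta> (x - y) = \<beta> x - \<beta> y"
  using \<beta>_add[of "x - y" y] closed(5)[of x y] by (simp add: algebra_simps)

lemma fib_nonempty: "t \<in> \<beta> ` carrier V \<Longrightarrow> \<exists>x. x \<in> carrier V \<and> \<beta> x = t \<and> x \<in> fib t"
  by (auto simp: fiber_def)

lemma inj_fib: "inj_on fib (\<beta> ` carrier V)"
  by (rule inj_onI) (auto simp: fiber_def)

text \<open>The record \<open>V'\<close> is kept apart from \<open>V\<close> because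
  \<open>R_deg\<close> takes the cosets of its carrier in \<open>zpoly_ring\<close>, but its
  operations from the quotient of \<open>zpoly_rep\<close>.\<close>

lemma coset_fib: assumes "x \<in> carrier V" "add V' = (+)" shows "fib 0 +>\<^bsub>V'\<^esub> x = fib (\<beta> x)"
proof -
  have "y \<in> (\<Union>h\<in>fib 0. {h + x})" if "y \<in> fib (\<beta> x)" for y
  proof -
    from that have "y \<in> carrier V" "\<beta> y = \<beta> x" by (auto simp: fiber_def)
    then have "y - x \<in> fib 0" using assms by (auto simp: fiber_def closed \<beta>_diff)
    then show ?thesis by force
  qed
  then show ?thesis
    using assms by (auto simp: a_r_coset_def' fiber_def \<beta>_add closed)
qed

lemma carrier_quot: "carrier (quot_rep V (fib 0)) = fib ` \<beta> ` carrier V"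
  by (auto simp: quot_rep_def mk_rep_def A_RCOSETS_def' coset_fib[OF _ Vadd])

lemma zero_quot: "\<zero>\<^bsub>quot_rep V (fib 0)\<^esub> = fib 0"
  by (simp add: quot_rep_def mk_rep_def)

lemma set_add_fib:
  assumes t: "t \<in> \<beta> ` carrier V" "t' \<in> \<beta> ` carrier V" and "add V' = (+)" 
  shows "fib t <+>\<^bsub>V'\<^esub> fib t' = fib (t + t')"
proof -
  from t obtain x where x: "x \<in> carrier V" "\<beta> x = t" by auto
  have "y \<in> (\<Union>h\<in>fib t. \<Union>k\<in>fib t'. {h + k})" if "y \<in> fib (t + t')" for y
  proof -
    have "y - x \<in> fib t'" "x \<in> fib t" using that x by (auto simp: fiber_def closed \<beta>_diff)
    then show ?thesis by force
  qed
  then show ?thesis by (auto simp: set_add_def' assms(3) fiber_def closed \<beta>_add)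
qed

lemma add_quot:
  assumes "t \<in> \<beta> ` carrier V" "t' \<in> \<beta> ` carrier V"
  shows "fib t \<oplus>\<^bsub>quot_rep V (fib 0)\<^esub> fib t' = fib (t + t')"
  using set_add_fib[OF assms Vadd] by (simp add: quot_rep_def mk_rep_def)

text \<open>In \<open>quot_rep\<close> an operation is a union over all representatives. All of them
  yield the same fiber, and there is at least one because \<open>t\<close> is a value of
  \<open>\<beta>\<close>.\<close>

lemma smult_quot:
  assumes t: "t \<in> \<beta> ` carrier V"
  shows "c \<odot>\<^bsub>quot_rep V (fib 0)\<^esub> fib t = fib (s' c t)"
proof -
  have "fib 0 +>\<^bsub>V\<^esub> s c v = fib (s' c t)" if "v \<in> fib t" for v
    using that by (subst coset_fib[OF _ Vadd]) (auto simp: fiber_def closed \<beta>_scale)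
  then show ?thesis
    using fib_nonempty[OF t] by (auto simp: quot_rep_def mk_rep_def Vsmult)
qed

lemma act_quot:
  assumes t: "t \<in> \<beta> ` carrier V"
    and "\<And>v. v \<in> carrier V \<Longrightarrow> act V g v \<in> carrier V \<and> \<beta> (act V g v) = A (\<beta> v)"
  shows "act (quot_rep V (fib 0)) g (fib t) = fib (A t)"
proof -
  have "fib 0 +>\<^bsub>V\<^esub> act V g v = fib (A t)" if "v \<in> fib t" for v
    using that assms(2) by (subst coset_fib[OF _ Vadd]) (auto simp: fiber_def)
  then show ?thesis
    using fib_nonempty[OF t] by (auto simp: quot_rep_def mk_rep_def)
qed

end

section \<open>Finitely supported functions and their reindexing\<close>

definition pscale :: "'c::comm_ring_1 \<Rightarrow> ('a \<Rightarrow>\<^sub>0 'c) \<Rightarrow> 'a \<Rightarrow>\<^sub>0 'c" where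
  "pscale c = Poly_Mapping.map ((*) c)"

lemma cf_pscale [simp]: "cf (pscale c p) k = c * cf p k"
  by (simp add: pscale_def Poly_Mapping.map.rep_eq when_def)

lemma vector_space_pscale: "vector_space (pscale :: complex \<Rightarrow> ('a \<Rightarrow>\<^sub>0 complex) \<Rightarrow> _)"
  by unfold_locales (auto intro!: poly_mapping_eqI simp: lookup_add algebra_simps)

lemma cf_reindex: "cf (reindex f p) k = (\<Sum>l\<in>Poly_Mapping.keys p. cf p l when f l = k)"
  by (simp add: reindex_def lookup_sum lookup_single)

lemma cf_reindex': 
  assumes "finite A" "Poly_Mapping.keys p \<subseteq> A"
  shows "cf (reindex f p) k = (\<Sum>l\<in>A. cf p l when f l = k)"
  unfolding cf_reindex using assms 
  by (intro sum.mono_neutral_left) (auto simp: in_keys_iff when_def)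

lemma reindex_add: "reindex f (p + q) = reindex f p + reindex f q"
proof (rule poly_mapping_eqI)
  fix k
  let ?A = "Poly_Mapping.keys p \<union> Poly_Mapping.keys q"
  show "cf (reindex f (p + q)) k = cf (reindex f p + reindex f q) k"
    using keys_add[of p q]
    by (simp add: lookup_add cf_reindex'[of ?A] when_add_distrib sum.distrib)
qed

lemma reindex_single [simp]: "reindex f (Poly_Mapping.single k c) = Poly_Mapping.single (f k) c"
  by (rule poly_mapping_eqI) (auto simp: cf_reindex lookup_single when_def)

lemma reindex_pscale: "reindex f (pscale c p) = pscale c (reindex f p)"
proof (rule poly_mapping_eqI)
  fix k
  have "Poly_Mapping.keys (pscale c p) \<subseteq> Poly_Mapping.keys p" by (auto simp: in_keys_iff)
  then show "cf (reindex f (pscale c p)) k = cf (pscale c (reindex f p)) k"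
    by (simp add: cf_reindex'[of "Poly_Mapping.keys p"] sum_distrib_left when_def if_distrib cong: if_cong)
qed

lemma cf_reindex_inj: "inj f \<Longrightarrow> cf (reindex f p) (f k) = cf p k"
  by (simp add: cf_reindex inj_eq when_def in_keys_iff)

lemma cf_reindex_out: "k \<notin> f ` Poly_Mapping.keys p \<Longrightarrow> cf (reindex f p) k = 0"
  by (auto simp: cf_reindex intro!: sum.neutral)

lemma keys_reindex: "Poly_Mapping.keys (reindex f p) \<subseteq> f ` Poly_Mapping.keys p"
  using cf_reindex_out by (force simp: in_keys_iff)

lemma poly_mapping_sum_single: "(\<Sum>k\<in>Poly_Mapping.keys p. Poly_Mapping.single k (cf p k)) = p"
  by (rule poly_mapping_eqI) (simp add: lookup_sum lookup_single when_def in_keys_iff)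

lemma poly_mapping_sum_single': 
  "finite A \<Longrightarrow> Poly_Mapping.keys p \<subseteq> A \<Longrightarrow> (\<Sum>k\<in>A. Poly_Mapping.single k (cf p k)) = p"
  by (rule poly_mapping_eqI) (auto simp: lookup_sum lookup_single when_def in_keys_iff)

lemma concrete_space_mk_rep:
  assumes "vector_space s" "Modules.module.subspace s C"
  shows "concrete_space s (mk_rep C 0 (+) s a)"
  by (intro concrete_space.intro concrete_space_axioms.intro assms(1)) (simp_all add: mk_rep_def assms(2))

lemma concrete_space_free_rep: "concrete_space pscale (free_rep S a)"
  unfolding free_rep_def pscale_def[symmetric]
proof (rule concrete_space_mk_rep[OF vector_space_pscale])
  interpret vector_space "pscale :: complex \<Rightarrow> ('a \<Rightarrow>\<^sub>0 complex) \<Rightarrow> _" by (rule vector_space_pscale)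
  show "subspace {p. Poly_Mapping.keys p \<subseteq> S}"
  proof (rule subspaceI)
    fix x y :: "'a \<Rightarrow>\<^sub>0 complex"
    assume "x \<in> {p. Poly_Mapping.keys p \<subseteq> S}" "y \<in> {p. Poly_Mapping.keys p \<subseteq> S}"
    then show "x + y \<in> {p. Poly_Mapping.keys p \<subseteq> S}" using keys_add[of x y] by blast
  qed (auto simp: in_keys_iff)
qed

section \<open>The action of matrices on words\<close>

definition words :: "nat \<Rightarrow> nat \<Rightarrow> nat list set" where
  "words n N = {w. length w = N \<and> set w \<subseteq> {..<n}}"

lemma finite_words [simp]: "finite (words n N)"
  using finite_lists_length_eq[of "{..<n}" N] by (simp add: words_def conj_commute)

lemma words_update: "w \<in> words n N \<Longrightarrow> b < n \<Longrightarrow> w[p := b] \<in> words n N"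
  using set_update_subset_insert[of w p b] by (auto simp: words_def)

lemma words_nth: "w \<in> words n N \<Longrightarrow> p < N \<Longrightarrow> w ! p < n"
  by (force simp: words_def)

lemma words_length: "w \<in> words n N \<Longrightarrow> length w = N"
  by (simp add: words_def)

lemma words_snoc: "w @ [a] \<in> words n (Suc N) \<longleftrightarrow> w \<in> words n N \<and> a < n"
  by (auto simp: words_def)

lemma words_SucE:
  assumes "w \<in> words n (Suc N)" obtains u a where "w = u @ [a]" "u \<in> words n N" "a < n"
  using assms words_snoc[of "butlast w" "last w" n N]
  by (cases w rule: rev_cases) (auto simp: words_def)

text \<open>The diagonal action of a matrix on the tensor power, written for coefficient functions:
  the coefficient at \<open>w\<close> collects those of the words that differ from \<open>w\<close>
  at one position. Values in a commutative ring allow the same formula for polynomial and for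
  complex coefficients.\<close>

definition wop :: "nat \<Rightarrow> (nat \<Rightarrow> nat \<Rightarrow> 'a::comm_ring_1) \<Rightarrow> (nat list \<Rightarrow> 'a) \<Rightarrow> nat list \<Rightarrow> 'a" where
  "wop n x c w = (\<Sum>p<length w. \<Sum>b<n. x (w ! p) b * c (w[p := b]))"

text \<open>Two operators meet either at one position, where the matrices multiply
  (\<open>D\<close>), or at two different ones (\<open>Off\<close>). Updates at different positions
  commute, so \<open>Off\<close> is symmetric in \<open>x\<close> and \<open>y\<close> and drops out
  of the commutator.\<close>

lemma wop_commutator:
  fixes c :: "nat list \<Rightarrow> 'a::comm_ring_1"
  assumes "w \<in> words n N"
  shows "wop n x (wop n y c) w - wop n y (wop n x c) w
    = wop n (\<lambda>a b. \<Sum>k<n. x a k * y k b - y a k * x k b) c w"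
proof -
  define D where "D x y = (\<Sum>p<N. \<Sum>d<n. (\<Sum>b<n. x (w ! p) b * y b d) * c (w[p := d]))"
    for x y :: "nat \<Rightarrow> nat \<Rightarrow> 'a"
  define Off where "Off x y = (\<Sum>p<N. \<Sum>q\<in>{..<N} - {p}. \<Sum>b<n. \<Sum>d<n.
      x (w ! p) b * (y (w ! q) d * c (w[p := b, q := d])))" for x y :: "nat \<Rightarrow> nat \<Rightarrow> 'a"
  have len: "length w = N" using assms by (simp add: words_def)
  have exp: "wop n x (wop n y c) w = D x y + Off x y" for x y
  proof -
    have "wop n x (wop n y c) w
      = (\<Sum>p<N. \<Sum>b<n. \<Sum>q<N. x (w ! p) b * (\<Sum>d<n. y (w[p := b] ! q) d * c (w[p := b, q := d])))"
      by (simp add: wop_def len sum_distrib_left)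
    also have "\<dots> = (\<Sum>p<N. (\<Sum>b<n. \<Sum>d<n. x (w ! p) b * (y b d * c (w[p := d])))
        + (\<Sum>b<n. \<Sum>q\<in>{..<N}-{p}. \<Sum>d<n. x (w ! p) b * (y (w ! q) d * c (w[p := b, q := d]))))"
    proof (rule sum.cong[OF refl])
      fix p assume p: "p \<in> {..<N}"
      have "(\<Sum>q<N. x (w ! p) b * (\<Sum>d<n. y (w[p := b] ! q) d * c (w[p := b, q := d])))
         = (\<Sum>d<n. x (w ! p) b * (y b d * c (w[p := d]))) 
           + (\<Sum>q\<in>{..<N}-{p}. \<Sum>d<n. x (w ! p) b * (y (w ! q) d * c (w[p := b, q := d])))" for b
        using p by (subst sum.remove[of _ p]) (auto simp: len sum_distrib_left intro!: sum.cong)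
      then show "(\<Sum>b<n. \<Sum>q<N. x (w ! p) b * (\<Sum>d<n. y (w[p := b] ! q) d * c (w[p := b, q := d])))
        = (\<Sum>b<n. \<Sum>d<n. x (w ! p) b * (y b d * c (w[p := d])))
        + (\<Sum>b<n. \<Sum>q\<in>{..<N}-{p}. \<Sum>d<n. x (w ! p) b * (y (w ! q) d * c (w[p := b, q := d])))"
        by (simp add: sum.distrib)
    qed
    also have "\<dots> = D x y + Off x y"
      unfolding sum.distrib D_def Off_def
      by (rule arg_cong2[where f = "(+)"]; rule sum.cong[OF refl]; subst sum.swap)
        (auto simp: sum_distrib_left sum_distrib_right mult.assoc)
    finally show ?thesis .
  qed
  have Off_sym: "Off x y = Off y x"
  proof -
    let ?g = "\<lambda>x y p q. \<Sum>b<n. \<Sum>d<n. x (w ! p) b * (y (w ! q) d * c (w[p := b, q := d]))"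
    have sw: "?g x y p q = ?g y x q p" if "p \<noteq> q" for p q
      by (subst sum.swap) (auto intro!: sum.cong simp: list_update_swap[OF that] mult.left_commute)
    have "Off x y = (\<Sum>p<N. \<Sum>q | q \<in> {..<N} \<and> p \<noteq> q. ?g x y p q)"
      unfolding Off_def by (intro sum.cong) auto
    also have "\<dots> = (\<Sum>q<N. \<Sum>p | p \<in> {..<N} \<and> p \<noteq> q. ?g x y p q)"
      by (rule sum.swap_restrict) auto
    also have "\<dots> = (\<Sum>q<N. \<Sum>p\<in>{..<N}-{q}. ?g y x q p)"
      by (rule sum.cong[OF refl], rule sum.cong) (auto simp: sw)
    finally show ?thesis by (simp add: Off_def)
  qed
  have "wop n x (wop n y c) w - wop n y (wop n x c) w = D x y - D y x"
    by (simp add: exp Off_sym)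
  also have "\<dots> = wop n (\<lambda>a b. \<Sum>k<n. x a k * y k b - y a k * x k b) c w"
    by (simp add: D_def wop_def len sum_subtractf left_diff_distrib)
  finally show ?thesis .
qed

text \<open>Words are orthonormal for this form, so passing to the adjoint conjugates and transposes
  the matrix. The sum is reindexed by the involution that exchanges the inserted letter
  \<open>b\<close> with the letter \<open>w ! p\<close> that it replaces.\<close>

lemma wop_adjoint:
  fixes c d :: "nat list \<Rightarrow> complex"
  shows "(\<Sum>w\<in>words n N. wop n x c w * cnj (d w))
    = (\<Sum>w\<in>words n N. c w * cnj (wop n (\<lambda>a b. cnj (x b a)) d w))"
proof -
  have "(\<Sum>w\<in>words n N. wop n x c w * cnj (d w))
      = (\<Sum>w\<in>words n N. \<Sum>p<N. \<Sum>b<n. x (w ! p) b * c (w[p := b]) * cnj (d w))"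
    by (intro sum.cong) (auto simp: wop_def words_length sum_distrib_right)
  also have "\<dots> = (\<Sum>p<N. \<Sum>(w, b)\<in>words n N \<times> {..<n}. x (w ! p) b * c (w[p := b]) * cnj (d w))"
    by (subst sum.swap) (simp add: sum.cartesian_product)
  also have "\<dots> = (\<Sum>p<N. \<Sum>(w, b)\<in>words n N \<times> {..<n}. x b (w ! p) * c w * cnj (d (w[p := b])))"
  proof (rule sum.cong[OF refl])
    fix p assume p: "p \<in> {..<N}"
    show "(\<Sum>(w, b)\<in>words n N \<times> {..<n}. x (w ! p) b * c (w[p := b]) * cnj (d w))
      = (\<Sum>(w, b)\<in>words n N \<times> {..<n}. x b (w ! p) * c w * cnj (d (w[p := b])))"
      by (rule sum.reindex_bij_witness[where i = "\<lambda>(w, b). (w[p := b], w ! p)" 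
            and j = "\<lambda>(w, b). (w[p := b], w ! p)"])
        (use p in \<open>auto simp: words_length words_update words_nth\<close>)
  qed
  also have "\<dots> = (\<Sum>w\<in>words n N. \<Sum>p<N. \<Sum>b<n. x b (w ! p) * c w * cnj (d (w[p := b])))"
    by (subst (2) sum.swap) (simp add: sum.cartesian_product)
  also have "\<dots> = (\<Sum>w\<in>words n N. c w * cnj (wop n (\<lambda>a b. cnj (x b a)) d w))"
    by (intro sum.cong) (auto simp: wop_def words_length sum_distrib_left mult_ac)
  finally show ?thesis .
qed

lemma wop_diag:
  assumes "w \<in> words n N"
  shows "wop n (\<lambda>a b. if a = b then d a else 0) c w = (\<Sum>p<N. d (w ! p)) * c w"
proof -
  have "(\<Sum>b<n. (if w ! p = b then d (w ! p) else 0) * c (w[p := b])) = d (w ! p) * c w"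
    if "p < N" for p
    using words_nth[OF assms that] by (simp add: if_distrib[of "\<lambda>x. x * _"] cong: if_cong)
  then show ?thesis
    using assms by (simp add: wop_def words_length sum_distrib_right)
qed

lemma sum_nth_count: 
  fixes d :: "nat \<Rightarrow> 'a::comm_ring_1"
  shows "set w \<subseteq> {..<n} \<Longrightarrow> (\<Sum>p<length w. d (w ! p)) = (\<Sum>j<n. of_nat (count_list w j) * d j)"
proof (induction w rule: rev_induct)
  case (snoc a w)
  have "(\<Sum>p<length (w @ [a]). d ((w @ [a]) ! p)) = (\<Sum>p<length w. d (w ! p)) + d a"
    by (simp add: nth_append)
  also have "\<dots> = (\<Sum>j<n. of_nat (count_list w j) * d j) + (\<Sum>j<n. if j = a then d j else 0)"
    using snoc by simp
  also have "\<dots> = (\<Sum>j<n. of_nat (count_list (w @ [a]) j) * d j)"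
    unfolding sum.distrib[symmetric] by (intro sum.cong) (auto simp: algebra_simps)
  finally show ?case .
qed simp

subsection \<open>Highest weight functions on words\<close>

definition unit_entry :: "nat \<Rightarrow> nat \<Rightarrow> nat \<Rightarrow> nat \<Rightarrow> 'a::comm_ring_1" where
  "unit_entry i j a b = (if a = i \<and> b = j then 1 else 0)"

lemma wop_unit:
  assumes "j < n"
  shows "wop n (unit_entry i j) c w = (\<Sum>p | p < length w \<and> w ! p = i. c (w[p := j]))"
proof -
  have "(\<Sum>b<n. unit_entry i j (w ! p) b * c (w[p := b])) = (if w ! p = i then c (w[p := j]) else 0)" for p
    using assms by (auto simp: unit_entry_def if_distrib[of "\<lambda>x. x * _"] cong: if_cong)
  then have "wop n (unit_entry i j) c w = (\<Sum>p<length w. if w ! p = i then c (w[p := j]) else 0)"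
    by (simp add: wop_def)
  also have "\<dots> = (\<Sum>p | p < length w \<and> w ! p = i. c (w[p := j]))"
    by (simp add: sum.inter_filter[symmetric])
  finally show ?thesis .
qed

definition highest :: "nat \<Rightarrow> nat \<Rightarrow> (nat list \<Rightarrow> complex) \<Rightarrow> bool" where
  "highest n N c \<longleftrightarrow> (\<forall>i j. i < j \<longrightarrow> j < n \<longrightarrow> (\<forall>w\<in>words n N. wop n (unit_entry i j) c w = 0))"

definition has_content :: "nat \<Rightarrow> (nat \<Rightarrow> nat) \<Rightarrow> nat list \<Rightarrow> bool" where
  "has_content n \<kappa> w \<longleftrightarrow> (\<forall>j<n. count_list w j = \<kappa> j)"

text \<open>Since \<open>[E, F] = H\<close>, the squared norms satisfy \<open>|F c|\<^sup>2 = |E c|\<^sup>2 + (\<kappa> i - \<kappa> j) |c|\<^sup>2\<close>.\<close>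

lemma highest_dominant:
  assumes hi: "highest n N c" and ct: "\<And>w. w \<in> words n N \<Longrightarrow> c w \<noteq> 0 \<Longrightarrow> has_content n \<kappa> w"
    and nz: "v0 \<in> words n N" "c v0 \<noteq> 0" and ij: "i < j" "j < n"
  shows "\<kappa> j \<le> \<kappa> i"
proof -
  define E F :: "nat \<Rightarrow> nat \<Rightarrow> complex" where "E = unit_entry i j" and "F = unit_entry j i"
  have Ec: "wop n E c w = 0" if "w \<in> words n N" for w
    using hi ij that by (simp add: highest_def E_def)
  \<comment> \<open>The commutator of the matrix units at (i, j) and (j, i) is the diagonal matrix
    with 1 at i and -1 at j.\<close>
  have H: "(\<lambda>a b. \<Sum>k<n. E a k * F k b - F a k * E k b)
     = (\<lambda>a b. if a = b then (if a = i then 1 else 0) - (if a = j then 1 else 0) else 0)" (is "?L = ?R")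
  proof (intro ext)
    fix a b
    have "?L a b = (\<Sum>k<n. if k = j then (if a = i \<and> b = i then 1 else 0) else 0)
        - (\<Sum>k<n. if k = i then (if a = j \<and> b = j then 1 else 0) else 0)"
      unfolding sum_subtractf by (intro arg_cong2[where f = "(-)"] sum.cong) 
        (auto simp: E_def F_def unit_entry_def)
    then show "?L a b = ?R a b" using ij by auto
  qed
  have count: "(\<Sum>p<length w. if w ! p = k then 1 else 0) = (of_nat (count_list w k) :: complex)"
    if "set w \<subseteq> {..<n}" "k < n" for w k
    using that sum_nth_count[OF that(1), of "\<lambda>a. if a = k then 1 else 0"]
    by (simp add: if_distrib cong: if_cong)
  have EF: "wop n E (wop n F c) w = of_int (int (\<kappa> i) - int (\<kappa> j)) * c w" if w: "w \<in> words n N" for w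
  proof -
    have "wop n F (wop n E c) w = 0"
      unfolding wop_def[of n F] using w by (auto intro!: sum.neutral simp: Ec words_update)
    then have "wop n E (wop n F c) w = wop n ?R c w"
      using wop_commutator[OF w, of E F c] by (simp add: H)
    also have "\<dots> = (\<Sum>p<N. (if w ! p = i then 1 else 0) - (if w ! p = j then 1 else 0)) * c w"
      by (rule wop_diag[OF w])
    also have "(\<Sum>p<N. (if w ! p = i then 1 else 0) - (if w ! p = j then 1 else 0))
       = (of_nat (count_list w i) - of_nat (count_list w j) :: complex)"
      using w ij by (simp add: sum_subtractf count[symmetric] words_def)
    finally show ?thesis
      using ct[OF w] ij by (cases "c w = 0") (auto simp: has_content_def)
  qed
  \<comment> \<open>The raising unit is the adjoint of the lowering one; this turns the squared norm
    of \<open>wop n F c\<close> into the pairing of \<open>c\<close> with the function computed in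
    \<open>EF\<close>.\<close>
  have adj: "(\<lambda>a b. cnj (F b a)) = E" by (auto simp: E_def F_def unit_entry_def fun_eq_iff)
  have "(\<Sum>w\<in>words n N. wop n F c w * cnj (wop n F c w))
      = (\<Sum>w\<in>words n N. c w * cnj (wop n E (wop n F c) w))"
    by (simp add: wop_adjoint adj)
  also have "\<dots> = of_int (int (\<kappa> i) - int (\<kappa> j)) * (\<Sum>w\<in>words n N. c w * cnj (c w))"
    unfolding sum_distrib_left by (intro sum.cong refl) (simp add: EF algebra_simps)
  finally have "of_real (\<Sum>w\<in>words n N. (cmod (wop n F c w))\<^sup>2)
     = (of_real (of_int (int (\<kappa> i) - int (\<kappa> j)) * (\<Sum>w\<in>words n N. (cmod (c w))\<^sup>2)) :: complex)"
    by (simp add: complex_norm_square del: of_real_power)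
  then have eq: "(\<Sum>w\<in>words n N. (cmod (wop n F c w))\<^sup>2)
     = of_int (int (\<kappa> i) - int (\<kappa> j)) * (\<Sum>w\<in>words n N. (cmod (c w))\<^sup>2)"
    by (simp only: of_real_eq_iff)
  have "0 < (\<Sum>w\<in>words n N. (cmod (c w))\<^sup>2)" using nz by (intro sum_pos2[of _ v0]) auto
  moreover have "0 \<le> (\<Sum>w\<in>words n N. (cmod (wop n F c w))\<^sup>2)" by (intro sum_nonneg) auto
  ultimately have "0 \<le> (of_int (int (\<kappa> i) - int (\<kappa> j)) :: real)"
    unfolding eq by (simp add: zero_le_mult_iff)
  then show ?thesis by simp
qed

text \<open>Words are compared from their right end, since the leading word of a highest weight
  function is found by fixing its last letter first.\<close>

definition rlex_less :: "nat list \<Rightarrow> nat list \<Rightarrow> bool" where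
  "rlex_less w' w \<longleftrightarrow> (\<exists>k<length w. w' ! k < w ! k \<and> (\<forall>l. k < l \<and> l < length w \<longrightarrow> w' ! l = w ! l))"

lemma rlex_less_irrefl: "\<not> rlex_less w w"
  by (auto simp: rlex_less_def)

lemma rlex_less_trans:
  assumes "rlex_less u v" "rlex_less v w" "length v = length w" shows "rlex_less u w"
proof -
  from assms obtain k l where k: "k < length w" "u ! k < v ! k" "\<And>m. k < m \<Longrightarrow> m < length w \<Longrightarrow> u ! m = v ! m"
    and l: "l < length w" "v ! l < w ! l" "\<And>m. l < m \<Longrightarrow> m < length w \<Longrightarrow> v ! m = w ! m"
    unfolding rlex_less_def by metis
  have "u ! max k l < w ! max k l"
    using k l by (cases k l rule: linorder_cases) auto
  then show ?thesis
    unfolding rlex_less_def using k l by (intro exI[of _ "max k l"]) auto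
qed

text \<open>These are the ballot or Yamanouchi words: every prefix has dominant content. Read as the
  row numbers of successive entries, they encode standard tableaux.\<close>

definition lattice_word :: "nat \<Rightarrow> nat list \<Rightarrow> bool" where
  "lattice_word n w \<longleftrightarrow> (\<forall>k\<le>length w. \<forall>i j. i < j \<longrightarrow> j < n \<longrightarrow>
     count_list (take k w) j \<le> count_list (take k w) i)"

text \<open>Restricting to the words with the largest possible last letter yields a highest weight
  function again.\<close>

lemma highest_leading_lattice_word:
  assumes "highest n N c" "\<And>w. w \<in> words n N \<Longrightarrow> c w \<noteq> 0 \<Longrightarrow> has_content n \<kappa> w"
    and "v0 \<in> words n N" "c v0 \<noteq> 0"
  shows "\<exists>w\<in>words n N. c w \<noteq> 0 \<and> lattice_word n w \<and>
    (\<forall>w'\<in>words n N. c w' \<noteq> 0 \<longrightarrow> w' \<noteq> w \<longrightarrow> rlex_less w' w)"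
  using assms
proof (induction N arbitrary: c \<kappa> v0)
  case 0
  then show ?case by (auto simp: words_def lattice_word_def)
next
  case (Suc N)
  note hi = Suc.prems(1) and ct = Suc.prems(2)
  define I where "I = {i. i < n \<and> (\<exists>w\<in>words n N. c (w @ [i]) \<noteq> 0)}"
  have fin: "finite I" unfolding I_def by simp
  obtain u a where "v0 = u @ [a]" "u \<in> words n N" "a < n" using Suc.prems(3) by (rule words_SucE)
  then have "I \<noteq> {}" using Suc.prems(4) by (auto simp: I_def)
  then have iI: "Max I \<in> I" using fin by simp
  define i where "i = Max I"
  have imax: "k \<le> i" if "k < n" "w \<in> words n N" "c (w @ [k]) \<noteq> 0" for k w
    unfolding i_def using fin that by (intro Max_ge) (auto simp: I_def)
  obtain u0 where u0: "i < n" "u0 \<in> words n N" "c (u0 @ [i]) \<noteq> 0" using iI by (auto simp: I_def i_def)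
  define c' where "c' w = c (w @ [i])" for w
  have hi': "highest n N c'"
    unfolding highest_def
  proof (intro allI impI ballI)
    fix j k w assume jk: "j < k" "k < n" and w: "w \<in> words n N"
    have "0 = wop n (unit_entry j k) c (w @ [i])"
      using hi jk w u0 by (simp add: highest_def words_snoc)
    also have "\<dots> = (\<Sum>p<N. \<Sum>b<n. unit_entry j k (w ! p) b * c (w[p := b] @ [i]))
        + (\<Sum>b<n. unit_entry j k i b * c (w @ [b]))"
      using w by (simp add: wop_def words_length nth_append list_update_append)
    \<comment> \<open>A nonzero term would need j = i and b = k > i, a last letter beyond the
      maximum \<open>i\<close>.\<close>
    also have "(\<Sum>b<n. unit_entry j k i b * c (w @ [b])) = 0"
    proof (intro sum.neutral ballI)
      fix b assume b: "b \<in> {..<n}"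
      show "unit_entry j k i b * c (w @ [b]) = 0"
        using imax[of b w] b w jk by (cases "c (w @ [b]) = 0") (auto simp: unit_entry_def)
    qed
    finally show "wop n (unit_entry j k) c' w = 0"
      using w by (simp add: wop_def c'_def words_length)
  qed
  \<comment> \<open>The subtraction is exact where it is applied, since \<open>w @ [i]\<close>
    contains the letter \<open>i\<close>.\<close>
  have ct': "has_content n (\<lambda>j. \<kappa> j - (if j = i then 1 else 0)) w" if "w \<in> words n N" "c' w \<noteq> 0" for w
    using ct[of "w @ [i]"] that u0 by (fastforce simp: has_content_def c'_def words_snoc)
  from Suc.IH[OF hi' ct' u0(2)] u0(3) obtain w where w: "w \<in> words n N" "c' w \<noteq> 0" "lattice_word n w"
    and lead: "\<And>w'. w' \<in> words n N \<Longrightarrow> c' w' \<noteq> 0 \<Longrightarrow> w' \<noteq> w \<Longrightarrow> rlex_less w' w"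
    by (auto simp: c'_def)
  have wi: "w @ [i] \<in> words n (Suc N)" "c (w @ [i]) \<noteq> 0" using w u0 by (auto simp: words_snoc c'_def)
  \<comment> \<open>Proper prefixes are prefixes of \<open>w\<close>; for the whole word the
    condition is the dominance of its content \<open>\<kappa>\<close>.\<close>
  have "lattice_word n (w @ [i])"
    unfolding lattice_word_def
  proof (intro allI impI)
    fix k a b assume k: "k \<le> length (w @ [i])" and ab: "a < b" "b < n"
    show "count_list (take k (w @ [i])) b \<le> count_list (take k (w @ [i])) a"
    proof (cases "k \<le> length w")
      case True
      then show ?thesis using w(3) ab by (simp add: lattice_word_def)
    next
      case False
      then have "take k (w @ [i]) = w @ [i]" using k by simp
      moreover have "\<kappa> b \<le> \<kappa> a" by (rule highest_dominant[OF hi ct wi ab])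
      moreover have "has_content n \<kappa> (w @ [i])" by (rule ct[OF wi])
      ultimately show ?thesis using ab by (simp only: has_content_def)
    qed
  qed
  moreover have "rlex_less w' (w @ [i])" if w': "w' \<in> words n (Suc N)" "c w' \<noteq> 0" "w' \<noteq> w @ [i]" for w'
  proof -
    obtain u a where u: "w' = u @ [a]" "u \<in> words n N" "a < n" using w'(1) by (rule words_SucE)
    have "a \<le> i" using imax u w' by auto
    then consider "a < i" | "a = i" by linarith
    then show ?thesis
    proof cases
      case 1
      then show ?thesis
        using u w by (auto simp: rlex_less_def words_length nth_append intro!: exI[of _ N])
    next
      case 2
      then have "rlex_less u w" using u w' by (intro lead) (auto simp: c'_def)
      then obtain k where "k < N" "u ! k < w ! k" "\<And>l. k < l \<Longrightarrow> l < N \<Longrightarrow> u ! l = w ! l"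
        using w by (auto simp: rlex_less_def words_length)
      then show ?thesis
        using u w 2 by (auto simp: rlex_less_def words_length nth_append intro!: exI[of _ k])
    qed
  qed
  ultimately show ?case using wi by blast
qed

section \<open>Specht modules as spaces of highest weight functions\<close>

interpretation free_vs: vector_space "pscale :: complex \<Rightarrow> ('a \<Rightarrow>\<^sub>0 complex) \<Rightarrow> 'a \<Rightarrow>\<^sub>0 complex"
  by (rule vector_space_pscale)

abbreviation pinv :: "(nat \<Rightarrow> nat) \<Rightarrow> nat \<Rightarrow> nat" where
  "pinv \<equiv> inv_into UNIV"

lemma count_list_card: "count_list w a = card {p. p < length w \<and> w ! p = a}"
  by (simp add: count_list_eq_length_filter length_filter_conv_card eq_commute)

lemma count_take_mono: "p \<le> q \<Longrightarrow> count_list (take p w) a \<le> count_list (take q w) a"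
  by (metis count_list_append le_add1 min.absorb1 take_take append_take_drop_id)

lemma count_take_Suc: 
  "p < length w \<Longrightarrow> count_list (take (Suc p) w) a = count_list (take p w) a + (if w ! p = a then 1 else 0)"
  by (simp add: take_Suc_conv_app_nth)

section \<open>Words of content \<open>\<mu>\<close>, tabloids and tableaux\<close>

definition pcont :: "nat list \<Rightarrow> nat \<Rightarrow> nat" where
  "pcont \<mu> j = (if j < length \<mu> then \<mu> ! j else 0)"

definition cwords :: "nat \<Rightarrow> nat list \<Rightarrow> nat list set" where
  "cwords n \<mu> = {w \<in> words n (sum_list \<mu>). has_content n (pcont \<mu>) w}"

text \<open>Positions of a word are the entries of a tabloid and letters are its row numbers. Words
  thus index both the tabloids and the basis of the tensor power, and so connect the two
  sides.\<close>

definition word_tabloid :: "nat list \<Rightarrow> nat list \<Rightarrow> nat set list" where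
  "word_tabloid \<mu> w = map (\<lambda>i. {p. p < length w \<and> w ! p = i}) [0..<length \<mu>]"

definition cell :: "nat list \<Rightarrow> (nat \<times> nat \<Rightarrow> nat) \<Rightarrow> nat \<Rightarrow> nat \<times> nat" where
  "cell \<mu> t = inv_into (diagram \<mu>) t"

definition tableau_word :: "nat list \<Rightarrow> (nat \<times> nat \<Rightarrow> nat) \<Rightarrow> nat list" where
  "tableau_word \<mu> t = map (\<lambda>p. fst (cell \<mu> t p)) [0..<sum_list \<mu>]"

lemma finite_cwords [simp]: "finite (cwords n \<mu>)"
  by (simp add: cwords_def)

lemma diagram_Sigma: "diagram \<mu> = Sigma {..<length \<mu>} (\<lambda>i. {..<\<mu> ! i})"
  by (auto simp: diagram_def)

lemma finite_diagram [simp]: "finite (diagram \<mu>)"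
  by (simp add: diagram_Sigma)

lemma card_diagram: "card (diagram \<mu>) = sum_list \<mu>"
  by (simp add: diagram_Sigma sum_list_sum_nth lessThan_atLeast0)

lemma wop_linear: "wop n x (\<lambda>w. c w + a * d w) w = wop n x c w + a * wop n x d w"
proof -
  have "wop n x (\<lambda>w. c w + a * d w) w = (\<Sum>p<length w. \<Sum>b<n. x (w ! p) b * c (w[p := b])
      + a * (x (w ! p) b * d (w[p := b])))"
    unfolding wop_def by (intro sum.cong refl) (simp add: algebra_simps)
  then show ?thesis by (simp add: wop_def sum.distrib sum_distrib_left)
qed

lemma highest_linear:
  "highest n N c \<Longrightarrow> highest n N d \<Longrightarrow> highest n N (\<lambda>w. c w + a * d w)"
  by (simp add: highest_def wop_linear)

context
  fixes n :: nat and \<mu> :: "nat list"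
  assumes len: "length \<mu> \<le> n" and dec: "sorted_wrt (\<ge>) \<mu>"
begin

private abbreviation "N \<equiv> sum_list \<mu>"

lemma cell_tableau:
  assumes "t \<in> tableaux \<mu>" "p < N"
  shows "cell \<mu> t p \<in> diagram \<mu>" "t (cell \<mu> t p) = p"
  using assms by (auto simp: tableaux_def cell_def bij_betw_def intro: inv_into_into f_inv_into_f)

lemma cell_eq: "t \<in> tableaux \<mu> \<Longrightarrow> x \<in> diagram \<mu> \<Longrightarrow> cell \<mu> t (t x) = x"
  by (auto simp: tableaux_def cell_def bij_betw_def)

lemma tableau_less: "t \<in> tableaux \<mu> \<Longrightarrow> x \<in> diagram \<mu> \<Longrightarrow> t x < N"
  by (auto simp: tableaux_def bij_betw_def)

lemma row_tableau_word:
  assumes t: "t \<in> tableaux \<mu>"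
  shows "{p. p < N \<and> tableau_word \<mu> t ! p = i} = t ` {x \<in> diagram \<mu>. fst x = i}"
proof (intro equalityI subsetI)
  fix p assume "p \<in> {p. p < N \<and> tableau_word \<mu> t ! p = i}"
  then show "p \<in> t ` {x \<in> diagram \<mu>. fst x = i}"
    using cell_tableau[OF t, of p] by (intro image_eqI[of _ _ "cell \<mu> t p"]) (auto simp: tableau_word_def)
qed (auto simp: tableau_word_def cell_eq[OF t] tableau_less[OF t])

lemma length_tableau_word [simp]: "length (tableau_word \<mu> t) = N"
  by (simp add: tableau_word_def)

lemma tableau_word_nth: "p < N \<Longrightarrow> tableau_word \<mu> t ! p = fst (cell \<mu> t p)"
  by (simp add: tableau_word_def)

lemma diagram_row: "{x \<in> diagram \<mu>. fst x = i} = (if i < length \<mu> then {(i, j) | j. j < \<mu> ! i} else {})"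
  by (auto simp: diagram_def)

lemma word_tabloid_tableau_word: "t \<in> tableaux \<mu> \<Longrightarrow> word_tabloid \<mu> (tableau_word \<mu> t) = tabloid \<mu> t"
  by (simp add: word_tabloid_def tabloid_def row_tableau_word diagram_row)

lemma tableau_word_cwords:
  assumes t: "t \<in> tableaux \<mu>" shows "tableau_word \<mu> t \<in> cwords n \<mu>"
proof -
  have "fst (cell \<mu> t p) < n" if "p < N" for p
    using cell_tableau[OF t that] len by (auto simp: diagram_def)
  moreover have "count_list (tableau_word \<mu> t) i = pcont \<mu> i" for i
  proof -
    have "{(i, j) | j. j < \<mu> ! i} = Pair i ` {..<\<mu> ! i}" by auto
    then have "card {x \<in> diagram \<mu>. fst x = i} = pcont \<mu> i"
      by (simp add: diagram_row pcont_def card_image inj_on_def)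
    moreover have "inj_on t {x \<in> diagram \<mu>. fst x = i}"
      using t by (auto simp: tableaux_def bij_betw_def inj_on_def)
    ultimately show ?thesis
      by (simp add: count_list_card row_tableau_word[OF t] card_image)
  qed
  ultimately show ?thesis
    by (auto simp: cwords_def words_def has_content_def tableau_word_def)
qed

lemma cwords_length: "w \<in> cwords n \<mu> \<Longrightarrow> length w = N"
  by (simp add: cwords_def words_def)

lemma cwords_nth:
  assumes w: "w \<in> cwords n \<mu>" "p < N" shows "w ! p < length \<mu>" "w ! p < n"
proof -
  show a: "w ! p < n" using w words_nth by (auto simp: cwords_def)
  have "w ! p \<in> set w" using w by (simp add: cwords_length)
  then have "count_list w (w ! p) \<noteq> 0" by (simp add: count_list_0_iff)
  then show "w ! p < length \<mu>" using w a by (auto simp: cwords_def has_content_def pcont_def split: if_splits)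
qed

lemma inj_word_tabloid: "inj_on (word_tabloid \<mu>) (cwords n \<mu>)"
proof (rule inj_onI)
  fix v w assume v: "v \<in> cwords n \<mu>" and w: "w \<in> cwords n \<mu>" and eq: "word_tabloid \<mu> v = word_tabloid \<mu> w"
  show "v = w"
  proof (rule nth_equalityI)
    fix p assume "p < length v"
    then have p: "p < N" using v by (simp add: cwords_length)
    have "p \<in> word_tabloid \<mu> v ! (v ! p)"
      using cwords_nth(1)[OF v p] p by (simp add: word_tabloid_def cwords_length[OF v])
    then have "p \<in> word_tabloid \<mu> w ! (v ! p)" by (simp only: eq)
    then show "v ! p = w ! p"
      using cwords_nth(1)[OF v p] by (simp add: word_tabloid_def)
  qed (use v w in \<open>simp add: cwords_length\<close>)
qed

text \<open>Each row is filled from left to right in the order in which its letter occurs, so the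
  column of a position is the number of earlier occurrences of the same letter.\<close>

definition word_cell :: "nat list \<Rightarrow> nat \<Rightarrow> nat \<times> nat" where
  "word_cell w p = (w ! p, count_list (take p w) (w ! p))"

text \<open>Between two occurrences of a letter its count grows strictly, whence injectivity; the
  diagram has as many cells as the word has positions, whence surjectivity.\<close>

lemma bij_word_cell:
  assumes w: "w \<in> cwords n \<mu>" shows "bij_betw (word_cell w) {..<N} (diagram \<mu>)"
proof -
  note lw = cwords_length[OF w]
  have lt: "count_list (take p w) (w ! p) < count_list (take q w) (w ! p)" if "p < q" "q \<le> N" for p q
    using count_take_mono[of "Suc p" q w "w ! p"] count_take_Suc[of p w "w ! p"] that lw by simp
  have inj: "inj_on (word_cell w) {..<N}"
  proof (rule inj_onI)
    fix p q assume "p \<in> {..<N}" "q \<in> {..<N}" "word_cell w p = word_cell w q"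
    then show "p = q" using lt[of p q] lt[of q p]
      by (cases p q rule: linorder_cases) (auto simp: word_cell_def)
  qed
  have "word_cell w p \<in> diagram \<mu>" if p: "p < N" for p
    using lt[of p N] cwords_nth[OF w p] w p lw
    by (auto simp: word_cell_def diagram_def cwords_def has_content_def pcont_def)
  then have "word_cell w ` {..<N} = diagram \<mu>"
    by (intro card_subset_eq) (auto simp: card_image[OF inj] card_diagram)
  then show ?thesis using inj by (simp add: bij_betw_def)
qed

definition word_tableau :: "nat list \<Rightarrow> nat \<times> nat \<Rightarrow> nat" where
  "word_tableau w = inv_into {..<N} (word_cell w)"

lemma word_tableau: assumes w: "w \<in> cwords n \<mu>"
  shows "word_tableau w \<in> tableaux \<mu>" "p < N \<Longrightarrow> cell \<mu> (word_tableau w) p = word_cell w p"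
    "tableau_word \<mu> (word_tableau w) = w"
proof -
  note bij = bij_word_cell[OF w]
  show t: "word_tableau w \<in> tableaux \<mu>"
    unfolding tableaux_def word_tableau_def using bij_betw_inv_into[OF bij] by simp
  show c: "cell \<mu> (word_tableau w) p = word_cell w p" if "p < N" for p
  proof -
    have "word_tableau w (word_cell w p) = p"
      using bij that by (auto simp: word_tableau_def bij_betw_def)
    then show ?thesis using cell_eq[OF t, of "word_cell w p"] bij that by (auto simp: bij_betw_def)
  qed
  show "tableau_word \<mu> (word_tableau w) = w"
    by (rule nth_equalityI) (auto simp: tableau_word_nth c cwords_length[OF w], simp add: word_cell_def)
qed

lemma tabloids_eq: "tabloid \<mu> ` tableaux \<mu> = word_tabloid \<mu> ` cwords n \<mu>"
proof (intro equalityI subsetI)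
  fix x assume "x \<in> word_tabloid \<mu> ` cwords n \<mu>"
  then obtain w where w: "w \<in> cwords n \<mu>" "x = word_tabloid \<mu> w" by blast
  then have "x = tabloid \<mu> (word_tableau w)"
    using word_tabloid_tableau_word[OF word_tableau(1)[OF w(1)]] word_tableau(3)[OF w(1)] by simp
  then show "x \<in> tabloid \<mu> ` tableaux \<mu>" using word_tableau(1)[OF w(1)] by blast
next
  fix x assume "x \<in> tabloid \<mu> ` tableaux \<mu>"
  then obtain t where t: "t \<in> tableaux \<mu>" "x = tabloid \<mu> t" by blast
  then show "x \<in> word_tabloid \<mu> ` cwords n \<mu>"
    by (intro image_eqI[OF _ tableau_word_cwords]) (simp_all add: word_tabloid_tableau_word)
qed

lemma comp_tableau:
  assumes t: "t \<in> tableaux \<mu>" and \<sigma>: "\<sigma> permutes {..<N}"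
  shows "\<sigma> \<circ> t \<in> tableaux \<mu>" "p < N \<Longrightarrow> cell \<mu> (\<sigma> \<circ> t) p = cell \<mu> t (pinv \<sigma> p)"
proof -
  show st: "\<sigma> \<circ> t \<in> tableaux \<mu>"
    using t bij_betw_trans[OF _ permutes_imp_bij[OF \<sigma>]] by (auto simp: tableaux_def)
  assume p: "p < N"
  then have ip: "pinv \<sigma> p < N" using permutes_in_image[OF permutes_inv[OF \<sigma>], of p] by simp
  have "(\<sigma> \<circ> t) (cell \<mu> t (pinv \<sigma> p)) = p"
    using cell_tableau[OF t ip] permutes_inverses[OF \<sigma>] by simp
  then show "cell \<mu> (\<sigma> \<circ> t) p = cell \<mu> t (pinv \<sigma> p)"
    using cell_eq[OF st cell_tableau(1)[OF t ip]] by simp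
qed

section \<open>Polytabloids as highest weight functions\<close>

definition word_coeff :: "(nat set list \<Rightarrow>\<^sub>0 complex) \<Rightarrow> nat list \<Rightarrow> complex" where
  "word_coeff s w = (if w \<in> cwords n \<mu> then cf s (word_tabloid \<mu> w) else 0)"

lemma word_coeff_linear:
  "word_coeff 0 w = 0" "word_coeff (s + s') w = word_coeff s w + word_coeff s' w"
  "word_coeff (pscale c s) w = c * word_coeff s w"
  by (simp_all add: word_coeff_def lookup_add)

lemma finite_column_stabilizer [simp]: "finite (column_stabilizer \<mu> t)"
  unfolding column_stabilizer_def by (rule finite_subset[OF _ finite_permutations[of "{..<N}"]]) auto

lemma word_coeff_polytabloid:
  assumes t: "t \<in> tableaux \<mu>"
  shows "word_coeff (polytabloid \<mu> t) w
    = (\<Sum>\<sigma> | \<sigma> \<in> column_stabilizer \<mu> t \<and> tableau_word \<mu> (\<sigma> \<circ> t) = w. of_int (sign \<sigma>))"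
proof -
  have st: "\<sigma> \<circ> t \<in> tableaux \<mu>" if "\<sigma> \<in> column_stabilizer \<mu> t" for \<sigma>
    using comp_tableau(1)[OF t] that by (simp add: column_stabilizer_def)
  show ?thesis
  proof (cases "w \<in> cwords n \<mu>")
    case True
    have "tabloid \<mu> (\<sigma> \<circ> t) = word_tabloid \<mu> w \<longleftrightarrow> tableau_word \<mu> (\<sigma> \<circ> t) = w"
      if "\<sigma> \<in> column_stabilizer \<mu> t" for \<sigma>
      using word_tabloid_tableau_word[OF st[OF that]] tableau_word_cwords[OF st[OF that]]
        inj_word_tabloid True by (metis inj_onD)
    then have "word_coeff (polytabloid \<mu> t) w
      = (\<Sum>\<sigma>\<in>column_stabilizer \<mu> t. if tableau_word \<mu> (\<sigma> \<circ> t) = w then of_int (sign \<sigma>) else 0)"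
      using True by (simp add: word_coeff_def polytabloid_def lookup_sum lookup_single when_def cong: sum.cong)
    then show ?thesis by (simp add: sum.inter_filter)
  next
    case False
    then have "{\<sigma>. \<sigma> \<in> column_stabilizer \<mu> t \<and> tableau_word \<mu> (\<sigma> \<circ> t) = w} = {}"
      using st tableau_word_cwords by blast
    then show ?thesis using False by (simp only: word_coeff_def if_False sum.empty)
  qed
qed

text \<open>Composing with the transposition of the entries in rows \<open>i\<close> and \<open>j\<close> of one column
  cancels the terms in pairs.\<close>

lemma highest_polytabloid:
  assumes t: "t \<in> tableaux \<mu>"
  shows "highest n N (word_coeff (polytabloid \<mu> t))"
  unfolding highest_def
proof (intro allI impI ballI)
  fix i j w assume ij: "i < j" "j < n" and w: "w \<in> words n N"
  let ?C = "column_stabilizer \<mu> t"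
  define P where "P = (SIGMA p:{p. p < N \<and> w ! p = i}. {\<sigma> \<in> ?C. tableau_word \<mu> (\<sigma> \<circ> t) = w[p := j]})"
  have lw: "length w = N" using w by (simp add: words_def)
  have "wop n (unit_entry i j) (word_coeff (polytabloid \<mu> t)) w
     = (\<Sum>p | p < N \<and> w ! p = i. \<Sum>\<sigma> | \<sigma> \<in> ?C \<and> tableau_word \<mu> (\<sigma> \<circ> t) = w[p := j]. of_int (sign \<sigma>))"
    by (simp add: wop_unit ij lw word_coeff_polytabloid[OF t])
  also have "\<dots> = (\<Sum>(p, \<sigma>)\<in>P. of_int (sign \<sigma>))"
    unfolding P_def by (subst sum.Sigma) auto
  finally have eq: "wop n (unit_entry i j) (word_coeff (polytabloid \<mu> t)) w = (\<Sum>(p, \<sigma>)\<in>P. of_int (sign \<sigma>))" .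
  \<comment> \<open>\<open>q\<close> is the entry of \<open>\<sigma> \<circ> t\<close> in row
    \<open>i\<close> of the column that holds \<open>p\<close> in row \<open>j\<close>. Exchanging
    \<open>p\<close> and \<open>q\<close> swaps the roles of the two positions, so that doing it
    twice returns the original pair.\<close>
  define \<iota> where "\<iota> = (\<lambda>(p, \<sigma>). let q = \<sigma> (t (i, snd (cell \<mu> (\<sigma> \<circ> t) p))) in (q, Transposition.transpose p q \<circ> \<sigma>))"
  have \<iota>: "\<iota> x \<in> P \<and> \<iota> (\<iota> x) = x \<and> sign (snd (\<iota> x)) = - sign (snd x)" if x: "x \<in> P" for x
  proof -
    obtain p \<sigma> where x_eq: "x = (p, \<sigma>)" by (cases x)
    then have p: "p < N" "w ! p = i" and \<sigma>C: "\<sigma> \<in> ?C" and word: "tableau_word \<mu> (\<sigma> \<circ> t) = w[p := j]"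
      using x by (auto simp: P_def)
    have \<sigma>: "\<sigma> permutes {..<N}" using \<sigma>C by (simp add: column_stabilizer_def)
    note u = comp_tableau(1)[OF t \<sigma>]
    have "fst (cell \<mu> (\<sigma> \<circ> t) p) = j"
      using tableau_word_nth[OF p(1), of "\<sigma> \<circ> t"] p(1) lw by (simp add: word)
    then obtain b where cp: "cell \<mu> (\<sigma> \<circ> t) p = (j, b)" by (metis prod.collapse)
    have jb: "(j, b) \<in> diagram \<mu>" "\<sigma> (t (j, b)) = p"
      using cell_tableau[OF u p(1)] cp by auto
    have ib: "(i, b) \<in> diagram \<mu>"
    proof -
      have "\<mu> ! j \<le> \<mu> ! i"
        using jb(1) ij dec by (auto simp: diagram_def sorted_wrt_iff_nth_less)
      then show ?thesis using jb(1) ij by (auto simp: diagram_def)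
    qed
    define q where "q = \<sigma> (t (i, b))"
    define \<tau> where "\<tau> = Transposition.transpose p q"
    have q: "q < N" unfolding q_def using tableau_less[OF u ib] by simp
    have cq: "cell \<mu> (\<sigma> \<circ> t) q = (i, b)" unfolding q_def using cell_eq[OF u ib] by simp
    have pq: "p \<noteq> q" using cp cq ij by auto
    have wq: "w ! q = i"
      using tableau_word_nth[OF q, of "\<sigma> \<circ> t"] pq cq by (simp add: word)
    have \<tau>: "\<tau> permutes {..<N}" unfolding \<tau>_def using p q by (intro permutes_swap_id) auto
    have \<tau>\<sigma>: "\<tau> \<circ> \<sigma> permutes {..<N}" by (rule permutes_compose[OF \<sigma> \<tau>])
    have inv\<tau>: "pinv \<tau> = \<tau>" by (simp add: \<tau>_def)
    have col: "\<exists>i'. (i', d) \<in> diagram \<mu> \<and> \<sigma> (t (a, d)) = t (i', d)" if "(a, d) \<in> diagram \<mu>" for a d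
      using \<sigma>C that by (auto simp: column_stabilizer_def)
    \<comment> \<open>\<open>\<sigma>\<close> preserves the columns of \<open>t\<close>, so
      \<open>p\<close> and \<open>q\<close> lie in one column of \<open>t\<close> itself and their
      exchange preserves columns again.\<close>
    have \<tau>\<sigma>C: "\<tau> \<circ> \<sigma> \<in> ?C"
      unfolding column_stabilizer_def
    proof (intro CollectI conjI \<tau>\<sigma> ballI, clarify)
      fix a d assume ad: "(a, d) \<in> diagram \<mu>"
      obtain a' where a': "(a', d) \<in> diagram \<mu>" "\<sigma> (t (a, d)) = t (a', d)" using col[OF ad] by blast
      obtain j' where j': "(j', b) \<in> diagram \<mu>" "p = t (j', b)" using col[OF jb(1)] unfolding jb(2) by blast
      obtain i' where i': "(i', b) \<in> diagram \<mu>" "q = t (i', b)" using col[OF ib] unfolding q_def by blast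
      have tinj: "t y = t z \<Longrightarrow> y \<in> diagram \<mu> \<Longrightarrow> z \<in> diagram \<mu> \<Longrightarrow> y = z" for y z
        by (metis cell_eq[OF t])
      consider "t (a', d) = p" | "t (a', d) = q" | "t (a', d) \<noteq> p" "t (a', d) \<noteq> q" by blast
      then show "\<exists>i'. (i', d) \<in> diagram \<mu> \<and> (\<tau> \<circ> \<sigma>) (t (a, d)) = t (i', d)"
      proof cases
        case 1
        then have "d = b" using tinj[of "(a', d)" "(j', b)"] a' j' by simp
        moreover have "(\<tau> \<circ> \<sigma>) (t (a, d)) = q" by (simp add: a'(2) 1 \<tau>_def)
        ultimately show ?thesis using i' by blast
      next
        case 2
        then have "d = b" using tinj[of "(a', d)" "(i', b)"] a' i' by simp
        moreover have "(\<tau> \<circ> \<sigma>) (t (a, d)) = p" by (simp add: a'(2) 2 \<tau>_def)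
        ultimately show ?thesis using j' by blast
      next
        case 3
        then have "(\<tau> \<circ> \<sigma>) (t (a, d)) = t (a', d)" by (simp add: a'(2) \<tau>_def)
        then show ?thesis using a' by blast
      qed
    qed
    have cells: "cell \<mu> (\<tau> \<circ> \<sigma> \<circ> t) r = cell \<mu> (\<sigma> \<circ> t) (\<tau> r)" if "r < N" for r
      using comp_tableau(2)[OF u \<tau> that] by (simp add: inv\<tau> o_assoc)
    have "tableau_word \<mu> (\<tau> \<circ> \<sigma> \<circ> t) = w[q := j]"
    proof (rule nth_equalityI)
      fix r assume "r < length (tableau_word \<mu> (\<tau> \<circ> \<sigma> \<circ> t))"
      then have r: "r < N" by simp
      then have \<tau>r: "\<tau> r < N" using permutes_in_image[OF \<tau>, of r] by simp
      have "tableau_word \<mu> (\<tau> \<circ> \<sigma> \<circ> t) ! r = tableau_word \<mu> (\<sigma> \<circ> t) ! (\<tau> r)"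
        by (simp only: tableau_word_nth[OF r] tableau_word_nth[OF \<tau>r] cells[OF r])
      also have "\<dots> = w[p := j] ! (\<tau> r)" by (simp only: word)
      also have "\<dots> = w[q := j] ! r"
      proof -
        consider "r = p" | "r = q" | "r \<noteq> p" "r \<noteq> q" by blast
        then show ?thesis
          by cases (use p q r lw pq wq in \<open>simp_all add: \<tau>_def\<close>)
      qed
      finally show "tableau_word \<mu> (\<tau> \<circ> \<sigma> \<circ> t) ! r = w[q := j] ! r" .
    qed (simp add: lw)
    moreover have \<iota>x: "\<iota> x = (q, \<tau> \<circ> \<sigma>)"
      unfolding x_eq \<iota>_def q_def \<tau>_def by (simp add: cp Let_def)
    moreover have "\<iota> (q, \<tau> \<circ> \<sigma>) = (p, \<sigma>)"
    proof -
      have "cell \<mu> (\<tau> \<circ> \<sigma> \<circ> t) q = (j, b)" using cells[OF q] cp by (simp add: \<tau>_def)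
      moreover have "(\<tau> \<circ> \<sigma>) (t (i, b)) = p" by (simp add: \<tau>_def q_def[symmetric])
      moreover have "Transposition.transpose q p \<circ> (\<tau> \<circ> \<sigma>) = \<sigma>"
        unfolding \<tau>_def transpose_commute[of q p] by (simp add: fun_eq_iff)
      ultimately show ?thesis by (simp add: \<iota>_def Let_def)
    qed
    moreover have "sign (\<tau> \<circ> \<sigma>) = - sign \<sigma>"
    proof -
      have "permutation \<sigma>" "permutation \<tau>" using \<sigma> \<tau> by (meson permutation_permutes finite_lessThan)+
      then show ?thesis using pq by (simp add: sign_compose \<tau>_def sign_swap_id)
    qed
    ultimately show ?thesis using q wq \<tau>\<sigma>C by (simp add: P_def x_eq)
  qed
  have "(\<Sum>(p, \<sigma>)\<in>P. of_int (sign \<sigma>)) = (\<Sum>x\<in>P. of_int (sign (snd x)) :: complex)"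
    by (intro sum.cong) auto
  also have "\<dots> = (\<Sum>x\<in>P. - of_int (sign (snd x)))"
    by (rule sum.reindex_bij_witness[where i = \<iota> and j = \<iota>]) (auto simp: \<iota>)
  finally have "(\<Sum>(p, \<sigma>)\<in>P. of_int (sign \<sigma>)) = (- (\<Sum>x\<in>P. of_int (sign (snd x))) :: complex)"
    by (simp only: sum_negf)
  moreover have "(\<Sum>(p, \<sigma>)\<in>P. of_int (sign \<sigma>)) = (\<Sum>x\<in>P. of_int (sign (snd x)) :: complex)"
    by (intro sum.cong) auto
  ultimately show "wop n (unit_entry i j) (word_coeff (polytabloid \<mu> t)) w = 0"
    unfolding eq by simp
qed

text \<open>The tableau of a ballot word increases down its columns. Let \<open>k\<close> be the
  largest position moved by a column permutation other than the identity: it receives the row of a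
  smaller entry of its column, which is a smaller row number, while nothing changes to its right.
  Hence every other term precedes \<open>w\<close>, and only the identity contributes to the
  coefficient at \<open>w\<close>.\<close>

lemma leading_polytabloid:
  assumes w: "w \<in> cwords n \<mu>" and lat: "lattice_word n w"
  defines "e \<equiv> word_coeff (polytabloid \<mu> (word_tableau w))"
  shows "e w = 1" "e v \<noteq> 0 \<Longrightarrow> v \<noteq> w \<Longrightarrow> rlex_less v w"
proof -
  define t where "t = word_tableau w"
  note t = word_tableau(1)[OF w, folded t_def] and ct = word_tableau(2)[OF w, folded t_def]
    and wt = word_tableau(3)[OF w, folded t_def]
  note lw = cwords_length[OF w]
  have e: "e v = (\<Sum>\<sigma> | \<sigma> \<in> column_stabilizer \<mu> t \<and> tableau_word \<mu> (\<sigma> \<circ> t) = v. of_int (sign \<sigma>))" for v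
    unfolding e_def t_def[symmetric] by (rule word_coeff_polytabloid[OF t])
  \<comment> \<open>In a ballot word the occurrence number \<open>b\<close> of a letter comes later
    than that of any smaller letter; the condition is evaluated on the prefix ending at
    \<open>q\<close>.\<close>
  have incr: "p < q" if p: "p < N" "cell \<mu> t p = (r1, b)" and q: "q < N" "cell \<mu> t q = (r2, b)" and r: "r1 < r2" for p q r1 r2 b
  proof (rule ccontr)
    assume "\<not> p < q"
    then have qp: "q < p" using p q r by (cases p q rule: linorder_cases) auto
    have P: "w ! p = r1" "count_list (take p w) r1 = b" "w ! q = r2" "count_list (take q w) r2 = b"
      using p q by (auto simp: ct word_cell_def)
    have "r2 < n" using cwords_nth[OF w q(1)] P by simp
    then have "count_list (take (Suc q) w) r2 \<le> count_list (take (Suc q) w) r1"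
      using lat r q lw by (auto simp: lattice_word_def)
    moreover have "count_list (take (Suc q) w) r1 \<le> count_list (take p w) r1"
      using qp by (intro count_take_mono) simp
    ultimately show False using count_take_Suc[of q w r2] q lw P by simp
  qed
  have less: "rlex_less (tableau_word \<mu> (\<sigma> \<circ> t)) w" if \<sigma>C: "\<sigma> \<in> column_stabilizer \<mu> t" and ne: "\<sigma> \<noteq> id" for \<sigma>
  proof -
    have \<sigma>: "\<sigma> permutes {..<N}" using \<sigma>C by (simp add: column_stabilizer_def)
    note i\<sigma> = permutes_inv[OF \<sigma>]
    define M where "M = {k. pinv \<sigma> k \<noteq> k}"
    have M: "M \<subseteq> {..<N}" using permutes_not_in[OF i\<sigma>] by (auto simp: M_def)
    then have fin: "finite M" by (rule finite_subset) simp
    have "M \<noteq> {}"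
    proof
      assume "M = {}"
      then have "pinv \<sigma> = id" by (auto simp: M_def fun_eq_iff)
      then show False using ne \<sigma> by (metis inv_id inv_inv_eq permutes_bij)
    qed
    define k where "k = Max M"
    have kM: "k \<in> M" unfolding k_def using fin \<open>M \<noteq> {}\<close> by simp
    define m where "m = pinv \<sigma> k"
    have k: "k < N" "m \<noteq> k" using kM M by (auto simp: m_def M_def)
    have \<sigma>m: "\<sigma> m = k" unfolding m_def using permutes_inverses[OF \<sigma>] by simp
    have "m \<in> M"
    proof -
      have "pinv \<sigma> m \<noteq> m"
        using k(2) \<sigma>m permutes_inverses[OF \<sigma>] by metis
      then show ?thesis by (simp add: M_def)
    qed
    then have "m \<le> k" unfolding k_def using fin by simp
    then have mk: "m < k" using k by simp
    then have mN: "m < N" using k by simp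
    obtain a b where ab: "cell \<mu> t m = (a, b)" by fastforce
    then have abd: "(a, b) \<in> diagram \<mu>" "t (a, b) = m" using cell_tableau[OF t mN] by auto
    then obtain a' where a': "(a', b) \<in> diagram \<mu>" "k = t (a', b)"
      using \<sigma>C \<sigma>m unfolding column_stabilizer_def by fastforce
    then have ck: "cell \<mu> t k = (a', b)" using cell_eq[OF t] by simp
    have "a < a'"
    proof (rule ccontr)
      assume "\<not> a < a'"
      then consider "a = a'" | "a' < a" by linarith
      then show False
        by cases (use a' abd k in simp, use incr[OF k(1) ck mN ab] mk in simp)
    qed
    moreover have "tableau_word \<mu> (\<sigma> \<circ> t) ! k = a"
      using k ab by (simp add: tableau_word_nth comp_tableau(2)[OF t \<sigma>] m_def)
    moreover have "w ! k = a'" using ck ct[OF k(1)] by (simp add: word_cell_def)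
    moreover have "tableau_word \<mu> (\<sigma> \<circ> t) ! l = w ! l" if l: "k < l" "l < N" for l
    proof -
      have "l \<notin> M" using l fin unfolding k_def by (meson Max_ge leD)
      then show ?thesis using l ct[OF l(2)]
        by (simp add: tableau_word_nth comp_tableau(2)[OF t \<sigma>] M_def) (simp add: word_cell_def)
    qed
    ultimately show ?thesis using k lw by (auto simp: rlex_less_def)
  qed
  have id: "id \<in> column_stabilizer \<mu> t"
    by (auto simp: column_stabilizer_def permutes_id)
  have "{\<sigma>. \<sigma> \<in> column_stabilizer \<mu> t \<and> tableau_word \<mu> (\<sigma> \<circ> t) = w} = {id}"
  proof -
    have "\<sigma> = id" if "\<sigma> \<in> column_stabilizer \<mu> t" "tableau_word \<mu> (\<sigma> \<circ> t) = w" for \<sigma>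
      using less[OF that(1)] that(2) rlex_less_irrefl[of w] by (cases "\<sigma> = id") auto
    moreover have "tableau_word \<mu> (id \<circ> t) = w" using wt by simp
    ultimately show ?thesis using id by blast
  qed
  then show "e w = 1" by (simp add: e)
  assume "e v \<noteq> 0" "v \<noteq> w"
  then obtain \<sigma> where "\<sigma> \<in> column_stabilizer \<mu> t" "tableau_word \<mu> (\<sigma> \<circ> t) = v"
    unfolding e by (metis (mono_tags, lifting) mem_Collect_eq sum.neutral)
  then show "rlex_less v w" using less wt \<open>v \<noteq> w\<close> by (cases "\<sigma> = id") auto
qed

text \<open>Elimination of leading words: the leading word \<open>w\<close> of \<open>c\<close> is a
  ballot word of content \<open>\<mu>\<close>, so the polytabloid of its tableau leads with the same
  word and can be subtracted. The measure counts the words that equal or precede a word of the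
  support, a set that loses \<open>w\<close> in each round.\<close>

lemma highest_in_span_polytabloids:
  assumes "highest n N c" and "\<And>w. c w \<noteq> 0 \<Longrightarrow> w \<in> cwords n \<mu>"
  shows "\<exists>s \<in> free_vs.span (polytabloid \<mu> ` tableaux \<mu>). word_coeff s = c"
  using assms
proof (induction "card {v \<in> cwords n \<mu>. \<exists>u. c u \<noteq> 0 \<and> (v = u \<or> rlex_less v u)}" arbitrary: c rule: less_induct)
  case less
  note hi = less.prems(1) and supp = less.prems(2)
  show ?case
  proof (cases "\<exists>w. c w \<noteq> 0")
    case False
    then have "word_coeff 0 = c" by (simp add: word_coeff_linear fun_eq_iff)
    then show ?thesis using free_vs.span_zero by blast
  next
    case True
    then obtain v0 where v0: "c v0 \<noteq> 0" by blast
    have v0N: "v0 \<in> words n N" using supp[OF v0] by (simp add: cwords_def)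
    have "\<exists>w\<in>words n N. c w \<noteq> 0 \<and> lattice_word n w \<and>
        (\<forall>w'\<in>words n N. c w' \<noteq> 0 \<longrightarrow> w' \<noteq> w \<longrightarrow> rlex_less w' w)"
    proof (rule highest_leading_lattice_word[OF hi _ v0N v0])
      fix w assume "c w \<noteq> 0"
      from supp[OF this] show "has_content n (pcont \<mu>) w" by (simp add: cwords_def)
    qed
    then obtain w where w: "c w \<noteq> 0" "lattice_word n w"
      and lead: "\<And>w'. w' \<in> words n N \<Longrightarrow> c w' \<noteq> 0 \<Longrightarrow> w' \<noteq> w \<Longrightarrow> rlex_less w' w"
      by blast
    note wc = supp[OF w(1)]
    define e where "e = word_coeff (polytabloid \<mu> (word_tableau w))"
    note e = leading_polytabloid[OF wc w(2), folded e_def]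
    define c' where "c' = (\<lambda>v. c v + (- c w) * e v)"
    have hi': "highest n N c'"
      unfolding c'_def e_def
      by (rule highest_linear[OF hi highest_polytabloid[OF word_tableau(1)[OF wc]]])
    have supp': "v \<in> cwords n \<mu>" if "c' v \<noteq> 0" for v
      using supp[of v] that by (cases "v \<in> cwords n \<mu>") (auto simp: c'_def e_def word_coeff_def)
    have small: "rlex_less v w" if "c' v \<noteq> 0" for v
    proof -
      have "v \<noteq> w" using that e(1) by (auto simp: c'_def)
      moreover have "v \<in> words n N" using supp'[OF that] by (simp add: cwords_def)
      ultimately show ?thesis using that lead[of v] e(2)[of v] by (cases "c v = 0") (auto simp: c'_def)
    qed
    let ?D = "\<lambda>c. {v \<in> cwords n \<mu>. \<exists>u. c u \<noteq> 0 \<and> (v = u \<or> rlex_less v u)}"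
    have "?D c' \<subset> ?D c"
    proof
      show "?D c' \<subseteq> ?D c"
      proof safe
        fix v u assume "v \<in> cwords n \<mu>" "c' u \<noteq> 0" "rlex_less v u"
        then have "rlex_less v w"
          using small[of u] supp'[of u] wc by (auto intro: rlex_less_trans simp: cwords_length)
        then show "\<exists>u. c u \<noteq> 0 \<and> (v = u \<or> rlex_less v u)" using w by blast
      qed (use small w in blast)
      show "?D c' \<noteq> ?D c"
      proof
        assume "?D c' = ?D c"
        then have "w \<in> ?D c'" using wc w by blast
        then obtain u where "c' u \<noteq> 0" "w = u \<or> rlex_less w u" by blast
        then have "rlex_less w w"
          using small[of u] supp'[of u] wc by (auto intro: rlex_less_trans simp: cwords_length)
        then show False by (simp add: rlex_less_irrefl)
      qed
    qed
    then have "card (?D c') < card (?D c)" by (intro psubset_card_mono) auto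
    from less.hyps[OF this hi' supp'] obtain s where
      s: "s \<in> free_vs.span (polytabloid \<mu> ` tableaux \<mu>)" "word_coeff s = c'" by blast
    let ?s = "s + pscale (c w) (polytabloid \<mu> (word_tableau w))"
    have "?s \<in> free_vs.span (polytabloid \<mu> ` tableaux \<mu>)"
      by (intro free_vs.span_add s free_vs.span_scale free_vs.span_base imageI word_tableau(1)[OF wc])
    moreover have "word_coeff ?s = c"
      by (simp add: fun_eq_iff word_coeff_linear s(2) c'_def e_def)
    ultimately show ?thesis by blast
  qed
qed

lemma highest_span_polytabloids:
  assumes "s \<in> free_vs.span (polytabloid \<mu> ` tableaux \<mu>)"
  shows "highest n N (word_coeff s)"
  using assms
proof (induction rule: free_vs.span_induct_alt)
  case base
  then show ?case by (simp add: highest_def wop_def word_coeff_linear)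
next
  case (step c x s)
  then show ?case
    using highest_linear[OF step(2) highest_polytabloid, of _ c]
    by (auto simp: word_coeff_linear[abs_def] add.commute)
qed

lemma carrier_tabloid_rep:
  "carrier (tabloid_rep \<mu>) = {s. Poly_Mapping.keys s \<subseteq> word_tabloid \<mu> ` cwords n \<mu>}"
  by (simp add: tabloid_rep_def free_rep_def mk_rep_def tabloids_eq)

lemma polytabloid_carrier: "t \<in> tableaux \<mu> \<Longrightarrow> polytabloid \<mu> t \<in> carrier (tabloid_rep \<mu>)"
proof -
  assume t: "t \<in> tableaux \<mu>"
  have "Poly_Mapping.keys (polytabloid \<mu> t)
      \<subseteq> (\<Union>\<sigma>\<in>column_stabilizer \<mu> t. Poly_Mapping.keys (Poly_Mapping.single (tabloid \<mu> (\<sigma> \<circ> t)) (of_int (sign \<sigma>) :: complex)))"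
    unfolding polytabloid_def by (rule keys_sum)
  also have "\<dots> \<subseteq> tabloid \<mu> ` tableaux \<mu>"
    using comp_tableau(1)[OF t] by (auto simp: column_stabilizer_def)
  finally show ?thesis by (simp add: tabloid_rep_def free_rep_def mk_rep_def)
qed

lemma carrier_specht: "carrier (specht \<mu>) = free_vs.span (polytabloid \<mu> ` tableaux \<mu>)"
  unfolding specht_def using polytabloid_carrier
  by (simp add: concrete_space.mspan_eq[OF concrete_space_free_rep] tabloid_rep_def image_subset_iff)

end

section \<open>Hermitian forms\<close>

locale hermitian_space = vector_space s
  for s :: "complex \<Rightarrow> 'b::ab_group_add \<Rightarrow> 'b" +
  fixes ip :: "'b \<Rightarrow> 'b \<Rightarrow> complex"
  assumes ip_add: "ip (x + y) z = ip x z + ip y z"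
    and ip_scale: "ip (s c x) z = c * ip x z"
    and ip_cnj: "ip y x = cnj (ip x y)"
    and ip_definite: "ip x x = 0 \<Longrightarrow> x = 0"
begin

lemma ip_add_right: "ip z (x + y) = ip z x + ip z y"
  using ip_cnj ip_add by (metis complex_cnj_add)

lemma ip_scale_right: "ip z (s c x) = cnj c * ip z x"
  using ip_cnj ip_scale by (metis complex_cnj_mult)

lemma ip_zero [simp]: "ip 0 z = 0" "ip z 0 = 0"
  using ip_scale[of 0 0 z] ip_scale_right[of z 0 0] by simp_all

lemma ip_minus: "ip (- x) z = - ip x z" "ip z (- x) = - ip z x"
  using ip_add[of x "- x" z] ip_add_right[of z x "- x"] by (simp_all add: add_eq_0_iff2)

lemma ip_diff: "ip (x - y) z = ip x z - ip y z" "ip z (x - y) = ip z x - ip z y"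
  using ip_add[of "x" "- y" z] ip_add_right[of z "x" "- y"] by (simp_all add: ip_minus)

lemma ip_sum: "ip (sum f A) z = (\<Sum>a\<in>A. ip (f a) z)"
  by (induction A rule: infinite_finite_induct) (simp_all add: ip_add)

lemma ip_zero_sym: "ip x y = 0 \<Longrightarrow> ip y x = 0"
  by (simp add: ip_cnj[of y x])

lemma subspace_ortho: "subspace {x. \<forall>y\<in>S. ip x y = 0}"
  by (auto simp: subspace_def ip_add ip_scale)

lemma ortho_span: "(\<And>y. y \<in> S \<Longrightarrow> ip x y = 0) \<Longrightarrow> y \<in> span S \<Longrightarrow> ip x y = 0"
  by (rule span_induct[where P = "\<lambda>y. ip x y = 0"])
    (auto simp: subspace_def ip_add_right ip_scale_right)

definition orthogonal_set :: "'b set \<Rightarrow> bool" where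
  "orthogonal_set C \<longleftrightarrow> finite C \<and> 0 \<notin> C \<and> (\<forall>x\<in>C. \<forall>y\<in>C. x \<noteq> y \<longrightarrow> ip x y = 0)"

definition proj :: "'b set \<Rightarrow> 'b \<Rightarrow> 'b" where
  "proj C x = (\<Sum>c\<in>C. s (ip x c / ip c c) c)"

lemma proj_span: "proj C x \<in> span C"
  unfolding proj_def by (intro span_sum span_scale span_base)

lemma proj_ortho:
  assumes C: "orthogonal_set C" and y: "y \<in> span C"
  shows "ip (x - proj C x) y = 0"
proof (rule ortho_span[OF _ y])
  fix d assume d: "d \<in> C"
  have "ip (proj C x) d = (\<Sum>c\<in>C. if c = d then ip x d else 0)"
    unfolding proj_def ip_sum
  proof (rule sum.cong[OF refl])
    fix c assume "c \<in> C"
    then show "ip (s (ip x c / ip c c) c) d = (if c = d then ip x d else 0)"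
      using C d ip_definite[of d] by (auto simp: orthogonal_set_def ip_scale)
  qed
  then show "ip (x - proj C x) d = 0"
    using C d by (simp add: ip_diff orthogonal_set_def)
qed

text \<open>Gram-Schmidt without normalization; a vanishing remainder is dropped, which disposes of
  linear dependencies in \<open>B\<close>.\<close>

lemma exists_orthogonal_set:
  "finite B \<Longrightarrow> \<exists>C. orthogonal_set C \<and> span C = span B"
proof (induction B rule: finite_induct)
  case empty
  then show ?case by (intro exI[of _ "{}"]) (simp add: orthogonal_set_def)
next
  case (insert b B)
  then obtain C where C: "orthogonal_set C" "span C = span B" by blast
  define d where "d = b - proj C b"
  have b: "b = d + proj C b" by (simp add: d_def)
  have eq: "span (insert b B) = span (insert d C)"
  proof
    have p: "proj C b \<in> span (insert x C)" for x
      using proj_span[of C b] span_mono[of C "insert x C"] by blast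
    have "b \<in> span (insert d C)"
      by (subst b) (intro span_add p, simp add: span_base)
    moreover have "B \<subseteq> span (insert d C)"
      using C(2) span_mono[of C "insert d C"] span_superset[of B] by blast
    ultimately show "span (insert b B) \<subseteq> span (insert d C)"
      by (intro span_minimal subspace_span) simp
    have "proj C b \<in> span (insert b B)"
      using proj_span[of C b] C(2) span_mono[of B "insert b B"] by blast
    then have "d \<in> span (insert b B)"
      unfolding d_def by (intro span_diff) (simp add: span_base)
    moreover have "C \<subseteq> span (insert b B)"
      using C(2) span_mono[of B "insert b B"] span_superset[of C] by blast
    ultimately show "span (insert d C) \<subseteq> span (insert b B)"
      by (intro span_minimal subspace_span) simp
  qed
  show ?case
  proof (cases "d = 0")
    case True
    then have "span (insert d C) = span C" by (simp add: span_insert_0)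
    then show ?thesis using C eq by auto
  next
    case False
    have "ip d c = 0" if "c \<in> C" for c
      unfolding d_def using proj_ortho[OF C(1) span_base[OF that]] .
    then have "orthogonal_set (insert d C)"
      using C(1) False ip_zero_sym by (fastforce simp: orthogonal_set_def)
    then show ?thesis using eq by blast
  qed
qed

lemma exists_orthogonal_basis:
  assumes "subspace S" "S \<subseteq> span B" "finite B"
  obtains C where "orthogonal_set C" "span C = S"
proof -
  obtain A where A: "A \<subseteq> S" "independent A" "S \<subseteq> span A"
    using maximal_independent_subset[of S] by metis
  then have "finite A"
    using independent_span_bound[OF assms(3) A(2)] assms(2) by blast
  moreover have "span A = S"
    using A assms(1) span_minimal[of A S] by blast
  ultimately show thesis using exists_orthogonal_set[of A] that by metis
qed

lemma span_orthogonal_coeffs: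
  assumes "orthogonal_set C" "x \<in> span C" shows "x = proj C x"
proof -
  have "x - proj C x \<in> span C" using assms proj_span by (intro span_diff) auto
  then have "ip (x - proj C x) (x - proj C x) = 0" by (rule proj_ortho[OF assms(1)])
  then show ?thesis using ip_definite[of "x - proj C x"] by simp
qed

end

definition pip :: "('a \<Rightarrow>\<^sub>0 complex) \<Rightarrow> ('a \<Rightarrow>\<^sub>0 complex) \<Rightarrow> complex" where
  "pip p q = (\<Sum>k\<in>Poly_Mapping.keys p. cf p k * cnj (cf q k))"

lemma pip_eq:
  assumes "finite A" "Poly_Mapping.keys p \<subseteq> A \<or> Poly_Mapping.keys q \<subseteq> A"
  shows "pip p q = (\<Sum>k\<in>A. cf p k * cnj (cf q k))"
proof -
  have "pip p q = (\<Sum>k\<in>A \<union> Poly_Mapping.keys p. cf p k * cnj (cf q k))"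
    unfolding pip_def using assms(1) by (intro sum.mono_neutral_left) (auto simp: in_keys_iff)
  also have "\<dots> = (\<Sum>k\<in>A. cf p k * cnj (cf q k))"
    using assms by (intro sum.mono_neutral_right) (auto simp: in_keys_iff)
  finally show ?thesis .
qed

interpretation free_hs: hermitian_space "pscale :: complex \<Rightarrow> ('a \<Rightarrow>\<^sub>0 complex) \<Rightarrow> 'a \<Rightarrow>\<^sub>0 complex" pip
proof
  fix x y z :: "'a \<Rightarrow>\<^sub>0 complex" and c
  let ?A = "Poly_Mapping.keys x \<union> Poly_Mapping.keys y \<union> Poly_Mapping.keys z"
  show "pip (x + y) z = pip x z + pip y z"
    by (subst (1 2 3) pip_eq[of ?A]) (auto simp: lookup_add algebra_simps sum.distrib)
  show "pip (pscale c x) z = c * pip x z"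
    by (subst (1 2) pip_eq[of ?A]) (auto simp: sum_distrib_left mult.assoc)
  show "pip y x = cnj (pip x y)"
    by (subst (1 2) pip_eq[of ?A]) (auto simp: mult.commute)
  assume "pip x x = 0"
  then have "of_real (\<Sum>k\<in>Poly_Mapping.keys x. (cmod (cf x k))\<^sup>2) = (0 :: complex)"
    by (simp add: pip_def complex_norm_square del: of_real_power)
  then have "(\<Sum>k\<in>Poly_Mapping.keys x. (cmod (cf x k))\<^sup>2) = 0" by (simp only: of_real_eq_0_iff)
  then have "\<forall>k\<in>Poly_Mapping.keys x. (cmod (cf x k))\<^sup>2 = 0"
    by (subst (asm) sum_nonneg_eq_0_iff) auto
  then show "x = 0" by (intro poly_mapping_eqI) (auto simp: in_keys_iff)
qed

section \<open>Polynomials\<close>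

text \<open>A finitely supported function is the sum of its terms, and cancellation in the target
  provides \<open>f 0 = 0\<close>. The class covers exponents as well as polynomials, so one
  principle serves \<open>kact\<close> and \<open>pact\<close>.\<close>

lemma poly_mapping_additive_eqI:
  fixes f g :: "('a \<Rightarrow>\<^sub>0 'b::comm_monoid_add) \<Rightarrow> 'c::cancel_comm_monoid_add"
  assumes f: "\<And>p q. f (p + q) = f p + f q" and g: "\<And>p q. g (p + q) = g p + g q"
    and eq: "\<And>k c. k \<in> Poly_Mapping.keys p \<Longrightarrow> f (Poly_Mapping.single k c) = g (Poly_Mapping.single k c)"
  shows "f p = g p"
proof -
  have 0: "f 0 = 0" "g 0 = 0" using f[of 0 0] g[of 0 0] by simp_all
  have "f (sum h A) = (\<Sum>x\<in>A. f (h x))" "g (sum h A) = (\<Sum>x\<in>A. g (h x))" for h and A :: "'a set"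
    by (induction A rule: infinite_finite_induct) (simp_all add: 0 f g)
  then have "f (\<Sum>k\<in>Poly_Mapping.keys p. Poly_Mapping.single k (cf p k))
      = g (\<Sum>k\<in>Poly_Mapping.keys p. Poly_Mapping.single k (cf p k))"
    by (simp add: eq)
  then show ?thesis by (simp add: poly_mapping_sum_single)
qed

lemma reindex_reindex: 
  fixes p :: "'a \<Rightarrow>\<^sub>0 'c::cancel_comm_monoid_add"
  shows "reindex f (reindex g p) = reindex (f \<circ> g) p"
  by (rule poly_mapping_additive_eqI[of "\<lambda>p. reindex f (reindex g p)" "reindex (f \<circ> g)"])
    (simp_all add: reindex_add)

lemma reindex_id:
  fixes p :: "'a \<Rightarrow>\<^sub>0 'c::cancel_comm_monoid_add"
  shows "(\<And>k. k \<in> Poly_Mapping.keys p \<Longrightarrow> f k = k) \<Longrightarrow> reindex f p = p"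
  by (rule poly_mapping_additive_eqI[of "reindex f" "\<lambda>p. p"]) (simp_all add: reindex_add)

abbreviation kact :: "(nat \<Rightarrow> nat) \<Rightarrow> (nat \<Rightarrow>\<^sub>0 nat) \<Rightarrow> (nat \<Rightarrow>\<^sub>0 nat)" where
  "kact \<equiv> reindex"

abbreviation pact :: "(nat \<Rightarrow> nat) \<Rightarrow> zpoly \<Rightarrow> zpoly" where
  "pact \<sigma> \<equiv> reindex (kact \<sigma>)"

abbreviation polys :: "nat \<Rightarrow> zpoly set" where
  "polys N \<equiv> carrier (zpoly_ring N)"

definition mdeg :: "(nat \<Rightarrow>\<^sub>0 nat) \<Rightarrow> nat" where
  "mdeg k = (\<Sum>i\<in>Poly_Mapping.keys k. cf k i)"

definition zmono :: "(nat \<Rightarrow>\<^sub>0 nat) \<Rightarrow> zpoly" where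
  "zmono k = Poly_Mapping.single k 1"

definition monoms :: "nat \<Rightarrow> (nat \<Rightarrow>\<^sub>0 nat) set" where
  "monoms N = {k. Poly_Mapping.keys k \<subseteq> {..<N}}"

lemma mdeg_eq: "finite A \<Longrightarrow> Poly_Mapping.keys k \<subseteq> A \<Longrightarrow> mdeg k = (\<Sum>i\<in>A. cf k i)"
  unfolding mdeg_def by (intro sum.mono_neutral_left) (auto simp: in_keys_iff)

lemma mdeg_add: "mdeg (k + l) = mdeg k + mdeg l"
proof -
  let ?A = "Poly_Mapping.keys k \<union> Poly_Mapping.keys l"
  show ?thesis using keys_add[of k l]
    by (simp add: mdeg_eq[of ?A] lookup_add sum.distrib)
qed

lemma mdeg_single [simp]: "mdeg (Poly_Mapping.single i a) = a"
  by (simp add: mdeg_def)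

lemma mdeg_0 [simp]: "mdeg 0 = 0"
  by (simp add: mdeg_def)

lemma mdeg_kact: "mdeg (kact \<sigma> k) = mdeg k"
  by (rule poly_mapping_additive_eqI[of "\<lambda>k. mdeg (kact \<sigma> k)" mdeg]) (simp_all add: reindex_add mdeg_add)

lemma monoms_add: "k \<in> monoms N \<Longrightarrow> l \<in> monoms N \<Longrightarrow> k + l \<in> monoms N"
  using keys_add[of k l] by (auto simp: monoms_def)

lemma monoms_0 [simp]: "0 \<in> monoms N" by (simp add: monoms_def)

lemma monoms_single: "i < N \<Longrightarrow> Poly_Mapping.single i a \<in> monoms N"
  by (simp add: monoms_def)

lemma monoms_kact:
  assumes "\<sigma> permutes {..<N}" "k \<in> monoms N" shows "kact \<sigma> k \<in> monoms N"
proof -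
  have "Poly_Mapping.keys (kact \<sigma> k) \<subseteq> \<sigma> ` {..<N}"
    using keys_reindex[of \<sigma> k] assms(2) by (auto simp: monoms_def)
  then show ?thesis using permutes_image[OF assms(1)] by (simp add: monoms_def)
qed

lemma kact_inv: "\<sigma> permutes S \<Longrightarrow> kact (pinv \<sigma>) (kact \<sigma> k) = k" "\<sigma> permutes S \<Longrightarrow> kact \<sigma> (kact (pinv \<sigma>) k) = k"
  by (simp_all add: reindex_reindex permutes_inv_o reindex_id)

lemma inj_kact: "\<sigma> permutes S \<Longrightarrow> inj (kact \<sigma>)"
  by (rule inj_on_inverseI[where g = "kact (pinv \<sigma>)"]) (rule kact_inv)

lemma cf_pact: "\<sigma> permutes S \<Longrightarrow> cf (pact \<sigma> p) (kact \<sigma> k) = cf p k"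
  by (rule cf_reindex_inj) (rule inj_kact)

lemma cf_pact': "\<sigma> permutes S \<Longrightarrow> cf (pact \<sigma> p) k = cf p (kact (pinv \<sigma>) k)"
  using cf_pact[of \<sigma> S p "kact (pinv \<sigma>) k"] by (simp add: kact_inv)

lemma zmono_mult: "zmono k * zmono l = zmono (k + l)"
  by (simp add: zmono_def mult_single)

lemma zmono_0 [simp]: "zmono 0 = 1"
  by (simp add: zmono_def)

lemma pact_zmono [simp]: "pact \<sigma> (zmono k) = zmono (kact \<sigma> k)"
  by (simp add: zmono_def)

lemma pact_mult: "pact \<sigma> (p * q) = pact \<sigma> p * pact \<sigma> q"
proof (rule poly_mapping_additive_eqI[of "\<lambda>p. pact \<sigma> (p * q)" "\<lambda>p. pact \<sigma> p * pact \<sigma> q"])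
  fix k c
  show "pact \<sigma> (Poly_Mapping.single k c * q) = pact \<sigma> (Poly_Mapping.single k c) * pact \<sigma> q"
    by (rule poly_mapping_additive_eqI[of "\<lambda>q. pact \<sigma> (Poly_Mapping.single k c * q)"
          "\<lambda>q. pact \<sigma> (Poly_Mapping.single k c) * pact \<sigma> q"])
      (simp_all add: reindex_add distrib_left mult_single)
qed (simp_all add: reindex_add distrib_right)

lemma pact_pact: "pact \<sigma> (pact \<tau> p) = pact (\<sigma> \<circ> \<tau>) p"
proof -
  have "kact \<sigma> \<circ> kact \<tau> = kact (\<sigma> \<circ> \<tau>)" by (simp add: fun_eq_iff reindex_reindex)
  then show ?thesis by (simp add: reindex_reindex)
qed

lemma pact_id [simp]: "pact id p = p"
  by (intro reindex_id) simp

lemma pact_inv: "\<sigma> permutes S \<Longrightarrow> pact (pinv \<sigma>) (pact \<sigma> p) = p" "\<sigma> permutes S \<Longrightarrow> pact \<sigma> (pact (pinv \<sigma>) p) = p"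
  by (simp_all only: pact_pact permutes_inv_o pact_id)

lemma pact_0 [simp]: "pact \<sigma> 0 = 0"
  by (simp add: reindex_def)

lemma pact_sum: "pact \<sigma> (sum f A) = (\<Sum>a\<in>A. pact \<sigma> (f a))"
  by (induction A rule: infinite_finite_induct) (simp_all add: reindex_add)

lemma pscale_eq_mult: "pscale c p = zconst c * p"
  by (simp add: pscale_def zconst_def mult_map_scale_conv_mult)

lemma zconst_simps: "zconst 0 = 0" "zconst 1 = 1" "zconst (a + b) = zconst a + zconst b"
  "zconst (a * b) = zconst a * zconst b" "zconst (- a) = - zconst a" "zconst (a - b) = zconst a - zconst b"
  by (simp_all add: zconst_def single_add mult_single single_uminus single_diff)

lemma zconst_sum: "zconst (sum f A) = (\<Sum>a\<in>A. zconst (f a))"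
  by (induction A rule: infinite_finite_induct) (simp_all add: zconst_simps)

lemma pact_zconst [simp]: "pact \<sigma> (zconst c) = zconst c"
proof -
  have "kact \<sigma> 0 = 0" by (simp add: reindex_def)
  then show ?thesis by (simp add: zconst_def)
qed

lemma polys_iff: "p \<in> polys N \<longleftrightarrow> Poly_Mapping.keys p \<subseteq> monoms N"
  by (auto simp: zpoly_ring_def monoms_def)

lemma polys_0 [simp]: "0 \<in> polys N" by (simp add: polys_iff)

lemma polys_add: "p \<in> polys N \<Longrightarrow> q \<in> polys N \<Longrightarrow> p + q \<in> polys N"
  using keys_add[of p q] by (auto simp: polys_iff)

lemma polys_mult: assumes "p \<in> polys N" "q \<in> polys N" shows "p * q \<in> polys N"
  unfolding polys_iff
proof
  fix k assume "k \<in> Poly_Mapping.keys (p * q)"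
  then obtain a b where "k = a + b" "a \<in> Poly_Mapping.keys p" "b \<in> Poly_Mapping.keys q"
    using keys_mult[of p q] by auto
  then show "k \<in> monoms N" using assms by (auto simp: polys_iff intro: monoms_add)
qed

lemma polys_single: "k \<in> monoms N \<Longrightarrow> Poly_Mapping.single k c \<in> polys N"
  by (simp add: polys_iff)

lemma polys_zmono: "k \<in> monoms N \<Longrightarrow> zmono k \<in> polys N"
  by (simp add: zmono_def polys_single)

lemma polys_zconst: "zconst c \<in> polys N"
  by (simp add: zconst_def polys_single)

lemma polys_one: "1 \<in> polys N"
  using polys_zconst[of 1 N] by (simp add: zconst_simps)

lemma polys_uminus: "p \<in> polys N \<Longrightarrow> - p \<in> polys N"
  by (simp add: polys_iff subset_iff in_keys_iff)

lemma polys_sum: "(\<And>a. a \<in> A \<Longrightarrow> f a \<in> polys N) \<Longrightarrow> sum f A \<in> polys N"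
  by (induction A rule: infinite_finite_induct) (simp_all add: polys_add)

lemma polys_pact:
  assumes "\<sigma> permutes {..<N}" "p \<in> polys N" shows "pact \<sigma> p \<in> polys N"
  unfolding polys_iff
proof
  fix k assume "k \<in> Poly_Mapping.keys (pact \<sigma> p)"
  then obtain l where "k = kact \<sigma> l" "l \<in> Poly_Mapping.keys p"
    using keys_reindex[of "kact \<sigma>" p] by auto
  then show "k \<in> monoms N" using assms(2) monoms_kact[OF assms(1)] by (auto simp: polys_iff)
qed

lemma subspace_polys: "free_vs.subspace (polys N)"
  by (rule free_vs.subspaceI) (simp_all add: polys_add pscale_eq_mult polys_mult polys_zconst)

lemma poly_span_zmono: "p \<in> polys N \<Longrightarrow> p \<in> free_vs.span (zmono ` monoms N)"
proof -
  assume p: "p \<in> polys N"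
  have "(\<Sum>k\<in>Poly_Mapping.keys p. pscale (cf p k) (zmono k)) \<in> free_vs.span (zmono ` monoms N)"
    using p by (intro free_vs.span_sum free_vs.span_scale free_vs.span_base) (auto simp: polys_iff)
  also have "(\<Sum>k\<in>Poly_Mapping.keys p. pscale (cf p k) (zmono k)) = p"
    by (rule poly_mapping_eqI) (auto simp: lookup_sum zmono_def lookup_single when_def in_keys_iff if_distrib cong: if_cong)
  finally show ?thesis .
qed

lemma zhom_iff: "p \<in> zhom m \<longleftrightarrow> (\<forall>k. cf p k \<noteq> 0 \<longrightarrow> mdeg k = m)"
  by (auto simp: zhom_def mdeg_def in_keys_iff)

lemma zhom_0 [simp]: "0 \<in> zhom m" by (simp add: zhom_iff)

lemma zhom_add: "p \<in> zhom m \<Longrightarrow> q \<in> zhom m \<Longrightarrow> p + q \<in> zhom m"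
  by (simp add: zhom_iff lookup_add) (metis add_0)

lemma zhom_pscale: "p \<in> zhom m \<Longrightarrow> pscale c p \<in> zhom m"
  by (auto simp: zhom_iff)

lemma zhom_mult: assumes "p \<in> zhom m" "q \<in> zhom m'" shows "p * q \<in> zhom (m + m')"
  unfolding zhom_iff
proof (intro allI impI)
  fix k assume "cf (p * q) k \<noteq> 0"
  then have "k \<in> Poly_Mapping.keys (p * q)" by (simp add: in_keys_iff)
  then obtain a b where "k = a + b" "a \<in> Poly_Mapping.keys p" "b \<in> Poly_Mapping.keys q"
    using keys_mult[of p q] by auto
  then show "mdeg k = m + m'" using assms by (simp add: zhom_iff in_keys_iff mdeg_add)
qed

lemma zhom_zmono: "zmono k \<in> zhom (mdeg k)"
  by (auto simp: zhom_iff zmono_def lookup_single when_def split: if_splits)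

lemma zhom_pact: assumes "p \<in> zhom m" shows "pact \<sigma> p \<in> zhom m"
  unfolding zhom_iff
proof (intro allI impI)
  fix k assume "cf (pact \<sigma> p) k \<noteq> 0"
  then have "k \<in> Poly_Mapping.keys (pact \<sigma> p)" by (simp add: in_keys_iff)
  then obtain l where "k = kact \<sigma> l" "l \<in> Poly_Mapping.keys p"
    using keys_reindex[of "kact \<sigma>" p] by auto
  then show "mdeg k = m" using assms by (simp add: zhom_iff in_keys_iff mdeg_kact)
qed

lemma zhom_sum: "(\<And>a. a \<in> A \<Longrightarrow> f a \<in> zhom m) \<Longrightarrow> sum f A \<in> zhom m"
  by (induction A rule: infinite_finite_induct) (simp_all add: zhom_add)

definition hcomp :: "nat \<Rightarrow> zpoly \<Rightarrow> zpoly" where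
  "hcomp m p = Poly_Mapping.mapp (\<lambda>k c. c when mdeg k = m) p"

lemma cf_hcomp: "cf (hcomp m p) k = (cf p k when mdeg k = m)"
  by (auto simp: hcomp_def lookup_mapp when_def in_keys_iff)

lemma hcomp_simps: "hcomp m (p + q) = hcomp m p + hcomp m q" "hcomp m (pscale c p) = pscale c (hcomp m p)"
  "hcomp m 0 = 0"
  by (auto intro!: poly_mapping_eqI simp: cf_hcomp lookup_add when_def)

lemma hcomp_zhom: "p \<in> zhom m' \<Longrightarrow> hcomp m p = (if m = m' then p else 0)"
  by (auto intro!: poly_mapping_eqI simp: cf_hcomp when_def zhom_iff)

lemma zhom_hcomp: "hcomp m p \<in> zhom m"
  by (auto simp: zhom_iff cf_hcomp when_def split: if_splits)

section \<open>The coinvariant ideal\<close>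

definition expo :: "nat set \<Rightarrow> nat \<Rightarrow>\<^sub>0 nat" where
  "expo S = (\<Sum>i\<in>S. Poly_Mapping.single i 1)"

lemma cf_expo: "finite S \<Longrightarrow> cf (expo S) i = (if i \<in> S then 1 else 0)"
  by (simp add: expo_def lookup_sum lookup_single when_def)

lemma keys_expo: "finite S \<Longrightarrow> Poly_Mapping.keys (expo S) = S"
  by (auto simp: in_keys_iff cf_expo split: if_splits)

lemma mdeg_expo: "finite S \<Longrightarrow> mdeg (expo S) = card S"
  by (simp add: mdeg_def keys_expo cf_expo)

lemma monoms_expo: "S \<subseteq> {..<N} \<Longrightarrow> expo S \<in> monoms N"
  using finite_subset[of S "{..<N}"] by (simp add: monoms_def keys_expo)

lemma kact_sum: "kact \<sigma> (sum f A) = (\<Sum>a\<in>A. kact \<sigma> (f a))"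
  by (induction A rule: infinite_finite_induct) (simp_all add: reindex_add reindex_def[of _ 0])

lemma kact_expo: "\<sigma> permutes U \<Longrightarrow> kact \<sigma> (expo S) = expo (\<sigma> ` S)"
  unfolding expo_def kact_sum
  by (subst sum.reindex) (auto intro: inj_on_subset[OF permutes_inj])

lemma prod_zvar: "finite S \<Longrightarrow> (\<Prod>i\<in>S. zvar i) = zmono (expo S)"
  by (induction S rule: finite_induct) (simp_all add: expo_def zmono_mult[symmetric] zvar_def zmono_def[symmetric])

abbreviation subsets_of_card :: "nat \<Rightarrow> nat \<Rightarrow> nat set set" where
  "subsets_of_card N k \<equiv> {S. S \<subseteq> {..<N} \<and> card S = k}"

lemma elem_sym_zmono: "elem_sym N k = (\<Sum>S\<in>subsets_of_card N k. zmono (expo S))"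
  unfolding elem_sym_def by (intro sum.cong refl prod_zvar) (auto intro: finite_subset)

lemma finite_subsets_of_card [simp]: "finite (subsets_of_card N k)"
  by simp

lemma elem_sym_polys: "elem_sym N k \<in> polys N"
  unfolding elem_sym_zmono by (intro polys_sum polys_zmono monoms_expo) simp

lemma elem_sym_zhom: "elem_sym N k \<in> zhom k"
  unfolding elem_sym_zmono
proof (rule zhom_sum)
  fix S assume "S \<in> subsets_of_card N k"
  then have "finite S" "card S = k" using finite_subset[of S "{..<N}"] by auto
  then show "zmono (expo S) \<in> zhom k" using zhom_zmono[of "expo S"] by (simp add: mdeg_expo)
qed

lemma pact_elem_sym:
  assumes \<sigma>: "\<sigma> permutes {..<N}" shows "pact \<sigma> (elem_sym N k) = elem_sym N k"
proof -
  have im: "\<sigma> ` S \<in> subsets_of_card N k" if "S \<in> subsets_of_card N k" "\<sigma> permutes {..<N}" for S \<sigma>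
  proof -
    have "inj_on \<sigma> S" using permutes_inj[OF that(2)] inj_on_subset by blast
    then have "card (\<sigma> ` S) = k" using that(1) by (simp add: card_image)
    moreover have "\<sigma> ` S \<subseteq> \<sigma> ` {..<N}" using that(1) by (intro image_mono) simp
    ultimately show ?thesis using permutes_image[OF that(2)] by simp
  qed
  have "pact \<sigma> (elem_sym N k) = (\<Sum>S\<in>subsets_of_card N k. zmono (expo (\<sigma> ` S)))"
    by (simp add: elem_sym_zmono pact_sum kact_expo[OF \<sigma>])
  also have "\<dots> = (\<Sum>S\<in>subsets_of_card N k. zmono (expo S))"
    by (rule sum.reindex_bij_witness[where i = "\<lambda>S. pinv \<sigma> ` S" and j = "\<lambda>S. \<sigma> ` S"])
      (use im \<sigma> permutes_inv[OF \<sigma>] in \<open>simp_all add: image_image permutes_inverses[OF \<sigma>]\<close>)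
  finally show ?thesis by (simp add: elem_sym_zmono)
qed

section \<open>The coinvariant ideal as a graded complex span\<close>

definition J_gens :: "nat \<Rightarrow> zpoly set" where
  "J_gens N = {zmono a * elem_sym N j | a j. a \<in> monoms N \<and> j \<in> {1..N}}"

lemma cring_zpoly_ring: "cring (zpoly_ring N)"
proof (rule cringI)
  show "abelian_group (zpoly_ring N)"
  proof (rule abelian_groupI)
    fix x assume "x \<in> polys N"
    then show "\<exists>y\<in>polys N. y \<oplus>\<^bsub>zpoly_ring N\<^esub> x = \<zero>\<^bsub>zpoly_ring N\<^esub>"
      using polys_uminus[of x N] by (intro bexI[of _ "- x"]) (simp_all add: zpoly_ring_def)
  next
    fix x y assume "x \<in> polys N" "y \<in> polys N"
    then show "x \<oplus>\<^bsub>zpoly_ring N\<^esub> y \<in> polys N"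
      using polys_add[of x N y] by (simp add: zpoly_ring_def)
  next
    show "\<zero>\<^bsub>zpoly_ring N\<^esub> \<in> polys N" using polys_0[of N] by (simp add: zpoly_ring_def)
  qed (simp_all add: zpoly_ring_def algebra_simps)
  show "Group.comm_monoid (zpoly_ring N)"
  proof (rule comm_monoidI)
    fix x y assume "x \<in> polys N" "y \<in> polys N"
    then show "x \<otimes>\<^bsub>zpoly_ring N\<^esub> y \<in> polys N"
      using polys_mult[of x N y] by (simp add: zpoly_ring_def)
  next
    show "\<one>\<^bsub>zpoly_ring N\<^esub> \<in> polys N" using polys_one[of N] by (simp add: zpoly_ring_def)
  qed (simp_all add: zpoly_ring_def algebra_simps)
qed (simp add: zpoly_ring_def algebra_simps)

lemma zpoly_ring_simps: "add (zpoly_ring N) = (+)" "mult (zpoly_ring N) = (*)" "\<zero>\<^bsub>zpoly_ring N\<^esub> = 0" "\<one>\<^bsub>zpoly_ring N\<^esub> = 1"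
  by (simp_all add: zpoly_ring_def)

lemma pscale_mult: "pscale c p * q = pscale c (p * q)" "p * pscale c q = pscale c (p * q)" for p q :: zpoly
  by (simp_all add: pscale_eq_mult ac_simps)

lemma span_mult_closed:
  assumes X: "\<And>a x. a \<in> monoms N \<Longrightarrow> x \<in> X \<Longrightarrow> zmono a * x \<in> free_vs.span X"
    and p: "p \<in> polys N" and q: "q \<in> free_vs.span X"
  shows "p * q \<in> free_vs.span X"
  using q
proof (induction rule: free_vs.span_induct_alt)
  case base
  then show ?case by (simp add: free_vs.span_zero)
next
  case (step c x y)
  have "p * x \<in> free_vs.span X"
    using poly_span_zmono[OF p]
  proof (induction rule: free_vs.span_induct_alt)
    case base
    then show ?case by (simp add: free_vs.span_zero)
  next
    case (step d k r)
    then have "pscale d (k * x) + r * x \<in> free_vs.span X"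
      using X \<open>x \<in> X\<close> by (intro free_vs.span_add free_vs.span_scale) auto
    then show ?case by (simp add: pscale_mult distrib_right)
  qed
  then have "pscale c (p * x) + p * y \<in> free_vs.span X"
    by (intro free_vs.span_add free_vs.span_scale step)
  then show ?case by (simp add: pscale_mult distrib_left)
qed

lemma J_gens_mult: "a \<in> monoms N \<Longrightarrow> x \<in> J_gens N \<Longrightarrow> zmono a * x \<in> J_gens N"
  unfolding J_gens_def by (clarify, rename_tac b j, rule_tac x = "a + b" in exI, rule_tac x = j in exI)
    (simp add: zmono_mult[symmetric] mult.assoc monoms_add)

text \<open>Multiplying the generators by all monomials makes the ideal a complex span, so that span
  induction, homogeneous components and orthogonality become available for it.\<close>

lemma J_eq_span: "J N = free_vs.span (J_gens N)"
proof (rule equalityI)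
  interpret R: cring "zpoly_ring N" by (rule cring_zpoly_ring)
  let ?E = "elem_sym N ` {1..N}" and ?I = "free_vs.span (J_gens N)"
  have gens: "J_gens N \<subseteq> polys N"
    by (auto simp: J_gens_def intro!: polys_mult polys_zmono elem_sym_polys)
  have sub: "?I \<subseteq> polys N" using gens subspace_polys by (rule free_vs.span_minimal)
  have mult: "p * q \<in> ?I" if "p \<in> polys N" "q \<in> ?I" for p q
    using that by (rule span_mult_closed[rotated]) (intro free_vs.span_base J_gens_mult)
  have "ideal ?I (zpoly_ring N)"
  proof (rule idealI)
    show "subgroup ?I (add_monoid (zpoly_ring N))"
    proof (rule R.add.subgroupI)
      show "?I \<subseteq> polys N" by (rule sub)
      show "?I \<noteq> {}" using free_vs.span_zero by blast
    next
      fix a assume a: "a \<in> ?I"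
      have "- a = \<ominus>\<^bsub>zpoly_ring N\<^esub> a"
      proof (rule R.minus_equality[symmetric])
        show "- a \<oplus>\<^bsub>zpoly_ring N\<^esub> a = \<zero>\<^bsub>zpoly_ring N\<^esub>" by (simp add: zpoly_ring_simps)
      qed (use a sub polys_uminus in auto)
      then show "\<ominus>\<^bsub>zpoly_ring N\<^esub> a \<in> ?I" using free_vs.span_neg[OF a] by simp
    next
      fix a b assume "a \<in> ?I" "b \<in> ?I"
      then show "a \<oplus>\<^bsub>zpoly_ring N\<^esub> b \<in> ?I" by (simp add: zpoly_ring_simps free_vs.span_add)
    qed
  next
    fix a x assume "a \<in> ?I" "x \<in> polys N"
    then show "x \<otimes>\<^bsub>zpoly_ring N\<^esub> a \<in> ?I" "a \<otimes>\<^bsub>zpoly_ring N\<^esub> x \<in> ?I"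
      using mult by (simp_all add: zpoly_ring_simps mult.commute[of a])
  qed (rule R.ring_axioms)
  moreover have "?E \<subseteq> ?I"
  proof
    fix x assume "x \<in> ?E"
    then obtain j where "j \<in> {1..N}" "x = elem_sym N j" by blast
    then have "x \<in> J_gens N" 
      unfolding J_gens_def by (intro CollectI exI[of _ 0] exI[of _ j]) simp
    then show "x \<in> ?I" by (rule free_vs.span_base)
  qed
  ultimately show "J N \<subseteq> ?I" unfolding J_def by (rule R.genideal_minimal)
  have E: "?E \<subseteq> polys N" using elem_sym_polys by blast
  interpret I: ideal "J N" "zpoly_ring N" unfolding J_def by (rule R.genideal_ideal[OF E])
  have JE: "?E \<subseteq> J N" unfolding J_def by (rule R.genideal_self[OF E])
  have "J_gens N \<subseteq> J N"
  proof
    fix x assume "x \<in> J_gens N"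
    then obtain a j where aj: "a \<in> monoms N" "j \<in> {1..N}" "x = zmono a * elem_sym N j"
      by (auto simp: J_gens_def)
    have "elem_sym N j \<in> J N" using JE aj(2) by blast
    from I.I_l_closed[OF this polys_zmono[OF aj(1)]] show "x \<in> J N"
      by (simp add: zpoly_ring_simps aj)
  qed
  moreover have "free_vs.subspace (J N)"
  proof (rule free_vs.subspaceI)
    show "0 \<in> J N" using I.zero_closed by (simp add: zpoly_ring_simps)
    fix x y assume x: "x \<in> J N" and y: "y \<in> J N"
    show "x + y \<in> J N" using I.a_closed[OF x y] by (simp add: zpoly_ring_simps)
    fix c show "pscale c x \<in> J N"
      using I.I_l_closed[OF x polys_zconst[of c]] by (simp add: zpoly_ring_simps pscale_eq_mult)
  qed
  ultimately show "?I \<subseteq> J N" by (rule free_vs.span_minimal)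
qed

lemma subspace_J: "free_vs.subspace (J N)"
  unfolding J_eq_span by (rule free_vs.subspace_span)

lemma J_polys: "p \<in> J N \<Longrightarrow> p \<in> polys N"
proof -
  have "J_gens N \<subseteq> polys N"
    by (auto simp: J_gens_def intro!: polys_mult polys_zmono elem_sym_polys)
  then have "J N \<subseteq> polys N" unfolding J_eq_span using subspace_polys by (rule free_vs.span_minimal)
  then show "p \<in> J N \<Longrightarrow> p \<in> polys N" by blast
qed

lemma J_mult: "p \<in> polys N \<Longrightarrow> q \<in> J N \<Longrightarrow> p * q \<in> J N"
  unfolding J_eq_span by (rule span_mult_closed[rotated]) (auto intro: free_vs.span_base J_gens_mult)

lemma J_add: "p \<in> J N \<Longrightarrow> q \<in> J N \<Longrightarrow> p + q \<in> J N"
  by (rule free_vs.subspace_add[OF subspace_J])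

lemma J_pscale: "p \<in> J N \<Longrightarrow> pscale c p \<in> J N"
  by (rule free_vs.subspace_scale[OF subspace_J])

lemma J_sum: "(\<And>a. a \<in> A \<Longrightarrow> f a \<in> J N) \<Longrightarrow> sum f A \<in> J N"
  by (rule free_vs.subspace_sum[OF subspace_J])

lemma J_0: "0 \<in> J N"
  by (rule free_vs.subspace_0[OF subspace_J])

lemma elem_sym_J: "j \<in> {1..N} \<Longrightarrow> elem_sym N j \<in> J N"
  unfolding J_eq_span by (rule free_vs.span_base) (force simp: J_gens_def intro: exI[of _ 0])

lemma span_image_closed:
  fixes f :: "('a \<Rightarrow>\<^sub>0 complex) \<Rightarrow> ('b \<Rightarrow>\<^sub>0 complex)"
  assumes "\<And>p q. f (p + q) = f p + f q" "\<And>c p. f (pscale c p) = pscale c (f p)"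
    and "\<And>x. x \<in> X \<Longrightarrow> f x \<in> free_vs.span Y" and "x \<in> free_vs.span X"
  shows "f x \<in> free_vs.span Y"
  using assms(4)
proof (induction rule: free_vs.span_induct_alt)
  case base
  have "f 0 = 0" using assms(1)[of 0 0] by simp
  then show ?case by (simp add: free_vs.span_zero)
next
  case (step c x y)
  then show ?case using assms by (simp add: free_vs.span_add free_vs.span_scale)
qed

lemma J_pact:
  assumes \<sigma>: "\<sigma> permutes {..<N}" and "p \<in> J N" shows "pact \<sigma> p \<in> J N"
proof -
  have "pact \<sigma> x \<in> free_vs.span (J_gens N)" if "x \<in> J_gens N" for x
  proof -
    from that obtain a j where aj: "a \<in> monoms N" "j \<in> {1..N}" "x = zmono a * elem_sym N j"
      by (auto simp: J_gens_def)
    then show ?thesis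
      using J_mult[OF polys_zmono[OF monoms_kact[OF \<sigma> aj(1)]] elem_sym_J[OF aj(2)]]
      by (simp add: pact_mult pact_elem_sym[OF \<sigma>] J_eq_span)
  qed
  then show ?thesis using assms(2) unfolding J_eq_span
    by (rule span_image_closed[OF reindex_add reindex_pscale])
qed

definition J_hgens :: "nat \<Rightarrow> nat \<Rightarrow> zpoly set" where
  "J_hgens N m = {zmono a * elem_sym N j | a j. a \<in> monoms N \<and> j \<in> {1..N} \<and> mdeg a + j = m}"

lemma hcomp_J_gens:
  assumes "x \<in> J_gens N" shows "hcomp m x \<in> free_vs.span (J_hgens N m)"
proof -
  from assms obtain a j where aj: "a \<in> monoms N" "j \<in> {1..N}" "x = zmono a * elem_sym N j"
    by (auto simp: J_gens_def)
  then have "x \<in> zhom (mdeg a + j)" by (simp add: zhom_mult zhom_zmono elem_sym_zhom)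
  then have "hcomp m x = (if m = mdeg a + j then x else 0)" by (rule hcomp_zhom)
  moreover have "x \<in> J_hgens N m" if "m = mdeg a + j" using aj that by (auto simp: J_hgens_def)
  ultimately show ?thesis by (simp add: free_vs.span_zero free_vs.span_base)
qed

text \<open>The generators are homogeneous, so the ideal is graded. Its part of degree
  \<open>m\<close> is spanned inside the finite-dimensional space of polynomials of degree
  \<open>m\<close>, where orthogonal projections exist.\<close>

lemma hcomp_J: "p \<in> J N \<Longrightarrow> hcomp m p \<in> free_vs.span (J_hgens N m)"
  unfolding J_eq_span
  by (rule span_image_closed[of "hcomp m", OF hcomp_simps(1,2) hcomp_J_gens])

lemma J_hgens_J: "free_vs.span (J_hgens N m) \<subseteq> J N"
  unfolding J_eq_span by (intro free_vs.span_mono) (auto simp: J_hgens_def J_gens_def)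

lemma J_zhom_span: "p \<in> J N \<Longrightarrow> p \<in> zhom m \<Longrightarrow> p \<in> free_vs.span (J_hgens N m)"
  using hcomp_J[of p N m] by (simp add: hcomp_zhom)

subsection \<open>Symmetric polynomials without constant term\<close>

abbreviation perms :: "nat \<Rightarrow> (nat \<Rightarrow> nat) set" where
  "perms N \<equiv> {\<sigma>. \<sigma> permutes {..<N}}"

text \<open>Summed over the group rather than over the orbit: the monomial symmetric polynomial
  times the order of the stabilizer of \<open>a\<close>. This is the form that symmetrization
  produces.\<close>

definition orbit_sum :: "nat \<Rightarrow> (nat \<Rightarrow>\<^sub>0 nat) \<Rightarrow> zpoly" where
  "orbit_sum N a = (\<Sum>\<sigma>\<in>perms N. zmono (kact \<sigma> a))"

lemma orbit_sum_kact:
  assumes "\<tau> permutes {..<N}" shows "orbit_sum N (kact \<tau> a) = orbit_sum N a"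
  using sum_permutations_compose_right[OF assms, of "\<lambda>\<sigma>. zmono (kact \<sigma> a)"]
  by (simp add: orbit_sum_def reindex_reindex)

text \<open>Glued from three bijections: the identity on \<open>K\<close>, one from
  \<open>A - K\<close> to \<open>B - K\<close>, and one between the complements of \<open>A\<close>
  and \<open>B\<close>.\<close>

lemma exists_permutation_extending:
  assumes U: "finite U" and K: "K \<subseteq> A" "K \<subseteq> B" and AB: "A \<subseteq> U" "B \<subseteq> U" "card A = card B"
  obtains \<tau> where "\<tau> permutes U" "\<And>i. i \<in> K \<Longrightarrow> \<tau> i = i" "\<tau> ` A = B"
proof -
  have fin: "finite A" "finite B" "finite K" using U AB K by (auto dest: finite_subset)
  obtain f where f: "bij_betw f (A - K) (B - K)"
    using finite_same_card_bij[of "A - K" "B - K"] fin K AB by (auto simp: card_Diff_subset)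
  obtain g where g: "bij_betw g (U - A) (U - B)"
    using finite_same_card_bij[of "U - A" "U - B"] fin U AB by (auto simp: card_Diff_subset)
  define \<tau> where "\<tau> i = (if i \<in> K then i else if i \<in> A then f i else if i \<in> U then g i else i)" for i
  have 1: "bij_betw \<tau> K K" by (rule bij_betw_cong[THEN iffD2, of K \<tau> id]) (auto simp: \<tau>_def)
  have 2: "bij_betw \<tau> (A - K) (B - K)"
    by (rule bij_betw_cong[THEN iffD2, of _ \<tau> f, OF _ f]) (auto simp: \<tau>_def)
  have 3: "bij_betw \<tau> (U - A) (U - B)"
    by (rule bij_betw_cong[THEN iffD2, of _ \<tau> g, OF _ g]) (use K in \<open>auto simp: \<tau>_def\<close>)
  have "bij_betw \<tau> (K \<union> (A - K)) (K \<union> (B - K))" by (rule bij_betw_combine[OF 1 2]) blast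
  then have 4: "bij_betw \<tau> A B" using K by (simp add: Un_absorb1 Un_Diff_cancel)
  have "bij_betw \<tau> (A \<union> (U - A)) (B \<union> (U - B))" by (rule bij_betw_combine[OF 4 3]) blast
  then have "bij_betw \<tau> U U" using AB by (simp add: Un_absorb1 Un_Diff_cancel)
  then have "\<tau> permutes U" by (rule bij_imp_permutes) (use K AB in \<open>auto simp: \<tau>_def\<close>)
  moreover have "\<tau> ` A = B" using 4 by (simp add: bij_betw_def)
  ultimately show thesis using that by (simp add: \<tau>_def)
qed

text \<open>For \<open>|supp a| = s\<close> one expands \<open>e\<^sub>s\<close> times the orbit sum of \<open>a\<close> with every exponent lowered by
  one: the terms other than the orbit sum of \<open>a\<close> have larger support.\<close>

lemma orbit_sum_J:
  assumes "a \<in> monoms N" "a \<noteq> 0"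
  shows "orbit_sum N a \<in> J N"
  using assms
proof (induction "N - card (Poly_Mapping.keys a)" arbitrary: a rule: less_induct)
  case less
  define S0 where "S0 = Poly_Mapping.keys a"
  define s where "s = card S0"
  have S0: "S0 \<subseteq> {..<N}" "finite S0" using less.prems by (auto simp: S0_def monoms_def)
  have s1: "s \<in> {1..N}"
    using card_mono[OF _ S0(1)] less.prems(2) by (auto simp: s_def S0_def Suc_le_eq card_gt_0_iff)
  define b where "b = a - expo S0"
  have cfb: "cf b i = cf a i - (if i \<in> S0 then 1 else 0)" for i
    by (simp add: b_def lookup_minus cf_expo S0)
  have a: "a = b + expo S0"
  proof (rule poly_mapping_eqI)
    fix i show "cf a i = cf (b + expo S0) i"
      by (cases "cf a i = 0") (auto simp: lookup_add cfb cf_expo S0 in_keys_iff S0_def)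
  qed
  have kb: "Poly_Mapping.keys b \<subseteq> S0" by (auto simp: in_keys_iff cfb S0_def)
  have bN: "b \<in> monoms N" using kb S0 by (auto simp: monoms_def)
  \<comment> \<open>For \<open>S\<close> in \<open>G\<close> a permutation fixing the support of
    \<open>b\<close> carries \<open>S0\<close> to \<open>S\<close>, so the term lies in the orbit of
    \<open>a\<close>. For any other \<open>S\<close> the support of the term is the union of
    \<open>S\<close> with that of \<open>b\<close>, which has more than \<open>s\<close>
    elements.\<close>
  define G where "G = {S \<in> subsets_of_card N s. Poly_Mapping.keys b \<subseteq> S}"
  have S0G: "S0 \<in> G" using S0 kb by (simp add: G_def s_def)
  have same: "orbit_sum N (b + expo S) = orbit_sum N a" if SG: "S \<in> G" for S
  proof -
    obtain \<tau> where \<tau>: "\<tau> permutes {..<N}" "\<And>i. i \<in> Poly_Mapping.keys b \<Longrightarrow> \<tau> i = i" "\<tau> ` S0 = S"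
      by (rule exists_permutation_extending[of "{..<N}" "Poly_Mapping.keys b" S0 S])
        (use kb SG S0 in \<open>simp_all add: G_def s_def\<close>)
    have "kact \<tau> a = b + expo S"
      by (simp add: a reindex_add reindex_id \<tau>(2) kact_expo[OF \<tau>(1)] \<tau>(3))
    then show ?thesis using orbit_sum_kact[OF \<tau>(1), of a] by simp
  qed
  have bigger: "orbit_sum N (b + expo S) \<in> J N" if S: "S \<in> subsets_of_card N s - G" for S
  proof -
    have fS: "finite S" and SN: "S \<subseteq> {..<N}" and cS: "card S = s"
      using S finite_subset[of S "{..<N}"] by auto
    have k: "Poly_Mapping.keys (b + expo S) = Poly_Mapping.keys b \<union> S"
      using fS by (auto simp: in_keys_iff lookup_add cf_expo split: if_splits)
    have "S \<subset> Poly_Mapping.keys b \<union> S" using S by (auto simp: G_def)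
    then have "s < card (Poly_Mapping.keys (b + expo S))"
      using psubset_card_mono[of "Poly_Mapping.keys b \<union> S" S] fS cS k by simp
    moreover have "card (Poly_Mapping.keys (b + expo S)) \<le> N"
      using card_mono[of "{..<N}" "Poly_Mapping.keys b \<union> S"] SN bN k by (simp add: monoms_def)
    moreover have "b + expo S \<in> monoms N" by (intro monoms_add bN monoms_expo SN)
    moreover have "b + expo S \<noteq> 0" using calculation(1) by auto
    ultimately show ?thesis by (intro less.hyps) (auto simp: s_def S0_def)
  qed
  have "elem_sym N s * orbit_sum N b = (\<Sum>\<sigma>\<in>perms N. pact \<sigma> (elem_sym N s * zmono b))"
    unfolding orbit_sum_def sum_distrib_left
    by (intro sum.cong refl) (simp add: pact_mult pact_elem_sym)
  also have "\<dots> = (\<Sum>\<sigma>\<in>perms N. \<Sum>S\<in>subsets_of_card N s. zmono (kact \<sigma> (b + expo S)))"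
    by (simp add: elem_sym_zmono sum_distrib_right zmono_mult pact_sum add.commute)
  also have "\<dots> = (\<Sum>S\<in>subsets_of_card N s. orbit_sum N (b + expo S))"
    unfolding orbit_sum_def by (rule sum.swap)
  also have "\<dots> = (\<Sum>S\<in>subsets_of_card N s - G. orbit_sum N (b + expo S)) + (\<Sum>S\<in>G. orbit_sum N (b + expo S))"
    by (rule sum.subset_diff) (auto simp: G_def)
  also have "(\<Sum>S\<in>G. orbit_sum N (b + expo S)) = (\<Sum>S\<in>G. orbit_sum N a)"
    by (rule sum.cong[OF refl same])
  also have "\<dots> = pscale (of_nat (card G)) (orbit_sum N a)"
    by (simp add: pscale_eq_mult zconst_def)
  finally have eq: "elem_sym N s * orbit_sum N b
    = (\<Sum>S\<in>subsets_of_card N s - G. orbit_sum N (b + expo S)) + pscale (of_nat (card G)) (orbit_sum N a)" .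
  have "orbit_sum N b \<in> polys N"
    unfolding orbit_sum_def by (intro polys_sum polys_zmono monoms_kact bN) simp
  then have "orbit_sum N b * elem_sym N s \<in> J N" by (rule J_mult) (rule elem_sym_J[OF s1])
  then have "elem_sym N s * orbit_sum N b \<in> J N" by (simp add: mult.commute)
  moreover have "(\<Sum>S\<in>subsets_of_card N s - G. orbit_sum N (b + expo S)) \<in> J N"
    by (rule J_sum) (rule bigger)
  ultimately have "elem_sym N s * orbit_sum N b - (\<Sum>S\<in>subsets_of_card N s - G. orbit_sum N (b + expo S)) \<in> J N"
    by (rule free_vs.subspace_diff[OF subspace_J])
  then have "pscale (of_nat (card G)) (orbit_sum N a) \<in> J N" by (simp add: eq)
  then have "pscale (1 / of_nat (card G)) (pscale (of_nat (card G)) (orbit_sum N a)) \<in> J N"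
    by (rule J_pscale)
  \<comment> \<open>\<open>S0\<close> itself belongs to \<open>G\<close>, so the multiplicity is
    positive and can be divided out.\<close>
  moreover have "card G \<noteq> 0" using S0G by (auto simp: G_def card_eq_0_iff)
  ultimately show ?case by simp
qed

subsection \<open>Orthogonal projection along the ideal\<close>

text \<open>A complement of the ideal that is graded and stable under permutations. The form has no
  factorial weights, so in general this is not the space of classical harmonic polynomials.\<close>

definition harm :: "nat \<Rightarrow> zpoly set" where
  "harm N = {r \<in> polys N. \<forall>q\<in>J N. pip r q = 0}"

lemma finite_monoms_deg: "finite {k \<in> monoms N. mdeg k = m}"
proof (rule finite_imageD)
  let ?f = "\<lambda>k. map (cf k) [0..<N]"
  have "?f ` {k \<in> monoms N. mdeg k = m} \<subseteq> {xs. set xs \<subseteq> {..m} \<and> length xs = N}"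
  proof safe
    fix k i assume k: "k \<in> monoms N" "m = mdeg k" and "i \<in> set (?f k)"
    then obtain j where j: "j < N" "i = cf k j" by auto
    have "cf k j \<le> (\<Sum>i<N. cf k i)" using j by (intro member_le_sum) auto
    also have "\<dots> = mdeg k" using k by (intro mdeg_eq[symmetric]) (auto simp: monoms_def)
    finally show "i \<le> mdeg k" using j by simp
  qed simp
  then show "finite (?f ` {k \<in> monoms N. mdeg k = m})"
    by (rule finite_subset) (rule finite_lists_length_eq, simp)
  show "inj_on ?f {k \<in> monoms N. mdeg k = m}"
  proof (rule inj_onI)
    fix k l assume k: "k \<in> {k \<in> monoms N. mdeg k = m}" and l: "l \<in> {k \<in> monoms N. mdeg k = m}"
      and eq: "?f k = ?f l"
    show "k = l"
    proof (rule poly_mapping_eqI)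
      fix i show "cf k i = cf l i"
      proof (cases "i < N")
        case True
        then show ?thesis using eq by (simp add: list_eq_iff_nth_eq)
      next
        case False
        then have "i \<notin> Poly_Mapping.keys k" "i \<notin> Poly_Mapping.keys l" using k l by (auto simp: monoms_def)
        then show ?thesis by (simp add: in_keys_iff)
      qed
    qed
  qed
qed

lemma polys_zhom_span:
  assumes "p \<in> polys N" "p \<in> zhom m" shows "p \<in> free_vs.span (zmono ` {k \<in> monoms N. mdeg k = m})"
proof -
  have "hcomp m p \<in> free_vs.span (zmono ` {k \<in> monoms N. mdeg k = m})"
  proof (rule span_image_closed[of "hcomp m", OF hcomp_simps(1,2) _ poly_span_zmono[OF assms(1)]])
    fix x assume "x \<in> zmono ` monoms N"
    then obtain k where k: "k \<in> monoms N" "x = zmono k" by blast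
    then have "hcomp m x = (if m = mdeg k then x else 0)" by (simp add: hcomp_zhom[OF zhom_zmono])
    then show "hcomp m x \<in> free_vs.span (zmono ` {k \<in> monoms N. mdeg k = m})"
      using k by (auto intro: free_vs.span_zero free_vs.span_base)
  qed
  then show ?thesis using assms(2) by (simp add: hcomp_zhom)
qed

lemma pip_hcomp: "pip (hcomp m p) q = pip p (hcomp m q)"
proof -
  let ?A = "Poly_Mapping.keys p"
  have "Poly_Mapping.keys (hcomp m p) \<subseteq> ?A" by (auto simp: in_keys_iff cf_hcomp)
  then have "pip (hcomp m p) q = (\<Sum>k\<in>?A. cf (hcomp m p) k * cnj (cf q k))"
    "pip p (hcomp m q) = (\<Sum>k\<in>?A. cf p k * cnj (cf (hcomp m q) k))"
    by (simp_all add: pip_eq[of ?A])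
  moreover have "cf (hcomp m p) k * cnj (cf q k) = cf p k * cnj (cf (hcomp m q) k)" for k
    by (simp add: cf_hcomp when_def)
  ultimately show ?thesis by simp
qed

text \<open>The ideal is in general not finite-dimensional, so the projection is made one degree at
  a time: a monomial of degree \<open>m\<close> is projected onto the span of
  \<open>J_hgens N m\<close>. The remainder is homogeneous of degree \<open>m\<close>, hence
  orthogonal to the components of all other degrees too.\<close>

lemma exists_J_projection:
  assumes "p \<in> polys N" shows "\<exists>r. p - r \<in> J N \<and> (\<forall>q\<in>J N. pip r q = 0)"
  using poly_span_zmono[OF assms]
proof (induction rule: free_vs.span_induct_alt)
  case base
  then show ?case by (intro exI[of _ 0]) (simp add: J_0)
next
  case (step c x y)
  then obtain k where k: "k \<in> monoms N" "x = zmono k" by blast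
  define m where "m = mdeg k"
  let ?S = "free_vs.span (J_hgens N m)"
  have "J_hgens N m \<subseteq> free_vs.span (zmono ` {k \<in> monoms N. mdeg k = m})"
  proof
    fix y assume "y \<in> J_hgens N m"
    then obtain a j where "a \<in> monoms N" "mdeg a + j = m" "y = zmono a * elem_sym N j"
      by (auto simp: J_hgens_def)
    moreover from this have "zmono a * elem_sym N j \<in> zhom m"
      using zhom_mult[OF zhom_zmono[of a] elem_sym_zhom[of N j]] by simp
    ultimately show "y \<in> free_vs.span (zmono ` {k \<in> monoms N. mdeg k = m})"
      by (simp add: polys_zhom_span polys_mult polys_zmono elem_sym_polys)
  qed
  then have "?S \<subseteq> free_vs.span (zmono ` {k \<in> monoms N. mdeg k = m})"
    by (rule free_vs.span_minimal[OF _ free_vs.subspace_span])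
  then obtain C where C: "free_hs.orthogonal_set C" "free_vs.span C = ?S"
    by (rule free_hs.exists_orthogonal_basis[OF free_vs.subspace_span])
      (simp_all add: finite_monoms_deg)
  define r where "r = x - free_hs.proj C x"
  have xr: "x - r \<in> ?S" unfolding r_def using free_hs.proj_span[of C x] C(2) by simp
  have orth: "pip r q = 0" if q: "q \<in> J N" for q
  proof -
    have "x \<in> zhom m" unfolding k m_def by (rule zhom_zmono)
    moreover have "hcomp m (x - r) = x - r"
    proof -
      have "hcomp m z \<in> ?S \<and> hcomp m z = z" if "z \<in> ?S" for z
        using that
      proof (induction rule: free_vs.span_induct_alt)
        case (step c a b)
        from step(1) obtain d j where "mdeg d + j = m" "a = zmono d * elem_sym N j"
          by (auto simp: J_hgens_def)
        then have "a \<in> zhom m" using zhom_mult[OF zhom_zmono[of d] elem_sym_zhom[of N j]] by simp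
        then show ?case using step
          by (auto simp: hcomp_simps hcomp_zhom free_vs.span_base intro!: free_vs.span_add free_vs.span_scale)
      qed (simp add: hcomp_simps free_vs.span_zero)
      then show ?thesis using xr by blast
    qed
    ultimately have "hcomp m r = r"
      using hcomp_simps(1)[of m "x - r" r] by (simp add: hcomp_zhom)
    then have "pip r q = pip r (hcomp m q)" by (metis pip_hcomp)
    also have "\<dots> = 0"
      unfolding r_def using C(1) hcomp_J[OF q, of m] by (intro free_hs.proj_ortho) (simp_all add: C(2))
    finally show ?thesis .
  qed
  obtain r' where r': "y - r' \<in> J N" "\<forall>q\<in>J N. pip r' q = 0" using step by blast
  have xrJ: "x - r \<in> J N" using xr J_hgens_J by blast
  have eq: "pscale c x + y - (pscale c r + r') = pscale c (x - r) + (y - r')"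
    by (simp add: free_vs.scale_right_diff_distrib)
  have "pscale c x + y - (pscale c r + r') \<in> J N"
    unfolding eq by (rule J_add[OF J_pscale[OF xrJ] r'(1)])
  moreover have "\<forall>q\<in>J N. pip (pscale c r + r') q = 0"
    using orth r'(2) by (simp add: free_hs.ip_add free_hs.ip_scale)
  ultimately show ?case by blast
qed

definition rho :: "nat \<Rightarrow> zpoly \<Rightarrow> zpoly" where
  "rho N p = (SOME r. p - r \<in> J N \<and> (\<forall>q\<in>J N. pip r q = 0))"

lemma rho:
  assumes "p \<in> polys N" shows "p - rho N p \<in> J N" "q \<in> J N \<Longrightarrow> pip (rho N p) q = 0"
  using someI_ex[OF exists_J_projection[OF assms], folded rho_def] by blast+

lemma rho_polys: "p \<in> polys N \<Longrightarrow> rho N p \<in> polys N"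
  using free_vs.subspace_diff[OF subspace_polys, of p N "p - rho N p"] rho(1)[of p N] J_polys by auto

text \<open>Two candidates differ by an element of \<open>J N\<close> that is orthogonal to
  \<open>J N\<close>, hence to itself. Linearity, equivariance and homogeneity of \<open>rho\<close>
  all follow from this uniqueness.\<close>

lemma rho_eqI:
  assumes p: "p \<in> polys N" and r: "p - r \<in> J N" "\<And>q. q \<in> J N \<Longrightarrow> pip r q = 0"
  shows "rho N p = r"
proof -
  have d: "r - rho N p \<in> J N"
    using free_vs.subspace_diff[OF subspace_J rho(1)[OF p] r(1)] by simp
  have "pip (r - rho N p) (r - rho N p) = 0"
    using rho(2)[OF p d] r(2)[OF d] by (simp add: free_hs.ip_diff(1)[of r])
  then show ?thesis using free_hs.ip_definite[of "r - rho N p"] by simp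
qed

lemma rho_harm: "p \<in> polys N \<Longrightarrow> rho N p \<in> harm N"
  by (simp add: harm_def rho rho_polys)

lemma rho_id: "r \<in> harm N \<Longrightarrow> rho N r = r"
  by (intro rho_eqI) (auto simp: harm_def J_0)

lemma rho_add: "p \<in> polys N \<Longrightarrow> q \<in> polys N \<Longrightarrow> rho N (p + q) = rho N p + rho N q"
proof (rule rho_eqI)
  assume p: "p \<in> polys N" and q: "q \<in> polys N"
  show "p + q \<in> polys N" using p q by (rule polys_add)
  show "p + q - (rho N p + rho N q) \<in> J N"
    using J_add[OF rho(1)[OF p] rho(1)[OF q]] by (simp add: algebra_simps)
qed (simp add: free_hs.ip_add rho)

lemma rho_pscale: "p \<in> polys N \<Longrightarrow> rho N (pscale c p) = pscale c (rho N p)"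
proof (rule rho_eqI)
  assume p: "p \<in> polys N"
  show "pscale c p \<in> polys N" using p by (rule free_vs.subspace_scale[OF subspace_polys])
  show "pscale c p - pscale c (rho N p) \<in> J N"
    using J_pscale[OF rho(1)[OF p], of c] by (simp add: free_vs.scale_right_diff_distrib)
qed (simp add: free_hs.ip_scale rho)

lemma rho_0 [simp]: "rho N 0 = 0"
  by (rule rho_eqI) (simp_all add: J_0)

lemma rho_eq_0_iff: "p \<in> polys N \<Longrightarrow> rho N p = 0 \<longleftrightarrow> p \<in> J N"
  using rho(1)[of p N] rho_eqI[of p N 0] by auto

lemma pip_pact:
  assumes "\<sigma> permutes S" shows "pip (pact \<sigma> p) (pact \<sigma> q) = pip p q"
proof -
  have "pip (pact \<sigma> p) (pact \<sigma> q) = (\<Sum>k\<in>kact \<sigma> ` Poly_Mapping.keys p. cf (pact \<sigma> p) k * cnj (cf (pact \<sigma> q) k))"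
    by (rule pip_eq) (simp_all add: keys_reindex)
  also have "\<dots> = pip p q"
    using inj_on_subset[OF inj_kact[OF assms]]
    by (subst sum.reindex) (simp_all add: cf_pact[OF assms] pip_def)
  finally show ?thesis .
qed

lemma rho_pact:
  assumes \<sigma>: "\<sigma> permutes {..<N}" and p: "p \<in> polys N"
  shows "rho N (pact \<sigma> p) = pact \<sigma> (rho N p)"
proof (rule rho_eqI)
  show "pact \<sigma> p \<in> polys N" by (rule polys_pact[OF \<sigma> p])
  have diff: "pact \<sigma> (a - b) = pact \<sigma> a - pact \<sigma> b" for a b
    using reindex_add[of "kact \<sigma>" "a - b" b] by (simp add: eq_diff_eq)
  show "pact \<sigma> p - pact \<sigma> (rho N p) \<in> J N"
    using J_pact[OF \<sigma> rho(1)[OF p]] by (simp add: diff)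
  fix q assume q: "q \<in> J N"
  have "pip (pact \<sigma> (rho N p)) q = pip (pact \<sigma> (rho N p)) (pact \<sigma> (pact (pinv \<sigma>) q))"
    by (simp only: pact_inv[OF \<sigma>])
  also have "\<dots> = 0"
    using rho(2)[OF p J_pact[OF permutes_inv[OF \<sigma>] q]] by (simp only: pip_pact[OF \<sigma>])
  finally show "pip (pact \<sigma> (rho N p)) q = 0" .
qed

lemma rho_zhom:
  assumes p: "p \<in> polys N" "p \<in> zhom m" shows "rho N p \<in> zhom m"
proof -
  have "rho N p = hcomp m (rho N p)"
  proof (rule rho_eqI[OF p(1)])
    have "hcomp m (p - rho N p) \<in> J N" using hcomp_J[OF rho(1)[OF p(1)]] J_hgens_J by blast
    moreover have "hcomp m (p - rho N p) = p - hcomp m (rho N p)"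
      using hcomp_simps(1)[of m "p - rho N p" "rho N p"] p(2) by (simp add: hcomp_zhom eq_diff_eq)
    ultimately show "p - hcomp m (rho N p) \<in> J N" by simp
    fix q assume "q \<in> J N"
    then have "hcomp m q \<in> J N" using hcomp_J J_hgens_J by blast
    then show "pip (hcomp m (rho N p)) q = 0" using rho(2)[OF p(1)] by (simp add: pip_hcomp)
  qed
  then show ?thesis using zhom_hcomp by metis
qed

section \<open>Vectors over the polynomial ring\<close>

lemma wop_cong: "(\<And>p b. b < n \<Longrightarrow> c (w[p := b]) = d (w[p := b])) \<Longrightarrow> wop n x c w = wop n x d w"
  by (simp add: wop_def)

abbreviation vscale :: "complex \<Rightarrow> zvec \<Rightarrow> zvec" where
  "vscale c \<equiv> zscale (zconst c)"

lemma cf_zscale [simp]: "cf (zscale p v) w = p * cf v w"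
  using cf_pscale[of p v w] by (simp add: zscale_def pscale_def)

lemma vector_space_vscale: "vector_space vscale"
  by unfold_locales (auto intro!: poly_mapping_eqI simp: lookup_add algebra_simps zconst_simps)

interpretation vvs: vector_space vscale
  by (rule vector_space_vscale)

lemma zscale_simps: "zscale p (u + v) = zscale p u + zscale p v" "zscale (p + q) u = zscale p u + zscale q u"
  "zscale p (zscale q u) = zscale (p * q) u" "zscale 1 u = u" "zscale 0 u = 0" "zscale p 0 = 0"
  by (auto intro!: poly_mapping_eqI simp: lookup_add algebra_simps)

lemma zscale_sum: "zscale (sum f A) u = (\<Sum>a\<in>A. zscale (f a) u)" "zscale p (sum g A) = (\<Sum>a\<in>A. zscale p (g a))"
  by (induction A rule: infinite_finite_induct) (simp_all add: zscale_simps)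

lemma V_carrier_iff: "u \<in> V_carrier n N \<longleftrightarrow> (\<forall>w. w \<notin> words n N \<longrightarrow> cf u w = 0) \<and> (\<forall>w. cf u w \<in> polys N)"
proof -
  have "(\<forall>w\<in>Poly_Mapping.keys u. length w = N \<and> set w \<subseteq> {..<n}) \<longleftrightarrow> (\<forall>w. w \<notin> words n N \<longrightarrow> cf u w = 0)"
    by (auto simp: words_def in_keys_iff)
  then show ?thesis unfolding V_carrier_def by simp
qed

lemma subspace_V_carrier: "vvs.subspace (V_carrier n N)"
  by (rule vvs.subspaceI)
    (simp_all add: V_carrier_iff lookup_add polys_add polys_mult polys_zconst)

lemma concrete_space_V_rep:
  assumes "vvs.subspace C" shows "concrete_space vscale ((V_rep n N)\<lparr>carrier := C\<rparr>)"
  by (intro concrete_space.intro concrete_space_axioms.intro vector_space_vscale)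
    (simp_all add: V_rep_def mk_rep_def assms)

lemma V_rep_simps [simp]: "add (V_rep n N) = (+)" "\<zero>\<^bsub>V_rep n N\<^esub> = 0" "smult (V_rep n N) = vscale"
  "act (V_rep n N) x = current_act N x 1" "carrier (V_rep n N) = V_carrier n N"
  by (simp_all add: V_rep_def mk_rep_def)

lemma V_carrier_zscale: "p \<in> polys N \<Longrightarrow> u \<in> V_carrier n N \<Longrightarrow> zscale p u \<in> V_carrier n N"
  by (simp add: V_carrier_iff polys_mult)

lemma V_carrier_sum_single: "u \<in> V_carrier n N \<Longrightarrow> (\<Sum>w\<in>words n N. Poly_Mapping.single w (cf u w)) = u"
  by (rule poly_mapping_sum_single') (auto simp: V_carrier_iff in_keys_iff)

lemma V_carrier_single: "w \<in> words n N \<Longrightarrow> p \<in> polys N \<Longrightarrow> Poly_Mapping.single w p \<in> V_carrier n N"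
  by (auto simp: V_carrier_iff lookup_single when_def)

lemma V_deg_iff: "u \<in> V_deg n N m \<longleftrightarrow> u \<in> V_carrier n N \<and> (\<forall>w. cf u w \<in> zhom m)"
  by (simp add: V_deg_def)

lemma subspace_V_deg: "vvs.subspace (V_deg n N m)"
proof (rule vvs.subspaceI)
  fix x y c assume x: "x \<in> V_deg n N m"
  show "vscale c x \<in> V_deg n N m"
    using x vvs.subspace_scale[OF subspace_V_carrier, of x n N c] zhom_pscale[of _ m c]
    by (simp add: V_deg_iff pscale_eq_mult)
  assume "y \<in> V_deg n N m"
  then show "x + y \<in> V_deg n N m"
    using x vvs.subspace_add[OF subspace_V_carrier, of x n N y] by (simp add: V_deg_iff lookup_add zhom_add)
qed (simp add: V_deg_iff vvs.subspace_0[OF subspace_V_carrier])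

lemma V_deg_zscale: "p \<in> polys N \<Longrightarrow> p \<in> zhom k \<Longrightarrow> u \<in> V_deg n N m \<Longrightarrow> zscale p u \<in> V_deg n N (k + m)"
  by (simp add: V_deg_iff V_carrier_zscale zhom_mult)

definition vcomp :: "nat \<Rightarrow> zvec \<Rightarrow> zvec" where
  "vcomp m = Poly_Mapping.map (hcomp m)"

lemma cf_vcomp [simp]: "cf (vcomp m u) w = hcomp m (cf u w)"
  by (simp add: vcomp_def Poly_Mapping.map.rep_eq when_def hcomp_simps)

lemma vcomp_simps: "vcomp m (u + v) = vcomp m u + vcomp m v" "vcomp m (vscale c u) = vscale c (vcomp m u)"
  by (auto intro!: poly_mapping_eqI simp: lookup_add hcomp_simps pscale_eq_mult[symmetric])

lemma vcomp_V_deg: "u \<in> V_deg n N m' \<Longrightarrow> vcomp m u = (if m = m' then u else 0)"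
proof (rule poly_mapping_eqI)
  fix w assume "u \<in> V_deg n N m'"
  then have "hcomp m (cf u w) = (if m = m' then cf u w else 0)" by (intro hcomp_zhom) (simp add: V_deg_iff)
  then show "cf (vcomp m u) w = cf (if m = m' then u else 0) w" by simp
qed

text \<open>Linearity of \<open>f\<close> is asked for only on a subspace \<open>C\<close>, since
  the linearity of \<open>current_act\<close> is established only on
  \<open>V_carrier\<close>.\<close>

lemma vspan_image_closed:
  fixes f :: "zvec \<Rightarrow> zvec"
  assumes "\<And>p q. p \<in> C \<Longrightarrow> q \<in> C \<Longrightarrow> f (p + q) = f p + f q" "\<And>c p. p \<in> C \<Longrightarrow> f (vscale c p) = vscale c (f p)"
    and "vvs.subspace C" "X \<subseteq> C" "vvs.subspace S"
    and "\<And>x. x \<in> X \<Longrightarrow> f x \<in> S" and x: "x \<in> vvs.span X"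
  shows "f x \<in> S"
proof -
  have "x \<in> C \<and> f x \<in> S"
    using x
  proof (induction rule: vvs.span_induct_alt)
    case base
    have "f 0 = 0" using assms(1)[of 0 0] vvs.subspace_0[OF assms(3)] by simp
    then show ?case using vvs.subspace_0[OF assms(3)] vvs.subspace_0[OF assms(5)] by simp
  next
    case (step c x y)
    have x: "x \<in> C" "vscale c x \<in> C" using step(1) assms(4) vvs.subspace_scale[OF assms(3)] by auto
    then have "f (vscale c x + y) = vscale c (f x) + f y" using step assms(1,2) by simp
    moreover have "vscale c (f x) + f y \<in> S"
      using vvs.subspace_add[OF assms(5) vvs.subspace_scale[OF assms(5) assms(6)[OF step(1)]]] step(2) by simp
    ultimately show ?case using x step vvs.subspace_add[OF assms(3)] by simp
  qed
  then show ?thesis by simp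
qed

subsection \<open>The current algebra in coordinates\<close>

definition ev :: "complex poly \<Rightarrow> nat \<Rightarrow> zpoly" where
  "ev f p = poly (map_poly zconst f) (zvar p)"

lemma zvar_zmono: "zvar p = zmono (Poly_Mapping.single p 1)"
  by (simp add: zvar_def zmono_def)

lemma ev_0 [simp]: "ev 0 p = 0"
  by (simp add: ev_def)

lemma ev_pCons [simp]: "ev (pCons a f) p = zconst a + zvar p * ev f p"
  by (simp add: ev_def map_poly_pCons zconst_simps)

lemma ev_1 [simp]: "ev 1 p = 1"
  by (simp add: one_pCons zconst_simps)

lemma ev_monom: "ev (monom 1 k) p = zmono (Poly_Mapping.single p k)"
proof (induction k)
  case 0
  then show ?case by (simp add: monom_0 zconst_simps)
next
  case (Suc k)
  then show ?case by (simp add: monom_Suc zconst_simps zvar_zmono zmono_mult single_add[symmetric])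
qed

lemma polys_ev: "p < N \<Longrightarrow> ev f p \<in> polys N"
  by (induction f) (simp_all add: polys_add polys_mult polys_zconst zvar_zmono polys_zmono monoms_single)

lemma pact_ev: "pact \<sigma> (ev f p) = ev f (\<sigma> p)"
  by (induction f) (simp_all add: reindex_add pact_mult zvar_zmono)

lemma cf_site_act:
  assumes u: "u \<in> V_carrier n N" and x: "x \<in> carrier_mat n n" and p: "p < N"
  shows "cf (site_act x p u) w = (if w \<in> words n N then \<Sum>b<n. zconst (x $$ (w ! p, b)) * cf u (w[p := b]) else 0)"
proof -
  have ks: "Poly_Mapping.keys u \<subseteq> words n N" using u by (auto simp: V_carrier_iff in_keys_iff)
  let ?t = "\<lambda>v b. (zconst (x $$ (b, v ! p)) * cf u v when v[p := b] = w)"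
  have "cf (site_act x p u) w = (\<Sum>v\<in>Poly_Mapping.keys u. \<Sum>b<n. ?t v b)"
    using x by (simp add: site_act_def lookup_sum lookup_single)
  also have "\<dots> = (\<Sum>v\<in>words n N. \<Sum>b<n. ?t v b)"
    using ks by (intro sum.mono_neutral_left) (auto simp: in_keys_iff)
  also have "\<dots> = (if w \<in> words n N then \<Sum>b<n. zconst (x $$ (w ! p, b)) * cf u (w[p := b]) else 0)"
  proof (cases "w \<in> words n N")
    case False
    then have "?t v b = 0" if "v \<in> words n N" "b < n" for v b
      using words_update[OF that, of p] by (auto simp: when_def)
    then show ?thesis using False by simp
  next
    case True
    have wp: "w ! p < n" using words_nth[OF True p] .
    have lw: "length w = N" using True by (rule words_length)
    have "(\<Sum>v\<in>words n N. \<Sum>b<n. ?t v b) = (\<Sum>(v, b)\<in>words n N \<times> {..<n}. ?t v b)"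
      by (simp add: sum.cartesian_product)
    \<comment> \<open>\<open>v[p := b] = w\<close> holds exactly when \<open>b = w ! p\<close> and
      \<open>v\<close> arises from \<open>w\<close> by changing the letter at \<open>p\<close>. This
      turns the action on basis words into a formula for coefficients.\<close>
    also have "\<dots> = (\<Sum>(v, b)\<in>(\<lambda>b. (w[p := b], w ! p)) ` {..<n}. ?t v b)"
    proof (rule sum.mono_neutral_right)
      show "(\<lambda>b. (w[p := b], w ! p)) ` {..<n} \<subseteq> words n N \<times> {..<n}"
        using wp by (auto intro: words_update[OF True])
      show "\<forall>i\<in>words n N \<times> {..<n} - (\<lambda>b. (w[p := b], w ! p)) ` {..<n}. (case i of (v, b) \<Rightarrow> ?t v b) = 0"
      proof
        fix z assume "z \<in> words n N \<times> {..<n} - (\<lambda>b. (w[p := b], w ! p)) ` {..<n}"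
        then obtain v b where z: "z = (v, b)"
          and vb: "v \<in> words n N" "b \<in> {..<n}" "(v, b) \<notin> (\<lambda>b. (w[p := b], w ! p)) ` {..<n}" by blast
        have "v[p := b] \<noteq> w"
        proof
          assume eq: "v[p := b] = w"
          have lv: "length v = N" using vb(1) by (rule words_length)
          have "w ! p = b" using p lv by (simp add: eq[symmetric])
          moreover have "w[p := v ! p] = v" by (simp add: eq[symmetric])
          ultimately have "(v, b) = (w[p := v ! p], w ! p)" by simp
          moreover have "v ! p < n" using words_nth[OF vb(1) p] .
          ultimately show False using vb(3) by blast
        qed
        then show "(case z of (v, b) \<Rightarrow> ?t v b) = 0" by (simp add: z when_def)
      qed
    qed simp
    also have "\<dots> = (\<Sum>b<n. ?t (w[p := b]) (w ! p))"
    proof (subst sum.reindex)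
      show "inj_on (\<lambda>b. (w[p := b], w ! p)) {..<n}"
      proof (rule inj_onI)
        fix b c assume "(w[p := b], w ! p) = (w[p := c], w ! p)"
        then have "w[p := b] ! p = w[p := c] ! p" by simp
        then show "b = c" using p lw by simp
      qed
    qed simp
    finally show ?thesis using True p lw by simp
  qed
  finally show ?thesis .
qed

lemma cf_current_act:
  assumes "u \<in> V_carrier n N" "x \<in> carrier_mat n n"
  shows "cf (current_act N x f u) w = (if w \<in> words n N then
    \<Sum>p<N. ev f p * (\<Sum>b<n. zconst (x $$ (w ! p, b)) * cf u (w[p := b])) else 0)"
  using assms by (simp add: current_act_def lookup_sum ev_def cf_site_act)

lemma current_act_V_carrier:
  assumes u: "u \<in> V_carrier n N" and x: "x \<in> carrier_mat n n"
  shows "current_act N x f u \<in> V_carrier n N"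
proof -
  have "cf u v \<in> polys N" for v using u by (simp add: V_carrier_iff)
  then show ?thesis
    unfolding V_carrier_iff
    by (auto simp: cf_current_act[OF u x] intro!: polys_sum polys_mult polys_ev polys_zconst)
qed

lemma current_act_linear:
  assumes u: "u \<in> V_carrier n N" and v: "v \<in> V_carrier n N" and x: "x \<in> carrier_mat n n"
  shows "current_act N x f (u + v) = current_act N x f u + current_act N x f v"
    and "p \<in> polys N \<Longrightarrow> current_act N x f (zscale p u) = zscale p (current_act N x f u)"
proof -
  have uv: "u + v \<in> V_carrier n N" using vvs.subspace_add[OF subspace_V_carrier u v] .
  show "current_act N x f (u + v) = current_act N x f u + current_act N x f v"
    by (rule poly_mapping_eqI)
      (simp add: cf_current_act[OF u x] cf_current_act[OF v x] cf_current_act[OF uv x] lookup_add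
        distrib_left sum.distrib)
  assume p: "p \<in> polys N"
  show "current_act N x f (zscale p u) = zscale p (current_act N x f u)"
    by (rule poly_mapping_eqI)
      (simp add: cf_current_act[OF u x] cf_current_act[OF V_carrier_zscale[OF p u] x] sum_distrib_left
        mult.left_commute[of p])
qed

lemma current_act_sum:
  assumes "\<And>a. a \<in> A \<Longrightarrow> g a \<in> V_carrier n N" "x \<in> carrier_mat n n"
  shows "current_act N x f (sum g A) = (\<Sum>a\<in>A. current_act N x f (g a))"
proof -
  have 0: "current_act N x f 0 = 0"
    using current_act_linear(2)[of 0 n N 0 x 0] assms(2)
    by (simp add: zscale_simps vvs.subspace_0[OF subspace_V_carrier])
  have "sum g A \<in> V_carrier n N \<and> current_act N x f (sum g A) = (\<Sum>a\<in>A. current_act N x f (g a))"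
    using assms(1)
    by (induction A rule: infinite_finite_induct)
      (simp_all add: 0 vvs.subspace_0[OF subspace_V_carrier] vvs.subspace_add[OF subspace_V_carrier]
        current_act_linear(1)[OF _ _ assms(2)])
  then show ?thesis by simp
qed

lemma current_act_1:
  assumes "u \<in> V_carrier n N" "x \<in> carrier_mat n n" "w \<in> words n N"
  shows "cf (current_act N x 1 u) w = wop n (\<lambda>a b. zconst (x $$ (a, b))) (cf u) w"
  using assms by (simp add: cf_current_act wop_def words_length)

lemma current_act_V_deg:
  assumes u: "u \<in> V_deg n N m" and x: "x \<in> carrier_mat n n"
  shows "current_act N x 1 u \<in> V_deg n N m"
proof -
  have uV: "u \<in> V_carrier n N" and h: "\<And>w. cf u w \<in> zhom m" using u by (auto simp: V_deg_iff)
  have "zconst c * cf u w \<in> zhom m" for c w using zhom_pscale[OF h] by (simp add: pscale_eq_mult)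
  then show ?thesis
    unfolding V_deg_iff using current_act_V_carrier[OF uV x]
    by (simp add: cf_current_act[OF uV x] zhom_sum)
qed

lemma current_act_matrix_linear:
  assumes u: "u \<in> V_carrier n N" and x: "x \<in> carrier_mat n n" and y: "y \<in> carrier_mat n n"
  shows "current_act N (x + y) 1 u = current_act N x 1 u + current_act N y 1 u"
    and "current_act N (c \<cdot>\<^sub>m x) 1 u = vscale c (current_act N x 1 u)"
    and "current_act N (x * y - y * x) 1 u
      = current_act N x 1 (current_act N y 1 u) - current_act N y 1 (current_act N x 1 u)"
proof -
  have xy: "x + y \<in> carrier_mat n n" "c \<cdot>\<^sub>m x \<in> carrier_mat n n" "x * y - y * x \<in> carrier_mat n n"
    using x y by auto
  show "current_act N (x + y) 1 u = current_act N x 1 u + current_act N y 1 u"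
  proof (rule poly_mapping_eqI)
    fix w show "cf (current_act N (x + y) 1 u) w = cf (current_act N x 1 u + current_act N y 1 u) w"
    proof (cases "w \<in> words n N")
      case True
      have "(\<Sum>b<n. zconst ((x + y) $$ (w ! p, b)) * cf u (w[p := b]))
        = (\<Sum>b<n. zconst (x $$ (w ! p, b)) * cf u (w[p := b])) + (\<Sum>b<n. zconst (y $$ (w ! p, b)) * cf u (w[p := b]))"
        if "p < N" for p
        unfolding sum.distrib[symmetric] using words_nth[OF True that] x y
        by (intro sum.cong) (simp_all add: zconst_simps distrib_right)
      then show ?thesis using True
        by (simp add: lookup_add cf_current_act[OF u xy(1)] cf_current_act[OF u x] cf_current_act[OF u y] sum.distrib)
    qed (simp add: lookup_add cf_current_act[OF u xy(1)] cf_current_act[OF u x] cf_current_act[OF u y])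
  qed
  show "current_act N (c \<cdot>\<^sub>m x) 1 u = vscale c (current_act N x 1 u)"
  proof (rule poly_mapping_eqI)
    fix w show "cf (current_act N (c \<cdot>\<^sub>m x) 1 u) w = cf (vscale c (current_act N x 1 u)) w"
    proof (cases "w \<in> words n N")
      case True
      have "(\<Sum>b<n. zconst ((c \<cdot>\<^sub>m x) $$ (w ! p, b)) * cf u (w[p := b]))
        = zconst c * (\<Sum>b<n. zconst (x $$ (w ! p, b)) * cf u (w[p := b]))" if "p < N" for p
        unfolding sum_distrib_left using words_nth[OF True that] x
        by (intro sum.cong) (simp_all add: zconst_simps mult.assoc)
      then show ?thesis using True
        by (simp add: cf_current_act[OF u xy(2)] cf_current_act[OF u x] sum_distrib_left)
    qed (simp add: cf_current_act[OF u xy(2)] cf_current_act[OF u x])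
  qed
  show "current_act N (x * y - y * x) 1 u
      = current_act N x 1 (current_act N y 1 u) - current_act N y 1 (current_act N x 1 u)"
  proof (rule poly_mapping_eqI)
    fix w
    let ?L = "current_act N (x * y - y * x) 1 u"
    let ?xy = "current_act N x 1 (current_act N y 1 u)" and ?yx = "current_act N y 1 (current_act N x 1 u)"
    note xu = current_act_V_carrier[OF u x, of 1] and yu = current_act_V_carrier[OF u y, of 1]
    show "cf ?L w = cf (?xy - ?yx) w"
    proof (cases "w \<in> words n N")
      case False
      then show ?thesis
        by (simp add: lookup_minus cf_current_act[OF u xy(3)] cf_current_act[OF xu y] cf_current_act[OF yu x])
    next
      case True
      let ?X = "\<lambda>a b. zconst (x $$ (a, b))" and ?Y = "\<lambda>a b. zconst (y $$ (a, b))"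
      have inner: "wop n ?X (cf (current_act N y 1 u)) w = wop n ?X (wop n ?Y (cf u)) w"
        "wop n ?Y (cf (current_act N x 1 u)) w = wop n ?Y (wop n ?X (cf u)) w"
        by (rule wop_cong, simp add: current_act_1[OF u y words_update[OF True]])
          (rule wop_cong, simp add: current_act_1[OF u x words_update[OF True]])
      have "cf (?xy - ?yx) w = wop n ?X (wop n ?Y (cf u)) w - wop n ?Y (wop n ?X (cf u)) w"
        by (simp add: lookup_minus current_act_1[OF xu y True] current_act_1[OF yu x True] inner)
      also have "\<dots> = wop n (\<lambda>a b. \<Sum>k<n. ?X a k * ?Y k b - ?Y a k * ?X k b) (cf u) w"
        by (rule wop_commutator[OF True])
      also have "\<dots> = wop n (\<lambda>a b. zconst ((x * y - y * x) $$ (a, b))) (cf u) w"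
        unfolding wop_def
      proof (intro sum.cong refl arg_cong2[where f = "(*)"])
        fix p b assume p: "p \<in> {..<length w}" and b: "b \<in> {..<n}"
        have "w ! p < n" using p words_nth[OF True] words_length[OF True] by simp
        then have "(x * y - y * x) $$ (w ! p, b) = (\<Sum>k<n. x $$ (w ! p, k) * y $$ (k, b) - y $$ (w ! p, k) * x $$ (k, b))"
          using b x y by (simp add: scalar_prod_def sum_subtractf lessThan_atLeast0)
        then show "(\<Sum>k<n. ?X (w ! p) k * ?Y k b - ?Y (w ! p) k * ?X k b) = zconst ((x * y - y * x) $$ (w ! p, b))"
          by (simp add: zconst_sum zconst_simps)
      qed
      finally show ?thesis by (simp add: current_act_1[OF u xy(3) True])
    qed
  qed
qed

subsection \<open>The diagonal action of the symmetric group\<close>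

text \<open>Tensor factors and variables are permuted together. The coefficient at \<open>w\<close>
  is read at the word whose letter at position \<open>p\<close> is \<open>w ! \<sigma> p\<close>,
  which makes this a left action.\<close>

definition gact :: "nat \<Rightarrow> nat \<Rightarrow> (nat \<Rightarrow> nat) \<Rightarrow> zvec \<Rightarrow> zvec" where
  "gact n N \<sigma> u = (\<Sum>w\<in>words n N. Poly_Mapping.single w (pact \<sigma> (cf u (permute_list \<sigma> w))))"

lemma cf_gact: "cf (gact n N \<sigma> u) w = (if w \<in> words n N then pact \<sigma> (cf u (permute_list \<sigma> w)) else 0)"
  by (simp add: gact_def lookup_sum lookup_single when_def)

lemma words_permute_list:
  "\<sigma> permutes {..<N} \<Longrightarrow> w \<in> words n N \<Longrightarrow> permute_list \<sigma> w \<in> words n N"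
  by (auto simp: words_def)

lemma permute_list_pinv:
  assumes "\<sigma> permutes {..<N}" "length w = N"
  shows "permute_list \<sigma> (permute_list (pinv \<sigma>) w) = w" "permute_list (pinv \<sigma>) (permute_list \<sigma> w) = w"
  using permute_list_compose[of \<sigma> w "pinv \<sigma>"] permute_list_compose[of "pinv \<sigma>" w \<sigma>]
    assms permutes_inv[OF assms(1)] by (simp_all add: permutes_inv_o)

lemma gact_linear: "gact n N \<sigma> (u + v) = gact n N \<sigma> u + gact n N \<sigma> v"
  "gact n N \<sigma> (zscale p u) = zscale (pact \<sigma> p) (gact n N \<sigma> u)"
  by (rule poly_mapping_eqI, simp add: cf_gact lookup_add reindex_add)
    (rule poly_mapping_eqI, simp add: cf_gact pact_mult)

lemma gact_sum: "gact n N \<sigma> (sum f A) = (\<Sum>a\<in>A. gact n N \<sigma> (f a))"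
proof -
  have "gact n N \<sigma> 0 = 0" by (rule poly_mapping_eqI) (simp add: cf_gact)
  then show ?thesis by (induction A rule: infinite_finite_induct) (simp_all add: gact_linear)
qed

lemma gact_gact:
  assumes "\<sigma> permutes {..<N}" "\<tau> permutes {..<N}"
  shows "gact n N \<sigma> (gact n N \<tau> u) = gact n N (\<sigma> \<circ> \<tau>) u"
  by (rule poly_mapping_eqI)
    (simp add: cf_gact words_permute_list[OF assms(1)] pact_pact permute_list_compose assms words_length)

lemma gact_V_carrier:
  assumes \<sigma>: "\<sigma> permutes {..<N}" and u: "u \<in> V_carrier n N" shows "gact n N \<sigma> u \<in> V_carrier n N"
proof -
  have "cf u v \<in> polys N" for v using u by (simp add: V_carrier_iff)
  then show ?thesis unfolding V_carrier_iff by (simp add: cf_gact polys_pact[OF \<sigma>])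
qed

lemma gact_V_deg:
  assumes \<sigma>: "\<sigma> permutes {..<N}" and u: "u \<in> V_deg n N m" shows "gact n N \<sigma> u \<in> V_deg n N m"
  using u gact_V_carrier[OF \<sigma>, of u n] by (simp add: V_deg_iff cf_gact zhom_pact)

lemma permute_list_update:
  assumes "\<sigma> permutes {..<N}" "length w = N" "p < N"
  shows "permute_list \<sigma> (w[\<sigma> p := b]) = (permute_list \<sigma> w)[p := b]"
proof (rule nth_equalityI)
  fix i assume "i < length (permute_list \<sigma> (w[\<sigma> p := b]))"
  then have i: "i < N" using assms by simp
  have "\<sigma> i < N" "\<sigma> p < N" using permutes_in_image[OF assms(1)] i assms(3) by auto
  moreover have "\<sigma> p = \<sigma> i \<longleftrightarrow> p = i" using permutes_inj[OF assms(1)] by (simp add: inj_eq)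
  ultimately show "permute_list \<sigma> (w[\<sigma> p := b]) ! i = (permute_list \<sigma> w)[p := b] ! i"
    using assms i by (simp add: permute_list_def nth_list_update)
qed (use assms in simp)

text \<open>Site \<open>p\<close> together with \<open>ev f p\<close> moves to site
  \<open>\<sigma> p\<close> with \<open>ev f (\<sigma> p)\<close>, so the sum over all sites is
  merely reordered.\<close>

lemma gact_current_act:
  assumes \<sigma>: "\<sigma> permutes {..<N}" and u: "u \<in> V_carrier n N" and x: "x \<in> carrier_mat n n"
  shows "gact n N \<sigma> (current_act N x f u) = current_act N x f (gact n N \<sigma> u)"
proof (rule poly_mapping_eqI)
  fix w
  show "cf (gact n N \<sigma> (current_act N x f u)) w = cf (current_act N x f (gact n N \<sigma> u)) w"
  proof (cases "w \<in> words n N")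
    case True
    note lw = words_length[OF True]
    define w' where "w' = permute_list \<sigma> w"
    have w': "w' \<in> words n N" unfolding w'_def by (rule words_permute_list[OF \<sigma> True])
    have nth: "w' ! p = w ! \<sigma> p" if "p < N" for p
      using that lw by (simp add: w'_def permute_list_def)
    have "cf (gact n N \<sigma> (current_act N x f u)) w
      = (\<Sum>p<N. ev f (\<sigma> p) * (\<Sum>b<n. zconst (x $$ (w' ! p, b)) * pact \<sigma> (cf u (w'[p := b]))))"
      using True w' by (simp add: cf_gact w'_def[symmetric] cf_current_act[OF u x] pact_sum pact_mult pact_ev)
    also have "\<dots> = (\<Sum>p<N. ev f (\<sigma> p) * (\<Sum>b<n. zconst (x $$ (w ! \<sigma> p, b)) * cf (gact n N \<sigma> u) (w[\<sigma> p := b])))"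
    proof (intro sum.cong refl arg_cong2[where f = "(*)"])
      fix p assume "p \<in> {..<N}"
      then have p: "p < N" by simp
      show "zconst (x $$ (w' ! p, b)) = zconst (x $$ (w ! \<sigma> p, b))" for b by (simp add: nth[OF p])
      fix b assume "b \<in> {..<n}"
      then have "w[\<sigma> p := b] \<in> words n N" using True by (simp add: words_update)
      then show "pact \<sigma> (cf u (w'[p := b])) = cf (gact n N \<sigma> u) (w[\<sigma> p := b])"
        by (simp add: cf_gact permute_list_update[OF \<sigma> lw p] w'_def)
    qed
    also have "\<dots> = (\<Sum>p<N. ev f p * (\<Sum>b<n. zconst (x $$ (w ! p, b)) * cf (gact n N \<sigma> u) (w[p := b])))"
      by (rule sum.reindex_bij_betw[OF permutes_imp_bij[OF \<sigma>]])
    also have "\<dots> = cf (current_act N x f (gact n N \<sigma> u)) w"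
      using True by (simp add: cf_current_act[OF gact_V_carrier[OF \<sigma> u] x])
    finally show ?thesis .
  qed (simp add: cf_gact cf_current_act[OF gact_V_carrier[OF \<sigma> u] x])
qed

definition invariants :: "nat \<Rightarrow> nat \<Rightarrow> nat \<Rightarrow> zvec set" where
  "invariants n N m = {u \<in> V_deg n N m. \<forall>\<sigma>\<in>perms N. gact n N \<sigma> u = u}"

lemma subspace_invariants: "vvs.subspace (invariants n N m)"
  by (rule vvs.subspaceI)
    (simp_all add: invariants_def vvs.subspace_0[OF subspace_V_deg] vvs.subspace_add[OF subspace_V_deg]
      vvs.subspace_scale[OF subspace_V_deg] gact_linear gact_sum[of _ _ _ _ "{}", simplified])

text \<open>Not divided by the order of the group: an invariant vector is multiplied by
  \<open>fact N\<close>.\<close>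

definition symm :: "nat \<Rightarrow> nat \<Rightarrow> zvec \<Rightarrow> zvec" where
  "symm n N u = (\<Sum>\<sigma>\<in>perms N. gact n N \<sigma> u)"

lemma symm_linear: "symm n N (u + v) = symm n N u + symm n N v" "symm n N (vscale c u) = vscale c (symm n N u)"
  by (simp_all add: symm_def gact_linear sum.distrib zscale_sum)

lemma symm_sum: "symm n N (sum f A) = (\<Sum>a\<in>A. symm n N (f a))"
  unfolding symm_def gact_sum by (rule sum.swap)

lemma symm_V_deg: "u \<in> V_deg n N m \<Longrightarrow> symm n N u \<in> V_deg n N m"
  unfolding symm_def by (intro vvs.subspace_sum[OF subspace_V_deg] gact_V_deg) auto

lemma symm_gact: 
  assumes \<tau>: "\<tau> permutes {..<N}" shows "symm n N (gact n N \<tau> u) = symm n N u"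
proof -
  have "symm n N (gact n N \<tau> u) = (\<Sum>\<sigma>\<in>perms N. gact n N (\<sigma> \<circ> \<tau>) u)"
    unfolding symm_def by (rule sum.cong) (simp_all add: gact_gact \<tau>)
  then show ?thesis
    using sum_permutations_compose_right[OF \<tau>, of "\<lambda>\<sigma>. gact n N \<sigma> u"] by (simp add: symm_def)
qed

lemma gact_symm:
  assumes \<tau>: "\<tau> permutes {..<N}" shows "gact n N \<tau> (symm n N u) = symm n N u"
proof -
  have "gact n N \<tau> (symm n N u) = (\<Sum>\<sigma>\<in>perms N. gact n N (\<tau> \<circ> \<sigma>) u)"
    unfolding symm_def gact_sum by (rule sum.cong) (simp_all add: gact_gact \<tau>)
  then show ?thesis
    using setum_permutations_compose_left[OF \<tau>, of "\<lambda>\<sigma>. gact n N \<sigma> u"] by (simp add: symm_def)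
qed

lemma symm_invariants: "u \<in> V_deg n N m \<Longrightarrow> symm n N u \<in> invariants n N m"
  by (simp add: invariants_def symm_V_deg gact_symm)

lemma symm_of_invariant:
  assumes "\<And>\<sigma>. \<sigma> permutes {..<N} \<Longrightarrow> gact n N \<sigma> u = u"
  shows "symm n N u = vscale (fact N) u"
proof -
  have "symm n N u = (\<Sum>\<sigma>\<in>perms N. u)" unfolding symm_def using assms by (intro sum.cong) auto
  also have "\<dots> = vscale (of_nat (card (perms N))) u"
    unfolding vvs.sum_constant_scale[symmetric] ..
  finally show ?thesis by (simp add: card_permutations[OF refl])
qed

lemma symm_current_act:
  assumes u: "u \<in> V_carrier n N" and x: "x \<in> carrier_mat n n"
  shows "symm n N (current_act N x f u) = current_act N x f (symm n N u)"
  unfolding symm_def using assms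
  by (subst current_act_sum[OF gact_V_carrier[OF _ u] x]) (auto simp: gact_current_act intro!: sum.cong)

definition zterm :: "(nat \<Rightarrow>\<^sub>0 nat) \<Rightarrow> nat list \<Rightarrow> zvec" where
  "zterm a w = Poly_Mapping.single w (zmono a)"

lemma zterm_V_deg:
  "a \<in> monoms N \<Longrightarrow> w \<in> words n N \<Longrightarrow> zterm a w \<in> V_deg n N (mdeg a)"
  using zhom_zmono[of a] 
  by (auto simp: zterm_def V_deg_iff V_carrier_single polys_zmono lookup_single when_def)

lemma gact_zterm:
  assumes \<sigma>: "\<sigma> permutes {..<N}" and w: "w \<in> words n N"
  shows "gact n N \<sigma> (zterm a w) = zterm (kact \<sigma> a) (permute_list (pinv \<sigma>) w)"
proof (rule poly_mapping_eqI)
  fix v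
  have "w = permute_list \<sigma> v \<longleftrightarrow> permute_list (pinv \<sigma>) w = v" if "v \<in> words n N"
    using permute_list_pinv[OF \<sigma>] words_length[OF that] words_length[OF w] by metis
  moreover have "permute_list (pinv \<sigma>) w \<in> words n N"
    by (rule words_permute_list[OF permutes_inv[OF \<sigma>] w])
  ultimately show "cf (gact n N \<sigma> (zterm a w)) v = cf (zterm (kact \<sigma> a) (permute_list (pinv \<sigma>) w)) v"
    by (auto simp: cf_gact zterm_def lookup_single when_def)
qed

lemma zscale_zterm: "zscale (zmono b) (zterm a w) = zterm (b + a) w"
  by (rule poly_mapping_eqI) (simp add: zterm_def lookup_single mult_when zmono_mult)

lemma V_deg_span:
  assumes "u \<in> V_deg n N m"
  shows "u \<in> vvs.span {zterm a w | a w. a \<in> monoms N \<and> mdeg a = m \<and> w \<in> words n N}" (is "_ \<in> vvs.span ?Z")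
proof -
  have single: "Poly_Mapping.single w p \<in> vvs.span ?Z"
    if w: "w \<in> words n N" and p: "p \<in> free_vs.span (zmono ` {k \<in> monoms N. mdeg k = m})" for w p
    using p
  proof (induction rule: free_vs.span_induct_alt)
    case base
    then show ?case by (simp add: vvs.span_zero)
  next
    case (step c x y)
    have "Poly_Mapping.single w (pscale c x + y) = vscale c (Poly_Mapping.single w x) + Poly_Mapping.single w y"
      by (rule poly_mapping_eqI) (simp add: lookup_add lookup_single when_def pscale_eq_mult)
    moreover have "Poly_Mapping.single w x \<in> ?Z" using step(1) w by (auto simp: zterm_def)
    ultimately show ?case using step(2) by (simp add: vvs.span_add vvs.span_scale vvs.span_base)
  qed
  have "(\<Sum>w\<in>words n N. Poly_Mapping.single w (cf u w)) \<in> vvs.span ?Z"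
  proof (intro vvs.span_sum)
    fix w assume w: "w \<in> words n N"
    have "cf u w \<in> free_vs.span (zmono ` {k \<in> monoms N. mdeg k = m})"
      using assms by (intro polys_zhom_span) (simp_all add: V_deg_iff V_carrier_iff)
    then show "Poly_Mapping.single w (cf u w) \<in> vvs.span ?Z" by (rule single[OF w])
  qed
  then show ?thesis using assms V_carrier_sum_single[of u n N] by (simp add: V_deg_iff)
qed

section \<open>The module generated by the cyclic vector\<close>

definition F_gens :: "nat \<Rightarrow> nat \<Rightarrow> zvec set" where
  "F_gens n N = {foldr (\<lambda>(x, f). current_act N x f) us (w0 N) | us. set us \<subseteq> sl_lower n \<times> UNIV}"

lemma sl_lower_carrier: "x \<in> sl_lower n \<Longrightarrow> x \<in> carrier_mat n n"
  by (simp add: sl_lower_def sl_def)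

lemma F_gens_induct [consumes 1, case_names base step]:
  assumes "u \<in> F_gens n N" and "P (w0 N)"
    and "\<And>x f u. x \<in> sl_lower n \<Longrightarrow> u \<in> F_gens n N \<Longrightarrow> P u \<Longrightarrow> P (current_act N x f u)"
  shows "P u"
proof -
  have "P (foldr (\<lambda>(x, f). current_act N x f) us (w0 N))" if "set us \<subseteq> sl_lower n \<times> UNIV" for us
    using that
  proof (induction us)
    case (Cons xf us)
    obtain x f where xf: "xf = (x, f)" by fastforce
    have "foldr (\<lambda>(x, f). current_act N x f) us (w0 N) \<in> F_gens n N"
      using Cons.prems by (auto simp: F_gens_def)
    then show ?case using Cons assms(3) by (simp add: xf)
  qed (simp add: assms(2))
  then show ?thesis using assms(1) by (auto simp: F_gens_def)
qed

lemma F_gens_step: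
  assumes "x \<in> sl_lower n" "u \<in> F_gens n N" shows "current_act N x f u \<in> F_gens n N"
proof -
  obtain us where us: "u = foldr (\<lambda>(x, f). current_act N x f) us (w0 N)" "set us \<subseteq> sl_lower n \<times> UNIV"
    using assms(2) by (auto simp: F_gens_def)
  show ?thesis unfolding F_gens_def using us assms(1) by (intro CollectI exI[of _ "(x, f) # us"]) auto
qed

context
  fixes n N :: nat
  assumes n: "2 \<le> n"
begin

lemma replicate_words: "replicate N 0 \<in> words n N"
  using n by (auto simp: words_def set_replicate_conv_if)

lemma w0_zterm: "w0 N = zterm 0 (replicate N 0)"
  by (simp add: w0_def zterm_def)

lemma w0_V_deg: "w0 N \<in> V_deg n N 0"
  using zterm_V_deg[OF monoms_0 replicate_words] by (simp add: w0_zterm)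

lemma gact_w0: assumes "\<sigma> permutes {..<N}" shows "gact n N \<sigma> (w0 N) = w0 N"
proof -
  have "permute_list (pinv \<sigma>) (replicate N 0) = replicate N (0::nat)"
    using words_permute_list[OF permutes_inv[OF assms] replicate_words] permutes_in_image[OF permutes_inv[OF assms]]
    by (intro nth_equalityI) (auto simp: permute_list_def)
  then show ?thesis
    by (simp add: w0_zterm gact_zterm[OF assms replicate_words] reindex_def[of _ 0])
qed

lemma F_gens_V_carrier: "u \<in> F_gens n N \<Longrightarrow> u \<in> V_carrier n N"
proof (induction rule: F_gens_induct)
  case base
  then show ?case using w0_V_deg by (simp add: V_deg_iff)
qed (simp add: current_act_V_carrier sl_lower_carrier)

lemma F_span: "F n N = vvs.span (F_gens n N)"
proof -
  interpret concrete_space vscale "(V_rep n N)\<lparr>carrier := V_carrier n N\<rparr>"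
    by (rule concrete_space_V_rep[OF subspace_V_carrier])
  have "(V_rep n N)\<lparr>carrier := V_carrier n N\<rparr> = V_rep n N" by (simp add: V_rep_def mk_rep_def)
  moreover have "mspan class_ring ((V_rep n N)\<lparr>carrier := V_carrier n N\<rparr>) (F_gens n N) = vvs.span (F_gens n N)"
    by (rule mspan_eq) (auto simp: F_gens_V_carrier)
  moreover have "F n N = mspan class_ring (V_rep n N) (F_gens n N)" by (simp add: F_def F_gens_def)
  ultimately show ?thesis by metis
qed

lemma F_current_act:
  assumes x: "x \<in> sl_lower n" and "u \<in> F n N" shows "current_act N x f u \<in> F n N"
proof -
  have "current_act N x f u \<in> vvs.span (F_gens n N)"
    by (rule vspan_image_closed[of "V_carrier n N" "current_act N x f" "F_gens n N"])
      (use assms in \<open>auto simp: F_span current_act_linear[OF _ _ sl_lower_carrier[OF x]] polys_zconst subspace_V_carrier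
        F_gens_V_carrier intro!: vvs.span_base F_gens_step\<close>)
  then show ?thesis by (simp add: F_span)
qed

lemma F_invariant:
  assumes "u \<in> F n N" and \<sigma>: "\<sigma> permutes {..<N}" shows "gact n N \<sigma> u = u"
proof -
  have gens: "gact n N \<sigma> u = u" if "u \<in> F_gens n N" for u
    using that
  proof (induction rule: F_gens_induct)
    case (step x f u)
    then show ?case using gact_current_act[OF \<sigma> F_gens_V_carrier sl_lower_carrier] by simp
  qed (rule gact_w0[OF \<sigma>])
  show ?thesis
    using assms(1) unfolding F_span
  proof (induction rule: vvs.span_induct_alt)
    case base
    then show ?case by (rule poly_mapping_eqI) (simp add: cf_gact)
  qed (simp add: gact_linear gens)
qed

lemma F_deg_invariants: "F_deg n N m \<subseteq> invariants n N m"
  using F_invariant by (auto simp: F_deg_def invariants_def)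

lemma subspace_F_deg: "vvs.subspace (F_deg n N m)"
  unfolding F_deg_def F_span by (intro vvs.subspace_inter vvs.subspace_span subspace_V_deg)

subsection \<open>Symmetrized monomials\<close>

abbreviation symterm :: "(nat \<Rightarrow>\<^sub>0 nat) \<Rightarrow> nat list \<Rightarrow> zvec" where
  "symterm a w \<equiv> symm n N (zterm a w)"

lemma symterm_V_deg: "a \<in> monoms N \<Longrightarrow> w \<in> words n N \<Longrightarrow> symterm a w \<in> V_deg n N (mdeg a)"
  by (intro symm_V_deg zterm_V_deg)

definition E0 :: "nat \<Rightarrow> complex mat" where
  "E0 l = mat n n (\<lambda>(r, c). if r = l \<and> c = 0 then 1 else 0)"

lemma E0_lower: "0 < l \<Longrightarrow> E0 l \<in> sl_lower n"
  by (auto simp: E0_def sl_lower_def sl_def intro!: sum.neutral)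

lemma current_act_E0_zterm:
  assumes w: "w \<in> words n N" and a: "a \<in> monoms N" and l: "0 < l" "l < n"
  shows "current_act N (E0 l) (monom 1 k) (zterm a w)
    = (\<Sum>j | j < N \<and> w ! j = 0. zterm (a + Poly_Mapping.single j k) (w[j := l]))"
proof (rule poly_mapping_eqI)
  fix v
  note lw = words_length[OF w]
  have zV: "zterm a w \<in> V_carrier n N" using zterm_V_deg[OF a w] by (simp add: V_deg_iff)
  have E: "E0 l \<in> carrier_mat n n" by (simp add: E0_def)
  show "cf (current_act N (E0 l) (monom 1 k) (zterm a w)) v
    = cf (\<Sum>j | j < N \<and> w ! j = 0. zterm (a + Poly_Mapping.single j k) (w[j := l])) v"
  proof (cases "v \<in> words n N")
    case True
    note lv = words_length[OF True]
    have inner: "(\<Sum>b<n. zconst (E0 l $$ (v ! p, b)) * cf (zterm a w) (v[p := b]))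
       = (if w ! p = 0 \<and> w[p := l] = v then zmono a else 0)" if p: "p < N" for p
    proof -
      have vp: "v ! p < n" by (rule words_nth[OF True p])
      have "(\<Sum>b<n. zconst (E0 l $$ (v ! p, b)) * cf (zterm a w) (v[p := b]))
        = (\<Sum>b<n. if b = 0 then (if v ! p = l \<and> w = v[p := 0] then zmono a else 0) else 0)"
        using vp by (intro sum.cong) (auto simp: E0_def zterm_def lookup_single when_def zconst_simps)
      also have "\<dots> = (if v ! p = l \<and> w = v[p := 0] then zmono a else 0)" using n by simp
      also have "(v ! p = l \<and> w = v[p := 0]) \<longleftrightarrow> (w ! p = 0 \<and> w[p := l] = v)"
      proof
        assume "v ! p = l \<and> w = v[p := 0]"
        then show "w ! p = 0 \<and> w[p := l] = v" using p lv list_update_id[of v p] by auto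
      next
        assume *: "w ! p = 0 \<and> w[p := l] = v"
        then have "v ! p = l" using p lw by auto
        moreover have "v[p := 0] = w" using * list_update_id[of w p] by auto
        ultimately show "v ! p = l \<and> w = v[p := 0]" by simp
      qed
      finally show ?thesis .
    qed
    have "cf (current_act N (E0 l) (monom 1 k) (zterm a w)) v
      = (\<Sum>p<N. zmono (Poly_Mapping.single p k) * (if w ! p = 0 \<and> w[p := l] = v then zmono a else 0))"
      using True by (simp add: cf_current_act[OF zV E] ev_monom inner)
    also have "\<dots> = (\<Sum>p<N. if w ! p = 0 then (if w[p := l] = v then zmono (a + Poly_Mapping.single p k) else 0) else 0)"
      by (intro sum.cong) (auto simp: zmono_mult add.commute)
    also have "\<dots> = (\<Sum>j | j < N \<and> w ! j = 0. cf (zterm (a + Poly_Mapping.single j k) (w[j := l])) v)"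
      by (simp add: sum.inter_filter[symmetric] zterm_def lookup_single when_def)
    finally show ?thesis by (simp add: lookup_sum)
  next
    case False
    then have "w[j := l] \<noteq> v" for j using words_update[OF w l(2)] by auto
    then show ?thesis using False by (simp add: cf_current_act[OF zV E] lookup_sum) (simp add: zterm_def lookup_single when_def)
  qed
qed

lemma kact_transpose:
  assumes "i \<notin> Poly_Mapping.keys a" "j \<notin> Poly_Mapping.keys a"
  shows "kact (Transposition.transpose i j) (a + Poly_Mapping.single i k) = a + Poly_Mapping.single j k"
proof -
  have "kact (Transposition.transpose i j) a = a"
    using assms by (intro reindex_id) (metis transpose_apply_other)
  then show ?thesis by (simp add: reindex_add)
qed

lemma symterm_transpose:
  assumes "i < N" "j < N" and w: "w \<in> words n N"
  shows "symterm (kact (Transposition.transpose i j) a) (permute_list (Transposition.transpose i j) w) = symterm a w"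
proof -
  let ?\<tau> = "Transposition.transpose i j"
  have \<tau>: "?\<tau> permutes {..<N}" using assms by (intro permutes_swap_id) auto
  have "gact n N ?\<tau> (zterm a w) = zterm (kact ?\<tau> a) (permute_list ?\<tau> w)"
    by (simp add: gact_zterm[OF \<tau> w])
  then show ?thesis using symm_gact[OF \<tau>, of n "zterm a w"] by simp
qed

lemma vscale_cancel: 
  assumes "vscale c u \<in> S" "c \<noteq> 0" "vvs.subspace S" shows "u \<in> S"
proof -
  have "vscale (1 / c) (vscale c u) \<in> S" using assms by (simp only: vvs.subspace_scale)
  moreover have "1 / c * c = 1" using assms(2) by simp
  ultimately show ?thesis by (simp only: vvs.scale_scale vvs.scale_one)
qed

lemma sum_const_vscale: "(\<Sum>x\<in>S. u) = vscale (of_nat (card S)) u"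
  by (rule vvs.sum_constant_scale)

text \<open>The vector for \<open>w\<close> arises from that for \<open>w[i := 0]\<close> by applying \<open>E\<^sub>l\<^sub>0 \<otimes> t\<^sup>k\<close>, where \<open>l\<close> is the
  letter and \<open>k\<close> the exponent at position \<open>i\<close>.\<close>

lemma symterm_F:
  assumes "w \<in> words n N" "a \<in> monoms N" "\<And>i. i \<in> Poly_Mapping.keys a \<Longrightarrow> w ! i \<noteq> 0"
  shows "symterm a w \<in> F n N"
  using assms
proof (induction "card {i. i < N \<and> w ! i \<noteq> 0}" arbitrary: a w rule: less_induct)
  case less
  note w = less.prems(1) and a = less.prems(2) and keys = less.prems(3)
  note lw = words_length[OF w]
  show ?case
  proof (cases "\<exists>i<N. w ! i \<noteq> 0")
    case False
    then have "w = replicate N 0" using lw by (intro nth_equalityI) auto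
    moreover have "a = 0"
    proof (rule poly_mapping_eqI)
      fix i
      have "i \<notin> Poly_Mapping.keys a" using False keys[of i] a by (auto simp: monoms_def)
      then show "cf a i = cf 0 i" by (simp add: in_keys_iff)
    qed
    ultimately have "symterm a w = vscale (fact N) (w0 N)"
      using symm_of_invariant[of N n "w0 N"] gact_w0 by (simp add: w0_zterm)
    moreover have "w0 N \<in> F_gens n N" unfolding F_gens_def by (intro CollectI exI[of _ "[]"]) simp
    ultimately show ?thesis using F_span by (simp add: vvs.span_base vvs.span_scale)
  next
    case True
    then obtain i where i: "i < N" "w ! i \<noteq> 0" by blast
    define l k where "l = w ! i" and "k = cf a i"
    define b where "b = a - Poly_Mapping.single i k"
    have cfb: "cf b j = (if j = i then 0 else cf a j)" for j
      by (auto simp: b_def lookup_minus lookup_single when_def k_def)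
    have ab: "a = b + Poly_Mapping.single i k"
      by (rule poly_mapping_eqI) (auto simp: lookup_add cfb lookup_single when_def k_def)
    have kb: "Poly_Mapping.keys b = Poly_Mapping.keys a - {i}"
      by (auto simp: in_keys_iff cfb split: if_splits)
    have bN: "b \<in> monoms N" using a kb by (auto simp: monoms_def)
    have l: "0 < l" "l < n" using i words_nth[OF w i(1)] by (simp_all add: l_def)
    define v where "v = w[i := 0]"
    have v: "v \<in> words n N" unfolding v_def using w n by (intro words_update) auto
    have vn: "v ! j = (if j = i then 0 else w ! j)" if "j < N" for j
      using that lw by (simp add: v_def)
    have IH: "symterm b v \<in> F n N"
    proof (rule less.hyps[OF _ v bN])
      show "card {j. j < N \<and> v ! j \<noteq> 0} < card {i. i < N \<and> w ! i \<noteq> 0}"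
      proof (rule psubset_card_mono)
        have "{j. j < N \<and> v ! j \<noteq> 0} \<subseteq> {i. i < N \<and> w ! i \<noteq> 0}"
        proof (rule Collect_mono, intro impI)
          fix j assume "j < N \<and> v ! j \<noteq> 0"
          then show "j < N \<and> w ! j \<noteq> 0" using vn[of j] by (simp split: if_splits)
        qed
        moreover have "i \<in> {i. i < N \<and> w ! i \<noteq> 0}" using i by simp
        moreover have "i \<notin> {j. j < N \<and> v ! j \<noteq> 0}" using vn[OF i(1)] by simp
        ultimately show "{j. j < N \<and> v ! j \<noteq> 0} \<subset> {i. i < N \<and> w ! i \<noteq> 0}" by blast
      qed simp
      fix j assume "j \<in> Poly_Mapping.keys b"
      then have j: "j \<in> Poly_Mapping.keys a" "j \<noteq> i" using kb by auto
      then have "j < N" using a by (auto simp: monoms_def)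
      then show "v ! j \<noteq> 0" using keys[OF j(1)] vn j(2) by simp
    qed
    \<comment> \<open>Every position that carries the letter 0 in \<open>v\<close> has exponent 0 in
      \<open>b\<close>, so transposing it with \<open>i\<close> relates the term created there to
      the one created at \<open>i\<close>. After symmetrization all of these terms coincide.\<close>
    have same: "symterm (b + Poly_Mapping.single j k) (v[j := l]) = symterm a w"
      if j: "j < N" "v ! j = 0" for j
    proof -
      let ?\<tau> = "Transposition.transpose i j"
      have "j \<notin> Poly_Mapping.keys b"
        using kb keys[of j] vn[OF j(1)] j(2) by (auto split: if_splits)
      then have "kact ?\<tau> a = b + Poly_Mapping.single j k"
        using kact_transpose[of i b j k] kb by (simp add: ab)
      moreover have "permute_list ?\<tau> w = v[j := l]"
      proof (rule nth_equalityI)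
        fix q assume "q < length (permute_list ?\<tau> w)"
        then have q: "q < N" using lw by simp
        consider "q = j" | "q = i" "i \<noteq> j" | "q \<noteq> i" "q \<noteq> j" by blast
        then show "permute_list ?\<tau> w ! q = v[j := l] ! q"
        proof cases
          case 1
          then show ?thesis using q lw by (simp add: permute_list_def l_def v_def)
        next
          case 2
          then have "w ! j = 0" using vn[OF j(1)] j(2) by simp
          then show ?thesis using 2 q lw vn[OF q] by (simp add: permute_list_def)
        next
          case 3
          then show ?thesis using q lw vn[OF q] by (simp add: permute_list_def)
        qed
      qed (use lw in \<open>simp add: v_def\<close>)
      ultimately show ?thesis using symterm_transpose[OF i(1) j(1) w, of a] by simp
    qed
    have "current_act N (E0 l) (monom 1 k) (symterm b v)
        = symm n N (current_act N (E0 l) (monom 1 k) (zterm b v))"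
      using zterm_V_deg[OF bN v] by (intro symm_current_act[symmetric]) (simp_all add: V_deg_iff E0_def)
    also have "\<dots> = (\<Sum>j | j < N \<and> v ! j = 0. symterm (b + Poly_Mapping.single j k) (v[j := l]))"
      by (simp add: current_act_E0_zterm[OF v bN l] symm_sum)
    also have "\<dots> = (\<Sum>j | j < N \<and> v ! j = 0. symterm a w)"
      by (rule sum.cong[OF refl]) (use same in blast)
    also have "\<dots> = vscale (of_nat (card {j. j < N \<and> v ! j = 0})) (symterm a w)"
      by (rule sum_const_vscale)
    finally have "vscale (of_nat (card {j. j < N \<and> v ! j = 0})) (symterm a w) \<in> F n N"
      using F_current_act[OF E0_lower[OF l(1)] IH] by metis
    moreover have "i \<in> {j. j < N \<and> v ! j = 0}" using i vn by simp
    then have "(of_nat (card {j. j < N \<and> v ! j = 0}) :: complex) \<noteq> 0" by (auto simp: card_eq_0_iff)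
    ultimately show ?thesis
      by (rule vscale_cancel) (simp add: F_span vvs.subspace_span)
  qed
qed

subsection \<open>The filtration by degree\<close>

text \<open>In total degree \<open>m\<close>, the monomial multiples of elements of degree below
  \<open>m\<close> span \<open>low_part\<close>. The only further products are constant multiples of
  elements of \<open>F_deg n N m\<close>, which are added in \<open>full_part\<close>.\<close>

definition low_gens :: "nat \<Rightarrow> zvec set" where
  "low_gens m = {zscale (zmono a) f | a k f. a \<in> monoms N \<and> f \<in> F_deg n N k \<and> mdeg a + k = m \<and> k < m}"

definition low_part :: "nat \<Rightarrow> zvec set" where
  "low_part m = vvs.span (low_gens m)"

definition full_part :: "nat \<Rightarrow> zvec set" where
  "full_part m = {f + x | f x. f \<in> F_deg n N m \<and> x \<in> low_part m}"

lemma low_gens_V_deg: assumes "u \<in> low_gens m" shows "u \<in> V_deg n N m"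
proof -
  obtain a k f where y: "a \<in> monoms N" "f \<in> F_deg n N k" "mdeg a + k = m" "u = zscale (zmono a) f"
    using assms by (auto simp: low_gens_def)
  have "f \<in> V_deg n N k" using y(2) by (simp add: F_deg_def)
  then show ?thesis
    using V_deg_zscale[OF polys_zmono[OF y(1)] zhom_zmono] by (simp add: y(4) y(3)[symmetric])
qed

lemma low_part_V_deg: "u \<in> low_part m \<Longrightarrow> u \<in> V_deg n N m"
proof -
  have "low_gens m \<subseteq> V_deg n N m" using low_gens_V_deg by blast
  then have "low_part m \<subseteq> V_deg n N m" unfolding low_part_def by (rule vvs.span_minimal[OF _ subspace_V_deg])
  then show "u \<in> low_part m \<Longrightarrow> u \<in> V_deg n N m" by blast
qed

lemma subspace_low_part: "vvs.subspace (low_part m)"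
  unfolding low_part_def by (rule vvs.subspace_span)

lemma subspace_full_part: "vvs.subspace (full_part m)"
  unfolding full_part_def by (rule vvs.subspace_sums[OF subspace_F_deg subspace_low_part])

lemma low_part_full_part: "u \<in> low_part m \<Longrightarrow> u \<in> full_part m"
  unfolding full_part_def using vvs.subspace_0[OF subspace_F_deg] by (intro CollectI exI[of _ 0] exI[of _ u]) simp

lemma F_deg_full_part: "u \<in> F_deg n N m \<Longrightarrow> u \<in> full_part m"
  unfolding full_part_def using vvs.subspace_0[OF subspace_low_part] by (intro CollectI exI[of _ u] exI[of _ 0]) simp

lemma full_part_V_deg: assumes "u \<in> full_part m" shows "u \<in> V_deg n N m"
proof -
  obtain f x where fx: "f \<in> F_deg n N m" "x \<in> low_part m" "u = f + x" using assms by (auto simp: full_part_def)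
  have "f \<in> V_deg n N m" using fx(1) by (simp add: F_deg_def)
  then show ?thesis unfolding fx(3) by (rule vvs.subspace_add[OF subspace_V_deg _ low_part_V_deg[OF fx(2)]])
qed

text \<open>Both summands of \<open>u\<close> come from elements of degree at most \<open>m\<close>,
  so a factor of positive degree makes them multiples of something of strictly lower degree.\<close>

lemma zmono_full_part:
  assumes b: "b \<in> monoms N" "0 < mdeg b" and u: "u \<in> full_part m"
  shows "zscale (zmono b) u \<in> low_part (mdeg b + m)"
proof -
  obtain f x where fx: "f \<in> F_deg n N m" "x \<in> low_part m" "u = f + x" using u by (auto simp: full_part_def)
  have "zscale (zmono b) f \<in> low_gens (mdeg b + m)"
    unfolding low_gens_def using b fx(1) by (intro CollectI exI[of _ b] exI[of _ m] exI[of _ f]) simp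
  then have 1: "zscale (zmono b) f \<in> low_part (mdeg b + m)" unfolding low_part_def by (rule vvs.span_base)
  have 2: "zscale (zmono b) x \<in> low_part (mdeg b + m)"
  proof (rule vspan_image_closed[of UNIV "zscale (zmono b)" "low_gens m"])
    show "x \<in> vvs.span (low_gens m)" using fx(2) by (simp add: low_part_def)
    fix y assume "y \<in> low_gens m"
    then obtain a k f where y: "a \<in> monoms N" "f \<in> F_deg n N k" "mdeg a + k = m" "k < m" "y = zscale (zmono a) f"
      by (auto simp: low_gens_def)
    have "zscale (zmono b) y \<in> low_gens (mdeg b + m)"
      unfolding low_gens_def using y b
      by (intro CollectI exI[of _ "b + a"] exI[of _ k] exI[of _ f])
        (simp add: zscale_simps zmono_mult monoms_add mdeg_add)
    then show "zscale (zmono b) y \<in> low_part (mdeg b + m)" unfolding low_part_def by (rule vvs.span_base)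
  qed (simp_all add: zscale_simps mult.commute subspace_low_part)
  show ?thesis unfolding fx(3) zscale_simps by (rule vvs.subspace_add[OF subspace_low_part 1 2])
qed

text \<open>A position with letter 0 and exponent \<open>k > 0\<close> is beyond the lowering
  operators. The power sum \<open>p\<close> of degree \<open>k\<close> commutes with symmetrization,
  and its product with \<open>symterm b w\<close> lies in \<open>low_part\<close>. That product
  expands into the vectors with \<open>k\<close> added to the exponent at one position
  \<open>j\<close>: for \<open>j\<close> in \<open>G\<close> all of them equal
  \<open>symterm a w\<close>, and for the others there are no more bad positions than in
  \<open>b\<close>, so the induction applies.\<close>

lemma symterm_full_part:
  assumes "w \<in> words n N" "a \<in> monoms N" shows "symterm a w \<in> full_part (mdeg a)"
  using assms
proof (induction "card {i \<in> Poly_Mapping.keys a. w ! i = 0}" arbitrary: a rule: less_induct)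
  case less
  note w = less.prems(1) and a = less.prems(2)
  show ?case
  proof (cases "\<exists>i\<in>Poly_Mapping.keys a. w ! i = 0")
    case False
    then have "symterm a w \<in> F n N" using w a by (intro symterm_F) auto
    then show ?thesis using symterm_V_deg[OF a w] by (intro F_deg_full_part) (simp add: F_deg_def)
  next
    case True
    then obtain i where i: "i \<in> Poly_Mapping.keys a" "w ! i = 0" by blast
    have iN: "i < N" using i a by (auto simp: monoms_def)
    define k where "k = cf a i"
    define b where "b = a - Poly_Mapping.single i k"
    have cfb: "cf b j = (if j = i then 0 else cf a j)" for j
      by (auto simp: b_def lookup_minus lookup_single when_def k_def)
    have ab: "a = b + Poly_Mapping.single i k"
      by (rule poly_mapping_eqI) (auto simp: lookup_add cfb lookup_single when_def k_def)
    have kb: "Poly_Mapping.keys b = Poly_Mapping.keys a - {i}"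
      by (auto simp: in_keys_iff cfb split: if_splits)
    have bN: "b \<in> monoms N" using a kb by (auto simp: monoms_def)
    have k0: "0 < k" using i by (simp add: k_def in_keys_iff)
    have deg: "mdeg a = k + mdeg b" by (simp add: ab mdeg_add)
    have small: "{j \<in> Poly_Mapping.keys b. w ! j = 0} \<subset> {i \<in> Poly_Mapping.keys a. w ! i = 0}"
      using i kb by blast
    have IH: "symterm c w \<in> full_part (mdeg c)"
      if "{j \<in> Poly_Mapping.keys c. w ! j = 0} \<subseteq> {j \<in> Poly_Mapping.keys b. w ! j = 0}" "c \<in> monoms N" for c
    proof (rule less.hyps[OF _ w that(2)])
      show "card {i \<in> Poly_Mapping.keys c. w ! i = 0} < card {i \<in> Poly_Mapping.keys a. w ! i = 0}"
        using that(1) small by (intro psubset_card_mono) auto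
    qed
    define p where "p = (\<Sum>j<N. zmono (Poly_Mapping.single j k))"
    define G where "G = {j \<in> {..<N}. w ! j = 0 \<and> j \<notin> Poly_Mapping.keys b}"
    have p_sym: "pact \<sigma> p = p" if "\<sigma> permutes {..<N}" for \<sigma>
      unfolding p_def pact_sum by (simp add: sum.permute[OF that, of "\<lambda>j. zmono (Poly_Mapping.single j k)"] comp_def)
    have "zscale p (symterm b w) = symm n N (zscale p (zterm b w))"
      unfolding symm_def zscale_sum by (intro sum.cong refl) (simp add: gact_linear p_sym)
    also have "\<dots> = (\<Sum>j<N. symterm (b + Poly_Mapping.single j k) w)"
      by (simp add: p_def zscale_sum zscale_zterm symm_sum add.commute)
    also have "\<dots> = (\<Sum>j\<in>{..<N} - G. symterm (b + Poly_Mapping.single j k) w) + (\<Sum>j\<in>G. symterm (b + Poly_Mapping.single j k) w)"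
      by (rule sum.subset_diff) (auto simp: G_def)
    also have "(\<Sum>j\<in>G. symterm (b + Poly_Mapping.single j k) w) = (\<Sum>j\<in>G. symterm a w)"
    proof (rule sum.cong[OF refl])
      fix j assume "j \<in> G"
      then have j: "j < N" "w ! j = 0" "j \<notin> Poly_Mapping.keys b" by (auto simp: G_def)
      let ?\<tau> = "Transposition.transpose i j"
      have "kact ?\<tau> a = b + Poly_Mapping.single j k"
        using kact_transpose[of i b j k] kb j by (simp add: ab)
      moreover have "permute_list ?\<tau> w = w"
      proof (rule nth_equalityI)
        fix q assume "q < length (permute_list ?\<tau> w)"
        then show "permute_list ?\<tau> w ! q = w ! q"
          using i j by (cases "q = i"; cases "q = j") (simp_all add: permute_list_def)
      qed simp
      ultimately show "symterm (b + Poly_Mapping.single j k) w = symterm a w"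
        using symterm_transpose[OF iN j(1) w, of a] by simp
    qed
    also have "\<dots> = vscale (of_nat (card G)) (symterm a w)" by (rule sum_const_vscale)
    finally have eq: "vscale (of_nat (card G)) (symterm a w)
      = zscale p (symterm b w) - (\<Sum>j\<in>{..<N} - G. symterm (b + Poly_Mapping.single j k) w)"
      by (simp add: algebra_simps)
    have bA: "symterm b w \<in> full_part (mdeg b)" by (rule IH[OF _ bN]) simp
    have "zscale p (symterm b w) \<in> full_part (mdeg a)"
      unfolding p_def zscale_sum
    proof (rule vvs.subspace_sum[OF subspace_full_part])
      fix j assume "j \<in> {..<N}"
      then show "zscale (zmono (Poly_Mapping.single j k)) (symterm b w) \<in> full_part (mdeg a)"
        using zmono_full_part[OF _ _ bA, of "Poly_Mapping.single j k"] k0 by (intro low_part_full_part) (simp add: monoms_single deg)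
    qed
    moreover have "(\<Sum>j\<in>{..<N} - G. symterm (b + Poly_Mapping.single j k) w) \<in> full_part (mdeg a)"
    proof (rule vvs.subspace_sum[OF subspace_full_part])
      fix j assume j: "j \<in> {..<N} - G"
      have "{q \<in> Poly_Mapping.keys (b + Poly_Mapping.single j k). w ! q = 0} \<subseteq> {q \<in> Poly_Mapping.keys b. w ! q = 0}"
        using j by (auto simp: G_def in_keys_iff lookup_add lookup_single when_def split: if_splits)
      then have "symterm (b + Poly_Mapping.single j k) w \<in> full_part (mdeg (b + Poly_Mapping.single j k))"
        using j by (intro IH monoms_add bN monoms_single) auto
      then show "symterm (b + Poly_Mapping.single j k) w \<in> full_part (mdeg a)"
        by (simp add: mdeg_add deg add.commute)
    qed
    ultimately have "vscale (of_nat (card G)) (symterm a w) \<in> full_part (mdeg a)"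
      unfolding eq by (rule vvs.subspace_diff[OF subspace_full_part])
    moreover have "i \<in> G" using i iN kb by (simp add: G_def)
    then have "(of_nat (card G) :: complex) \<noteq> 0" by (auto simp: G_def card_eq_0_iff)
    ultimately show ?thesis using subspace_full_part by (rule vscale_cancel)
  qed
qed

lemma invariants_full_part: "u \<in> invariants n N m \<Longrightarrow> u \<in> full_part m"
proof -
  assume u: "u \<in> invariants n N m"
  have "symm n N u \<in> full_part m"
  proof (rule vspan_image_closed[of UNIV "symm n N", OF _ _ _ _ subspace_full_part _ V_deg_span])
    fix x assume "x \<in> {zterm a w | a w. a \<in> monoms N \<and> mdeg a = m \<and> w \<in> words n N}"
    then show "symm n N x \<in> full_part m" using symterm_full_part by auto
  qed (use u in \<open>simp_all add: symm_linear invariants_def\<close>)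
  moreover have "symm n N u = vscale (fact N) u"
    using u by (intro symm_of_invariant) (simp add: invariants_def)
  ultimately have "vscale (fact N) u \<in> full_part m" by simp
  then show ?thesis by (rule vscale_cancel) (simp_all add: subspace_full_part)
qed

lemma invariants_V_carrier: "u \<in> invariants n N m \<Longrightarrow> u \<in> V_carrier n N"
  by (simp add: invariants_def V_deg_iff)

lemma invariants_current_act:
  assumes u: "u \<in> invariants n N m" and x: "x \<in> carrier_mat n n"
  shows "current_act N x 1 u \<in> invariants n N m"
proof -
  have uV: "u \<in> V_deg n N m" and inv: "\<And>\<sigma>. \<sigma> \<in> perms N \<Longrightarrow> gact n N \<sigma> u = u"
    using u by (auto simp: invariants_def)
  have "gact n N \<sigma> (current_act N x 1 u) = current_act N x 1 u" if "\<sigma> \<in> perms N" for \<sigma>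
    using gact_current_act[OF _ invariants_V_carrier[OF u] x, of \<sigma> 1] that inv[OF that] by simp
  then show ?thesis using current_act_V_deg[OF uV x] by (simp add: invariants_def)
qed

text \<open>\<open>F_deg\<close> is not stable under the whole Lie algebra, but
  \<open>invariants\<close> is. An operator therefore moves an element of degree \<open>k\<close> to
  an invariant, which lies in \<open>full_part k\<close>, and the monomial in front brings it back
  to \<open>low_part\<close>.\<close>

lemma low_part_current_act:
  assumes u: "u \<in> low_part m" and x: "x \<in> carrier_mat n n"
  shows "current_act N x 1 u \<in> low_part m"
proof (rule vspan_image_closed[of "V_carrier n N" "current_act N x 1" "low_gens m"])
  show "u \<in> vvs.span (low_gens m)" using u by (simp add: low_part_def)
  show "low_gens m \<subseteq> V_carrier n N"
  proof
    fix y assume "y \<in> low_gens m"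
    from low_gens_V_deg[OF this] show "y \<in> V_carrier n N" by (simp add: V_deg_iff)
  qed
  fix y assume "y \<in> low_gens m"
  then obtain a k f where y: "a \<in> monoms N" "f \<in> F_deg n N k" "mdeg a + k = m" "k < m" "y = zscale (zmono a) f"
    by (auto simp: low_gens_def)
  have f: "f \<in> invariants n N k" using F_deg_invariants y(2) by blast
  note fV = invariants_V_carrier[OF f]
  have "current_act N x 1 y = zscale (zmono a) (current_act N x 1 f)"
    unfolding y(5) by (rule current_act_linear(2)[OF fV fV x polys_zmono[OF y(1)]])
  moreover have "zscale (zmono a) (current_act N x 1 f) \<in> low_part (mdeg a + k)"
  proof (rule zmono_full_part[OF y(1)])
    show "0 < mdeg a" using y(3,4) by simp
    show "current_act N x 1 f \<in> full_part k" by (rule invariants_full_part[OF invariants_current_act[OF f x]])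
  qed
  ultimately show "current_act N x 1 y \<in> low_part m" by (simp add: y(3))
next
  fix c p assume p: "p \<in> V_carrier n N"
  show "current_act N x 1 (vscale c p) = vscale c (current_act N x 1 p)"
    by (rule current_act_linear(2)[OF p p x polys_zconst])
next
  fix p q assume "p \<in> V_carrier n N" "q \<in> V_carrier n N"
  then show "current_act N x 1 (p + q) = current_act N x 1 p + current_act N x 1 q"
    by (rule current_act_linear(1)[OF _ _ x])
qed (rule subspace_V_carrier, rule subspace_low_part)

lemma full_part_current_act:
  assumes u: "u \<in> full_part m" and x: "x \<in> carrier_mat n n"
  shows "current_act N x 1 u \<in> full_part m"
proof -
  obtain f y where fy: "f \<in> F_deg n N m" "y \<in> low_part m" "u = f + y" using u by (auto simp: full_part_def)
  have "f \<in> invariants n N m" using F_deg_invariants fy(1) by blast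
  then have "current_act N x 1 f \<in> full_part m" by (intro invariants_full_part invariants_current_act x)
  moreover have "current_act N x 1 y \<in> full_part m" by (intro low_part_full_part low_part_current_act fy x)
  moreover have "current_act N x 1 u = current_act N x 1 f + current_act N x 1 y"
  proof -
    have "f \<in> V_carrier n N" "y \<in> V_carrier n N"
      using fy(1) low_part_V_deg[OF fy(2)] by (simp_all add: F_deg_def V_deg_iff)
    then show ?thesis unfolding fy(3) by (rule current_act_linear(1)[OF _ _ x])
  qed
  ultimately show ?thesis using vvs.subspace_add[OF subspace_full_part] by simp
qed

subsection \<open>Coefficients in the coinvariant ideal\<close>

text \<open>With \<open>f\<close> invariant, symmetrizing a monomial multiple of \<open>f\<close>
  multiplies \<open>f\<close> by an orbit sum; the monomial has positive degree, so the orbit sum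
  lies in the ideal.\<close>

lemma symm_low_part_J:
  assumes "u \<in> low_part m" shows "cf (symm n N u) w \<in> J N"
proof -
  have gens: "cf (symm n N y) w \<in> J N" if "y \<in> low_gens m" for y
  proof -
    from that obtain a k f where y: "a \<in> monoms N" "f \<in> F_deg n N k" "mdeg a + k = m" "k < m" "y = zscale (zmono a) f"
      by (auto simp: low_gens_def)
    have f: "f \<in> invariants n N k" using F_deg_invariants y(2) by blast
    have "symm n N y = (\<Sum>\<sigma>\<in>perms N. zscale (zmono (kact \<sigma> a)) f)"
      unfolding symm_def y(5)
    proof (rule sum.cong[OF refl])
      fix \<sigma> assume "\<sigma> \<in> perms N"
      then have "gact n N \<sigma> f = f" using f by (simp add: invariants_def)
      then show "gact n N \<sigma> (zscale (zmono a) f) = zscale (zmono (kact \<sigma> a)) f" by (simp add: gact_linear)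
    qed
    then have "symm n N y = zscale (orbit_sum N a) f" by (simp add: orbit_sum_def zscale_sum)
    then have "cf (symm n N y) w = cf f w * orbit_sum N a" by (simp add: mult.commute)
    moreover have "a \<noteq> 0" using y(3,4) by auto
    then have "orbit_sum N a \<in> J N" by (rule orbit_sum_J[OF y(1)])
    moreover have "cf f w \<in> polys N" using invariants_V_carrier[OF f] by (simp add: V_carrier_iff)
    ultimately show ?thesis by (simp add: J_mult)
  qed
  show ?thesis
    using assms unfolding low_part_def
  proof (induction rule: vvs.span_induct_alt)
    case base
    have "symm n N 0 = 0" using symm_linear(1)[of n N 0 0] by simp
    then show ?case by (simp add: J_0)
  next
    case (step c x y)
    have "pscale c (cf (symm n N x) w) + cf (symm n N y) w \<in> J N"
      by (rule J_add[OF J_pscale[OF gens[OF step(1)]] step(2)])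
    then show ?case by (simp add: symm_linear lookup_add pscale_eq_mult)
  qed
qed

lemma elem_sym_full_part:
  assumes "u \<in> full_part m" "1 \<le> j" shows "zscale (elem_sym N j) u \<in> low_part (j + m)"
  unfolding elem_sym_zmono zscale_sum
proof (rule vvs.subspace_sum[OF subspace_low_part])
  fix S assume S: "S \<in> subsets_of_card N j"
  then have "finite S" using finite_subset[of S "{..<N}"] by auto
  then show "zscale (zmono (expo S)) u \<in> low_part (j + m)"
    using zmono_full_part[OF monoms_expo _ assms(1), of S] S assms(2) by (simp add: mdeg_expo)
qed

text \<open>The homogeneous generators write the coefficients as combinations of monomials times
  elementary symmetric polynomials. The symmetric factor passes through symmetrization and, having
  positive degree, carries the remaining \<open>symterm\<close> from \<open>full_part\<close> into
  \<open>low_part\<close>.\<close>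

lemma invariants_J_low_part:
  assumes u: "u \<in> invariants n N m" and J: "\<And>w. cf u w \<in> J N"
  shows "u \<in> low_part m"
proof -
  have single: "symm n N (Poly_Mapping.single w q) \<in> low_part m"
    if w: "w \<in> words n N" and q: "q \<in> free_vs.span (J_hgens N m)" for w q
    using q
  proof (induction rule: free_vs.span_induct_alt)
    case base
    have "symm n N 0 = 0" using symm_linear(1)[of n N 0 0] by simp
    then show ?case using vvs.subspace_0[OF subspace_low_part] by simp
  next
    case (step c x y)
    from step(1) obtain a j where aj: "a \<in> monoms N" "j \<in> {1..N}" "mdeg a + j = m" "x = zmono a * elem_sym N j"
      by (auto simp: J_hgens_def)
    have "Poly_Mapping.single w x = zscale (elem_sym N j) (zterm a w)"
      by (rule poly_mapping_eqI) (simp add: zterm_def lookup_single when_def aj(4) mult.commute)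
    moreover have "symm n N (zscale (elem_sym N j) (zterm a w)) = zscale (elem_sym N j) (symterm a w)"
      unfolding symm_def zscale_sum by (rule sum.cong[OF refl]) (simp add: gact_linear pact_elem_sym)
    ultimately have "symm n N (Poly_Mapping.single w x) = zscale (elem_sym N j) (symterm a w)" by simp
    also have "\<dots> \<in> low_part (j + mdeg a)" using aj by (intro elem_sym_full_part symterm_full_part w) auto
    finally have "symm n N (Poly_Mapping.single w x) \<in> low_part m" using aj(3) by (simp add: add.commute)
    then have "vscale c (symm n N (Poly_Mapping.single w x)) + symm n N (Poly_Mapping.single w y) \<in> low_part m"
      by (intro vvs.subspace_add[OF subspace_low_part] vvs.subspace_scale[OF subspace_low_part] step)
    moreover have "Poly_Mapping.single w (pscale c x + y) = vscale c (Poly_Mapping.single w x) + Poly_Mapping.single w y"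
      by (rule poly_mapping_eqI) (simp add: lookup_add lookup_single when_def pscale_eq_mult)
    ultimately show ?case by (simp add: symm_linear)
  qed
  have uV: "u \<in> V_deg n N m" using u by (simp add: invariants_def)
  have "symm n N u = (\<Sum>w\<in>words n N. symm n N (Poly_Mapping.single w (cf u w)))"
    using V_carrier_sum_single[of u n N] uV by (simp add: symm_sum[symmetric] V_deg_iff)
  also have "\<dots> \<in> low_part m"
  proof (rule vvs.subspace_sum[OF subspace_low_part])
    fix w assume "w \<in> words n N"
    then show "symm n N (Poly_Mapping.single w (cf u w)) \<in> low_part m"
      using J uV by (intro single J_zhom_span) (simp_all add: V_deg_iff)
  qed
  finally have "vscale (fact N) u \<in> low_part m"
    using symm_of_invariant[of N n u] u by (simp add: invariants_def)
  then show ?thesis by (rule vscale_cancel) (simp_all add: subspace_low_part)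
qed

subsection \<open>Invariant vectors with harmonic coefficients\<close>

definition harm_vectors :: "nat \<Rightarrow> zvec set" where
  "harm_vectors m = {u \<in> invariants n N m. \<forall>w. cf u w \<in> harm N}"

text \<open>Elements of \<open>full_part\<close> need not be invariant, so \<open>rho\<close> is
  applied after symmetrization; the factor makes the map the identity on
  \<open>harm_vectors\<close>. Its kernel on \<open>full_part\<close> is
  \<open>low_part\<close>.\<close>

definition harm_proj :: "zvec \<Rightarrow> zvec" where
  "harm_proj u = vscale (1 / fact N) (Poly_Mapping.map (rho N) (symm n N u))"

lemma cf_harm_proj: "u \<in> V_carrier n N \<Longrightarrow> cf (harm_proj u) w = rho N (pscale (1 / fact N) (cf (symm n N u) w))"
proof -
  assume u: "u \<in> V_carrier n N"
  have "symm n N u \<in> V_carrier n N"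
    unfolding symm_def using u by (intro vvs.subspace_sum[OF subspace_V_carrier] gact_V_carrier) auto
  then have "cf (symm n N u) w \<in> polys N" by (simp add: V_carrier_iff)
  then show ?thesis
    by (simp add: harm_proj_def Poly_Mapping.map.rep_eq when_def rho_pscale pscale_eq_mult[symmetric])
qed

lemma symm_V_carrier: "u \<in> V_carrier n N \<Longrightarrow> symm n N u \<in> V_carrier n N"
  unfolding symm_def by (intro vvs.subspace_sum[OF subspace_V_carrier] gact_V_carrier) auto

lemma cf_symm_polys: "u \<in> V_carrier n N \<Longrightarrow> pscale c (cf (symm n N u) w) \<in> polys N"
  using symm_V_carrier[of u] by (simp add: V_carrier_iff pscale_eq_mult polys_mult polys_zconst)

lemma harm_proj_add: "u \<in> V_carrier n N \<Longrightarrow> v \<in> V_carrier n N \<Longrightarrow> harm_proj (u + v) = harm_proj u + harm_proj v"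
  by (rule poly_mapping_eqI)
    (simp add: cf_harm_proj lookup_add vvs.subspace_add[OF subspace_V_carrier] symm_linear
      free_vs.scale_right_distrib rho_add cf_symm_polys)

lemma harm_proj_scale: "u \<in> V_carrier n N \<Longrightarrow> harm_proj (vscale c u) = vscale c (harm_proj u)"
proof (rule poly_mapping_eqI)
  fix w assume u: "u \<in> V_carrier n N"
  have "pscale (1 / fact N) (pscale c (cf (symm n N u) w)) = pscale c (pscale (1 / fact N) (cf (symm n N u) w))"
    by (simp add: mult.commute)
  then show "cf (harm_proj (vscale c u)) w = cf (vscale c (harm_proj u)) w"
    using u by (simp add: cf_harm_proj vvs.subspace_scale[OF subspace_V_carrier] symm_linear
      pscale_eq_mult[symmetric] rho_pscale[symmetric] cf_symm_polys)
qed

lemma harm_proj_invariant: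
  assumes "u \<in> invariants n N m" shows "cf (harm_proj u) w = rho N (cf u w)"
proof -
  have "symm n N u = vscale (fact N) u"
    using assms by (intro symm_of_invariant) (simp add: invariants_def)
  then show ?thesis
    using assms by (simp add: cf_harm_proj invariants_def V_deg_iff pscale_eq_mult[symmetric])
qed

lemma harm_proj_id: "u \<in> harm_vectors m \<Longrightarrow> harm_proj u = u"
  by (rule poly_mapping_eqI) (auto simp: harm_vectors_def harm_proj_invariant rho_id)

lemma harm_vectors_full_part: "u \<in> harm_vectors m \<Longrightarrow> u \<in> full_part m"
  by (rule invariants_full_part) (simp add: harm_vectors_def)

lemma subspace_harm_vectors: "vvs.subspace (harm_vectors m)"
proof -
  have "0 \<in> harm N" by (simp add: harm_def)
  moreover have "p + q \<in> harm N" if "p \<in> harm N" "q \<in> harm N" for p q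
    using that by (simp add: harm_def polys_add free_hs.ip_add)
  moreover have "zconst c * p \<in> harm N" if "p \<in> harm N" for c p
    using that by (simp add: harm_def polys_mult polys_zconst pscale_eq_mult[symmetric] free_hs.ip_scale)
      (simp add: pscale_eq_mult polys_mult polys_zconst)
  ultimately show ?thesis
    using subspace_invariants[of n N m] by (simp add: vvs.subspace_def harm_vectors_def lookup_add)
qed

lemma harm_proj_harm_vectors:
  assumes u: "u \<in> V_deg n N m" shows "harm_proj u \<in> harm_vectors m"
proof -
  have uV: "u \<in> V_carrier n N" using u by (simp add: V_deg_iff)
  let ?s = "vscale (1 / fact N) (symm n N u)"
  have s: "?s \<in> invariants n N m"
    by (intro vvs.subspace_scale[OF subspace_invariants] symm_invariants u)
  have cs: "cf (harm_proj u) w = rho N (cf ?s w)" for w using cf_harm_proj[OF uV] by (simp add: pscale_eq_mult)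
  have sp: "cf ?s w \<in> polys N" "cf ?s w \<in> zhom m" and out: "w \<notin> words n N \<Longrightarrow> cf ?s w = 0" for w
  proof -
    have "?s \<in> V_deg n N m" using s unfolding invariants_def by blast
    then show "cf ?s w \<in> polys N" "cf ?s w \<in> zhom m" and "w \<notin> words n N \<Longrightarrow> cf ?s w = 0"
      unfolding V_deg_iff V_carrier_iff by blast+
  qed
  have b_out: "cf (harm_proj u) w = 0" if "w \<notin> words n N" for w
    by (simp only: cs out[OF that] rho_0)
  have "harm_proj u \<in> V_deg n N m"
    unfolding V_deg_iff V_carrier_iff
  proof (intro conjI allI impI b_out)
    show "cf (harm_proj u) w \<in> polys N" "cf (harm_proj u) w \<in> zhom m" for w
      unfolding cs by (rule rho_polys[OF sp(1)], rule rho_zhom[OF sp])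
  qed
  moreover have "gact n N \<sigma> (harm_proj u) = harm_proj u" if \<sigma>: "\<sigma> \<in> perms N" for \<sigma>
  proof (rule poly_mapping_eqI)
    fix w
    have "gact n N \<sigma> ?s = ?s" using s \<sigma> by (simp only: invariants_def mem_Collect_eq)
    then have g: "cf (gact n N \<sigma> ?s) w = cf ?s w" by simp
    have \<sigma>': "\<sigma> permutes {..<N}" using \<sigma> by simp
    show "cf (gact n N \<sigma> (harm_proj u)) w = cf (harm_proj u) w"
    proof (cases "w \<in> words n N")
      case True
      have "cf (gact n N \<sigma> (harm_proj u)) w = pact \<sigma> (rho N (cf ?s (permute_list \<sigma> w)))"
        using True by (simp only: cf_gact cs if_True)
      also have "\<dots> = rho N (pact \<sigma> (cf ?s (permute_list \<sigma> w)))"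
        by (rule rho_pact[OF \<sigma>' sp(1), symmetric])
      also have "\<dots> = cf (harm_proj u) w" using g True by (simp only: cf_gact cs if_True)
      finally show ?thesis .
    next
      case False
      then show ?thesis using b_out[OF False] by (simp only: cf_gact if_False)
    qed
  qed
  moreover have "cf (harm_proj u) w \<in> harm N" for w unfolding cs by (rule rho_harm[OF sp(1)])
  ultimately show ?thesis by (simp add: harm_vectors_def invariants_def)
qed

lemma harm_proj_low_part: assumes "u \<in> low_part m" shows "harm_proj u = 0"
proof (rule poly_mapping_eqI)
  fix w
  have u: "u \<in> V_carrier n N" using low_part_V_deg[OF assms] by (simp add: V_deg_iff)
  have "pscale (1 / fact N) (cf (symm n N u) w) \<in> J N" by (intro J_pscale symm_low_part_J[OF assms])
  then show "cf (harm_proj u) w = cf 0 w"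
    using cf_symm_polys[OF u] by (simp add: cf_harm_proj[OF u] rho_eq_0_iff)
qed

text \<open>The summand in \<open>low_part\<close> is killed, so the invariant summand
  \<open>f\<close> has coefficients that project to 0, that is, coefficients in the ideal.\<close>

lemma harm_proj_eq_0_iff: assumes u: "u \<in> full_part m" shows "harm_proj u = 0 \<longleftrightarrow> u \<in> low_part m"
proof
  assume 0: "harm_proj u = 0"
  obtain f x where fx: "f \<in> F_deg n N m" "x \<in> low_part m" "u = f + x" using u by (auto simp: full_part_def)
  have f: "f \<in> invariants n N m" using F_deg_invariants fx(1) by blast
  have "harm_proj u = harm_proj f + harm_proj x"
    using f low_part_V_deg[OF fx(2)] by (simp add: fx(3) harm_proj_add invariants_def V_deg_iff)
  then have "harm_proj f = 0" using 0 harm_proj_low_part[OF fx(2)] by simp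
  then have "rho N (cf f w) = 0" for w using harm_proj_invariant[OF f, of w] by simp
  then have "cf f w \<in> J N" for w
    using f rho_eq_0_iff[of "cf f w" N] by (simp add: invariants_def V_deg_iff V_carrier_iff)
  then have "f \<in> low_part m" by (rule invariants_J_low_part[OF f])
  then show "u \<in> low_part m" unfolding fx(3) by (rule vvs.subspace_add[OF subspace_low_part _ fx(2)])
qed (rule harm_proj_low_part)

text \<open>A harmonic invariant lies in \<open>full_part\<close>, and its \<open>low_part\<close>
  summand is killed. So \<open>F_deg\<close> has the same image as \<open>full_part\<close>, which
  is the identification of the two quotients in the definition of the graded tensor product.\<close>

lemma harm_proj_image: "harm_proj ` full_part m = harm_vectors m" "harm_proj ` F_deg n N m = harm_vectors m"
proof -
  have sub: "harm_proj ` full_part m \<subseteq> harm_vectors m" using harm_proj_harm_vectors full_part_V_deg by blast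
  moreover have "harm_vectors m \<subseteq> harm_proj ` F_deg n N m"
  proof
    fix t assume t: "t \<in> harm_vectors m"
    obtain f x where fx: "f \<in> F_deg n N m" "x \<in> low_part m" "t = f + x" using harm_vectors_full_part[OF t] by (auto simp: full_part_def)
    have "t = harm_proj t" using harm_proj_id[OF t] by simp
    also have "\<dots> = harm_proj f + harm_proj x"
      using fx(1) low_part_V_deg[OF fx(2)] by (simp add: fx(3) harm_proj_add F_deg_def V_deg_iff)
    also have "\<dots> = harm_proj f" using harm_proj_low_part[OF fx(2)] by simp
    finally show "t \<in> harm_proj ` F_deg n N m" using fx(1) by blast
  qed
  moreover have "harm_proj ` F_deg n N m \<subseteq> harm_proj ` full_part m" using F_deg_full_part by blast
  ultimately show "harm_proj ` full_part m = harm_vectors m" "harm_proj ` F_deg n N m = harm_vectors m" by blast+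
qed

text \<open>The current 1 acts on coefficients through complex scalars, with which the linear map
  \<open>rho\<close> commutes. For other currents polynomial factors would appear, and
  \<open>rho\<close> is not multiplicative.\<close>

lemma harm_proj_current_act:
  assumes u: "u \<in> V_carrier n N" and x: "x \<in> carrier_mat n n"
  shows "harm_proj (current_act N x 1 u) = current_act N x 1 (harm_proj u)"
proof (rule poly_mapping_eqI)
  fix w
  note xu = current_act_V_carrier[OF u x, of 1]
  note su = symm_V_carrier[OF u]
  have bV: "harm_proj u \<in> V_carrier n N"
    using cf_symm_polys[OF u] su by (simp add: V_carrier_iff cf_harm_proj[OF u] rho_polys)
  have rho_sum: "rho N (sum g B) = (\<Sum>b\<in>B. rho N (g b))" if "\<And>b. b \<in> B \<Longrightarrow> g b \<in> polys N" for g and B :: "nat set"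
    using that by (induction B rule: infinite_finite_induct) (simp_all add: rho_add polys_sum)
  let ?r = "1 / fact N :: complex"
  show "cf (harm_proj (current_act N x 1 u)) w = cf (current_act N x 1 (harm_proj u)) w"
  proof (cases "w \<in> words n N")
    case True
    have P: "cf (symm n N u) v \<in> polys N" for v using su by (simp add: V_carrier_iff)
    have "cf (harm_proj (current_act N x 1 u)) w
      = rho N (\<Sum>p<N. \<Sum>b<n. pscale (x $$ (w ! p, b)) (pscale ?r (cf (symm n N u) (w[p := b]))))"
      using True by (simp add: cf_harm_proj[OF xu] symm_current_act[OF u x] cf_current_act[OF su x]
        pscale_eq_mult sum_distrib_left mult.left_commute)
    also have "\<dots> = (\<Sum>p<N. \<Sum>b<n. pscale (x $$ (w ! p, b)) (rho N (pscale ?r (cf (symm n N u) (w[p := b])))))"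
    proof -
      have Q: "pscale c (pscale ?r (cf (symm n N u) v)) \<in> polys N" for c v
        using P by (simp add: pscale_eq_mult polys_mult polys_zconst)
      have Q': "pscale ?r (cf (symm n N u) v) \<in> polys N" for v
        using P by (simp add: pscale_eq_mult polys_mult polys_zconst)
      show ?thesis
        by (subst rho_sum, rule polys_sum, rule Q, rule sum.cong[OF refl], subst rho_sum, rule Q,
            rule sum.cong[OF refl], rule rho_pscale[OF Q'])
    qed
    also have "\<dots> = cf (current_act N x 1 (harm_proj u)) w"
      using True by (simp add: cf_current_act[OF bV x] cf_harm_proj[OF u] pscale_eq_mult)
    finally show ?thesis .
  next
    case False
    then show ?thesis using xu bV current_act_V_carrier[OF bV x, of 1] 
      by (simp add: cf_harm_proj[OF xu] symm_current_act[OF u x] cf_current_act[OF su x] cf_current_act[OF bV x])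
  qed
qed

end

section \<open>The graded tensor product as a space of invariants\<close>

context
  fixes n N :: nat
  assumes n: "2 \<le> n"
begin

definition Y_gens :: "nat \<Rightarrow> zvec set" where
  "Y_gens M = {zscale (zmono a) f | a k f. a \<in> monoms N \<and> f \<in> F_deg n N k \<and> k < M}"

lemma F_deg_V_carrier: "f \<in> F_deg n N k \<Longrightarrow> f \<in> V_carrier n N"
  by (simp add: F_deg_def V_deg_iff)

lemma Y_gens_V_carrier: "Y_gens M \<subseteq> V_carrier n N"
  by (auto simp: Y_gens_def intro!: V_carrier_zscale polys_zmono intro: F_deg_V_carrier)

lemma module_V_zmodule: "Module.module (zpoly_ring N) (V_zmodule n N)"
proof (rule moduleI)
  show "cring (zpoly_ring N)" by (rule cring_zpoly_ring)
  show "abelian_group (V_zmodule n N)"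
  proof (rule abelian_groupI)
    fix x assume x: "x \<in> carrier (V_zmodule n N)"
    then have "- x \<in> carrier (V_zmodule n N)"
      using vvs.subspace_neg[OF subspace_V_carrier, of x n N] by (simp add: V_zmodule_def)
    then show "\<exists>y\<in>carrier (V_zmodule n N). y \<oplus>\<^bsub>V_zmodule n N\<^esub> x = \<zero>\<^bsub>V_zmodule n N\<^esub>"
      by (intro bexI[of _ "- x"]) (simp_all add: V_zmodule_def)
  qed (simp_all add: V_zmodule_def vvs.subspace_0[OF subspace_V_carrier] vvs.subspace_add[OF subspace_V_carrier] algebra_simps)
qed (simp_all add: V_zmodule_def zpoly_ring_simps V_carrier_zscale zscale_simps)

lemma submodule_Y: "LinearCombinations.submodule (zpoly_ring N) (vvs.span (Y_gens M)) (V_zmodule n N)"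
proof -
  have sub: "vvs.span (Y_gens M) \<subseteq> V_carrier n N"
    by (rule vvs.span_minimal[OF Y_gens_V_carrier subspace_V_carrier])
  have smult: "zscale p u \<in> vvs.span (Y_gens M)" if p: "p \<in> polys N" and u: "u \<in> vvs.span (Y_gens M)" for p u
  proof (rule vspan_image_closed[of UNIV "zscale p" "Y_gens M", OF _ _ _ _ vvs.subspace_span _ u])
    fix y assume "y \<in> Y_gens M"
    then obtain a k f where y: "a \<in> monoms N" "f \<in> F_deg n N k" "k < M" "y = zscale (zmono a) f"
      by (auto simp: Y_gens_def)
    show "zscale p y \<in> vvs.span (Y_gens M)"
      using poly_span_zmono[OF p]
    proof (induction rule: free_vs.span_induct_alt)
      case base
      then show ?case by (simp add: zscale_simps vvs.span_zero)
    next
      case (step c x q)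
      then obtain b where b: "b \<in> monoms N" "x = zmono b" by blast
      have "zscale x y \<in> Y_gens M"
        unfolding Y_gens_def using y b
        by (intro CollectI exI[of _ "b + a"] exI[of _ k] exI[of _ f]) (simp add: zscale_simps zmono_mult monoms_add)
      then have "vscale c (zscale x y) + zscale q y \<in> vvs.span (Y_gens M)"
        by (intro vvs.span_add vvs.span_scale step(2) vvs.span_base)
      then show ?case by (simp add: zscale_simps pscale_eq_mult)
    qed
  qed (simp_all add: zscale_simps mult.commute)
  show ?thesis
    unfolding LinearCombinations.submodule_def
    using module_V_zmodule sub smult by (simp add: V_zmodule_def vvs.span_add vvs.span_zero)
qed

lemma F_deg_Y_gens: "f \<in> F_deg n N k \<Longrightarrow> k < M \<Longrightarrow> f \<in> Y_gens M"
  unfolding Y_gens_def by (intro CollectI exI[of _ 0] exI[of _ k] exI[of _ f]) (simp add: zscale_simps)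

text \<open>A span over the polynomial ring becomes a complex span once all monomial multiples are
  included among the generators.\<close>

lemma ZF_below_span: "ZF_below n N M = vvs.span (Y_gens M)"
  unfolding ZF_below_def
proof (rule mspan_eqI[OF module_V_zmodule _ submodule_Y])
  have sum: "(\<Sum>k<M. u k) \<in> vvs.span (Y_gens M)" if "\<forall>k<M. u k \<in> F_deg n N k" for u
    using that by (intro vvs.span_sum vvs.span_base) (auto intro: F_deg_Y_gens)
  then show *: "F_below n N M \<subseteq> vvs.span (Y_gens M)" by (auto simp: F_below_def)
  show "F_below n N M \<subseteq> carrier (V_zmodule n N)"
    using * vvs.span_minimal[OF Y_gens_V_carrier subspace_V_carrier, of M] by (simp add: V_zmodule_def)
  fix S assume S: "LinearCombinations.submodule (zpoly_ring N) S (V_zmodule n N)" and FS: "F_below n N M \<subseteq> S"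
  interpret S: LinearCombinations.submodule "zpoly_ring N" S "V_zmodule n N" by (rule S)
  have sub: "F_deg n N k \<subseteq> S" if k: "k < M" for k
  proof
    fix f assume f: "f \<in> F_deg n N k"
    \<comment> \<open>A homogeneous element is a sum over degrees with a single nonzero term, as
      \<open>F_below\<close> demands.\<close>
    define u where "u j = (if j = k then f else 0)" for j
    have "\<forall>j<M. u j \<in> F_deg n N j" using f vvs.subspace_0[OF subspace_F_deg[OF n]] by (simp add: u_def)
    moreover have "(\<Sum>j<M. u j) = f" using k by (simp add: u_def)
    ultimately have "f \<in> F_below n N M" unfolding F_below_def by blast
    then show "f \<in> S" using FS by blast
  qed
  have "Y_gens M \<subseteq> S"
  proof (intro subsetI)
    fix y assume "y \<in> Y_gens M"
    then obtain a k f where y: "a \<in> monoms N" "f \<in> F_deg n N k" "k < M" "y = zscale (zmono a) f"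
      by (auto simp: Y_gens_def)
    have "f \<in> S" using sub y(2,3) by blast
    then show "y \<in> S" using S.smult_closed[OF polys_zmono[OF y(1)], of f] by (simp add: y(4) V_zmodule_def)
  qed
  moreover have "vvs.subspace S"
    using S.zero_closed S.m_closed S.smult_closed polys_zconst
    by (simp add: vvs.subspace_def V_zmodule_def)
  ultimately show "vvs.span (Y_gens M) \<subseteq> S" by (rule vvs.span_minimal)
qed

lemma vcomp_Y:
  assumes S: "vvs.subspace S" and u: "u \<in> vvs.span (Y_gens M)"
    and gens: "\<And>a k f. a \<in> monoms N \<Longrightarrow> f \<in> F_deg n N k \<Longrightarrow> k < M \<Longrightarrow> mdeg a + k = m \<Longrightarrow> zscale (zmono a) f \<in> S"
  shows "vcomp m u \<in> S"
proof (rule vspan_image_closed[of UNIV "vcomp m" "Y_gens M", OF _ _ _ _ S _ u])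
  fix y assume "y \<in> Y_gens M"
  then obtain a k f where y: "a \<in> monoms N" "f \<in> F_deg n N k" "k < M" "y = zscale (zmono a) f"
    by (auto simp: Y_gens_def)
  have "f \<in> V_deg n N k" using y(2) by (simp add: F_deg_def)
  then have "y \<in> V_deg n N (mdeg a + k)"
    unfolding y(4) by (rule V_deg_zscale[OF polys_zmono[OF y(1)] zhom_zmono])
  then have "vcomp m y = (if m = mdeg a + k then y else 0)" by (rule vcomp_V_deg)
  then show "vcomp m y \<in> S"
    using gens[OF y(1-3)] vvs.subspace_0[OF S] by (simp add: y(4))
qed (simp_all add: vcomp_simps)

lemma low_gens_Y_gens: "low_gens n N m \<subseteq> Y_gens m"
  using n by (auto simp: low_gens_def Y_gens_def)

lemma ZF_below_low_part: "ZF_below n N m \<inter> V_deg n N m = low_part n N m"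
proof (intro equalityI subsetI)
  fix u assume u: "u \<in> ZF_below n N m \<inter> V_deg n N m"
  have "vcomp m u \<in> low_part n N m"
  proof (rule vcomp_Y[OF subspace_low_part[OF n]])
    show "u \<in> vvs.span (Y_gens m)" using u by (simp add: ZF_below_span)
    fix a k f assume "a \<in> monoms N" "f \<in> F_deg n N k" "k < m" "mdeg a + k = m"
    then have "zscale (zmono a) f \<in> low_gens n N m"
      unfolding low_gens_def[OF n] by blast
    then show "zscale (zmono a) f \<in> low_part n N m" unfolding low_part_def[OF n] by (rule vvs.span_base)
  qed
  then show "u \<in> low_part n N m" using vcomp_V_deg[of u n N m m] u by simp
next
  fix u assume u: "u \<in> low_part n N m"
  then have "u \<in> vvs.span (Y_gens m)" using vvs.span_mono[OF low_gens_Y_gens] unfolding low_part_def[OF n] by blast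
  then show "u \<in> ZF_below n N m \<inter> V_deg n N m" using low_part_V_deg[OF n u] by (simp add: ZF_below_span)
qed

lemma ZF_below_full_part: "ZF_below n N (Suc m) \<inter> V_deg n N m = full_part n N m"
proof (intro equalityI subsetI)
  fix u assume u: "u \<in> ZF_below n N (Suc m) \<inter> V_deg n N m"
  have "vcomp m u \<in> full_part n N m"
  proof (rule vcomp_Y[OF subspace_full_part[OF n]])
    show "u \<in> vvs.span (Y_gens (Suc m))" using u by (simp add: ZF_below_span)
    fix a k f assume *: "a \<in> monoms N" "f \<in> F_deg n N k" "k < Suc m" "mdeg a + k = m"
    show "zscale (zmono a) f \<in> full_part n N m"
    \<comment> \<open>In degree 0 the monomial is 1 and the generator is an element of
      \<open>F_deg n N m\<close>; otherwise it is a proper multiple and lies in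
      \<open>low_part\<close>.\<close>
    proof (cases "mdeg a = 0")
      case True
      have "cf a i = 0" for i
      proof (rule ccontr)
        assume "cf a i \<noteq> 0"
        then have "i \<in> Poly_Mapping.keys a" by (simp add: in_keys_iff)
        then show False using True \<open>cf a i \<noteq> 0\<close> by (simp add: mdeg_def)
      qed
      then have "a = 0" by (intro poly_mapping_eqI) simp
      then show ?thesis using * F_deg_full_part[OF n] by (simp add: zscale_simps)
    next
      case False
      then show ?thesis
        using zmono_full_part[OF n *(1) _ F_deg_full_part[OF n *(2)]] low_part_full_part[OF n] *(4) by simp
    qed
  qed
  then show "u \<in> full_part n N m" using vcomp_V_deg[of u n N m m] u by simp
next
  fix u assume u: "u \<in> full_part n N m"
  then obtain f x where fx: "f \<in> F_deg n N m" "x \<in> low_part n N m" "u = f + x" by (auto simp: full_part_def[OF n])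
  have "f \<in> vvs.span (Y_gens (Suc m))" using F_deg_Y_gens[OF fx(1)] by (intro vvs.span_base) simp
  moreover have "Y_gens m \<subseteq> Y_gens (Suc m)" unfolding Y_gens_def using less_SucI by blast
  then have "x \<in> vvs.span (Y_gens (Suc m))"
    using fx(2) vvs.span_mono[OF low_gens_Y_gens] vvs.span_mono[of "Y_gens m" "Y_gens (Suc m)"] unfolding low_part_def[OF n] by blast
  ultimately have "u \<in> vvs.span (Y_gens (Suc m))" unfolding fx(3) by (rule vvs.span_add)
  then show "u \<in> ZF_below n N (Suc m) \<inter> V_deg n N m" using full_part_V_deg[OF n u] by (simp add: ZF_below_span)
qed

text \<open>Names a coset by the harmonic vector to which all its elements project.\<close>

definition tensor_inv :: "nat \<Rightarrow> zvec set \<Rightarrow> zvec" where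
  "tensor_inv m = inv_into (harm_vectors n N m) (fiber (F_deg n N m) (harm_proj n N))"

text \<open>The cosets in \<open>graded_tensor_product\<close> and in \<open>ZF_quot\<close> are the
  fibers of the same map \<open>harm_proj\<close> on \<open>F_deg\<close> and on
  \<open>full_part\<close>, over the same set of values. Enlarging a coset and intersecting it back
  therefore leaves the value unchanged, and the transported action is the ordinary one on harmonic
  vectors.\<close>

lemma graded_tensor_product_harm_vectors:
  fixes m defines "W \<equiv> graded_tensor_product n N m"
  shows "sl_module n W" "bij_betw (tensor_inv m) (carrier W) (harm_vectors n N m)"
    "Q \<in> carrier W \<Longrightarrow> Q' \<in> carrier W \<Longrightarrow> tensor_inv m (Q \<oplus>\<^bsub>W\<^esub> Q') = tensor_inv m Q + tensor_inv m Q'"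
    "Q \<in> carrier W \<Longrightarrow> tensor_inv m (c \<odot>\<^bsub>W\<^esub> Q) = vscale c (tensor_inv m Q)"
    "g \<in> sl n \<Longrightarrow> Q \<in> carrier W \<Longrightarrow> tensor_inv m (act W g Q) = current_act N g 1 (tensor_inv m Q)"
proof -
  let ?F = "F_deg n N m" and ?\<beta> = "harm_proj n N" and ?A = "full_part n N m" and ?T = "harm_vectors n N m"
  let ?VF = "(V_rep n N)\<lparr>carrier := ?F\<rparr>" and ?VA = "(V_rep n N)\<lparr>carrier := ?A\<rparr>"
  have FV: "u \<in> V_carrier n N" if "u \<in> ?F" for u using that by (rule F_deg_V_carrier)
  have AV: "u \<in> V_carrier n N" if "u \<in> ?A" for u using full_part_V_deg[OF n that] by (simp add: V_deg_iff)
  interpret LF: linear_quotient ?VF vscale ?\<beta> vscale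
  proof (rule linear_quotient.intro)
    show "concrete_space vscale ?VF" by (rule concrete_space_V_rep[OF subspace_F_deg[OF n]])
  qed (simp_all add: FV harm_proj_add[OF n] harm_proj_scale[OF n])
  interpret LA: linear_quotient ?VA vscale ?\<beta> vscale
  proof (rule linear_quotient.intro)
    show "concrete_space vscale ?VA" by (rule concrete_space_V_rep[OF subspace_full_part[OF n]])
  qed (simp_all add: AV harm_proj_add[OF n] harm_proj_scale[OF n])
  have fibF: "LF.fib = fiber ?F ?\<beta>" and fibA: "LA.fib = fiber ?A ?\<beta>" by (simp_all add: fun_eq_iff)
  have imF: "?\<beta> ` carrier ?VF = ?T" and imA: "?\<beta> ` carrier ?VA = ?T"
    using harm_proj_image[OF n, of N m] by simp_all
  have X0: "low_part n N m = fiber ?A ?\<beta> 0"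
    using harm_proj_eq_0_iff[OF n, of _ N m] low_part_full_part[OF n, of _ N m] by (auto simp: fiber_def)
  have tilde: "F_tilde n N m = fiber ?F ?\<beta> 0"
  proof -
    have "F_tilde n N m = (ZF_below n N m \<inter> V_deg n N m) \<inter> ?F" by (auto simp: F_tilde_def F_deg_def)
    also have "\<dots> = low_part n N m \<inter> ?F" by (simp only: ZF_below_low_part)
    also have "\<dots> = fiber ?F ?\<beta> 0" using F_deg_full_part[OF n, of _ N m] by (auto simp: X0 fiber_def)
    finally show ?thesis .
  qed
  have ZFq: "ZF_quot n N m = quot_rep ?VA (fiber ?A ?\<beta> 0)"
    unfolding ZF_quot_def Let_def ZF_below_low_part ZF_below_full_part X0 ..
  have sum: "fiber ?A ?\<beta> 0 <+>\<^bsub>V_rep n N\<^esub> fiber ?F ?\<beta> t = fiber ?A ?\<beta> t" if t: "t \<in> ?T" for t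
  proof (intro equalityI subsetI)
    fix y assume "y \<in> fiber ?A ?\<beta> 0 <+>\<^bsub>V_rep n N\<^esub> fiber ?F ?\<beta> t"
    then obtain a f where af: "a \<in> ?A" "?\<beta> a = 0" "f \<in> ?F" "?\<beta> f = t" "y = a + f"
      by (auto simp: set_add_def' fiber_def)
    have "?\<beta> y = t" using harm_proj_add[OF n AV[OF af(1)] FV[OF af(3)]] af by simp
    moreover have "y \<in> ?A" unfolding af(5) by (rule vvs.subspace_add[OF subspace_full_part[OF n] af(1) F_deg_full_part[OF n af(3)]])
    ultimately show "y \<in> fiber ?A ?\<beta> t" by (simp add: fiber_def)
  next
    fix y assume "y \<in> fiber ?A ?\<beta> t"
    then have y: "y \<in> ?A" "?\<beta> y = t" by (auto simp: fiber_def)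
    have "t \<in> ?\<beta> ` ?F" using t harm_proj_image(2)[OF n, of N m] by simp
    then obtain f where f: "f \<in> ?F" "?\<beta> f = t" by blast
    have d: "y - f \<in> ?A" by (rule vvs.subspace_diff[OF subspace_full_part[OF n] y(1) F_deg_full_part[OF n f(1)]])
    have "?\<beta> y = ?\<beta> (y - f) + ?\<beta> f" using harm_proj_add[OF n AV[OF d] FV[OF f(1)]] by simp
    then have "?\<beta> (y - f) = 0" using y f by simp
    then have "y - f \<in> fiber ?A ?\<beta> 0" "f \<in> fiber ?F ?\<beta> t" using d f by (simp_all add: fiber_def)
    then show "y \<in> fiber ?A ?\<beta> 0 <+>\<^bsub>V_rep n N\<^esub> fiber ?F ?\<beta> t"
      unfolding set_add_def' by (intro UN_I[of "y - f"] UN_I[of f]) simp_all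
  qed
  let ?f = "fiber ?F ?\<beta>"
  have W: "carrier W = carrier (quot_rep ?VF (?f 0))" "add W = add (quot_rep ?VF (?f 0))"
    "\<zero>\<^bsub>W\<^esub> = ?f 0" "smult W = smult (quot_rep ?VF (?f 0))"
    by (simp_all add: W_def graded_tensor_product_def tilde quot_rep_def mk_rep_def)
  have carW: "carrier W = ?f ` ?T" using LF.carrier_quot unfolding W fibF imF .
  have inj: "inj_on ?f ?T" using LF.inj_fib unfolding fibF imF .
  have addW: "?f t \<oplus>\<^bsub>W\<^esub> ?f t' = ?f (t + t')" if "t \<in> ?T" "t' \<in> ?T" for t t'
    using LF.add_quot[of t t'] that unfolding W(2) fibF imF by simp
  have smultW: "c \<odot>\<^bsub>W\<^esub> ?f t = ?f (vscale c t)" if "t \<in> ?T" for c t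
    using LF.smult_quot[of t c] that unfolding W(4) fibF imF by simp
  have actW: "act W g (?f t) = ?f (current_act N g 1 t)" if g: "g \<in> sl n" and t: "t \<in> ?T" for g t
  proof -
    have gc: "g \<in> carrier_mat n n" using g by (simp add: sl_def)
    have "act (ZF_quot n N m) g (fiber ?A ?\<beta> t) = fiber ?A ?\<beta> (current_act N g 1 t)"
    proof -
      have "act ?VA g v \<in> carrier ?VA \<and> ?\<beta> (act ?VA g v) = current_act N g 1 (?\<beta> v)" if "v \<in> carrier ?VA" for v
      proof -
        have v: "v \<in> ?A" using that by simp
        show ?thesis using full_part_current_act[OF n v gc] harm_proj_current_act[OF n AV[OF v] gc] by simp
      qed
      moreover have "t \<in> ?\<beta> ` carrier ?VA" using t imA by simp
      ultimately show ?thesis using LA.act_quot[of t g "current_act N g 1"] unfolding ZFq fibA by blast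
    qed
    then have "act W g (?f t) = ?F \<inter> fiber ?A ?\<beta> (current_act N g 1 t)"
      using sum[OF t] by (simp add: W_def graded_tensor_product_def ZFq quot_rep_def mk_rep_def)
    also have "\<dots> = ?f (current_act N g 1 t)" using F_deg_full_part[OF n, of _ N m] by (auto simp: fiber_def)
    finally show ?thesis .
  qed
  have Tadd: "t + t' \<in> ?T" if "t \<in> ?T" "t' \<in> ?T" for t t' using that by (rule vvs.subspace_add[OF subspace_harm_vectors[OF n]])
  have Tscale: "vscale c t \<in> ?T" if "t \<in> ?T" for c t using that by (rule vvs.subspace_scale[OF subspace_harm_vectors[OF n]])
  have T0: "0 \<in> ?T" by (rule vvs.subspace_0[OF subspace_harm_vectors[OF n]])
  have TV: "t \<in> V_carrier n N" if "t \<in> ?T" for t using that full_part_V_deg[OF n harm_vectors_full_part[OF n that]] by (simp add: V_deg_iff)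
  have Tact: "current_act N g 1 t \<in> ?T" if "g \<in> carrier_mat n n" "t \<in> ?T" for g t
  proof -
    have "current_act N g 1 t = harm_proj n N (current_act N g 1 t)"
      using harm_proj_current_act[OF n TV[OF that(2)] that(1)] harm_proj_id[OF n that(2)] by simp
    also have "\<dots> \<in> ?T" using imA full_part_current_act[OF n harm_vectors_full_part[OF n that(2)] that(1)] by auto
    finally show ?thesis .
  qed
  have inv: "tensor_inv m (?f t) = t" if "t \<in> ?T" for t
    unfolding tensor_inv_def by (rule inv_into_f_f[OF inj that])
  show bij: "bij_betw (tensor_inv m) (carrier W) ?T"
    unfolding carW by (rule bij_betwI[where g = ?f]) (auto simp: inv)
  show add: "tensor_inv m (Q \<oplus>\<^bsub>W\<^esub> Q') = tensor_inv m Q + tensor_inv m Q'"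
    if "Q \<in> carrier W" "Q' \<in> carrier W" for Q Q'
    using that unfolding carW by (auto simp: addW inv Tadd)
  show scale: "tensor_inv m (c \<odot>\<^bsub>W\<^esub> Q) = vscale c (tensor_inv m Q)" if "Q \<in> carrier W" for c Q
    using that unfolding carW by (auto simp: smultW inv Tscale)
  show act: "tensor_inv m (act W g Q) = current_act N g 1 (tensor_inv m Q)"
    if "g \<in> sl n" "Q \<in> carrier W" for g Q
    using that unfolding carW by (auto simp: actW inv Tact sl_def)
  have slc: "g \<in> carrier_mat n n" if "g \<in> sl n" for g using that by (simp add: sl_def)
  have im: "tensor_inv m ` carrier W = ?T" using bij by (simp add: bij_betw_def)
  show "sl_module n W"
  proof (rule sl_module_transport[where \<theta> = "tensor_inv m" and s = vscale and A = "\<lambda>g. current_act N g 1", OF vector_space_vscale])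
    show "inj_on (tensor_inv m) (carrier W)" using bij by (simp add: bij_betw_def)
    show "\<zero>\<^bsub>W\<^esub> \<in> carrier W" using T0 by (simp add: carW W(3))
    show "tensor_inv m \<zero>\<^bsub>W\<^esub> = 0" using inv[OF T0] by (simp add: W(3))
    show "x \<oplus>\<^bsub>W\<^esub> y \<in> carrier W" if "x \<in> carrier W" "y \<in> carrier W" for x y
      using that unfolding carW by (auto simp: addW Tadd)
    show "c \<odot>\<^bsub>W\<^esub> x \<in> carrier W" if "x \<in> carrier W" for x c
      using that unfolding carW by (auto simp: smultW Tscale)
    show "act W g x \<in> carrier W" if "g \<in> sl n" "x \<in> carrier W" for g x
      using that unfolding carW by (auto simp: actW Tact sl_def)
  next
    fix g u v assume "g \<in> sl n" "u \<in> tensor_inv m ` carrier W" "v \<in> tensor_inv m ` carrier W"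
    then show "current_act N g 1 (u + v) = current_act N g 1 u + current_act N g 1 v"
      unfolding im by (intro current_act_linear(1)[OF TV TV slc])
  next
    fix g c u assume g: "g \<in> sl n" and "u \<in> tensor_inv m ` carrier W"
    then have u: "u \<in> V_carrier n N" using im TV by blast
    show "current_act N g 1 (vscale c u) = vscale c (current_act N g 1 u)"
      by (rule current_act_linear(2)[OF u u slc[OF g] polys_zconst])
    show "current_act N (c \<cdot>\<^sub>m g) 1 u = vscale c (current_act N g 1 u)"
      by (rule current_act_matrix_linear(2)[OF u slc[OF g] slc[OF g]])
  next
    fix g h u assume g: "g \<in> sl n" and h: "h \<in> sl n" and "u \<in> tensor_inv m ` carrier W"
    then have u: "u \<in> V_carrier n N" using im TV by blast
    show "current_act N (g + h) 1 u = current_act N g 1 u + current_act N h 1 u"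
      by (rule current_act_matrix_linear(1)[OF u slc[OF g] slc[OF h]])
    show "current_act N (g * h - h * g) 1 u = current_act N g 1 (current_act N h 1 u) - current_act N h 1 (current_act N g 1 u)"
      by (rule current_act_matrix_linear(3)[OF u slc[OF g] slc[OF h]])
  qed (rule add scale act; assumption)+
qed

lemma harm_vectors_current_act:
  assumes g: "g \<in> carrier_mat n n" and t: "t \<in> harm_vectors n N m" shows "current_act N g 1 t \<in> harm_vectors n N m"
proof -
  have tV: "t \<in> V_carrier n N" using full_part_V_deg[OF n harm_vectors_full_part[OF n t]] by (simp add: V_deg_iff)
  have "current_act N g 1 t = harm_proj n N (current_act N g 1 t)"
    using harm_proj_current_act[OF n tV g] harm_proj_id[OF n t] by simp
  also have "\<dots> \<in> harm_vectors n N m" using harm_proj_image(1)[OF n] full_part_current_act[OF n harm_vectors_full_part[OF n t] g] by blast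
  finally show ?thesis .
qed

end

section \<open>Homomorphisms from irreducible highest weight modules\<close>

locale sl_mod =
  fixes n :: nat and V :: "(complex mat, 'v) rep"
  assumes sl_module: "sl_module n V"
begin

lemma vs: "vectorspace class_ring V"
  using sl_module by (simp add: sl_module_def)

interpretation V: vectorspace class_ring V by (rule vs)

lemma closed [simp]: "\<zero>\<^bsub>V\<^esub> \<in> carrier V" "x \<in> carrier V \<Longrightarrow> y \<in> carrier V \<Longrightarrow> x \<oplus>\<^bsub>V\<^esub> y \<in> carrier V"
  "x \<in> carrier V \<Longrightarrow> c \<odot>\<^bsub>V\<^esub> x \<in> carrier V"
  using V.smult_closed[of c x] by simp_all

lemma zero_simps [simp]: "x \<in> carrier V \<Longrightarrow> \<zero>\<^bsub>V\<^esub> \<oplus>\<^bsub>V\<^esub> x = x" "x \<in> carrier V \<Longrightarrow> x \<oplus>\<^bsub>V\<^esub> \<zero>\<^bsub>V\<^esub> = x"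
  "x \<in> carrier V \<Longrightarrow> 0 \<odot>\<^bsub>V\<^esub> x = \<zero>\<^bsub>V\<^esub>" "c \<odot>\<^bsub>V\<^esub> \<zero>\<^bsub>V\<^esub> = \<zero>\<^bsub>V\<^esub>"
  using V.smult_l_null[of x] V.smult_r_null[of c] by simp_all

lemma add_ac: "x \<in> carrier V \<Longrightarrow> y \<in> carrier V \<Longrightarrow> z \<in> carrier V \<Longrightarrow> x \<oplus>\<^bsub>V\<^esub> y \<oplus>\<^bsub>V\<^esub> z = x \<oplus>\<^bsub>V\<^esub> (y \<oplus>\<^bsub>V\<^esub> z)"
  "x \<in> carrier V \<Longrightarrow> y \<in> carrier V \<Longrightarrow> x \<oplus>\<^bsub>V\<^esub> y = y \<oplus>\<^bsub>V\<^esub> x"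
  "x \<in> carrier V \<Longrightarrow> y \<in> carrier V \<Longrightarrow> z \<in> carrier V \<Longrightarrow> x \<oplus>\<^bsub>V\<^esub> (y \<oplus>\<^bsub>V\<^esub> z) = y \<oplus>\<^bsub>V\<^esub> (x \<oplus>\<^bsub>V\<^esub> z)"
  using V.M.a_assoc V.M.a_comm V.M.a_lcomm by simp_all

lemma smult_simps: "x \<in> carrier V \<Longrightarrow> (a + b) \<odot>\<^bsub>V\<^esub> x = a \<odot>\<^bsub>V\<^esub> x \<oplus>\<^bsub>V\<^esub> b \<odot>\<^bsub>V\<^esub> x"
  "x \<in> carrier V \<Longrightarrow> y \<in> carrier V \<Longrightarrow> a \<odot>\<^bsub>V\<^esub> (x \<oplus>\<^bsub>V\<^esub> y) = a \<odot>\<^bsub>V\<^esub> x \<oplus>\<^bsub>V\<^esub> a \<odot>\<^bsub>V\<^esub> y"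
  "x \<in> carrier V \<Longrightarrow> a \<odot>\<^bsub>V\<^esub> (b \<odot>\<^bsub>V\<^esub> x) = (a * b) \<odot>\<^bsub>V\<^esub> x"
  "x \<in> carrier V \<Longrightarrow> 1 \<odot>\<^bsub>V\<^esub> x = x"
  using V.smult_l_distr[of a b x] V.smult_r_distr[of a x y] V.smult_assoc1[of a b x] V.smult_one[of x] by simp_all

lemma smult_eq_zero: 
  assumes "c \<odot>\<^bsub>V\<^esub> x = \<zero>\<^bsub>V\<^esub>" "x \<in> carrier V" "x \<noteq> \<zero>\<^bsub>V\<^esub>" shows "c = 0"
proof (rule ccontr)
  assume "c \<noteq> 0"
  then have "x = (1 / c) \<odot>\<^bsub>V\<^esub> (c \<odot>\<^bsub>V\<^esub> x)" using assms(2) by (simp add: smult_simps)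
  then show False using assms by simp
qed

lemma act_closed [simp]: "g \<in> sl n \<Longrightarrow> x \<in> carrier V \<Longrightarrow> act V g x \<in> carrier V"
  using sl_module by (auto simp: sl_module_def LinearCombinations.module_hom_def)

lemma act_add: "g \<in> sl n \<Longrightarrow> x \<in> carrier V \<Longrightarrow> y \<in> carrier V \<Longrightarrow> act V g (x \<oplus>\<^bsub>V\<^esub> y) = act V g x \<oplus>\<^bsub>V\<^esub> act V g y"
  using sl_module by (simp add: sl_module_def LinearCombinations.module_hom_def)

lemma act_smult: "g \<in> sl n \<Longrightarrow> x \<in> carrier V \<Longrightarrow> act V g (c \<odot>\<^bsub>V\<^esub> x) = c \<odot>\<^bsub>V\<^esub> act V g x"
  using sl_module by (simp add: sl_module_def LinearCombinations.module_hom_def)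

lemma act_plus: "g \<in> sl n \<Longrightarrow> h \<in> sl n \<Longrightarrow> x \<in> carrier V \<Longrightarrow> act V (g + h) x = act V g x \<oplus>\<^bsub>V\<^esub> act V h x"
  using sl_module by (simp add: sl_module_def)

lemma act_scale: "g \<in> sl n \<Longrightarrow> x \<in> carrier V \<Longrightarrow> act V (c \<cdot>\<^sub>m g) x = c \<odot>\<^bsub>V\<^esub> act V g x"
  using sl_module by (simp add: sl_module_def)

lemma act_zero [simp]: "g \<in> sl n \<Longrightarrow> act V g \<zero>\<^bsub>V\<^esub> = \<zero>\<^bsub>V\<^esub>"
  using act_smult[of g "\<zero>\<^bsub>V\<^esub>" 0] by simp

lemma act_swap:
  assumes g: "g \<in> sl n" and h: "h \<in> sl n" and x: "x \<in> carrier V"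
  shows "act V g (act V h x) = act V (g * h - h * g) x \<oplus>\<^bsub>V\<^esub> act V h (act V g x)"
proof -
  have "act V (g * h - h * g) x = act V g (act V h x) \<ominus>\<^bsub>V\<^esub> act V h (act V g x)"
    using sl_module g h x by (simp add: sl_module_def)
  then have "act V (g * h - h * g) x \<oplus>\<^bsub>V\<^esub> act V h (act V g x)
    = act V g (act V h x) \<oplus>\<^bsub>V\<^esub> (\<ominus>\<^bsub>V\<^esub> act V h (act V g x) \<oplus>\<^bsub>V\<^esub> act V h (act V g x))"
    using g h x by (simp add: a_minus_def V.M.a_assoc)
  also have "\<ominus>\<^bsub>V\<^esub> act V h (act V g x) \<oplus>\<^bsub>V\<^esub> act V h (act V g x) = \<zero>\<^bsub>V\<^esub>"
    using g h x by (intro V.M.l_neg) simp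
  finally show ?thesis using g h x by simp
qed

text \<open>The elements with property \<open>P\<close> form a submodule; it contains the nonzero
  vector \<open>v\<close>, so irreducibility leaves only the whole module.\<close>

lemma irreducible_induct:
  assumes irr: "irreducible_sl_module n V" and v: "v \<in> carrier V" "v \<noteq> \<zero>\<^bsub>V\<^esub>" "P v" and z: "P \<zero>\<^bsub>V\<^esub>"
    and add: "\<And>x y. x \<in> carrier V \<Longrightarrow> y \<in> carrier V \<Longrightarrow> P x \<Longrightarrow> P y \<Longrightarrow> P (x \<oplus>\<^bsub>V\<^esub> y)"
    and smult: "\<And>c x. x \<in> carrier V \<Longrightarrow> P x \<Longrightarrow> P (c \<odot>\<^bsub>V\<^esub> x)"
    and act: "\<And>g x. g \<in> sl n \<Longrightarrow> x \<in> carrier V \<Longrightarrow> P x \<Longrightarrow> P (act V g x)"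
    and x: "x \<in> carrier V"
  shows "P x"
proof -
  define H where "H = {x \<in> carrier V. P x}"
  have sub: "VectorSpace.subspace class_ring H V"
    unfolding VectorSpace.subspace_def LinearCombinations.submodule_def
    using vs V.module_axioms by (auto simp: H_def z add smult)
  have "\<forall>g\<in>sl n. \<forall>u\<in>H. act V g u \<in> H" by (auto simp: H_def act)
  then have "H = {\<zero>\<^bsub>V\<^esub>} \<or> H = carrier V" using irr sub unfolding irreducible_sl_module_def by blast
  moreover have "v \<in> H" using v by (simp add: H_def)
  ultimately have "H = carrier V" using v(2) by auto
  then show ?thesis using x by (auto simp: H_def)
qed

end

section \<open>Triangular parts, adjoints and matrix units\<close>

definition lower_part :: "nat \<Rightarrow> complex mat \<Rightarrow> complex mat" where
  "lower_part n z = mat n n (\<lambda>(i, j). if j < i then z $$ (i, j) else 0)"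

definition upper_part :: "nat \<Rightarrow> complex mat \<Rightarrow> complex mat" where
  "upper_part n z = mat n n (\<lambda>(i, j). if i < j then z $$ (i, j) else 0)"

definition diag_part :: "nat \<Rightarrow> complex mat \<Rightarrow> complex mat" where
  "diag_part n z = mat n n (\<lambda>(i, j). if i = j then z $$ (i, j) else 0)"

lemma sl_parts:
  assumes "z \<in> sl n"
  shows "lower_part n z \<in> sl_lower n" "upper_part n z \<in> sl_upper n" "diag_part n z \<in> sl_diag n"
    "z = lower_part n z + (diag_part n z + upper_part n z)"
proof -
  show "lower_part n z \<in> sl_lower n" "upper_part n z \<in> sl_upper n"
    by (auto simp: lower_part_def upper_part_def sl_lower_def sl_upper_def sl_def intro!: sum.neutral)
  have "(\<Sum>i<n. diag_part n z $$ (i, i)) = (\<Sum>i<n. z $$ (i, i))"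
    by (intro sum.cong) (auto simp: diag_part_def)
  then show "diag_part n z \<in> sl_diag n"
    using assms by (auto simp: sl_diag_def sl_def diagonal_mat_def diag_part_def)
  show "z = lower_part n z + (diag_part n z + upper_part n z)"
    using assms by (intro eq_matI) (auto simp: sl_def lower_part_def upper_part_def diag_part_def)
qed

lemma sl_subsets: "x \<in> sl_lower n \<Longrightarrow> x \<in> sl n" "x \<in> sl_upper n \<Longrightarrow> x \<in> sl n" "x \<in> sl_diag n \<Longrightarrow> x \<in> sl n"
  by (auto simp: sl_lower_def sl_upper_def sl_diag_def)

definition adj :: "nat \<Rightarrow> complex mat \<Rightarrow> complex mat" where
  "adj n g = mat n n (\<lambda>(i, j). cnj (g $$ (j, i)))"

lemma adj_adj: "g \<in> carrier_mat n n \<Longrightarrow> adj n (adj n g) = g"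
  by (intro eq_matI) (auto simp: adj_def)

lemma adj_carrier [simp]: "adj n g \<in> carrier_mat n n"
  by (simp add: adj_def)

lemma adj_sl: "g \<in> sl n \<Longrightarrow> adj n g \<in> sl n"
proof -
  assume g: "g \<in> sl n"
  have "(\<Sum>i<n. adj n g $$ (i, i)) = cnj (\<Sum>i<n. g $$ (i, i))" by (simp add: adj_def)
  then show ?thesis using g by (simp add: sl_def del: cnj_sum)
qed

lemma adj_lower: "g \<in> sl_lower n \<Longrightarrow> adj n g \<in> sl_upper n"
  using adj_sl[of g n] by (auto simp: sl_lower_def sl_upper_def) (auto simp: adj_def)

definition Eu :: "nat \<Rightarrow> nat \<Rightarrow> nat \<Rightarrow> complex mat" where
  "Eu n i j = mat n n (\<lambda>(a, b). if a = i \<and> b = j then 1 else 0)"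

lemma Eu_sl: "i \<noteq> j \<Longrightarrow> Eu n i j \<in> sl n"
  by (auto simp: Eu_def sl_def intro!: sum.neutral)

lemma Eu_upper: "i < j \<Longrightarrow> Eu n i j \<in> sl_upper n"
  using Eu_sl[of i j n] by (auto simp: sl_upper_def) (auto simp: Eu_def)

lemma zero_sl_lower: "0\<^sub>m n n \<in> sl_lower n"
  by (auto simp: sl_lower_def sl_def)

lemma sl_lower_induct [consumes 1, case_names zero add]:
  assumes z: "z \<in> sl_lower n" and 0: "P (0\<^sub>m n n)"
    and step: "\<And>c i j y. j < i \<Longrightarrow> i < n \<Longrightarrow> y \<in> sl_lower n \<Longrightarrow> P y \<Longrightarrow> P (y + c \<cdot>\<^sub>m Eu n i j)"
  shows "P z"
proof -
  have zc: "z \<in> carrier_mat n n" using z by (rule sl_lower_carrier)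
  let ?R = "\<lambda>S. mat n n (\<lambda>p. if p \<in> S then z $$ p else 0)"
  have "P (?R S) \<and> ?R S \<in> sl_lower n" if "finite S" "S \<subseteq> {(i, j). j < i \<and> i < n}" for S
    using that
  proof (induction S rule: finite_induct)
    case empty
    have "?R {} = 0\<^sub>m n n" by (intro eq_matI) auto
    then show ?case using 0 zero_sl_lower by simp
  next
    case (insert p S)
    obtain i j where p: "p = (i, j)" by (cases p)
    then have ij: "j < i" "i < n" using insert.prems by auto
    have eq: "?R (insert p S) = ?R S + (z $$ p) \<cdot>\<^sub>m Eu n i j"
      using insert.hyps(2) by (intro eq_matI) (auto simp: Eu_def p)
    have IH: "P (?R S)" "?R S \<in> sl_lower n" using insert by auto
    have "P (?R (insert p S))" unfolding eq by (rule step[OF ij IH(2,1)])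
    moreover have "?R (insert p S) \<in> sl_lower n"
      using insert.prems by (auto simp: sl_lower_def sl_def intro!: sum.neutral)
    ultimately show ?case by simp
  qed
  moreover have "finite {(i, j). j < i \<and> i < n}"
    by (rule finite_subset[of _ "{..<n} \<times> {..<n}"]) auto
  moreover have "?R {(i, j). j < i \<and> i < n} = z"
    using z zc by (intro eq_matI) (auto simp: sl_lower_def)
  ultimately show ?thesis by fastforce
qed

text \<open>The sum of the positive coroots, on which every simple root takes the value 2. Its
  eigenvalue drops by \<open>2 * (i - j)\<close> under the lowering matrix unit at (i, j), so this
  single element measures the depth below the highest weight.\<close>

definition h0 :: "nat \<Rightarrow> complex mat" where
  "h0 n = mat n n (\<lambda>(i, j). if i = j then of_nat n - 1 - 2 * of_nat i else 0)"

lemma h0_diag: "h0 n \<in> sl_diag n"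
proof -
  have "(\<Sum>i<n. of_nat n - 1 - 2 * of_nat i :: complex) = 0"
  proof -
    \<comment> \<open>The bound and the \<open>n\<close> in the summand are separated so that
      induction on the bound goes through.\<close>
    have "(\<Sum>i<m. of_nat k - 1 - 2 * of_nat i :: complex) = of_nat m * of_nat k - of_nat m * of_nat m" for m k
      by (induction m) (simp_all add: algebra_simps)
    then show ?thesis by simp
  qed
  then show ?thesis by (auto simp: sl_diag_def sl_def diagonal_mat_def h0_def)
qed

lemma mat_mult_entry:
  assumes "x \<in> carrier_mat n n" "y \<in> carrier_mat n n" "a < n" "b < n"
  shows "(x * y) $$ (a, b) = (\<Sum>k<n. x $$ (a, k) * y $$ (k, b))"
  using assms by (simp add: scalar_prod_def lessThan_atLeast0)

lemma h0_commutator: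
  assumes "i < n" "j < n"
  shows "h0 n * Eu n i j - Eu n i j * h0 n = (2 * of_nat j - 2 * of_nat i) \<cdot>\<^sub>m Eu n i j"
proof (rule eq_matI)
  fix a b assume "a < dim_row ((2 * of_nat j - 2 * of_nat i) \<cdot>\<^sub>m Eu n i j)" "b < dim_col ((2 * of_nat j - 2 * of_nat i) \<cdot>\<^sub>m Eu n i j)"
  then have ab: "a < n" "b < n" by (simp_all add: Eu_def)
  have c: "h0 n \<in> carrier_mat n n" "Eu n i j \<in> carrier_mat n n" by (simp_all add: h0_def Eu_def)
  have "(h0 n * Eu n i j) $$ (a, b) = (\<Sum>k<n. if k = a then (of_nat n - 1 - 2 * of_nat a) * (if a = i \<and> b = j then 1 else 0) else 0)"
    unfolding mat_mult_entry[OF c ab] using ab by (intro sum.cong) (auto simp: h0_def Eu_def)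
  moreover have "(Eu n i j * h0 n) $$ (a, b) = (\<Sum>k<n. if k = b then (of_nat n - 1 - 2 * of_nat b) * (if a = i \<and> b = j then 1 else 0) else 0)"
    unfolding mat_mult_entry[OF c(2,1) ab] using ab by (intro sum.cong) (auto simp: h0_def Eu_def)
  ultimately show "(h0 n * Eu n i j - Eu n i j * h0 n) $$ (a, b) = ((2 * of_nat j - 2 * of_nat i) \<cdot>\<^sub>m Eu n i j) $$ (a, b)"
    using ab by (simp add: Eu_def h0_def)
qed (simp_all add: Eu_def h0_def)

section \<open>Depth below the highest weight of an irreducible module\<close>

locale hw_mod = sl_mod n V for n and V :: "(complex mat, 'v) rep" +
  fixes v :: 'v and wt :: "complex mat \<Rightarrow> complex"
  assumes irr: "irreducible_sl_module n V"
    and v: "v \<in> carrier V" "v \<noteq> \<zero>\<^bsub>V\<^esub>"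
    and v_upper: "\<And>x. x \<in> sl_upper n \<Longrightarrow> act V x v = \<zero>\<^bsub>V\<^esub>"
    and v_diag: "\<And>h. h \<in> sl_diag n \<Longrightarrow> act V h v = wt h \<odot>\<^bsub>V\<^esub> v"
begin

text \<open>Annihilates vectors at depth \<open>k\<close>, where \<open>h0 n\<close> has the
  eigenvalue \<open>wt (h0 n) - 2 * k\<close>. Products of such operators stand in for a
  decomposition into weight spaces.\<close>

definition wop_shift :: "nat \<Rightarrow> 'v \<Rightarrow> 'v" where
  "wop_shift k x = act V (h0 n) x \<oplus>\<^bsub>V\<^esub> (2 * of_nat k - wt (h0 n)) \<odot>\<^bsub>V\<^esub> x"

abbreviation "wops \<equiv> foldr wop_shift"

text \<open>Sums of weight vectors of weight strictly below that of \<open>v\<close>.\<close>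

definition below :: "'v set" where
  "below = {x \<in> carrier V. \<exists>ks. 0 \<notin> set ks \<and> wops ks x = \<zero>\<^bsub>V\<^esub>}"

lemma h0_sl [simp]: "h0 n \<in> sl n"
  using h0_diag sl_subsets(3) by blast

lemma wop_shift_closed [simp]: "x \<in> carrier V \<Longrightarrow> wop_shift k x \<in> carrier V"
  by (simp add: wop_shift_def)

lemma wops_closed [simp]: "x \<in> carrier V \<Longrightarrow> wops ks x \<in> carrier V"
  by (induction ks) simp_all

lemma wop_shift_add: "x \<in> carrier V \<Longrightarrow> y \<in> carrier V \<Longrightarrow> wop_shift k (x \<oplus>\<^bsub>V\<^esub> y) = wop_shift k x \<oplus>\<^bsub>V\<^esub> wop_shift k y"
  by (simp add: wop_shift_def act_add smult_simps(2) add_ac)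

lemma wops_add: "x \<in> carrier V \<Longrightarrow> y \<in> carrier V \<Longrightarrow> wops ks (x \<oplus>\<^bsub>V\<^esub> y) = wops ks x \<oplus>\<^bsub>V\<^esub> wops ks y"
  by (induction ks) (simp_all add: wop_shift_add)

lemma wop_shift_smult: "x \<in> carrier V \<Longrightarrow> wop_shift k (c \<odot>\<^bsub>V\<^esub> x) = c \<odot>\<^bsub>V\<^esub> wop_shift k x"
  by (simp add: wop_shift_def act_smult smult_simps(2,3) mult.commute)

lemma wops_smult: "x \<in> carrier V \<Longrightarrow> wops ks (c \<odot>\<^bsub>V\<^esub> x) = c \<odot>\<^bsub>V\<^esub> wops ks x"
  by (induction ks) (simp_all add: wop_shift_smult)

lemma wops_zero [simp]: "wops ks \<zero>\<^bsub>V\<^esub> = \<zero>\<^bsub>V\<^esub>"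
  using wops_smult[of "\<zero>\<^bsub>V\<^esub>" ks 0] by simp

lemma wop_shift_commute: "x \<in> carrier V \<Longrightarrow> wop_shift k (wop_shift l x) = wop_shift l (wop_shift k x)"
  by (simp add: wop_shift_def act_add act_smult smult_simps(2,3) add_ac mult.commute)

lemma wops_commute1: "x \<in> carrier V \<Longrightarrow> wop_shift k (wops ls x) = wops ls (wop_shift k x)"
  by (induction ls) (simp_all add: wop_shift_commute)

lemma wops_commute: "x \<in> carrier V \<Longrightarrow> wops ks (wops ls x) = wops ls (wops ks x)"
  by (induction ks) (simp_all add: wops_commute1)

lemma below_closed: "x \<in> below \<Longrightarrow> x \<in> carrier V"
  by (simp add: below_def)

lemma below_zero: "\<zero>\<^bsub>V\<^esub> \<in> below"
  unfolding below_def by (intro CollectI conjI exI[of _ "[]"]) simp_all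

lemma below_smult: "x \<in> below \<Longrightarrow> c \<odot>\<^bsub>V\<^esub> x \<in> below"
  by (auto simp: below_def wops_smult)

text \<open>The operators commute, so the concatenated list annihilates both summands.\<close>

lemma below_add: assumes x: "x \<in> below" and y: "y \<in> below" shows "x \<oplus>\<^bsub>V\<^esub> y \<in> below"
proof -
  obtain ks ls where k: "0 \<notin> set ks" "wops ks x = \<zero>\<^bsub>V\<^esub>" and l: "0 \<notin> set ls" "wops ls y = \<zero>\<^bsub>V\<^esub>"
    and c: "x \<in> carrier V" "y \<in> carrier V" using x y by (auto simp: below_def)
  have "wops (ks @ ls) (x \<oplus>\<^bsub>V\<^esub> y) = wops ks (wops ls x) \<oplus>\<^bsub>V\<^esub> wops ks (wops ls y)"
    using c by (simp add: wops_add)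
  also have "\<dots> = \<zero>\<^bsub>V\<^esub>" using c k l by (simp add: wops_commute[of x ks])
  finally show ?thesis
    unfolding below_def using k(1) l(1) c by (intro CollectI conjI exI[of _ "ks @ ls"]) simp_all
qed

lemma wop_shift_Eu:
  assumes ij: "j < i" "i < n" and x: "x \<in> carrier V"
  shows "wop_shift (k + (i - j)) (act V (Eu n i j) x) = act V (Eu n i j) (wop_shift k x)"
proof -
  have E: "Eu n i j \<in> sl n" using ij by (intro Eu_sl) simp
  have c: "2 * of_nat j - 2 * of_nat i + (2 * of_nat (k + (i - j)) - wt (h0 n)) = 2 * of_nat k - wt (h0 n)"
    using ij by (simp add: of_nat_diff)
  have comm: "h0 n * Eu n i j - Eu n i j * h0 n = (2 * of_nat j - 2 * of_nat i) \<cdot>\<^sub>m Eu n i j"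
    using ij by (intro h0_commutator) simp_all
  let ?y = "act V (Eu n i j) x"
  have y: "?y \<in> carrier V" "act V (Eu n i j) (act V (h0 n) x) \<in> carrier V" using E x by simp_all
  have "act V (h0 n) ?y = (2 * of_nat j - 2 * of_nat i) \<odot>\<^bsub>V\<^esub> ?y \<oplus>\<^bsub>V\<^esub> act V (Eu n i j) (act V (h0 n) x)"
    using act_swap[OF h0_sl E x] unfolding comm by (simp add: act_scale E x)
  then have "wop_shift (k + (i - j)) ?y = act V (Eu n i j) (act V (h0 n) x) \<oplus>\<^bsub>V\<^esub>
     ((2 * of_nat j - 2 * of_nat i) \<odot>\<^bsub>V\<^esub> ?y \<oplus>\<^bsub>V\<^esub> (2 * of_nat (k + (i - j)) - wt (h0 n)) \<odot>\<^bsub>V\<^esub> ?y)"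
    using y unfolding wop_shift_def by (simp only: add_ac closed)
  also have "\<dots> = act V (Eu n i j) (act V (h0 n) x) \<oplus>\<^bsub>V\<^esub> (2 * of_nat k - wt (h0 n)) \<odot>\<^bsub>V\<^esub> ?y"
    by (simp only: smult_simps(1)[OF y(1), symmetric] c)
  also have "\<dots> = act V (Eu n i j) (wop_shift k x)"
    using E x by (simp add: wop_shift_def act_add act_smult)
  finally show ?thesis .
qed

lemma wops_Eu:
  assumes "j < i" "i < n" "x \<in> carrier V"
  shows "wops (map (\<lambda>k. k + (i - j)) ks) (act V (Eu n i j) x) = act V (Eu n i j) (wops ks x)"
  by (induction ks) (simp_all add: wop_shift_Eu assms)

lemma wop_shift_v: "wop_shift k v = (2 * of_nat k) \<odot>\<^bsub>V\<^esub> v"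
proof -
  have "wop_shift k v = wt (h0 n) \<odot>\<^bsub>V\<^esub> v \<oplus>\<^bsub>V\<^esub> (2 * of_nat k - wt (h0 n)) \<odot>\<^bsub>V\<^esub> v"
    by (simp add: wop_shift_def v_diag[OF h0_diag])
  also have "\<dots> = (wt (h0 n) + (2 * of_nat k - wt (h0 n))) \<odot>\<^bsub>V\<^esub> v"
    by (rule smult_simps(1)[OF v(1), symmetric])
  finally show ?thesis by simp
qed

text \<open>On \<open>v\<close> the operator for depth \<open>k\<close> is multiplication by
  \<open>2 * k\<close>, which is nonzero for every \<open>k\<close> in the list. The line of
  \<open>v\<close> thus meets \<open>below\<close> only in 0.\<close>

lemma smult_v_below: "c \<odot>\<^bsub>V\<^esub> v \<in> below \<Longrightarrow> c = 0"
proof -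
  assume "c \<odot>\<^bsub>V\<^esub> v \<in> below"
  then obtain ks where k: "0 \<notin> set ks" "wops ks (c \<odot>\<^bsub>V\<^esub> v) = \<zero>\<^bsub>V\<^esub>" by (auto simp: below_def)
  have "\<exists>d. d \<noteq> 0 \<and> wops ks v = d \<odot>\<^bsub>V\<^esub> v" if "0 \<notin> set ks" for ks
    using that
  proof (induction ks)
    case Nil
    show ?case using v by (intro exI[of _ 1]) (simp add: smult_simps)
  next
    case (Cons k ks)
    then obtain d where d: "d \<noteq> 0" "wops ks v = d \<odot>\<^bsub>V\<^esub> v" by auto
    have "wops (k # ks) v = (d * (2 * of_nat k)) \<odot>\<^bsub>V\<^esub> v"
      using v by (simp add: d wop_shift_smult wop_shift_v smult_simps)
    then show ?case using d Cons.prems by (intro exI[of _ "d * (2 * of_nat k)"]) simp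
  qed
  then obtain d where d: "d \<noteq> 0" "wops ks v = d \<odot>\<^bsub>V\<^esub> v" using k(1) by blast
  then have "(c * d) \<odot>\<^bsub>V\<^esub> v = \<zero>\<^bsub>V\<^esub>" using k(2) v by (simp add: wops_smult smult_simps)
  then have "c * d = 0" using v by (rule smult_eq_zero)
  then show "c = 0" using d by simp
qed

text \<open>Lowering adds \<open>i - j > 0\<close> to every depth. So 0 may occur in
  \<open>ks\<close>: the lemma applies to \<open>v\<close> with the list \<open>[0]\<close> as well
  as to elements of \<open>below\<close>.\<close>

lemma act_lower_below:
  assumes z: "z \<in> sl_lower n" and x: "x \<in> carrier V" "wops ks x = \<zero>\<^bsub>V\<^esub>"
  shows "act V z x \<in> below"
  using z
proof (induction rule: sl_lower_induct)
  case zero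
  have "0 \<cdot>\<^sub>m 0\<^sub>m n n = (0\<^sub>m n n :: complex mat)" by (intro eq_matI) simp_all
  then have "act V (0\<^sub>m n n) x = 0 \<odot>\<^bsub>V\<^esub> act V (0\<^sub>m n n) x"
    using act_scale[OF sl_subsets(1)[OF zero_sl_lower] x(1), of 0] by simp
  then show ?case using below_zero x sl_subsets(1)[OF zero_sl_lower] by simp
next
  case (add c i j y)
  have E: "Eu n i j \<in> sl n" using add by (intro Eu_sl) simp
  have "wops (map (\<lambda>k. k + (i - j)) ks) (act V (Eu n i j) x) = \<zero>\<^bsub>V\<^esub>"
    using wops_Eu[OF add(1,2) x(1), of ks] x(2) E by simp
  then have "act V (Eu n i j) x \<in> below"
    unfolding below_def using E x add(1) by (intro CollectI conjI exI[of _ "map (\<lambda>k. k + (i - j)) ks"]) auto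
  then have "act V y x \<oplus>\<^bsub>V\<^esub> c \<odot>\<^bsub>V\<^esub> act V (Eu n i j) x \<in> below"
    by (intro below_add below_smult add)
  then show ?case
    using E x sl_subsets(1)[OF add(3)] by (simp add: act_plus act_scale sl_smult)
qed

end

text \<open>Lowering and raising matrices are adjoint to each other, so orthogonal complements of
  stable subspaces are stable. The space is a subset \<open>T\<close> of its type because the
  operators obey the laws of an action only there.\<close>

locale unitary_sl = hermitian_space s ip
  for s :: "complex \<Rightarrow> 'b::ab_group_add \<Rightarrow> 'b" and ip +
  fixes n :: nat and T :: "'b set" and A :: "complex mat \<Rightarrow> 'b \<Rightarrow> 'b"
  assumes T: "subspace T"
    and A_closed: "g \<in> carrier_mat n n \<Longrightarrow> u \<in> T \<Longrightarrow> A g u \<in> T"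
    and A_add: "g \<in> carrier_mat n n \<Longrightarrow> u \<in> T \<Longrightarrow> u' \<in> T \<Longrightarrow> A g (u + u') = A g u + A g u'"
    and A_scale: "g \<in> carrier_mat n n \<Longrightarrow> u \<in> T \<Longrightarrow> A g (s c u) = s c (A g u)"
    and A_plus: "g \<in> carrier_mat n n \<Longrightarrow> g' \<in> carrier_mat n n \<Longrightarrow> u \<in> T \<Longrightarrow> A (g + g') u = A g u + A g' u"
    and A_smult: "g \<in> carrier_mat n n \<Longrightarrow> u \<in> T \<Longrightarrow> A (c \<cdot>\<^sub>m g) u = s c (A g u)"
    and A_commutator: "g \<in> carrier_mat n n \<Longrightarrow> g' \<in> carrier_mat n n \<Longrightarrow> u \<in> T \<Longrightarrow> A (g * g' - g' * g) u = A g (A g' u) - A g' (A g u)"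
    and A_adj: "g \<in> carrier_mat n n \<Longrightarrow> u \<in> T \<Longrightarrow> u' \<in> T \<Longrightarrow> ip (A g u) u' = ip u (A (adj n g) u')"
begin

definition HW :: "(complex mat \<Rightarrow> complex) \<Rightarrow> 'b set" where
  "HW wt = {h \<in> T. (\<forall>x\<in>sl_upper n. A x h = 0) \<and> (\<forall>d\<in>sl_diag n. A d h = s (wt d) h)}"

lemma sl_carrier: "g \<in> sl n \<Longrightarrow> g \<in> carrier_mat n n"
  by (simp add: sl_def)

lemma T_closed: "0 \<in> T" "u \<in> T \<Longrightarrow> u' \<in> T \<Longrightarrow> u + u' \<in> T" "u \<in> T \<Longrightarrow> s c u \<in> T"
  using T by (simp_all add: subspace_def)

lemma A_zero: "g \<in> carrier_mat n n \<Longrightarrow> A g 0 = 0"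
  using A_scale[of g 0 0] T_closed(1) by simp

lemma subspace_HW: "subspace (HW wt)"
proof (rule subspaceI)
  show "0 \<in> HW wt" using T_closed sl_subsets sl_carrier A_zero by (simp add: HW_def)
  fix x y assume x: "x \<in> HW wt" and y: "y \<in> HW wt"
  show "x + y \<in> HW wt"
    using x y A_add[OF sl_carrier[OF sl_subsets(2)], of _ x y] A_add[OF sl_carrier[OF sl_subsets(3)], of _ x y]
    by (simp add: HW_def T_closed scale_right_distrib)
next
  fix c x assume x: "x \<in> HW wt"
  show "s c x \<in> HW wt"
    using x A_scale[OF sl_carrier[OF sl_subsets(2)], of _ x c] A_scale[OF sl_carrier[OF sl_subsets(3)], of _ x c]
    by (simp add: HW_def T_closed mult.commute)
qed

end

text \<open>Only lowering matrices generate, which keeps the component of the first coordinate along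
  \<open>v\<close> under control. Closure under the rest of the Lie algebra is a theorem,
  \<open>D_sl\<close>.\<close>

inductive_set hw_graph :: "nat \<Rightarrow> (complex \<Rightarrow> 'b::ab_group_add \<Rightarrow> 'b) \<Rightarrow> (complex mat \<Rightarrow> 'b \<Rightarrow> 'b) \<Rightarrow> (complex mat, 'v) rep \<Rightarrow> 'v \<Rightarrow> 'b \<Rightarrow> ('v \<times> 'b) set"
  for n s A V v h where
  base: "(v, h) \<in> hw_graph n s A V v h"
| lower: "z \<in> sl_lower n \<Longrightarrow> (x, y) \<in> hw_graph n s A V v h \<Longrightarrow> (act V z x, A z y) \<in> hw_graph n s A V v h"
| add: "(x, y) \<in> hw_graph n s A V v h \<Longrightarrow> (x', y') \<in> hw_graph n s A V v h \<Longrightarrow> (x \<oplus>\<^bsub>V\<^esub> x', y + y') \<in> hw_graph n s A V v h"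
| smult: "(x, y) \<in> hw_graph n s A V v h \<Longrightarrow> (c \<odot>\<^bsub>V\<^esub> x, s c y) \<in> hw_graph n s A V v h"

text \<open>The submodule of \<open>V \<times> T\<close> generated by \<open>(v, h)\<close> is the graph of the homomorphism that sends
  \<open>v\<close> to \<open>h\<close>.\<close>

locale hw_hom = unitary_sl s ip n T A + hw_mod n V v wt
  for s :: "complex \<Rightarrow> 'b::ab_group_add \<Rightarrow> 'b" and ip n T A and V :: "(complex mat, 'v) rep" and v wt +
  fixes h :: 'b
  assumes h: "h \<in> HW wt"
begin

abbreviation "D \<equiv> hw_graph n s A V v h"

lemma hT: "h \<in> T" "x \<in> sl_upper n \<Longrightarrow> A x h = 0" "d \<in> sl_diag n \<Longrightarrow> A d h = s (wt d) h"
  using h by (auto simp: HW_def)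

lemma D_closed: "(x, y) \<in> D \<Longrightarrow> x \<in> carrier V \<and> y \<in> T"
  by (induction rule: hw_graph.induct)
    (simp_all add: v hT sl_subsets sl_carrier A_closed T_closed)

lemma D_zero: "(\<zero>\<^bsub>V\<^esub>, 0) \<in> D"
proof -
  have "(0 \<odot>\<^bsub>V\<^esub> v, s 0 h) \<in> D" by (intro hw_graph.smult hw_graph.base)
  then show ?thesis using v by simp
qed

text \<open>At the generating pair, \<open>z\<close> is split into its triangular parts: the
  diagonal part scales both vectors by the same weight, and the upper part kills both. Past a
  lowering matrix \<open>z\<close> is moved at the cost of a commutator, which lies in
  \<open>sl n\<close> again and falls under the induction hypothesis.\<close>

lemma D_sl: "(x, y) \<in> D \<Longrightarrow> z \<in> sl n \<Longrightarrow> (act V z x, A z y) \<in> D"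
proof (induction arbitrary: z rule: hw_graph.induct)
  case base
  note p = sl_parts[OF base]
  let ?l = "lower_part n z" and ?d = "diag_part n z" and ?u = "upper_part n z"
  have s: "?l \<in> sl n" "?d \<in> sl n" "?u \<in> sl n" using p sl_subsets by blast+
  have du: "?d + ?u \<in> sl n" using s by (intro sl_add)
  have "act V z v = act V ?l v \<oplus>\<^bsub>V\<^esub> (wt ?d \<odot>\<^bsub>V\<^esub> v \<oplus>\<^bsub>V\<^esub> \<zero>\<^bsub>V\<^esub>)"
    by (subst p(4)) (simp only: act_plus[OF s(1) du v(1)] act_plus[OF s(2,3) v(1)] v_diag[OF p(3)] v_upper[OF p(2)])
  moreover have "A z h = A ?l h + (s (wt ?d) h + 0)"
    by (subst p(4)) (simp only: A_plus[OF sl_carrier[OF s(1)] sl_carrier[OF du] hT(1)]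
      A_plus[OF sl_carrier[OF s(2)] sl_carrier[OF s(3)] hT(1)] hT(2)[OF p(2)] hT(3)[OF p(3)])
  moreover have "(act V ?l v \<oplus>\<^bsub>V\<^esub> (wt ?d \<odot>\<^bsub>V\<^esub> v \<oplus>\<^bsub>V\<^esub> \<zero>\<^bsub>V\<^esub>), A ?l h + (s (wt ?d) h + 0)) \<in> D"
    by (rule hw_graph.add[OF hw_graph.lower[OF p(1) hw_graph.base] hw_graph.add[OF hw_graph.smult[OF hw_graph.base] D_zero]])
  ultimately show ?case by simp
next
  case (lower z1 x y)
  have z1: "z1 \<in> sl n" using lower(1) by (rule sl_subsets)
  note c = D_closed[OF lower(2)]
  have "(act V (z * z1 - z1 * z) x \<oplus>\<^bsub>V\<^esub> act V z1 (act V z x), A (z * z1 - z1 * z) y + A z1 (A z y)) \<in> D"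
    by (intro hw_graph.add hw_graph.lower lower sl_commutator z1)
  moreover have "A (z * z1 - z1 * z) y + A z1 (A z y) = A z (A z1 y)"
    using A_commutator[OF sl_carrier[OF lower(4)] sl_carrier[OF z1], of y] c by simp
  moreover have "act V (z * z1 - z1 * z) x \<oplus>\<^bsub>V\<^esub> act V z1 (act V z x) = act V z (act V z1 x)"
    using act_swap[OF lower(4) z1, of x] c by simp
  ultimately show ?case by simp
next
  case (add x y x' y')
  have "(act V z x \<oplus>\<^bsub>V\<^esub> act V z x', A z y + A z y') \<in> D" by (intro hw_graph.add add)
  then show ?case
    using D_closed[OF add(1)] D_closed[OF add(2)] add(5) by (simp add: act_add A_add sl_carrier)
next
  case (smult x y c)
  have "(c \<odot>\<^bsub>V\<^esub> act V z x, s c (A z y)) \<in> D" by (intro hw_graph.smult smult)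
  then show ?case using D_closed[OF smult(1)] smult(3) by (simp add: act_smult A_scale sl_carrier)
qed

text \<open>Only the generator contributes to \<open>v\<close> in the first coordinate and to the
  pairing with \<open>h\<close> in the second. A lowered vector is below the highest weight on one
  side, and on the other it is orthogonal to \<open>h\<close>, because the adjoint of a lowering
  matrix kills \<open>h\<close>.\<close>

lemma D_leading: "(x, y) \<in> D \<Longrightarrow> \<exists>c l. l \<in> below \<and> x = c \<odot>\<^bsub>V\<^esub> v \<oplus>\<^bsub>V\<^esub> l \<and> ip y h = c * ip h h"
proof (induction rule: hw_graph.induct)
  case base
  show ?case
    using v below_zero by (intro exI[of _ 1] exI[of _ "\<zero>\<^bsub>V\<^esub>"]) (simp add: smult_simps)
next
  case (lower z x y)
  then obtain c l where cl: "l \<in> below" "x = c \<odot>\<^bsub>V\<^esub> v \<oplus>\<^bsub>V\<^esub> l" by blast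
  note zs = sl_subsets(1)[OF lower(1)] 
  obtain ks where ks: "wops ks l = \<zero>\<^bsub>V\<^esub>" "l \<in> carrier V" using cl(1) by (auto simp: below_def)
  have "wops [0] v = \<zero>\<^bsub>V\<^esub>" using v by (simp add: wop_shift_v)
  then have "act V z v \<in> below" "act V z l \<in> below"
    using act_lower_below[OF lower(1) v(1)] act_lower_below[OF lower(1) ks(2,1)] by blast+
  then have "c \<odot>\<^bsub>V\<^esub> act V z v \<oplus>\<^bsub>V\<^esub> act V z l \<in> below" by (intro below_add below_smult)
  then have b: "act V z x \<in> below" unfolding cl(2) using zs v ks by (simp add: act_add act_smult)
  have "ip (A z y) h = ip y (A (adj n z) h)"
    using D_closed[OF lower(2)] by (intro A_adj hT sl_carrier zs) simp
  then have "ip (A z y) h = 0" using hT(2)[OF adj_lower[OF lower(1)]] by simp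
  then show ?case using b below_closed[OF b] v by (intro exI[of _ 0] exI[of _ "act V z x"]) simp
next
  case (add x y x' y')
  then obtain c l c' l' where cl: "l \<in> below" "x = c \<odot>\<^bsub>V\<^esub> v \<oplus>\<^bsub>V\<^esub> l" "ip y h = c * ip h h"
    "l' \<in> below" "x' = c' \<odot>\<^bsub>V\<^esub> v \<oplus>\<^bsub>V\<^esub> l'" "ip y' h = c' * ip h h" by blast
  have "x \<oplus>\<^bsub>V\<^esub> x' = (c + c') \<odot>\<^bsub>V\<^esub> v \<oplus>\<^bsub>V\<^esub> (l \<oplus>\<^bsub>V\<^esub> l')"
    using cl(1,4) v by (simp add: cl(2,5) below_closed smult_simps(1) add_ac)
  moreover have "ip (y + y') h = (c + c') * ip h h" by (simp add: ip_add cl distrib_right)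
  ultimately show ?case using below_add[OF cl(1,4)] by blast
next
  case (smult x y d)
  then obtain c l where cl: "l \<in> below" "x = c \<odot>\<^bsub>V\<^esub> v \<oplus>\<^bsub>V\<^esub> l" "ip y h = c * ip h h" by blast
  have "d \<odot>\<^bsub>V\<^esub> x = (d * c) \<odot>\<^bsub>V\<^esub> v \<oplus>\<^bsub>V\<^esub> (d \<odot>\<^bsub>V\<^esub> l)"
    using cl(1) v by (simp add: cl(2) below_closed smult_simps(2,3))
  moreover have "ip (s d y) h = (d * c) * ip h h" by (simp add: ip_scale cl)
  ultimately show ?case using below_smult[OF cl(1)] by blast
qed

lemma adj_swap:
  assumes "z \<in> sl n" "y \<in> T" "y' \<in> T" shows "ip y (A z y') = ip (A (adj n z) y) y'"
  using A_adj[of "adj n z" y y'] assms adj_adj[OF sl_carrier[OF assms(1)]] by simp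

text \<open>The vectors \<open>y\<close> paired with zero form a stable subspace orthogonal to
  \<open>h\<close>, by \<open>D_leading\<close>. Moving lowering matrices across the form shows that
  they are orthogonal to every second coordinate in the graph, hence to themselves.\<close>

lemma D_zero_unique: assumes "(\<zero>\<^bsub>V\<^esub>, y) \<in> D" shows "y = 0"
proof -
  have perp_h: "ip y h = 0" if y: "(\<zero>\<^bsub>V\<^esub>, y) \<in> D" for y
  proof -
    obtain c l where cl: "l \<in> below" "\<zero>\<^bsub>V\<^esub> = c \<odot>\<^bsub>V\<^esub> v \<oplus>\<^bsub>V\<^esub> l" "ip y h = c * ip h h"
      using D_leading[OF y] by blast
    have lc: "l \<in> carrier V" using cl(1) by (rule below_closed)
    have "(-1) \<odot>\<^bsub>V\<^esub> l = (c \<odot>\<^bsub>V\<^esub> v \<oplus>\<^bsub>V\<^esub> l) \<oplus>\<^bsub>V\<^esub> (-1) \<odot>\<^bsub>V\<^esub> l"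
      using lc by (simp add: cl(2)[symmetric])
    also have "\<dots> = c \<odot>\<^bsub>V\<^esub> v \<oplus>\<^bsub>V\<^esub> (1 \<odot>\<^bsub>V\<^esub> l \<oplus>\<^bsub>V\<^esub> (-1) \<odot>\<^bsub>V\<^esub> l)"
      using lc v by (simp add: add_ac smult_simps(4))
    also have "\<dots> = c \<odot>\<^bsub>V\<^esub> v"
      using lc v by (simp add: smult_simps(1)[symmetric])
    finally have "c \<odot>\<^bsub>V\<^esub> v \<in> below" using below_smult[OF cl(1), of "-1"] by simp
    then show ?thesis using smult_v_below cl(3) by simp
  qed
  have "ip y y' = 0" if "(x', y') \<in> D" "(\<zero>\<^bsub>V\<^esub>, y) \<in> D" for x' y' y
    using that
  proof (induction arbitrary: y rule: hw_graph.induct)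
    case base
    then show ?case by (rule perp_h)
  next
    case (lower z x y')
    note zs = sl_subsets(1)[OF lower(1)]
    have "(act V (adj n z) \<zero>\<^bsub>V\<^esub>, A (adj n z) y) \<in> D" by (rule D_sl[OF lower(4) adj_sl[OF zs]])
    then have "ip (A (adj n z) y) y' = 0" using lower(3) adj_sl[OF zs] by simp
    then show ?case using adj_swap[OF zs] D_closed[OF lower(4)] D_closed[OF lower(2)] by simp
  qed (simp_all add: ip_add_right ip_scale_right)
  then have "ip y y = 0" using assms by blast
  then show ?thesis by (rule ip_definite)
qed

lemma D_total: assumes "x \<in> carrier V" shows "\<exists>y. (x, y) \<in> D"
proof (rule irreducible_induct[where P = "\<lambda>x. \<exists>y. (x, y) \<in> D", OF irr v _ _ _ _ _ assms])
  show "\<exists>y. (v, y) \<in> D" by (rule exI) (rule hw_graph.base)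
  show "\<exists>y. (\<zero>\<^bsub>V\<^esub>, y) \<in> D" using D_zero by blast
  show "\<exists>y. (x \<oplus>\<^bsub>V\<^esub> x', y) \<in> D" if "\<exists>y. (x, y) \<in> D" "\<exists>y. (x', y) \<in> D" for x x'
    using that by (elim exE) (rule exI, rule hw_graph.add)
  show "\<exists>y. (c \<odot>\<^bsub>V\<^esub> x, y) \<in> D" if "\<exists>y. (x, y) \<in> D" for c x
    using that by (elim exE) (rule exI, rule hw_graph.smult)
  show "\<exists>y. (act V g x, y) \<in> D" if "g \<in> sl n" "\<exists>y. (x, y) \<in> D" for g x
    using that D_sl by blast
qed

lemma D_unique: assumes "(x, y) \<in> D" "(x, y') \<in> D" shows "y = y'"
proof -
  have x: "x \<in> carrier V" using D_closed[OF assms(1)] by simp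
  have "(x \<oplus>\<^bsub>V\<^esub> (-1) \<odot>\<^bsub>V\<^esub> x, y + s (-1) y') \<in> D" by (intro hw_graph.add hw_graph.smult assms)
  moreover have "x \<oplus>\<^bsub>V\<^esub> (-1) \<odot>\<^bsub>V\<^esub> x = (1 + (-1)) \<odot>\<^bsub>V\<^esub> x" using x by (simp only: smult_simps)
  then have "x \<oplus>\<^bsub>V\<^esub> (-1) \<odot>\<^bsub>V\<^esub> x = \<zero>\<^bsub>V\<^esub>" using x by simp
  ultimately have "y + s (-1) y' = 0" by (intro D_zero_unique) simp
  then show ?thesis by (simp add: scale_minus_left)
qed

end

text \<open>Stated outside the locale with \<open>h\<close> as a parameter, since linearity in
  \<open>h\<close> is needed for the tensor product.\<close>

definition hw_map :: "nat \<Rightarrow> (complex \<Rightarrow> 'b::ab_group_add \<Rightarrow> 'b) \<Rightarrow> (complex mat \<Rightarrow> 'b \<Rightarrow> 'b) \<Rightarrow> (complex mat, 'v) rep \<Rightarrow> 'v \<Rightarrow> 'b \<Rightarrow> 'v \<Rightarrow> 'b" where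
  "hw_map n s A V v h x = (THE y. (x, y) \<in> hw_graph n s A V v h)"

context hw_hom
begin

abbreviation "\<psi> \<equiv> hw_map n s A V v h"

lemma psi_D: "x \<in> carrier V \<Longrightarrow> (x, \<psi> x) \<in> D"
proof -
  assume "x \<in> carrier V"
  then obtain y where "(x, y) \<in> D" using D_total by blast
  then show "(x, \<psi> x) \<in> D" unfolding hw_map_def by (rule theI) (rule D_unique[OF _ \<open>(x, y) \<in> D\<close>])
qed

lemma psi_eq: "(x, y) \<in> D \<Longrightarrow> \<psi> x = y"
  using psi_D D_unique D_closed by blast

lemma psi_T: "x \<in> carrier V \<Longrightarrow> \<psi> x \<in> T"
  using psi_D D_closed by blast

lemma psi_v: "\<psi> v = h"
  by (rule psi_eq[OF hw_graph.base])

lemma psi_add: "x \<in> carrier V \<Longrightarrow> y \<in> carrier V \<Longrightarrow> \<psi> (x \<oplus>\<^bsub>V\<^esub> y) = \<psi> x + \<psi> y"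
  by (intro psi_eq hw_graph.add psi_D)

lemma psi_smult: "x \<in> carrier V \<Longrightarrow> \<psi> (c \<odot>\<^bsub>V\<^esub> x) = s c (\<psi> x)"
  by (intro psi_eq hw_graph.smult psi_D)

lemma psi_act: "x \<in> carrier V \<Longrightarrow> g \<in> sl n \<Longrightarrow> \<psi> (act V g x) = A g (\<psi> x)"
  by (intro psi_eq D_sl psi_D)

lemma psi_zero: "\<psi> \<zero>\<^bsub>V\<^esub> = 0"
  by (rule psi_eq[OF D_zero])

text \<open>A nonzero vector of the kernel would generate \<open>v\<close>, forcing
  \<open>h = 0\<close>.\<close>

lemma psi_injective:
  assumes "h \<noteq> 0" "x \<in> carrier V" "\<psi> x = 0" shows "x = \<zero>\<^bsub>V\<^esub>"
proof (rule ccontr)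
  assume x: "x \<noteq> \<zero>\<^bsub>V\<^esub>"
  have "\<psi> v = 0"
  proof (rule irreducible_induct[where P = "\<lambda>x. \<psi> x = 0", OF irr assms(2) x assms(3)])
    show "\<psi> (act V g y) = 0" if "g \<in> sl n" "y \<in> carrier V" "\<psi> y = 0" for g y
      using that by (simp add: psi_act A_zero sl_carrier)
  qed (simp_all add: psi_zero psi_add psi_smult v)
  then show False using assms(1) by (simp add: psi_v)
qed

end

section \<open>Tensor products with multiplicity spaces\<close>

text \<open>A lowering matrix on one side becomes a raising one on the other, which kills the
  highest weight vector there. So orthogonality of \<open>h\<close> and \<open>h'\<close> spreads
  first to the graph of \<open>h\<close> against \<open>h'\<close> and then to both graphs; the two
  modules may be equal or different.\<close>

lemma hw_map_orthogonal:
  assumes 1: "hw_hom s ip n T A V v wt h" and 2: "hw_hom s ip n T A V' v' wt' h'"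
    and orth: "ip h h' = 0" and x: "x \<in> carrier V" and x': "x' \<in> carrier V'"
  shows "ip (hw_map n s A V v h x) (hw_map n s A V' v' h' x') = 0"
proof -
  interpret H: hw_hom s ip n T A V v wt h by (rule 1)
  interpret H': hw_hom s ip n T A V' v' wt' h' by (rule 2)
  have lead: "ip y h' = 0" if "(x, y) \<in> hw_graph n s A V v h" for x y
    using that
  proof (induction rule: hw_graph.induct)
    case (lower z x y)
    note z = sl_subsets(1)[OF lower(1)]
    have "ip (A z y) h' = ip y (A (adj n z) h')"
      using H.D_closed[OF lower(2)] by (intro H.A_adj H.sl_carrier z H'.hT) simp
    then show ?case using H'.hT(2)[OF adj_lower[OF lower(1)]] by simp
  qed (simp_all add: orth H.ip_add H.ip_scale)
  have "ip y y' = 0" if "(x', y') \<in> hw_graph n s A V' v' h'" "(x, y) \<in> hw_graph n s A V v h" for x y x' y'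
    using that
  proof (induction arbitrary: x y rule: hw_graph.induct)
    case base
    then show ?case by (rule lead)
  next
    case (lower z x' y')
    note z = sl_subsets(1)[OF lower(1)]
    have "ip (A (adj n z) y) y' = 0" by (rule lower(3)[OF H.D_sl[OF lower(4) adj_sl[OF z]]])
    then show ?case
      using H.adj_swap[OF z, of y y'] H.D_closed[OF lower(4)] H'.D_closed[OF lower(2)] by simp
  qed (simp_all add: H.ip_add_right H.ip_scale_right)
  then show ?thesis using H.psi_D[OF x] H'.psi_D[OF x'] by blast
qed

text \<open>The multiplicity space enters only through \<open>\<eta>\<close>, which identifies it
  linearly with the highest weight vectors of weight \<open>wt\<close> in \<open>T\<close>. The set
  \<open>B0\<close> bounds the dimension, so that these have a finite orthogonal basis.\<close>

locale tensor_hw = unitary_sl s ip n T A + hw_mod n V v wt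
  for s :: "complex \<Rightarrow> 'b::ab_group_add \<Rightarrow> 'b" and ip n T A and V :: "(complex mat, 'v) rep" and v wt +
  fixes M :: "(complex, 'w) module" and \<eta> :: "'w \<Rightarrow> 'b" and B0 :: "'b set"
  assumes fin_dim: "finite B0" "T \<subseteq> span B0"
    and M_add: "m \<in> carrier M \<Longrightarrow> m' \<in> carrier M \<Longrightarrow> m \<oplus>\<^bsub>M\<^esub> m' \<in> carrier M"
    and M_smult: "m \<in> carrier M \<Longrightarrow> c \<odot>\<^bsub>M\<^esub> m \<in> carrier M"
    and \<eta>_bij: "bij_betw \<eta> (carrier M) (HW wt)"
    and \<eta>_add: "m \<in> carrier M \<Longrightarrow> m' \<in> carrier M \<Longrightarrow> \<eta> (m \<oplus>\<^bsub>M\<^esub> m') = \<eta> m + \<eta> m'"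
    and \<eta>_smult: "m \<in> carrier M \<Longrightarrow> \<eta> (c \<odot>\<^bsub>M\<^esub> m) = s c (\<eta> m)"
begin

abbreviation "\<Psi> \<equiv> hw_map n s A V v"

lemma hom: "h \<in> HW wt \<Longrightarrow> hw_hom s ip n T A V v wt h"
  by unfold_locales

lemma Psi_simps:
  assumes h: "h \<in> HW wt" and x: "x \<in> carrier V"
  shows "\<Psi> h x \<in> T" "y \<in> carrier V \<Longrightarrow> \<Psi> h (x \<oplus>\<^bsub>V\<^esub> y) = \<Psi> h x + \<Psi> h y"
    "\<Psi> h (c \<odot>\<^bsub>V\<^esub> x) = s c (\<Psi> h x)" "g \<in> sl n \<Longrightarrow> \<Psi> h (act V g x) = A g (\<Psi> h x)"
    "\<Psi> h \<zero>\<^bsub>V\<^esub> = 0" "\<Psi> h v = h"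
proof -
  interpret hw_hom s ip n T A V v wt h by (rule hom[OF h])
  show "\<Psi> h x \<in> T" "y \<in> carrier V \<Longrightarrow> \<Psi> h (x \<oplus>\<^bsub>V\<^esub> y) = \<Psi> h x + \<Psi> h y"
    "\<Psi> h (c \<odot>\<^bsub>V\<^esub> x) = s c (\<Psi> h x)" "g \<in> sl n \<Longrightarrow> \<Psi> h (act V g x) = A g (\<Psi> h x)"
    "\<Psi> h \<zero>\<^bsub>V\<^esub> = 0" "\<Psi> h v = h"
    using psi_T[OF x] psi_add[OF x] psi_smult[OF x] psi_act[OF x] psi_zero psi_v by simp_all
qed

text \<open>Both sides are equivariant in \<open>x\<close> and agree at \<open>v\<close>, which
  generates \<open>V\<close>.\<close>

lemma Psi_linear:
  assumes h: "h \<in> HW wt" and h': "h' \<in> HW wt" and x: "x \<in> carrier V"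
  shows "\<Psi> (h + h') x = \<Psi> h x + \<Psi> h' x" "\<Psi> (s c h) x = s c (\<Psi> h x)"
proof -
  have hh: "h + h' \<in> HW wt" "s c h \<in> HW wt"
    using h h' subspace_HW by (simp_all add: subspace_def)
  show "\<Psi> (h + h') x = \<Psi> h x + \<Psi> h' x"
  proof (rule irreducible_induct[where P = "\<lambda>x. \<Psi> (h + h') x = \<Psi> h x + \<Psi> h' x", OF irr v _ _ _ _ _ x])
    fix g x assume "g \<in> sl n" "x \<in> carrier V" "\<Psi> (h + h') x = \<Psi> h x + \<Psi> h' x"
    then show "\<Psi> (h + h') (act V g x) = \<Psi> h (act V g x) + \<Psi> h' (act V g x)"
      using h h' hh by (simp add: Psi_simps A_add sl_carrier)
  qed (use h h' hh v in \<open>simp_all add: Psi_simps(2,3,5,6)[OF _ v(1)] Psi_simps(2,3) scale_right_distrib\<close>)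
  show "\<Psi> (s c h) x = s c (\<Psi> h x)"
  proof (rule irreducible_induct[where P = "\<lambda>x. \<Psi> (s c h) x = s c (\<Psi> h x)", OF irr v _ _ _ _ _ x])
    fix g x assume "g \<in> sl n" "x \<in> carrier V" "\<Psi> (s c h) x = s c (\<Psi> h x)"
    then show "\<Psi> (s c h) (act V g x) = s c (\<Psi> h (act V g x))"
      using h hh by (simp add: Psi_simps A_scale sl_carrier)
  qed (use h hh v in \<open>simp_all add: Psi_simps(2,3,5,6)[OF _ v(1)] Psi_simps(2,3) scale_right_distrib mult.commute\<close>)
qed

lemma \<eta>_HW: "m \<in> carrier M \<Longrightarrow> \<eta> m \<in> HW wt"
  using \<eta>_bij by (auto simp: bij_betw_def)

abbreviation pairs :: "('v \<times> 'w) set" where "pairs \<equiv> carrier V \<times> carrier M"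

definition pair_val :: "'v \<times> 'w \<Rightarrow> 'b" where
  "pair_val k = \<Psi> (\<eta> (snd k)) (fst k)"

definition val :: "('v \<times> 'w \<Rightarrow>\<^sub>0 complex) \<Rightarrow> 'b" where
  "val p = (\<Sum>k\<in>Poly_Mapping.keys p. s (cf p k) (pair_val k))"

lemma val_eq: "finite S \<Longrightarrow> Poly_Mapping.keys p \<subseteq> S \<Longrightarrow> val p = (\<Sum>k\<in>S. s (cf p k) (pair_val k))"
  unfolding val_def by (intro sum.mono_neutral_left) (auto simp: in_keys_iff)

lemma val_add: "val (p + q) = val p + val q"
  using keys_add[of p q] 
  by (simp add: val_eq[of "Poly_Mapping.keys p \<union> Poly_Mapping.keys q"] lookup_add scale_left_distrib sum.distrib)

lemma val_pscale: "val (pscale c p) = s c (val p)"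
proof -
  have "Poly_Mapping.keys (pscale c p) \<subseteq> Poly_Mapping.keys p" by (auto simp: in_keys_iff)
  then show ?thesis by (simp add: val_eq[of "Poly_Mapping.keys p"] scale_sum_right)
qed

lemma val_single: "val (Poly_Mapping.single k c) = s c (pair_val k)"
  by (simp add: val_def)

lemma val_diff: "val (p - q) = val p - val q"
  using val_add[of "p - q" q] by simp

lemma val_sum: "val (sum f S) = (\<Sum>x\<in>S. val (f x))"
proof -
  have "val 0 = 0" by (simp add: val_def)
  then show ?thesis by (induction S rule: infinite_finite_induct) (simp_all add: val_add)
qed

definition FM :: "(complex mat, 'v \<times> 'w \<Rightarrow>\<^sub>0 complex) rep" where
  "FM = free_rep pairs (\<lambda>x (v, w). (act V x v, w))"

lemma carrier_FM: "carrier FM = {p. Poly_Mapping.keys p \<subseteq> pairs}"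
  by (simp add: FM_def free_rep_def mk_rep_def)

lemma act_FM: "act FM x = reindex (\<lambda>(v, w). (act V x v, w))"
  by (simp add: FM_def free_rep_def mk_rep_def)

lemma subspace_FM: "free_vs.subspace (carrier FM)"
  using concrete_space.Vsub[OF concrete_space_free_rep] unfolding FM_def .

abbreviation single1 :: "'v \<Rightarrow> 'w \<Rightarrow> 'v \<times> 'w \<Rightarrow>\<^sub>0 complex" where
  "single1 x m \<equiv> Poly_Mapping.single (x, m) 1"

lemma FM_single: "x \<in> carrier V \<Longrightarrow> m \<in> carrier M \<Longrightarrow> Poly_Mapping.single (x, m) c \<in> carrier FM"
  by (simp add: carrier_FM)

definition NR :: "('v \<times> 'w \<Rightarrow>\<^sub>0 complex) set" where
  "NR = free_vs.span (bilinear_relations V M)"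

lemma relations:
  "bilinear_relations V M =
       {single1 (x \<oplus>\<^bsub>V\<^esub> x') w - single1 x w - single1 x' w | x x' w.
          x \<in> carrier V \<and> x' \<in> carrier V \<and> w \<in> carrier M} \<union>
       {single1 x (w \<oplus>\<^bsub>M\<^esub> w') - single1 x w - single1 x w' | x w w'.
          x \<in> carrier V \<and> w \<in> carrier M \<and> w' \<in> carrier M} \<union>
       {single1 (c \<odot>\<^bsub>V\<^esub> x) w - Poly_Mapping.single (x, w) c | c x w.
          x \<in> carrier V \<and> w \<in> carrier M} \<union>
       {single1 x (c \<odot>\<^bsub>M\<^esub> w) - Poly_Mapping.single (x, w) c | c x w.
          x \<in> carrier V \<and> w \<in> carrier M}"
  unfolding bilinear_relations_def Let_def ..

lemma NR_rel:
  assumes x: "x \<in> carrier V" and m: "m \<in> carrier M"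
  shows "x' \<in> carrier V \<Longrightarrow> single1 (x \<oplus>\<^bsub>V\<^esub> x') m - single1 x m - single1 x' m \<in> NR"
    "m' \<in> carrier M \<Longrightarrow> single1 x (m \<oplus>\<^bsub>M\<^esub> m') - single1 x m - single1 x m' \<in> NR"
    "single1 (c \<odot>\<^bsub>V\<^esub> x) m - Poly_Mapping.single (x, m) c \<in> NR"
    "single1 x (c \<odot>\<^bsub>M\<^esub> m) - Poly_Mapping.single (x, m) c \<in> NR"
  unfolding NR_def relations
  by (rule free_vs.span_base, use x m in blast)+

lemma NR_add: "p \<in> NR \<Longrightarrow> q \<in> NR \<Longrightarrow> p + q \<in> NR"
  and NR_diff: "p \<in> NR \<Longrightarrow> q \<in> NR \<Longrightarrow> p - q \<in> NR"
  and NR_pscale: "p \<in> NR \<Longrightarrow> pscale c p \<in> NR" and NR_0: "0 \<in> NR"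
  unfolding NR_def by (rule free_vs.span_add free_vs.span_diff free_vs.span_scale free_vs.span_zero; assumption?)+

lemma NR_sum: "(\<And>x. x \<in> S \<Longrightarrow> f x \<in> NR) \<Longrightarrow> sum f S \<in> NR"
  unfolding NR_def by (rule free_vs.span_sum)

lemma relations_val: 
  assumes "r \<in> bilinear_relations V M" shows "r \<in> carrier FM \<and> val r = 0"
proof -
  note FMs = FM_single free_vs.subspace_diff[OF subspace_FM]
  from assms consider
    (a) x x' w where "x \<in> carrier V" "x' \<in> carrier V" "w \<in> carrier M" "r = single1 (x \<oplus>\<^bsub>V\<^esub> x') w - single1 x w - single1 x' w"
  | (b) x w w' where "x \<in> carrier V" "w \<in> carrier M" "w' \<in> carrier M" "r = single1 x (w \<oplus>\<^bsub>M\<^esub> w') - single1 x w - single1 x w'"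
  | (c) c x w where "x \<in> carrier V" "w \<in> carrier M" "r = single1 (c \<odot>\<^bsub>V\<^esub> x) w - Poly_Mapping.single (x, w) c"
  | (d) c x w where "x \<in> carrier V" "w \<in> carrier M" "r = single1 x (c \<odot>\<^bsub>M\<^esub> w) - Poly_Mapping.single (x, w) c"
    unfolding relations by blast
  then show ?thesis
  proof cases
    case a
    then show ?thesis
      by (simp add: FMs val_diff val_single pair_val_def Psi_simps(2)[OF \<eta>_HW])
  next
    case b
    then show ?thesis
      by (simp add: FMs M_add val_diff val_single pair_val_def \<eta>_add Psi_linear(1)[OF \<eta>_HW \<eta>_HW])
  next
    case c
    then show ?thesis
      by (simp add: FMs val_diff val_single pair_val_def Psi_simps(3)[OF \<eta>_HW])
  next
    case d
    then show ?thesis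
      by (simp add: FMs M_smult val_diff val_single pair_val_def \<eta>_smult Psi_linear(2)[OF \<eta>_HW \<eta>_HW])
  qed
qed

lemma NR_val: "r \<in> NR \<Longrightarrow> r \<in> carrier FM \<and> val r = 0"
  unfolding NR_def
proof (induction rule: free_vs.span_induct_alt)
  case base
  then show ?case by (simp add: val_def free_vs.subspace_0[OF subspace_FM])
next
  case (step c x y)
  then show ?case
    using relations_val[OF step(1)] free_vs.subspace_add[OF subspace_FM] free_vs.subspace_scale[OF subspace_FM]
    by (simp add: val_add val_pscale)
qed

lemma exists_HW_basis: obtains E where "orthogonal_set E" "span E = HW wt"
proof -
  have "HW wt \<subseteq> span B0" using fin_dim(2) by (auto simp: HW_def)
  then show thesis using exists_orthogonal_basis[OF subspace_HW _ fin_dim(1)] that by blast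
qed

text \<open>Modulo the bilinearity relations every element is a sum of pure tensors whose second factors
  run through a fixed orthogonal basis; orthogonality then makes the summands of its image vanish
  separately.\<close>

lemma val_eq_0_NR:
  assumes p: "p \<in> carrier FM" and val: "val p = 0" shows "p \<in> NR"
proof -
  obtain E where E: "orthogonal_set E" "span E = HW wt" by (rule exists_HW_basis)
  have fE: "finite E" using E(1) by (simp add: orthogonal_set_def)
  \<comment> \<open>\<open>\<mu>\<close> is the inverse of \<open>\<eta>\<close> here, not a
    partition.\<close>
  define \<mu> where "\<mu> = inv_into (carrier M) \<eta>"
  have \<mu>: "\<mu> h \<in> carrier M" "\<eta> (\<mu> h) = h" if "h \<in> HW wt" for h
    using \<eta>_bij that unfolding \<mu>_def bij_betw_def by (auto intro: inv_into_into f_inv_into_f)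
  have \<mu>\<eta>: "\<mu> (\<eta> m) = m" if "m \<in> carrier M" for m
    using \<eta>_bij that unfolding \<mu>_def bij_betw_def by auto
  have EH: "e \<in> HW wt" if "e \<in> E" for e using E(2) span_base[OF that] by simp
  \<comment> \<open>\<open>S \<xi>\<close> is the sum of the tensors of \<open>\<xi> e\<close> with
    \<open>\<mu> e\<close> over the basis; the predicate \<open>NF\<close> defined next expresses
    congruence to such a sum.\<close>
  define S where "S \<xi> = (\<Sum>e\<in>E. single1 (\<xi> e) (\<mu> e))" for \<xi>
  define NF where "NF q \<longleftrightarrow> (\<exists>\<xi>. (\<forall>e\<in>E. \<xi> e \<in> carrier V) \<and> q - S \<xi> \<in> NR)" for q
  have zero_l: "single1 \<zero>\<^bsub>V\<^esub> m \<in> NR" if "m \<in> carrier M" for m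
    using NR_rel(3)[OF closed(1) that, of 0] by simp
  have NF_add: "NF (q + q')" if q: "NF q" "NF q'" for q q'
  proof -
    obtain \<xi> \<xi>' where x: "\<And>e. e \<in> E \<Longrightarrow> \<xi> e \<in> carrier V" "q - S \<xi> \<in> NR" "\<And>e. e \<in> E \<Longrightarrow> \<xi>' e \<in> carrier V" "q' - S \<xi>' \<in> NR"
      using q unfolding NF_def by blast
    have "(\<Sum>e\<in>E. single1 (\<xi> e \<oplus>\<^bsub>V\<^esub> \<xi>' e) (\<mu> e) - single1 (\<xi> e) (\<mu> e) - single1 (\<xi>' e) (\<mu> e)) \<in> NR"
      by (intro NR_sum NR_rel(1) x \<mu> EH)
    then have d: "S (\<lambda>e. \<xi> e \<oplus>\<^bsub>V\<^esub> \<xi>' e) - S \<xi> - S \<xi>' \<in> NR" by (simp add: S_def sum_subtractf)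
    have "(q - S \<xi>) + (q' - S \<xi>') - (S (\<lambda>e. \<xi> e \<oplus>\<^bsub>V\<^esub> \<xi>' e) - S \<xi> - S \<xi>') \<in> NR"
      by (intro NR_diff NR_add x d)
    moreover have "(q - S \<xi>) + (q' - S \<xi>') - (S (\<lambda>e. \<xi> e \<oplus>\<^bsub>V\<^esub> \<xi>' e) - S \<xi> - S \<xi>') = q + q' - S (\<lambda>e. \<xi> e \<oplus>\<^bsub>V\<^esub> \<xi>' e)"
      by simp
    ultimately show ?thesis unfolding NF_def using x by (intro exI[of _ "\<lambda>e. \<xi> e \<oplus>\<^bsub>V\<^esub> \<xi>' e"]) simp
  qed
  have NF_cong: "NF q" if NFq: "NF q'" "q - q' \<in> NR" for q q'
  proof -
    obtain \<xi> where x: "\<forall>e\<in>E. \<xi> e \<in> carrier V" "q' - S \<xi> \<in> NR" using NFq(1) unfolding NF_def by blast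
    have "(q - q') + (q' - S \<xi>) \<in> NR" by (rule NR_add[OF NFq(2) x(2)])
    then show ?thesis unfolding NF_def using x(1) by auto
  qed
  have NF_0: "NF 0"
  proof -
    have "S (\<lambda>e. \<zero>\<^bsub>V\<^esub>) \<in> NR" unfolding S_def by (intro NR_sum zero_l \<mu> EH)
    then have "0 - S (\<lambda>e. \<zero>\<^bsub>V\<^esub>) \<in> NR" by (rule NR_diff[OF NR_0])
    then show ?thesis unfolding NF_def by (intro exI[of _ "\<lambda>e. \<zero>\<^bsub>V\<^esub>"]) simp
  qed
  have NF_basis: "NF (single1 x (\<mu> e))" if x: "x \<in> carrier V" and e: "e \<in> E" for x e
  proof -
    let ?\<xi> = "\<lambda>d. if d = e then x else \<zero>\<^bsub>V\<^esub>"
    have "S ?\<xi> = single1 x (\<mu> e) + (\<Sum>d\<in>E - {e}. single1 \<zero>\<^bsub>V\<^esub> (\<mu> d))"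
      unfolding S_def by (subst sum.remove[OF fE e]) simp
    moreover have "(\<Sum>d\<in>E - {e}. single1 \<zero>\<^bsub>V\<^esub> (\<mu> d)) \<in> NR" by (intro NR_sum zero_l \<mu> EH) simp
    ultimately have "single1 x (\<mu> e) - S ?\<xi> \<in> NR" using NR_diff[OF NR_0] by simp
    then show ?thesis unfolding NF_def using x by (intro exI[of _ ?\<xi>]) simp
  qed
  have NF_HW: "h \<in> HW wt \<and> (\<forall>x\<in>carrier V. NF (single1 x (\<mu> h)))" if "h \<in> span E" for h
    using that
  proof (induction rule: span_induct_alt)
    case base
    have 0: "0 \<in> HW wt" by (rule subspace_0[OF subspace_HW])
    \<comment> \<open>The preimage of 0 is expressed as a multiple by the scalar 0, to which the
      relation for scalars in the second factor applies.\<close>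
    have m0: "\<mu> 0 = 0 \<odot>\<^bsub>M\<^esub> \<mu> 0"
      using \<mu>\<eta>[OF M_smult[OF \<mu>(1)[OF 0]], of 0] \<mu>[OF 0] by (simp add: \<eta>_smult)
    show ?case
    proof (intro conjI 0 ballI)
      fix x assume x: "x \<in> carrier V"
      have "single1 x (\<mu> 0) - 0 \<in> NR"
        using NR_rel(4)[OF x \<mu>(1)[OF 0], of 0] m0 by simp
      then show "NF (single1 x (\<mu> 0))" using NF_cong[OF NF_0] by blast
    qed
  next
    case (step c e h)
    have h: "h \<in> HW wt" using step(2) by simp
    note eH = EH[OF step(1)]
    have m: "\<mu> (s c e + h) = (c \<odot>\<^bsub>M\<^esub> \<mu> e) \<oplus>\<^bsub>M\<^esub> \<mu> h"
      using \<mu>\<eta>[OF M_add[OF M_smult[OF \<mu>(1)[OF eH]] \<mu>(1)[OF h]], of c] \<mu>[OF eH] \<mu>[OF h]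
      by (simp add: \<eta>_add \<eta>_smult M_smult)
    have "s c e + h \<in> HW wt" using subspace_add[OF subspace_HW subspace_scale[OF subspace_HW eH] h] .
    then show ?case
    proof (intro conjI ballI)
      fix x assume x: "x \<in> carrier V"
      have 1: "single1 x (\<mu> (s c e + h)) - single1 x (c \<odot>\<^bsub>M\<^esub> \<mu> e) - single1 x (\<mu> h) \<in> NR"
        unfolding m by (intro NR_rel(2) x M_smult \<mu> eH h)
      have 2: "single1 x (c \<odot>\<^bsub>M\<^esub> \<mu> e) - Poly_Mapping.single (x, \<mu> e) c \<in> NR" by (intro NR_rel(4) x \<mu> eH)
      have 3: "single1 (c \<odot>\<^bsub>V\<^esub> x) (\<mu> e) - Poly_Mapping.single (x, \<mu> e) c \<in> NR" by (intro NR_rel(3) x \<mu> eH)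
      have 4: "single1 x (\<mu> (s c e + h)) - (single1 (c \<odot>\<^bsub>V\<^esub> x) (\<mu> e) + single1 x (\<mu> h)) \<in> NR"
        using NR_diff[OF NR_add[OF 1 2] 3] by (simp add: algebra_simps)
      have "NF (single1 (c \<odot>\<^bsub>V\<^esub> x) (\<mu> e) + single1 x (\<mu> h))"
        using step(2) x by (intro NF_add NF_basis[OF closed(3)[OF x] step(1)]) simp
      then show "NF (single1 x (\<mu> (s c e + h)))" using 4 by (rule NF_cong)
    qed
  qed
  have NF_single: "NF (Poly_Mapping.single (x, m) c)" if x: "x \<in> carrier V" and m: "m \<in> carrier M" for x m c
  proof -
    have "NF (single1 (c \<odot>\<^bsub>V\<^esub> x) m)" using NF_HW[of "\<eta> m"] \<eta>_HW[OF m] \<mu>\<eta>[OF m] E(2) x by auto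
    moreover have "Poly_Mapping.single (x, m) c - single1 (c \<odot>\<^bsub>V\<^esub> x) m \<in> NR"
      using NR_diff[OF NR_0 NR_rel(3)[OF x m, of c]] by simp
    ultimately show ?thesis by (rule NF_cong)
  qed
  have "NF (\<Sum>k\<in>K. Poly_Mapping.single k (cf p k))" if "finite K" "K \<subseteq> pairs" for K
    using that by (induction K rule: finite_induct) (auto simp: NF_0 intro!: NF_add NF_single)
  from this[of "Poly_Mapping.keys p"] have "NF p"
    using p by (simp add: carrier_FM poly_mapping_sum_single)
  then obtain \<xi> where \<xi>: "\<And>e. e \<in> E \<Longrightarrow> \<xi> e \<in> carrier V" "p - S \<xi> \<in> NR" unfolding NF_def by blast
  have "val (S \<xi>) = 0" using NR_val[OF \<xi>(2)] val by (simp add: val_diff)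
  then have sum0: "(\<Sum>e\<in>E. \<Psi> e (\<xi> e)) = 0"
    unfolding S_def val_sum by (simp add: val_single pair_val_def \<mu> EH cong: sum.cong)
  have \<xi>0: "\<xi> e = \<zero>\<^bsub>V\<^esub>" if e: "e \<in> E" for e
  proof -
    have "0 = ip (\<Sum>d\<in>E. \<Psi> d (\<xi> d)) (\<Psi> e (\<xi> e))" by (simp add: sum0)
    also have "\<dots> = (\<Sum>d\<in>E. ip (\<Psi> d (\<xi> d)) (\<Psi> e (\<xi> e)))" by (rule ip_sum)
    also have "\<dots> = (\<Sum>d\<in>E. if d = e then ip (\<Psi> e (\<xi> e)) (\<Psi> e (\<xi> e)) else 0)"
    proof (rule sum.cong[OF refl])
      fix d assume d: "d \<in> E"
      show "ip (\<Psi> d (\<xi> d)) (\<Psi> e (\<xi> e)) = (if d = e then ip (\<Psi> e (\<xi> e)) (\<Psi> e (\<xi> e)) else 0)"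
      proof (cases "d = e")
        case False
        then have "ip d e = 0" using E(1) d e by (simp add: orthogonal_set_def)
        then show ?thesis
          using hw_map_orthogonal[OF hom[OF EH[OF d]] hom[OF EH[OF e]] _ \<xi>(1)[OF d] \<xi>(1)[OF e]] False by simp
      qed simp
    qed
    also have "\<dots> = ip (\<Psi> e (\<xi> e)) (\<Psi> e (\<xi> e))" using fE e by simp
    finally have "\<Psi> e (\<xi> e) = 0" using ip_definite by simp
    moreover have "e \<noteq> 0" using E(1) e by (auto simp: orthogonal_set_def)
    ultimately show ?thesis using hw_hom.psi_injective[OF hom[OF EH[OF e]]] \<xi>(1)[OF e] by simp
  qed
  have "S \<xi> = (\<Sum>e\<in>E. single1 \<zero>\<^bsub>V\<^esub> (\<mu> e))" unfolding S_def by (rule sum.cong) (simp_all add: \<xi>0)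
  also have "\<dots> \<in> NR" by (intro NR_sum zero_l \<mu> EH)
  finally have "(p - S \<xi>) + S \<xi> \<in> NR" by (rule NR_add[OF \<xi>(2)])
  then show ?thesis by simp
qed

lemma NR_kernel: "NR = fiber (carrier FM) val 0"
  using NR_val val_eq_0_NR by (auto simp: fiber_def)

lemma tensor_quot: "tensor_rep V M = quot_rep FM (fiber (carrier FM) val 0)"
proof -
  have "bilinear_relations V M \<subseteq> carrier FM" using relations_val by blast
  then have "mspan class_ring FM (bilinear_relations V M) = NR"
    unfolding NR_def FM_def by (rule concrete_space.mspan_eq[OF concrete_space_free_rep])
  then show ?thesis unfolding tensor_rep_def Let_def FM_def[symmetric] NR_kernel[symmetric] by simp
qed

lemma linear_quotient_FM: "linear_quotient FM pscale val s"
  by (rule linear_quotient.intro)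
    (simp_all add: FM_def concrete_space_free_rep val_add val_pscale)

lemma act_FM_closed:
  assumes g: "g \<in> sl n" and p: "p \<in> carrier FM"
  shows "act FM g p \<in> carrier FM" "val (act FM g p) = A g (val p)" "val p \<in> T"
proof -
  have rep: "p = (\<Sum>k\<in>Poly_Mapping.keys p. Poly_Mapping.single k (cf p k))"
    by (rule poly_mapping_sum_single[symmetric])
  have "Poly_Mapping.keys (act FM g p) \<subseteq> (\<lambda>(v, w). (act V g v, w)) ` Poly_Mapping.keys p"
    unfolding act_FM by (rule keys_reindex)
  then show "act FM g p \<in> carrier FM" using p g by (fastforce simp: carrier_FM)
  have pv: "pair_val k \<in> T \<and> pair_val (case k of (v, w) \<Rightarrow> (act V g v, w)) = A g (pair_val k)" if "k \<in> pairs" for k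
    using that g by (auto simp: pair_val_def Psi_simps \<eta>_HW)
  have *: "val (\<Sum>k\<in>K. Poly_Mapping.single k (cf p k)) \<in> T \<and>
     val (reindex (\<lambda>(v, w). (act V g v, w)) (\<Sum>k\<in>K. Poly_Mapping.single k (cf p k)))
     = A g (val (\<Sum>k\<in>K. Poly_Mapping.single k (cf p k)))" if "finite K" "K \<subseteq> pairs" for K
    using that
  proof (induction K rule: finite_induct)
    case empty
    show ?case using T_closed(1) A_zero[OF sl_carrier[OF g]] by (simp add: val_def reindex_def)
  next
    case (insert k K)
    then have k: "pair_val k \<in> T" "pair_val (case k of (v, w) \<Rightarrow> (act V g v, w)) = A g (pair_val k)" using pv by auto
    then show ?case
      using insert by (simp add: reindex_add val_add val_single T_closed A_add[OF sl_carrier[OF g]] A_scale[OF sl_carrier[OF g]])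
  qed
  from *[of "Poly_Mapping.keys p"] show "val (act FM g p) = A g (val p)" "val p \<in> T"
    using p unfolding act_FM by (simp_all add: carrier_FM poly_mapping_sum_single)
qed

definition tensor_val :: "('v \<times> 'w \<Rightarrow>\<^sub>0 complex) set \<Rightarrow> 'b" where
  "tensor_val = inv_into (val ` carrier FM) (fiber (carrier FM) val)"

definition image :: "'b set" where "image = val ` carrier FM"

lemma subspace_image: "subspace image"
proof (rule subspaceI)
  have "val 0 = 0" by (simp add: val_def)
  then show "0 \<in> image" unfolding image_def using free_vs.subspace_0[OF subspace_FM] by (intro image_eqI[of _ _ 0]) simp_all
  fix x y assume "x \<in> image" "y \<in> image"
  then obtain p q where "p \<in> carrier FM" "q \<in> carrier FM" "x = val p" "y = val q" by (auto simp: image_def)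
  then show "x + y \<in> image"
    unfolding image_def using free_vs.subspace_add[OF subspace_FM] by (intro image_eqI[of _ _ "p + q"]) (simp_all add: val_add)
next
  fix c x assume "x \<in> image"
  then obtain p where "p \<in> carrier FM" "x = val p" by (auto simp: image_def)
  then show "s c x \<in> image"
    unfolding image_def using free_vs.subspace_scale[OF subspace_FM] by (intro image_eqI[of _ _ "pscale c p"]) (simp_all add: val_pscale)
qed

lemma image_sl: "g \<in> sl n \<Longrightarrow> u \<in> image \<Longrightarrow> A g u \<in> image"
  unfolding image_def using act_FM_closed(1,2) by (auto simp: image_iff) metis

lemma image_T: assumes "u \<in> image" shows "u \<in> T"
  using assms act_FM_closed(3)[OF sl_subsets(1)[OF zero_sl_lower]] by (auto simp: image_def)

lemma HW_image: assumes "h \<in> HW wt" shows "h \<in> image"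
proof -
  obtain m where m: "m \<in> carrier M" "h = \<eta> m" using assms \<eta>_bij by (auto simp: bij_betw_def)
  have "val (single1 v m) = h" using Psi_simps(6)[OF assms v(1)] by (simp add: val_single pair_val_def m)
  then show ?thesis unfolding image_def using FM_single[OF v(1) m(1), of 1] by (intro image_eqI[of _ _ "single1 v m"]) simp_all
qed

lemma image_span: "u \<in> image \<Longrightarrow> u \<in> span {\<Psi> h x | h x. h \<in> HW wt \<and> x \<in> carrier V}"
proof -
  assume "u \<in> image"
  then obtain p where p: "p \<in> carrier FM" "u = val p" by (auto simp: image_def)
  have "s (cf p k) (pair_val k) \<in> span {\<Psi> h x | h x. h \<in> HW wt \<and> x \<in> carrier V}" if "k \<in> Poly_Mapping.keys p" for k
  proof -
    have "k \<in> pairs" using that p(1) by (auto simp: carrier_FM)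
    then have "pair_val k \<in> {\<Psi> h x | h x. h \<in> HW wt \<and> x \<in> carrier V}"
      unfolding pair_val_def using \<eta>_HW[of "snd k"] by (intro CollectI exI[of _ "\<eta> (snd k)"] exI[of _ "fst k"]) auto
    then show ?thesis by (intro span_scale span_base)
  qed
  then show ?thesis unfolding p(2) val_def by (rule span_sum)
qed

lemma tensor_val:
  defines "W \<equiv> tensor_rep V M"
  shows "bij_betw tensor_val (carrier W) image" "\<zero>\<^bsub>W\<^esub> \<in> carrier W" "tensor_val \<zero>\<^bsub>W\<^esub> = 0"
    "Q \<in> carrier W \<Longrightarrow> Q' \<in> carrier W \<Longrightarrow> Q \<oplus>\<^bsub>W\<^esub> Q' \<in> carrier W \<and> tensor_val (Q \<oplus>\<^bsub>W\<^esub> Q') = tensor_val Q + tensor_val Q'"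
    "Q \<in> carrier W \<Longrightarrow> c \<odot>\<^bsub>W\<^esub> Q \<in> carrier W \<and> tensor_val (c \<odot>\<^bsub>W\<^esub> Q) = s c (tensor_val Q)"
    "g \<in> sl n \<Longrightarrow> Q \<in> carrier W \<Longrightarrow> act W g Q \<in> carrier W \<and> tensor_val (act W g Q) = A g (tensor_val Q)"
proof -
  interpret L: linear_quotient FM pscale val s by (rule linear_quotient_FM)
  let ?f = "fiber (carrier FM) val"
  have W: "W = quot_rep FM (?f 0)" unfolding W_def by (rule tensor_quot)
  have car: "carrier W = ?f ` image" unfolding W image_def by (rule L.carrier_quot)
  have inj: "inj_on ?f image" unfolding image_def by (rule L.inj_fib)
  have inv: "tensor_val (?f t) = t" if "t \<in> image" for t
    using inv_into_f_f[OF inj that] unfolding tensor_val_def image_def .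
  have addW: "?f t \<oplus>\<^bsub>W\<^esub> ?f t' = ?f (t + t')" if "t \<in> image" "t' \<in> image" for t t'
    using that unfolding W image_def by (rule L.add_quot)
  have smultW: "c \<odot>\<^bsub>W\<^esub> ?f t = ?f (s c t)" if "t \<in> image" for c t
    using that unfolding W image_def by (rule L.smult_quot)
  have actW: "act W g (?f t) = ?f (A g t)" if "g \<in> sl n" "t \<in> image" for g t
    using that(2) unfolding W image_def by (rule L.act_quot) (use act_FM_closed[OF that(1)] in blast)
  have zW: "\<zero>\<^bsub>W\<^esub> = ?f 0" unfolding W by (rule L.zero_quot)
  note i = subspace_0[OF subspace_image] subspace_add[OF subspace_image] subspace_scale[OF subspace_image] image_sl
  show "bij_betw tensor_val (carrier W) image"
    unfolding car by (rule bij_betwI[where g = ?f]) (auto simp: inv)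
  show "\<zero>\<^bsub>W\<^esub> \<in> carrier W" "tensor_val \<zero>\<^bsub>W\<^esub> = 0" using i(1) by (simp_all add: zW car inv)
  show "Q \<oplus>\<^bsub>W\<^esub> Q' \<in> carrier W \<and> tensor_val (Q \<oplus>\<^bsub>W\<^esub> Q') = tensor_val Q + tensor_val Q'"
    if Q: "Q \<in> carrier W" "Q' \<in> carrier W" for Q Q'
  proof -
    obtain t t' where t: "t \<in> image" "t' \<in> image" "Q = ?f t" "Q' = ?f t'" using Q unfolding car by blast
    then show ?thesis using i(2)[OF t(1,2)] by (simp add: addW inv car)
  qed
  show "c \<odot>\<^bsub>W\<^esub> Q \<in> carrier W \<and> tensor_val (c \<odot>\<^bsub>W\<^esub> Q) = s c (tensor_val Q)" if Q: "Q \<in> carrier W" for c Q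
  proof -
    obtain t where t: "t \<in> image" "Q = ?f t" using Q unfolding car by blast
    then show ?thesis using i(3)[OF t(1)] by (simp add: smultW inv car)
  qed
  show "act W g Q \<in> carrier W \<and> tensor_val (act W g Q) = A g (tensor_val Q)" if g: "g \<in> sl n" and Q: "Q \<in> carrier W" for g Q
  proof -
    obtain t where t: "t \<in> image" "Q = ?f t" using Q unfolding car by blast
    then show ?thesis using i(4)[OF g t(1)] by (simp add: actW[OF g] inv car)
  qed
qed

end

section \<open>Direct sums over the highest weights\<close>

text \<open>The assumption \<open>separating\<close> takes the role of complete reducibility. It
  combines the existence of highest weight vectors in nonzero modules with the fact that the index
  set \<open>I\<close> covers all their weights.\<close>

locale hw_family = unitary_sl s ip n T A
  for s :: "complex \<Rightarrow> 'b::ab_group_add \<Rightarrow> 'b" and ip n T A +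
  fixes I :: "'i set" and V :: "'i \<Rightarrow> (complex mat, 'v) rep" and v :: "'i \<Rightarrow> 'v" and wt :: "'i \<Rightarrow> complex mat \<Rightarrow> complex"
    and M :: "'i \<Rightarrow> (complex, 'w) module" and \<eta> :: "'i \<Rightarrow> 'w \<Rightarrow> 'b" and B0 :: "'b set"
  assumes finI: "finite I"
    and tensor: "i \<in> I \<Longrightarrow> tensor_hw s ip n T A (V i) (v i) (wt i) (M i) (\<eta> i) B0"
    and fin_dim: "finite B0" "T \<subseteq> span B0"
    and orth: "i \<in> I \<Longrightarrow> j \<in> I \<Longrightarrow> i \<noteq> j \<Longrightarrow> h \<in> HW (wt i) \<Longrightarrow> h' \<in> HW (wt j) \<Longrightarrow> ip h h' = 0"
    and separating: "subspace S \<Longrightarrow> S \<subseteq> T \<Longrightarrow> (\<And>g u. g \<in> sl n \<Longrightarrow> u \<in> S \<Longrightarrow> A g u \<in> S) \<Longrightarrow>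
      (\<And>u i h. u \<in> S \<Longrightarrow> i \<in> I \<Longrightarrow> h \<in> HW (wt i) \<Longrightarrow> ip u h = 0) \<Longrightarrow> u \<in> S \<Longrightarrow> u = 0"
begin

definition tval :: "'i \<Rightarrow> ('v \<times> 'w \<Rightarrow>\<^sub>0 complex) set \<Rightarrow> 'b" where
  "tval i = tensor_hw.tensor_val s n A (V i) (v i) (M i) (\<eta> i)"

definition im :: "'i \<Rightarrow> 'b set" where
  "im i = tensor_hw.image s n A (V i) (v i) (M i) (\<eta> i)"

abbreviation "DS \<equiv> direct_sum_rep I (\<lambda>i. tensor_rep (V i) (M i))"

lemma tval:
  assumes i: "i \<in> I"
  shows "bij_betw (tval i) (carrier (tensor_rep (V i) (M i))) (im i)"
    "\<zero>\<^bsub>tensor_rep (V i) (M i)\<^esub> \<in> carrier (tensor_rep (V i) (M i))" "tval i \<zero>\<^bsub>tensor_rep (V i) (M i)\<^esub> = 0"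
    "Q \<in> carrier (tensor_rep (V i) (M i)) \<Longrightarrow> Q' \<in> carrier (tensor_rep (V i) (M i)) \<Longrightarrow>
      Q \<oplus>\<^bsub>tensor_rep (V i) (M i)\<^esub> Q' \<in> carrier (tensor_rep (V i) (M i)) \<and> tval i (Q \<oplus>\<^bsub>tensor_rep (V i) (M i)\<^esub> Q') = tval i Q + tval i Q'"
    "Q \<in> carrier (tensor_rep (V i) (M i)) \<Longrightarrow> c \<odot>\<^bsub>tensor_rep (V i) (M i)\<^esub> Q \<in> carrier (tensor_rep (V i) (M i)) \<and>
      tval i (c \<odot>\<^bsub>tensor_rep (V i) (M i)\<^esub> Q) = s c (tval i Q)"
    "g \<in> sl n \<Longrightarrow> Q \<in> carrier (tensor_rep (V i) (M i)) \<Longrightarrow> act (tensor_rep (V i) (M i)) g Q \<in> carrier (tensor_rep (V i) (M i)) \<and>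
      tval i (act (tensor_rep (V i) (M i)) g Q) = A g (tval i Q)"
  unfolding tval_def im_def by (rule tensor_hw.tensor_val[OF tensor[OF i]]; assumption)+

lemma im_T: "i \<in> I \<Longrightarrow> u \<in> im i \<Longrightarrow> u \<in> T"
  unfolding im_def by (rule tensor_hw.image_T[OF tensor])

text \<open>Each summand is spanned by images of homomorphisms, so orthogonality reduces to
  \<open>hw_map_orthogonal\<close> for highest weight vectors with different indices.\<close>

lemma im_orth: assumes i: "i \<in> I" and j: "j \<in> I" and ij: "i \<noteq> j" and u: "u \<in> im i" and u': "u' \<in> im j"
  shows "ip u u' = 0"
proof -
  let ?X = "\<lambda>i. {hw_map n s A (V i) (v i) h x | h x. h \<in> HW (wt i) \<and> x \<in> carrier (V i)}"
  have sp: "u \<in> span (?X i)" "u' \<in> span (?X j)"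
    using tensor_hw.image_span[OF tensor[OF i]] tensor_hw.image_span[OF tensor[OF j]] u u' unfolding im_def by blast+
  have xy: "ip x y = 0" if x: "x \<in> ?X i" and y: "y \<in> ?X j" for x y
  proof -
    obtain h a h' b where *: "h \<in> HW (wt i)" "a \<in> carrier (V i)" "x = hw_map n s A (V i) (v i) h a"
      "h' \<in> HW (wt j)" "b \<in> carrier (V j)" "y = hw_map n s A (V j) (v j) h' b" using x y by blast
    show ?thesis unfolding *(3,6)
      by (rule hw_map_orthogonal[OF tensor_hw.hom[OF tensor[OF i] *(1)] tensor_hw.hom[OF tensor[OF j] *(4)] orth[OF i j ij *(1,4)] *(2,5)])
  qed
  have "ip u' x = 0" if "x \<in> ?X i" for x
    using ortho_span[of "?X j" x u', OF xy[OF that] sp(2)] by (rule ip_zero_sym)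
  then have "ip u' u = 0" using ortho_span[of "?X i" u' u] sp(1) by blast
  then show ?thesis by (rule ip_zero_sym)
qed

definition total :: "('i \<Rightarrow> ('v \<times> 'w \<Rightarrow>\<^sub>0 complex) set) \<Rightarrow> 'b" where
  "total f = (\<Sum>i\<in>I. tval i (f i))"

text \<open>Finiteness of \<open>I\<close> makes the finite-support condition of
  \<open>direct_sum_rep\<close> automatic.\<close>

lemma DS_simps:
  "carrier DS = (\<Pi>\<^sub>E i\<in>I. carrier (tensor_rep (V i) (M i)))"
  "\<zero>\<^bsub>DS\<^esub> = (\<lambda>i\<in>I. \<zero>\<^bsub>tensor_rep (V i) (M i)\<^esub>)"
  "f \<oplus>\<^bsub>DS\<^esub> g = (\<lambda>i\<in>I. f i \<oplus>\<^bsub>tensor_rep (V i) (M i)\<^esub> g i)"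
  "c \<odot>\<^bsub>DS\<^esub> f = (\<lambda>i\<in>I. c \<odot>\<^bsub>tensor_rep (V i) (M i)\<^esub> f i)"
  "act DS x f = (\<lambda>i\<in>I. act (tensor_rep (V i) (M i)) x (f i))"
  using finI by (auto simp: direct_sum_rep_def mk_rep_def)

lemma sums_T: "(\<And>i. i \<in> I \<Longrightarrow> t i \<in> im i) \<Longrightarrow> (\<Sum>i\<in>I. t i) \<in> T"
  by (rule subspace_sum[OF T]) (rule im_T)

lemma subspace_im: "i \<in> I \<Longrightarrow> subspace (im i)"
  unfolding im_def by (rule tensor_hw.subspace_image[OF tensor])

lemma im_sl: "i \<in> I \<Longrightarrow> g \<in> sl n \<Longrightarrow> u \<in> im i \<Longrightarrow> A g u \<in> im i"
  unfolding im_def by (rule tensor_hw.image_sl[OF tensor])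

lemma HW_im: "i \<in> I \<Longrightarrow> h \<in> HW (wt i) \<Longrightarrow> h \<in> im i"
  unfolding im_def by (rule tensor_hw.HW_image[OF tensor])

lemma sums_zero:
  assumes t: "\<And>i. i \<in> I \<Longrightarrow> t i \<in> im i" and sum: "(\<Sum>i\<in>I. t i) = 0" and i: "i \<in> I"
  shows "t i = 0"
proof -
  have "0 = ip (\<Sum>j\<in>I. t j) (t i)" by (simp add: sum)
  also have "\<dots> = (\<Sum>j\<in>I. if j = i then ip (t i) (t i) else 0)"
    unfolding ip_sum using im_orth[OF _ i _ t t[OF i]] by (intro sum.cong) auto
  also have "\<dots> = ip (t i) (t i)" using finI i by simp
  finally show ?thesis using ip_definite by simp
qed

text \<open>The orthogonal complement of the sum of the isotypic parts is stable and orthogonal to all highest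
  weight vectors.\<close>

lemma sums_surj:
  assumes u: "u \<in> T"
  shows "\<exists>t. (\<forall>i\<in>I. t i \<in> im i) \<and> u = (\<Sum>i\<in>I. t i)"
proof -
  define T' where "T' = {(\<Sum>i\<in>I. t i) | t. \<forall>i\<in>I. t i \<in> im i}"
  have im_T': "x \<in> T'" if i: "i \<in> I" and x: "x \<in> im i" for i x
  proof -
    have "x = (\<Sum>j\<in>I. if j = i then x else 0)" using finI i by simp
    moreover have "\<forall>j\<in>I. (if j = i then x else 0) \<in> im j" using x subspace_0[OF subspace_im] by simp
    ultimately show ?thesis unfolding T'_def by (intro CollectI exI[of _ "\<lambda>j. if j = i then x else 0"]) simp
  qed
  have sub: "subspace T'"
  proof (rule subspaceI)
    show "0 \<in> T'" unfolding T'_def using subspace_0[OF subspace_im] by (intro CollectI exI[of _ "\<lambda>_. 0"]) simp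
    fix x y assume "x \<in> T'" "y \<in> T'"
    then obtain t t' where "\<forall>i\<in>I. t i \<in> im i" "\<forall>i\<in>I. t' i \<in> im i" "x = (\<Sum>i\<in>I. t i)" "y = (\<Sum>i\<in>I. t' i)"
      by (auto simp: T'_def)
    then show "x + y \<in> T'"
      unfolding T'_def using subspace_add[OF subspace_im]
      by (intro CollectI exI[of _ "\<lambda>i. t i + t' i"]) (simp add: sum.distrib)
  next
    fix c x assume "x \<in> T'"
    then obtain t where "\<forall>i\<in>I. t i \<in> im i" "x = (\<Sum>i\<in>I. t i)" by (auto simp: T'_def)
    then show "s c x \<in> T'"
      unfolding T'_def using subspace_scale[OF subspace_im]
      by (intro CollectI exI[of _ "\<lambda>i. s c (t i)"]) (simp add: scale_sum_right)
  qed
  have T'T: "T' \<subseteq> T" using sums_T by (auto simp: T'_def)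
  have A_sum: "A g (\<Sum>i\<in>J. t i) = (\<Sum>i\<in>J. A g (t i))" if g: "g \<in> sl n" and t: "\<forall>i\<in>I. t i \<in> im i" and "finite J" "J \<subseteq> I" for g t J
    using that(3,4)
  proof (induction J rule: finite_induct)
    case (insert j J)
    have "(\<Sum>i\<in>J. t i) \<in> T" using insert.prems t by (intro subspace_sum[OF T]) (auto intro: im_T)
    then show ?case using insert t im_T[of j "t j"] by (simp add: A_add[OF sl_carrier[OF g]])
  qed (simp add: A_zero sl_carrier g)
  have T'_sl: "A g x \<in> T'" if g: "g \<in> sl n" and x: "x \<in> T'" for g x
  proof -
    obtain t where t: "\<forall>i\<in>I. t i \<in> im i" "x = (\<Sum>i\<in>I. t i)" using x by (auto simp: T'_def)
    then show ?thesis
      unfolding T'_def using A_sum[OF g t(1) finI] im_sl[OF _ g]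
      by (intro CollectI exI[of _ "\<lambda>i. A g (t i)"]) simp
  qed
  define S where "S = {x \<in> T. \<forall>y\<in>T'. ip x y = 0}"
  have S0: "x = 0" if x: "x \<in> S" for x
  proof (rule separating[OF _ _ _ _ x])
    have "S = T \<inter> {x. \<forall>y\<in>T'. ip x y = 0}" by (auto simp: S_def)
    then show "subspace S" using subspace_inter[OF T subspace_ortho] by simp
    show "S \<subseteq> T" by (auto simp: S_def)
    fix g u assume g: "g \<in> sl n" and u: "u \<in> S"
    have "ip (A g u) y = 0" if y: "y \<in> T'" for y
    proof -
      have "ip (A g u) y = ip u (A (adj n g) y)"
        using u y T'T by (intro A_adj sl_carrier g) (auto simp: S_def)
      also have "\<dots> = 0" using u T'_sl[OF adj_sl[OF g] y] by (simp add: S_def)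
      finally show ?thesis .
    qed
    then show "A g u \<in> S" using u A_closed[OF sl_carrier[OF g]] by (simp add: S_def)
  next
    fix u i h assume "u \<in> S" "i \<in> I" "h \<in> HW (wt i)"
    then show "ip u h = 0" using im_T'[OF _ HW_im] by (simp add: S_def)
  qed
  \<comment> \<open>The sum of the isotypic parts lies in the span of the finite set
    \<open>B0\<close>, so it has a finite orthogonal basis onto which \<open>u\<close> can be
    projected.\<close>
  obtain C where C: "orthogonal_set C" "span C = T'"
    by (rule exists_orthogonal_basis[OF sub _ fin_dim(1)]) (use T'T fin_dim(2) in blast)
  have pT': "proj C u \<in> T'" using proj_span[of C u] C(2) by simp
  have "ip (u - proj C u) y = 0" if "y \<in> T'" for y using that C(2) by (intro proj_ortho[OF C(1)]) simp
  then have "u - proj C u \<in> S" using u pT' T'T subspace_diff[OF T] by (auto simp: S_def)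
  then have "u = proj C u" using S0[of "u - proj C u"] by simp
  then have "u \<in> T'" using pT' by simp
  then show ?thesis by (auto simp: T'_def)
qed

lemma direct_sum_T:
  shows "sl_module n DS" "bij_betw total (carrier DS) T"
    "Q \<in> carrier DS \<Longrightarrow> Q' \<in> carrier DS \<Longrightarrow> total (Q \<oplus>\<^bsub>DS\<^esub> Q') = total Q + total Q'"
    "Q \<in> carrier DS \<Longrightarrow> total (c \<odot>\<^bsub>DS\<^esub> Q) = s c (total Q)"
    "g \<in> sl n \<Longrightarrow> Q \<in> carrier DS \<Longrightarrow> total (act DS g Q) = A g (total Q)"
proof -
  have mem: "Q i \<in> carrier (tensor_rep (V i) (M i))" if "Q \<in> carrier DS" "i \<in> I" for Q i
    using that by (auto simp: DS_simps)
  have tim: "tval i (Q i) \<in> im i" if "Q \<in> carrier DS" "i \<in> I" for Q i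
    using tval(1)[OF that(2)] mem[OF that] by (auto simp: bij_betw_def)
  have totT: "total Q \<in> T" if "Q \<in> carrier DS" for Q
    unfolding total_def by (rule sums_T) (rule tim[OF that])
  show add: "total (Q \<oplus>\<^bsub>DS\<^esub> Q') = total Q + total Q'" if "Q \<in> carrier DS" "Q' \<in> carrier DS" for Q Q'
    unfolding total_def sum.distrib[symmetric] DS_simps(3)
    by (rule sum.cong) (simp_all add: tval(4) mem[OF that(1)] mem[OF that(2)])
  show scale: "total (c \<odot>\<^bsub>DS\<^esub> Q) = s c (total Q)" if "Q \<in> carrier DS" for c Q
    unfolding total_def scale_sum_right DS_simps(4)
    by (rule sum.cong) (simp_all add: tval(5) mem[OF that])
  have A_sum: "A g (\<Sum>i\<in>J. tval i (Q i)) = (\<Sum>i\<in>J. A g (tval i (Q i)))"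
    if g: "g \<in> sl n" and Q: "Q \<in> carrier DS" and "finite J" "J \<subseteq> I" for g Q J
    using that(3,4)
  proof (induction J rule: finite_induct)
    case (insert j J)
    have "(\<Sum>i\<in>J. tval i (Q i)) \<in> T" using insert.prems by (intro subspace_sum[OF T] im_T[OF _ tim[OF Q]]) auto
    then show ?case using insert im_T[OF _ tim[OF Q], of j] by (simp add: A_add[OF sl_carrier[OF g]])
  qed (simp add: A_zero sl_carrier g)
  show act: "total (act DS g Q) = A g (total Q)" if g: "g \<in> sl n" and Q: "Q \<in> carrier DS" for g Q
    unfolding total_def A_sum[OF g Q finI subset_refl] DS_simps(5)
    by (rule sum.cong) (simp_all add: tval(6)[OF _ g] mem[OF Q])
  have closed: "Q \<oplus>\<^bsub>DS\<^esub> Q' \<in> carrier DS" if "Q \<in> carrier DS" "Q' \<in> carrier DS" for Q Q'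
    unfolding DS_simps(1) DS_simps(3) using tval(4) mem[OF that(1)] mem[OF that(2)] by (intro restrict_PiE_iff[THEN iffD2]) simp
  have closed2: "c \<odot>\<^bsub>DS\<^esub> Q \<in> carrier DS" if "Q \<in> carrier DS" for c Q
    unfolding DS_simps(1) DS_simps(4) using tval(5) mem[OF that] by (intro restrict_PiE_iff[THEN iffD2]) simp
  have closed3: "act DS g Q \<in> carrier DS" if "g \<in> sl n" "Q \<in> carrier DS" for g Q
    unfolding DS_simps(1) DS_simps(5) using tval(6)[OF _ that(1)] mem[OF that(2)] by (intro restrict_PiE_iff[THEN iffD2]) simp
  have zero: "\<zero>\<^bsub>DS\<^esub> \<in> carrier DS"
    unfolding DS_simps(1) DS_simps(2) using tval(2) by (intro restrict_PiE_iff[THEN iffD2]) simp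
  have tot0: "total \<zero>\<^bsub>DS\<^esub> = 0" unfolding total_def DS_simps(2) by (rule sum.neutral) (simp add: tval(3))
  have inj: "inj_on total (carrier DS)"
  proof (rule inj_onI)
    fix Q Q' assume Q: "Q \<in> carrier DS" and Q': "Q' \<in> carrier DS" and eq: "total Q = total Q'"
    have "tval i (Q i) - tval i (Q' i) = 0" if i: "i \<in> I" for i
    proof (rule sums_zero[OF _ _ i])
      show "tval i (Q i) - tval i (Q' i) \<in> im i" if "i \<in> I" for i
        by (rule subspace_diff[OF subspace_im[OF that] tim[OF Q that] tim[OF Q' that]])
      show "(\<Sum>i\<in>I. tval i (Q i) - tval i (Q' i)) = 0" using eq by (simp add: sum_subtractf total_def)
    qed
    then have "Q i = Q' i" if "i \<in> I" for i
      using tval(1)[OF that] mem[OF Q that] mem[OF Q' that] that by (auto simp: bij_betw_def dest: inj_onD)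
    then show "Q = Q'" using Q Q' unfolding DS_simps(1) by (rule PiE_ext[rotated 2])
  qed
  have surj: "total ` carrier DS = T"
  proof (intro equalityI subsetI)
    fix u assume "u \<in> T"
    then obtain t where t: "\<And>i. i \<in> I \<Longrightarrow> t i \<in> im i" "u = (\<Sum>i\<in>I. t i)" using sums_surj by blast
    define Q where "Q = (\<lambda>i\<in>I. inv_into (carrier (tensor_rep (V i) (M i))) (tval i) (t i))"
    have Q: "Q i \<in> carrier (tensor_rep (V i) (M i))" "tval i (Q i) = t i" if "i \<in> I" for i
      using tval(1)[OF that] t(1)[OF that] that
      by (auto simp: Q_def bij_betw_def inv_into_into f_inv_into_f)
    have "Q \<in> carrier DS" unfolding DS_simps(1) using Q(1) by (auto simp: Q_def)
    moreover have "total Q = u" unfolding total_def t(2) by (rule sum.cong) (simp_all add: Q)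
    ultimately show "u \<in> total ` carrier DS" by blast
  qed (use totT in blast)
  show "bij_betw total (carrier DS) T" using inj surj by (simp add: bij_betw_def)
  show "sl_module n DS"
    by (rule sl_module_transport[where \<theta> = total and s = s and A = A, OF vector_space_axioms inj zero tot0 closed add closed2 scale closed3 act])
      (simp_all add: surj A_add A_scale A_plus A_smult A_commutator sl_carrier)
qed

end

section \<open>The Hermitian form on vectors\<close>

definition vip :: "zvec \<Rightarrow> zvec \<Rightarrow> complex" where
  "vip u v = (\<Sum>w\<in>Poly_Mapping.keys u. pip (cf u w) (cf v w))"

lemma vip_eq:
  assumes "finite S" "Poly_Mapping.keys u \<subseteq> S \<or> Poly_Mapping.keys v \<subseteq> S"
  shows "vip u v = (\<Sum>w\<in>S. pip (cf u w) (cf v w))"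
proof -
  have "vip u v = (\<Sum>w\<in>Poly_Mapping.keys u \<inter> Poly_Mapping.keys v. pip (cf u w) (cf v w))"
    unfolding vip_def by (rule sum.mono_neutral_right) (auto simp: in_keys_iff)
  also have "\<dots> = (\<Sum>w\<in>S \<inter> (Poly_Mapping.keys u \<inter> Poly_Mapping.keys v). pip (cf u w) (cf v w))"
    by (rule sum.mono_neutral_right) (use assms in \<open>auto simp: in_keys_iff\<close>)
  also have "\<dots> = (\<Sum>w\<in>S. pip (cf u w) (cf v w))"
    by (rule sum.mono_neutral_left) (use assms in \<open>auto simp: in_keys_iff\<close>)
  finally show ?thesis .
qed

lemma pip_self: "pip p p = of_real (\<Sum>k\<in>Poly_Mapping.keys p. (cmod (cf p k))\<^sup>2)"
  by (simp add: pip_def complex_norm_square del: of_real_power)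

lemma vip_cnj: "vip v u = cnj (vip u v)"
proof -
  let ?K = "Poly_Mapping.keys u \<union> Poly_Mapping.keys v"
  have "vip v u = (\<Sum>w\<in>?K. pip (cf v w) (cf u w))" by (rule vip_eq) auto
  also have "\<dots> = (\<Sum>w\<in>?K. cnj (pip (cf u w) (cf v w)))"
    by (intro sum.cong refl) (rule free_hs.ip_cnj)
  also have "\<dots> = cnj (vip u v)" by (subst vip_eq[of ?K u v]) simp_all
  finally show ?thesis .
qed

interpretation vhs: hermitian_space vscale vip
proof (unfold_locales)
  fix x y z :: zvec and c :: complex
  let ?K = "Poly_Mapping.keys z"
  have eq: "vip a z = (\<Sum>w\<in>?K. pip (cf a w) (cf z w))" for a by (rule vip_eq) auto
  show "vip (x + y) z = vip x z + vip y z"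
    by (simp add: eq lookup_add free_hs.ip_add sum.distrib)
  show "vip (vscale c x) z = c * vip x z"
    by (simp add: eq pscale_eq_mult[symmetric] free_hs.ip_scale sum_distrib_left)
  show "vip y x = cnj (vip x y)" by (rule vip_cnj)
  assume 0: "vip x x = 0"
  define f where "f p = (\<Sum>k\<in>Poly_Mapping.keys p. (cmod (cf p k))\<^sup>2)" for p :: zpoly
  have "vip x x = of_real (\<Sum>w\<in>Poly_Mapping.keys x. f (cf x w))"
    by (simp add: vip_def pip_self f_def)
  then have "(\<Sum>w\<in>Poly_Mapping.keys x. f (cf x w)) = 0" using 0 of_real_eq_0_iff by metis
  then have "\<forall>w\<in>Poly_Mapping.keys x. f (cf x w) = 0"
    by (subst (asm) sum_nonneg_eq_0_iff) (auto simp: f_def intro: sum_nonneg)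
  then have "cf x w = 0" for w
    using free_hs.ip_definite[of "cf x w"] by (cases "w \<in> Poly_Mapping.keys x") (simp_all add: pip_self f_def in_keys_iff del: of_real_sum)
  then show "x = 0" by (intro poly_mapping_eqI) simp
qed

text \<open>The coefficients of a fixed monomial \<open>k\<close>. Constant currents do not mix
  monomials, so adjointness and highest weight conditions are checked for one complex function on
  words at a time.\<close>

definition coeff_fun :: "(nat \<Rightarrow>\<^sub>0 nat) \<Rightarrow> zvec \<Rightarrow> nat list \<Rightarrow> complex" where
  "coeff_fun k u w = cf (cf u w) k"

lemma vip_coeff:
  assumes "u \<in> V_carrier n N" "finite K" "(\<forall>w. Poly_Mapping.keys (cf u w) \<subseteq> K) \<or> (\<forall>w. Poly_Mapping.keys (cf u' w) \<subseteq> K)"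
  shows "vip u u' = (\<Sum>k\<in>K. \<Sum>w\<in>words n N. coeff_fun k u w * cnj (coeff_fun k u' w))"
proof -
  have "vip u u' = (\<Sum>w\<in>words n N. pip (cf u w) (cf u' w))"
    using assms(1) by (intro vip_eq) (auto simp: V_carrier_iff in_keys_iff)
  also have "\<dots> = (\<Sum>w\<in>words n N. \<Sum>k\<in>K. coeff_fun k u w * cnj (coeff_fun k u' w))"
    unfolding coeff_fun_def using assms by (intro sum.cong refl pip_eq) blast+
  also have "\<dots> = (\<Sum>k\<in>K. \<Sum>w\<in>words n N. coeff_fun k u w * cnj (coeff_fun k u' w))" by (rule sum.swap)
  finally show ?thesis .
qed

lemma coeff_current_act:
  assumes "u \<in> V_carrier n N" "x \<in> carrier_mat n n" "w \<in> words n N"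
  shows "coeff_fun k (current_act N x 1 u) w = wop n (\<lambda>a b. x $$ (a, b)) (coeff_fun k u) w"
  using assms by (simp add: coeff_fun_def current_act_1 wop_def lookup_sum pscale_eq_mult[symmetric])

lemma wop_cong_entries:
  assumes "w \<in> words n N" "\<And>a b. a < n \<Longrightarrow> b < n \<Longrightarrow> x a b = y a b"
  shows "wop n x c w = wop n y c w"
  unfolding wop_def using assms words_nth[OF assms(1)] words_length[OF assms(1)] by (intro sum.cong refl) simp

lemma finite_coeff_keys:
  fixes u :: zvec
  shows "finite (\<Union>w\<in>Poly_Mapping.keys u. Poly_Mapping.keys (cf u w))" "Poly_Mapping.keys (cf u w) \<subseteq> (\<Union>w\<in>Poly_Mapping.keys u. Poly_Mapping.keys (cf u w))"
  by (simp, cases "w \<in> Poly_Mapping.keys u") (auto simp: in_keys_iff)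

lemma vip_current_act:
  assumes u: "u \<in> V_carrier n N" and u': "u' \<in> V_carrier n N" and g: "g \<in> carrier_mat n n"
  shows "vip (current_act N g 1 u) u' = vip u (current_act N (adj n g) 1 u')"
proof -
  define K where "K = (\<Union>w\<in>Poly_Mapping.keys u. Poly_Mapping.keys (cf u w)) \<union> (\<Union>w\<in>Poly_Mapping.keys u'. Poly_Mapping.keys (cf u' w))"
  have K: "finite K" "\<forall>w. Poly_Mapping.keys (cf u w) \<subseteq> K" "\<forall>w. Poly_Mapping.keys (cf u' w) \<subseteq> K"
    using finite_coeff_keys[of u] finite_coeff_keys[of u'] unfolding K_def by blast+
  have "vip (current_act N g 1 u) u'
      = (\<Sum>k\<in>K. \<Sum>w\<in>words n N. wop n (\<lambda>a b. g $$ (a, b)) (coeff_fun k u) w * cnj (coeff_fun k u' w))"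
    using K(3) by (subst vip_coeff[OF current_act_V_carrier[OF u g] K(1)]) (auto simp: coeff_current_act[OF u g])
  also have "\<dots> = (\<Sum>k\<in>K. \<Sum>w\<in>words n N. coeff_fun k u w * cnj (wop n (\<lambda>a b. cnj (g $$ (b, a))) (coeff_fun k u') w))"
    by (simp add: wop_adjoint)
  also have "\<dots> = (\<Sum>k\<in>K. \<Sum>w\<in>words n N. coeff_fun k u w * cnj (coeff_fun k (current_act N (adj n g) 1 u') w))"
  proof (intro sum.cong refl arg_cong2[where f = "(*)"] arg_cong[where f = cnj])
    fix k w assume w: "w \<in> words n N"
    show "wop n (\<lambda>a b. cnj (g $$ (b, a))) (coeff_fun k u') w = coeff_fun k (current_act N (adj n g) 1 u') w"
      unfolding coeff_current_act[OF u' adj_carrier w] by (rule wop_cong_entries[OF w]) (simp add: adj_def)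
  qed
  also have "\<dots> = vip u (current_act N (adj n g) 1 u')"
    using K(2) by (subst vip_coeff[OF u K(1)]) simp_all
  finally show ?thesis .
qed

lemma harm_vectors_iff:
  "2 \<le> n \<Longrightarrow> u \<in> harm_vectors n N m \<longleftrightarrow> u \<in> V_carrier n N \<and> (\<forall>w. cf u w \<in> zhom m \<and> cf u w \<in> harm N) \<and>
    (\<forall>\<sigma>\<in>perms N. gact n N \<sigma> u = u)"
  by (auto simp: harm_vectors_def invariants_def V_deg_iff)

lemma unitary_harm_vectors:
  assumes n: "2 \<le> n"
  shows "unitary_sl vscale vip n (harm_vectors n N m) (\<lambda>g. current_act N g 1)"
proof -
  have V: "u \<in> harm_vectors n N m \<Longrightarrow> u \<in> V_carrier n N" for u
    by (simp add: harm_vectors_iff[OF n])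
  have scale: "current_act N g 1 (vscale c u) = vscale c (current_act N g 1 u)"
    if "g \<in> carrier_mat n n" "u \<in> harm_vectors n N m" for g c u
    using current_act_linear(2)[OF V[OF that(2)] V[OF that(2)] that(1) polys_zconst] .
  show ?thesis
    by (intro unitary_sl.intro vhs.hermitian_space_axioms unitary_sl_axioms.intro subspace_harm_vectors[OF n] harm_vectors_current_act[OF n])
      (simp_all add: V scale current_act_linear(1)[where n = n] current_act_matrix_linear[where n = n] polys_zconst vip_current_act)
qed

lemma harm_vectors_fin_dim:
  assumes n: "2 \<le> n"
  shows "finite {zterm a w | a w. a \<in> monoms N \<and> mdeg a = m \<and> w \<in> words n N}" (is "finite ?B")
    and "harm_vectors n N m \<subseteq> vvs.span {zterm a w | a w. a \<in> monoms N \<and> mdeg a = m \<and> w \<in> words n N}"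
proof -
  have "?B = (\<lambda>(a, w). zterm a w) ` ({k \<in> monoms N. mdeg k = m} \<times> words n N)" by auto
  then show "finite ?B" using finite_monoms_deg[of N m] by simp
  show "harm_vectors n N m \<subseteq> vvs.span ?B"
    using V_deg_span[of _ n N m] by (auto simp: harm_vectors_iff[OF n] V_deg_iff)
qed

section \<open>Highest weight vectors\<close>

lemma abel_summation:
  fixes a d :: "nat \<Rightarrow> 'a::comm_ring_1"
  shows "(\<Sum>i=1..m. (a i - a (Suc i)) * (\<Sum>j<i. d j)) = (\<Sum>j<m. a (Suc j) * d j) - a (Suc m) * (\<Sum>j<m. d j)"
  by (induction m) (simp_all add: algebra_simps)

lemma part_pcont: "part \<mu> (Suc j) = pcont \<mu> j"
  by (simp add: part_def pcont_def Suc_le_eq)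

text \<open>Summation by parts rewrites the fundamental weights in diagonal coordinates; the
  boundary term becomes the coordinate of index \<open>n - 1\<close> because the trace
  vanishes.\<close>

lemma partition_weight_eq:
  assumes n: "1 \<le> n" and tr: "(\<Sum>j<n. d $$ (j, j)) = 0"
  shows "partition_weight n \<mu> d = (\<Sum>j<n. of_nat (pcont \<mu> j) * d $$ (j, j))"
proof -
  obtain l where l: "n = Suc l" using n by (cases n) auto
  have s: "(\<Sum>j<l. d $$ (j, j)) = - d $$ (l, l)" using tr by (simp add: l add_eq_0_iff2)
  have "partition_weight n \<mu> d = (\<Sum>j<l. of_nat (part \<mu> (Suc j)) * d $$ (j, j)) - of_nat (part \<mu> (Suc l)) * (\<Sum>j<l. d $$ (j, j))"
    unfolding partition_weight_def fundamental_weight_def l diff_Suc_1 by (rule abel_summation)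
  then show ?thesis by (simp add: s part_pcont l)
qed

lemma sum_count_list: 
  assumes "w \<in> words n N" shows "(\<Sum>j<n. count_list w j) = N"
proof -
  have "int (length w) = (\<Sum>j<n. int (count_list w j))"
    using sum_nth_count[of w n "\<lambda>_. 1::int"] assms by (simp add: words_def)
  then show ?thesis using assms by (simp add: words_def flip: of_nat_sum)
qed

lemma sum_pcont:
  assumes "length \<mu> \<le> n" shows "(\<Sum>j<n. pcont \<mu> j) = sum_list \<mu>"
proof -
  have "(\<Sum>j<n. pcont \<mu> j) = (\<Sum>j<length \<mu>. pcont \<mu> j)"
    by (rule sum.mono_neutral_right) (use assms in \<open>auto simp: pcont_def\<close>)
  also have "\<dots> = sum_list \<mu>" by (simp add: pcont_def sum_list_sum_nth lessThan_atLeast0)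
  finally show ?thesis .
qed

lemma wop_diagonal_mat:
  assumes w: "w \<in> words n N" and d: "d \<in> sl_diag n"
  shows "wop n (\<lambda>a b. d $$ (a, b)) c w = (\<Sum>j<n. of_nat (count_list w j) * d $$ (j, j)) * c w"
proof -
  have "wop n (\<lambda>a b. d $$ (a, b)) c w = wop n (\<lambda>a b. if a = b then d $$ (a, a) else 0) c w"
    using d by (intro wop_cong_entries[OF w]) (auto simp: sl_diag_def sl_def diagonal_mat_def)
  also have "\<dots> = (\<Sum>p<N. d $$ (w ! p, w ! p)) * c w" by (rule wop_diag[OF w])
  also have "(\<Sum>p<N. d $$ (w ! p, w ! p)) = (\<Sum>j<n. of_nat (count_list w j) * d $$ (j, j))"
    using sum_nth_count[of w n "\<lambda>j. d $$ (j, j)"] w by (simp add: words_def)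
  finally show ?thesis .
qed

text \<open>A weight of traceless diagonal matrices determines the letter counts only up to a common
  constant, as testing on the matrices with 1 at \<open>i\<close> and -1 at 0 shows. The length of
  the word, which is the size of \<open>\<mu>\<close>, removes the constant.\<close>

lemma content_of_weight:
  assumes len: "length \<mu> \<le> n" and w: "w \<in> words n (sum_list \<mu>)"
    and wt: "\<And>d. d \<in> sl_diag n \<Longrightarrow> (\<Sum>j<n. of_nat (count_list w j) * d $$ (j, j)) = (\<Sum>j<n. of_nat (pcont \<mu> j) * d $$ (j, j))"
  shows "has_content n (pcont \<mu>) w"
proof -
  define \<delta> where "\<delta> j = int (count_list w j) - int (pcont \<mu> j)" for j
  have eq: "\<delta> i = \<delta> 0" if i: "i < n" for i
  proof (cases "i = 0")
    case False
    define d :: "complex mat" where "d = mat n n (\<lambda>(a, b). if a = b then (if a = i then 1 else 0) - (if a = 0 then 1 else 0) else 0)"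
    have dj: "d $$ (j, j) = (if j = i then 1 else 0) - (if j = 0 then 1 else 0)" if "j < n" for j
      using that by (simp add: d_def)
    have "d \<in> sl_diag n"
      using i by (auto simp: sl_diag_def sl_def diagonal_mat_def d_def sum_subtractf)
    from wt[OF this] have "(\<Sum>j<n. of_int (\<delta> j) * d $$ (j, j)) = 0"
      by (simp add: \<delta>_def left_diff_distrib sum_subtractf)
    moreover have "(\<Sum>j<n. of_int (\<delta> j) * d $$ (j, j))
      = (\<Sum>j<n. (if j = i then of_int (\<delta> j) else 0) - (if j = 0 then of_int (\<delta> j) else 0))"
      by (intro sum.cong refl) (simp add: dj)
    ultimately have "(of_int (\<delta> i) - of_int (\<delta> 0) :: complex) = 0" using i by (simp add: sum_subtractf)
    then have "(of_int (\<delta> i - \<delta> 0) :: complex) = 0" by simp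
    then show ?thesis by (simp only: of_int_eq_0_iff eq_iff_diff_eq_0[of "\<delta> i"])
  qed simp
  have "(\<Sum>j<n. \<delta> j) = (\<Sum>j<n. \<delta> 0)" by (rule sum.cong[OF refl eq]) simp
  then have "int n * \<delta> 0 = (\<Sum>j<n. \<delta> j)" by simp
  also have "\<dots> = int (\<Sum>j<n. count_list w j) - int (\<Sum>j<n. pcont \<mu> j)"
    by (simp add: \<delta>_def sum_subtractf)
  also have "\<dots> = 0" by (simp only: sum_count_list[OF w] sum_pcont[OF len])
  finally have "n = 0 \<or> \<delta> 0 = 0" by simp
  then have "\<delta> j = 0" if "j < n" for j using eq[OF that] that by auto
  then show ?thesis unfolding has_content_def \<delta>_def by simp
qed

lemma wop_upper_mat:
  fixes x :: "nat \<Rightarrow> nat \<Rightarrow> complex"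
  assumes w: "w \<in> words n N" and x: "\<And>a b. a < n \<Longrightarrow> b < n \<Longrightarrow> b \<le> a \<Longrightarrow> x a b = 0" and c: "highest n N c"
  shows "wop n x c w = 0"
proof -
  have "wop n x c w = (\<Sum>p<N. \<Sum>b<n. \<Sum>i<n. \<Sum>j<n. if i < j then x i j * (unit_entry i j (w ! p) b * c (w[p := b])) else 0)"
    unfolding wop_def words_length[OF w]
  proof (intro sum.cong refl)
    fix p b assume "p \<in> {..<N}" and b: "b \<in> {..<n}"
    then have a: "w ! p < n" using words_nth[OF w] by simp
    have "(\<Sum>i<n. \<Sum>j<n. if i < j then x i j * (unit_entry i j (w ! p) b * c (w[p := b])) else 0)
      = (\<Sum>i<n. \<Sum>j<n. if i = w ! p then (if j = b then (if i < j then x i j * c (w[p := b]) else 0) else 0) else 0)"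
      by (intro sum.cong refl) (auto simp: unit_entry_def)
    also have "\<dots> = (\<Sum>i<n. if i = w ! p then (if i < b then x i b * c (w[p := b]) else 0) else 0)"
      using b by (intro sum.cong refl) auto
    also have "\<dots> = (if w ! p < b then x (w ! p) b * c (w[p := b]) else 0)" using a by simp
    finally show "x (w ! p) b * c (w[p := b]) = (\<Sum>i<n. \<Sum>j<n. if i < j then x i j * (unit_entry i j (w ! p) b * c (w[p := b])) else 0)"
      using x[OF a] b by simp
  qed
  also have "\<dots> = (\<Sum>i<n. \<Sum>j<n. if i < j then x i j * wop n (unit_entry i j) c w else 0)"
  proof -
    have 1: "(if i < j then x i j * wop n (unit_entry i j) c w else 0)
      = (\<Sum>p<N. \<Sum>b<n. if i < j then x i j * (unit_entry i j (w ! p) b * c (w[p := b])) else 0)" for i j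
      by (simp add: wop_def words_length[OF w] sum_distrib_left)
    have swap: "(\<Sum>p<N. \<Sum>b<n. \<Sum>i<n. \<Sum>j<n. f p b i j) = (\<Sum>i<n. \<Sum>j<n. \<Sum>p<N. \<Sum>b<n. f p b i j)"
      for f :: "nat \<Rightarrow> nat \<Rightarrow> nat \<Rightarrow> nat \<Rightarrow> complex"
    proof -
      have "(\<Sum>p<N. \<Sum>b<n. \<Sum>i<n. \<Sum>j<n. f p b i j) = (\<Sum>p<N. \<Sum>i<n. \<Sum>b<n. \<Sum>j<n. f p b i j)"
        by (rule sum.cong[OF refl], rule sum.swap)
      also have "\<dots> = (\<Sum>p<N. \<Sum>i<n. \<Sum>j<n. \<Sum>b<n. f p b i j)"
        by (rule sum.cong[OF refl], rule sum.cong[OF refl], rule sum.swap)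
      also have "\<dots> = (\<Sum>i<n. \<Sum>p<N. \<Sum>j<n. \<Sum>b<n. f p b i j)" by (rule sum.swap)
      also have "\<dots> = (\<Sum>i<n. \<Sum>j<n. \<Sum>p<N. \<Sum>b<n. f p b i j)"
        by (rule sum.cong[OF refl], rule sum.swap)
      finally show ?thesis .
    qed
    show ?thesis unfolding 1 by (rule swap)
  qed
  also have "\<dots> = 0"
    using c w by (intro sum.neutral ballI) (simp add: highest_def)
  finally show ?thesis .
qed

lemma vec_eqI:
  assumes "u \<in> V_carrier n N" "v \<in> V_carrier n N"
    and eq: "\<And>w k. w \<in> words n N \<Longrightarrow> coeff_fun k u w = coeff_fun k v w"
  shows "u = v"
proof (rule poly_mapping_eqI)
  fix w show "cf u w = cf v w"
  proof (cases "w \<in> words n N")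
    case True
    then show ?thesis using eq[OF True] by (intro poly_mapping_eqI) (simp add: coeff_fun_def)
  qed (use assms in \<open>simp add: V_carrier_iff\<close>)
qed

lemma coeff_fun_nonzero:
  assumes "cf u w \<noteq> 0" obtains k where "coeff_fun k u w \<noteq> 0"
proof -
  have "\<exists>k. cf (cf u w) k \<noteq> 0"
  proof (rule ccontr)
    assume "\<not> ?thesis"
    then have "cf u w = 0" by (intro poly_mapping_eqI) simp
    then show False using assms by simp
  qed
  then show thesis using that by (auto simp: coeff_fun_def)
qed

section \<open>Partitions, contents and weight components\<close>

lemma partitions_pcont_inj:
  assumes \<mu>: "\<mu> \<in> partitions N" "length \<mu> \<le> n" and \<nu>: "\<nu> \<in> partitions N" "length \<nu> \<le> n"
    and eq: "\<And>j. j < n \<Longrightarrow> pcont \<mu> j = pcont \<nu> j"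
  shows "\<mu> = \<nu>"
proof -
  have pos: "pcont \<mu>' j \<noteq> 0 \<longleftrightarrow> j < length \<mu>'" if "\<mu>' \<in> partitions N" for \<mu>' j
  proof (cases "j < length \<mu>'")
    case True
    then have "\<mu>' ! j \<in> set \<mu>'" by simp
    then have "\<mu>' ! j \<noteq> 0" using that unfolding partitions_def by (intro notI) simp
    then show ?thesis using True by (simp add: pcont_def)
  qed (simp add: pcont_def)
  have less: "j < length \<mu> \<longleftrightarrow> j < length \<nu>" if "j < n" for j
    using pos[OF \<mu>(1), of j] pos[OF \<nu>(1), of j] eq[OF that] by simp
  have len: "length \<mu> = length \<nu>"
  proof (rule ccontr)
    assume "length \<mu> \<noteq> length \<nu>"
    then consider "length \<mu> < length \<nu>" | "length \<nu> < length \<mu>" by linarith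
    then show False using less[of "length \<mu>"] less[of "length \<nu>"] \<mu>(2) \<nu>(2) by cases simp_all
  qed
  show ?thesis
  proof (rule nth_equalityI[OF len])
    fix j assume "j < length \<mu>"
    then show "\<mu> ! j = \<nu> ! j" using eq[of j] \<mu>(2) len by (simp add: pcont_def)
  qed
qed

lemma exists_partition_of_content:
  assumes dec: "\<And>i j. i < j \<Longrightarrow> j < n \<Longrightarrow> \<kappa> j \<le> \<kappa> i" and sum: "(\<Sum>j<n. \<kappa> j) = N"
  obtains \<mu> where "\<mu> \<in> partitions N" "length \<mu> \<le> n" "\<And>j. j < n \<Longrightarrow> pcont \<mu> j = \<kappa> j"
proof
  let ?xs = "map \<kappa> [0..<n]"
  \<comment> \<open>The values of \<open>\<kappa>\<close> decrease weakly, so cutting at the first 0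
    removes only zeros.\<close>
  let ?\<mu> = "takeWhile ((<) 0) ?xs"
  have "sorted_wrt (\<ge>) ?xs" using dec by (auto simp: sorted_wrt_iff_nth_less)
  then have s: "sorted_wrt (\<ge>) ?\<mu>" by (subst takeWhile_eq_take) (rule sorted_wrt_take)
  show len: "length ?\<mu> \<le> n" using length_takeWhile_le[of _ ?xs] by simp
  show pc: "pcont ?\<mu> j = \<kappa> j" if j: "j < n" for j
  proof (cases "j < length ?\<mu>")
    case True
    then show ?thesis using takeWhile_nth[of j _ ?xs] j by (simp add: pcont_def)
  next
    case False
    then have l: "length ?\<mu> < n" "length ?\<mu> \<le> j" using j by simp_all
    have "?xs ! length ?\<mu> = 0" using nth_length_takeWhile[of "(<) 0" ?xs] l(1) by simp
    then have "\<kappa> (length ?\<mu>) = 0" using l(1) by simp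
    then have "\<kappa> j = 0" using dec[of "length ?\<mu>" j] l(2) j by (cases "length ?\<mu> = j") simp_all
    then show ?thesis using False by (simp add: pcont_def)
  qed
  have "0 \<notin> set ?\<mu>" by (auto dest: set_takeWhileD)
  moreover have "sum_list ?\<mu> = N"
    unfolding sum_pcont[OF len, symmetric] sum[symmetric] by (rule sum.cong) (simp_all add: pc)
  ultimately show "?\<mu> \<in> partitions N" using s by (simp add: partitions_def)
qed

lemma has_content_mset: "mset v = mset w \<Longrightarrow> has_content n \<kappa> v \<longleftrightarrow> has_content n \<kappa> w"
  by (simp add: has_content_def flip: count_mset)

text \<open>The projection onto a weight space. Permuting a word keeps its content, so invariance
  under the symmetric group survives.\<close>

definition content_part :: "nat \<Rightarrow> nat \<Rightarrow> (nat \<Rightarrow> nat) \<Rightarrow> zvec \<Rightarrow> zvec" where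
  "content_part n N \<kappa> u = (\<Sum>w\<in>{w \<in> words n N. has_content n \<kappa> w}. Poly_Mapping.single w (cf u w))"

lemma cf_content_part:
  assumes "u \<in> V_carrier n N"
  shows "cf (content_part n N \<kappa> u) w = (if has_content n \<kappa> w then cf u w else 0)"
  using assms by (auto simp: content_part_def lookup_sum lookup_single when_def V_carrier_iff)

lemma permute_list_content:
  "\<sigma> permutes {..<N} \<Longrightarrow> w \<in> words n N \<Longrightarrow> has_content n \<kappa> (permute_list \<sigma> w) \<longleftrightarrow> has_content n \<kappa> w"
  by (intro has_content_mset mset_permute_list) (simp add: words_length)

lemma harm_0: "0 \<in> harm N"
  using rho_harm[of 0 N] by simp

lemma content_part_harm_vectors:
  assumes n: "2 \<le> n" and u: "u \<in> harm_vectors n N m"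
  shows "content_part n N \<kappa> u \<in> harm_vectors n N m"
proof -
  note u' = u[unfolded harm_vectors_iff[OF n]]
  have V: "u \<in> V_carrier n N" using u' by blast
  show ?thesis
    unfolding harm_vectors_iff[OF n]
  proof (intro conjI ballI allI)
    show "content_part n N \<kappa> u \<in> V_carrier n N" using V by (simp add: V_carrier_iff cf_content_part[OF V])
    fix w show "cf (content_part n N \<kappa> u) w \<in> zhom m" "cf (content_part n N \<kappa> u) w \<in> harm N"
      using u' by (simp_all add: cf_content_part[OF V] harm_0)
  next
    fix \<sigma> assume "\<sigma> \<in> perms N"
    then have \<sigma>: "\<sigma> permutes {..<N}" and inv: "gact n N \<sigma> u = u" using u' by auto
    show "gact n N \<sigma> (content_part n N \<kappa> u) = content_part n N \<kappa> u"
    proof (rule poly_mapping_eqI)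
      fix w
      show "cf (gact n N \<sigma> (content_part n N \<kappa> u)) w = cf (content_part n N \<kappa> u) w"
      proof (cases "w \<in> words n N")
        case True
        have "pact \<sigma> (cf u (permute_list \<sigma> w)) = cf u w"
          using arg_cong[OF inv, of "\<lambda>u. cf u w"] True by (simp add: cf_gact)
        then show ?thesis using True by (simp add: cf_gact cf_content_part[OF V] permute_list_content[OF \<sigma>])
      next
        case False
        then show ?thesis using V by (simp add: cf_gact cf_content_part[OF V] V_carrier_iff)
      qed
    qed
  qed
qed

text \<open>All words obtained from \<open>w\<close> by replacing one letter \<open>i\<close> by
  \<open>j\<close> have the same content. The truncation therefore keeps either every term of the
  vanishing sum or none.\<close>

lemma highest_content_part:
  assumes u: "u \<in> V_carrier n N" and hi: "highest n N (coeff_fun k u)"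
  shows "highest n N (coeff_fun k (content_part n N \<kappa> u))"
  unfolding highest_def
proof (intro allI impI ballI)
  fix i j w assume ij: "i < j" "j < n" and w: "w \<in> words n N"
  have m: "mset (w[p := j]) = add_mset j (mset w - {#i#})" if "p < length w" "w ! p = i" for p
    using that by (simp add: mset_update)
  have 0: "(\<Sum>p | p < length w \<and> w ! p = i. coeff_fun k u (w[p := j])) = 0"
    using hi ij w wop_unit[OF ij(2), of i "coeff_fun k u" w] by (simp add: highest_def)
  have "(\<Sum>p | p < length w \<and> w ! p = i. coeff_fun k (content_part n N \<kappa> u) (w[p := j])) = 0"
  proof (cases "\<exists>p<length w. w ! p = i \<and> has_content n \<kappa> (w[p := j])")
    case True
    then obtain q where q: "q < length w" "w ! q = i" "has_content n \<kappa> (w[q := j])" by blast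
    have "has_content n \<kappa> (w[p := j])" if "p < length w" "w ! p = i" for p
      using has_content_mset[of "w[p := j]" "w[q := j]" n \<kappa>] q m[OF that] m[OF q(1,2)] by simp
    then have "(\<Sum>p | p < length w \<and> w ! p = i. coeff_fun k (content_part n N \<kappa> u) (w[p := j]))
      = (\<Sum>p | p < length w \<and> w ! p = i. coeff_fun k u (w[p := j]))"
      by (intro sum.cong refl) (simp add: coeff_fun_def cf_content_part[OF u])
    then show ?thesis using 0 by simp
  next
    case False
    then show ?thesis by (intro sum.neutral ballI) (simp add: coeff_fun_def cf_content_part[OF u])
  qed
  then show "wop n (unit_entry i j) (coeff_fun k (content_part n N \<kappa> u)) w = 0"
    by (simp add: wop_unit[OF ij(2)])
qed

section \<open>Highest weight vectors among the harmonic invariants\<close>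

context
  fixes n N m :: nat
  assumes n: "2 \<le> n"
begin

interpretation U: unitary_sl vscale vip n "harm_vectors n N m" "\<lambda>g. current_act N g 1"
  by (rule unitary_harm_vectors[OF n])

lemma harm_vectors_V_carrier: "u \<in> harm_vectors n N m \<Longrightarrow> u \<in> V_carrier n N"
  by (simp add: harm_vectors_iff[OF n])

lemma highest_Eu:
  assumes u: "u \<in> V_carrier n N" and 0: "\<And>i j. i < j \<Longrightarrow> j < n \<Longrightarrow> current_act N (Eu n i j) 1 u = 0"
  shows "highest n N (coeff_fun k u)"
  unfolding highest_def
proof (intro allI impI ballI)
  fix i j w assume ij: "i < j" "j < n" and w: "w \<in> words n N"
  have E: "Eu n i j \<in> carrier_mat n n" by (simp add: Eu_def)
  have "0 = coeff_fun k (current_act N (Eu n i j) 1 u) w" by (simp add: 0[OF ij] coeff_fun_def)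
  also have "\<dots> = wop n (\<lambda>a b. Eu n i j $$ (a, b)) (coeff_fun k u) w" by (rule coeff_current_act[OF u E w])
  also have "\<dots> = wop n (unit_entry i j) (coeff_fun k u) w"
    by (rule wop_cong_entries[OF w]) (simp add: Eu_def unit_entry_def)
  finally show "wop n (unit_entry i j) (coeff_fun k u) w = 0" ..
qed

text \<open>The diagonal matrices confine the support to words of content \<open>\<mu>\<close>, and
  the strictly upper triangular ones act through matrix units on the coefficient function of each
  monomial.\<close>

lemma HW_iff:
  assumes \<mu>: "\<mu> \<in> partitions N" "length \<mu> \<le> n"
  shows "h \<in> U.HW (partition_weight n \<mu>) \<longleftrightarrow> h \<in> harm_vectors n N m \<and>
    (\<forall>w. cf h w \<noteq> 0 \<longrightarrow> w \<in> cwords n \<mu>) \<and> (\<forall>k. highest n N (coeff_fun k h))"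
proof (intro iffI conjI allI impI)
  have N: "sum_list \<mu> = N" using \<mu> by (simp add: partitions_def)
  have wt: "partition_weight n \<mu> d = (\<Sum>j<n. of_nat (pcont \<mu> j) * d $$ (j, j))" if "d \<in> sl_diag n" for d
    using that n by (intro partition_weight_eq) (auto simp: sl_diag_def sl_def)
  {
    assume h: "h \<in> U.HW (partition_weight n \<mu>)"
    then show T: "h \<in> harm_vectors n N m" by (simp add: U.HW_def)
    note V = harm_vectors_V_carrier[OF T]
    show "highest n N (coeff_fun k h)" for k
      using h by (intro highest_Eu V) (simp add: U.HW_def Eu_upper)
    fix w assume nz: "cf h w \<noteq> 0"
    then have w: "w \<in> words n N" using V by (auto simp: V_carrier_iff)
    obtain k where k: "coeff_fun k h w \<noteq> 0" using nz by (rule coeff_fun_nonzero)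
    have "has_content n (pcont \<mu>) w"
    proof (rule content_of_weight[OF \<mu>(2) w[folded N]])
      fix d assume d: "d \<in> sl_diag n"
      then have dc: "d \<in> carrier_mat n n" by (auto simp: sl_diag_def sl_def)
      have "(\<Sum>j<n. of_nat (count_list w j) * d $$ (j, j)) * coeff_fun k h w = coeff_fun k (current_act N d 1 h) w"
        by (simp add: coeff_current_act[OF V dc w] wop_diagonal_mat[OF w d])
      also have "\<dots> = partition_weight n \<mu> d * coeff_fun k h w"
        using h d by (simp add: U.HW_def coeff_fun_def pscale_eq_mult[symmetric])
      finally show "(\<Sum>j<n. of_nat (count_list w j) * d $$ (j, j)) = (\<Sum>j<n. of_nat (pcont \<mu> j) * d $$ (j, j))"
        using k wt[OF d] by simp
    qed
    then show "w \<in> cwords n \<mu>" using w by (simp add: cwords_def N)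
  }
  assume h: "h \<in> harm_vectors n N m \<and> (\<forall>w. cf h w \<noteq> 0 \<longrightarrow> w \<in> cwords n \<mu>) \<and> (\<forall>k. highest n N (coeff_fun k h))"
  then have T: "h \<in> harm_vectors n N m" by blast
  note V = harm_vectors_V_carrier[OF T]
  show "h \<in> U.HW (partition_weight n \<mu>)"
    unfolding U.HW_def
  proof (intro CollectI conjI T ballI)
    fix x assume x: "x \<in> sl_upper n"
    then have xc: "x \<in> carrier_mat n n" by (auto simp: sl_upper_def sl_def)
    show "current_act N x 1 h = 0"
    proof (rule vec_eqI[OF current_act_V_carrier[OF V xc] vvs.subspace_0[OF subspace_V_carrier]])
      fix w k assume w: "w \<in> words n N"
      have "wop n (\<lambda>a b. x $$ (a, b)) (coeff_fun k h) w = 0"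
        using x h by (intro wop_upper_mat[OF w]) (auto simp: sl_upper_def)
      then show "coeff_fun k (current_act N x 1 h) w = coeff_fun k 0 w"
        by (simp add: coeff_current_act[OF V xc w]) (simp add: coeff_fun_def)
    qed
  next
    fix d assume d: "d \<in> sl_diag n"
    then have dc: "d \<in> carrier_mat n n" by (auto simp: sl_diag_def sl_def)
    show "current_act N d 1 h = vscale (partition_weight n \<mu> d) h"
    proof (rule vec_eqI[OF current_act_V_carrier[OF V dc] vvs.subspace_scale[OF subspace_V_carrier V]])
      fix w k assume w: "w \<in> words n N"
      have "(\<Sum>j<n. of_nat (count_list w j) * d $$ (j, j)) * coeff_fun k h w = partition_weight n \<mu> d * coeff_fun k h w"
      proof (cases "cf h w = 0")
        case False
        then have "has_content n (pcont \<mu>) w" using h by (auto simp: cwords_def)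
        then show ?thesis by (simp add: wt[OF d] has_content_def)
      qed (simp add: coeff_fun_def)
      then show "coeff_fun k (current_act N d 1 h) w = coeff_fun k (vscale (partition_weight n \<mu> d) h) w"
        by (simp add: coeff_current_act[OF V dc w] wop_diagonal_mat[OF w d])
          (simp add: coeff_fun_def pscale_eq_mult[symmetric])
    qed
  qed
qed

text \<open>The supports are disjoint, since a partition is determined by its content.\<close>

lemma HW_orthogonal:
  assumes \<mu>: "\<mu> \<in> partitions N" "length \<mu> \<le> n" and \<nu>: "\<nu> \<in> partitions N" "length \<nu> \<le> n" and ne: "\<mu> \<noteq> \<nu>"
    and h: "h \<in> U.HW (partition_weight n \<mu>)" and h': "h' \<in> U.HW (partition_weight n \<nu>)"
  shows "vip h h' = 0"
  unfolding vip_def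
proof (intro sum.neutral ballI)
  fix w
  have "cf h w = 0 \<or> cf h' w = 0"
  proof (rule ccontr)
    assume "\<not> ?thesis"
    then have "has_content n (pcont \<mu>) w" "has_content n (pcont \<nu>) w"
      using h h' by (auto simp: HW_iff[OF \<mu>] HW_iff[OF \<nu>] cwords_def)
    then have "\<mu> = \<nu>" by (intro partitions_pcont_inj[OF \<mu> \<nu>]) (simp add: has_content_def)
    then show False using ne by simp
  qed
  then show "pip (cf h w) (cf h' w) = 0" by auto
qed

text \<open>A raising matrix unit replaces a letter by a smaller one, so it decreases the bound on
  the letter sums of words in the support. Repeated raising must therefore stop at a nonzero vector
  killed by all raising units.\<close>

lemma exists_killed:
  assumes stable: "\<And>g u. g \<in> sl n \<Longrightarrow> u \<in> S \<Longrightarrow> current_act N g 1 u \<in> S" and S: "S \<subseteq> V_carrier n N"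
    and u: "u \<in> S" "u \<noteq> 0" "\<And>w. cf u w \<noteq> 0 \<Longrightarrow> sum_list w \<le> M"
  shows "\<exists>u\<in>S. u \<noteq> 0 \<and> (\<forall>i j. i < j \<longrightarrow> j < n \<longrightarrow> current_act N (Eu n i j) 1 u = 0)"
  using u
proof (induction M arbitrary: u rule: less_induct)
  case (less M)
  show ?case
  proof (cases "\<forall>i j. i < j \<longrightarrow> j < n \<longrightarrow> current_act N (Eu n i j) 1 u = 0")
    case False
    then obtain i j where ij: "i < j" "j < n" and nz: "current_act N (Eu n i j) 1 u \<noteq> 0" by blast
    let ?u = "current_act N (Eu n i j) 1 u"
    have E: "Eu n i j \<in> carrier_mat n n" by (simp add: Eu_def)
    have V: "u \<in> V_carrier n N" using less.prems(1) S by blast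
    have uS: "?u \<in> S" using ij by (intro stable less.prems(1) Eu_sl) simp
    have lt: "sum_list w < M" if w: "cf ?u w \<noteq> 0" for w
    proof -
      have "?u \<in> V_carrier n N" using uS S by blast
      then have ww: "w \<in> words n N" using w by (auto simp: V_carrier_iff)
      obtain k where "coeff_fun k ?u w \<noteq> 0" using w by (rule coeff_fun_nonzero)
      moreover have "coeff_fun k ?u w = (\<Sum>p | p < length w \<and> w ! p = i. coeff_fun k u (w[p := j]))"
        unfolding coeff_current_act[OF V E ww] wop_unit[OF ij(2), symmetric]
        by (rule wop_cong_entries[OF ww]) (simp add: Eu_def unit_entry_def)
      ultimately have "(\<Sum>p | p < length w \<and> w ! p = i. coeff_fun k u (w[p := j])) \<noteq> 0" by simp
      then obtain p where p: "p < length w" "w ! p = i" "coeff_fun k u (w[p := j]) \<noteq> 0"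
        by (rule sum.not_neutral_contains_not_neutral) blast
      then have "cf u (w[p := j]) \<noteq> 0" by (auto simp: coeff_fun_def)
      then have "sum_list (w[p := j]) \<le> M" by (rule less.prems(3))
      moreover have "sum_list w < sum_list (w[p := j])"
      proof -
        have "w ! p \<le> sum_list w" using p(1) by (rule elem_le_sum_list)
        then show ?thesis using p(1,2) ij(1) by (simp add: sum_list_update)
      qed
      ultimately show ?thesis by simp
    qed
    have "\<exists>w. cf ?u w \<noteq> 0"
    proof (rule ccontr)
      assume "\<not> ?thesis"
      then have "?u = 0" by (intro poly_mapping_eqI) simp
      then show False using nz by simp
    qed
    then obtain w where "cf ?u w \<noteq> 0" by blast
    from lt[OF this] have M: "M - 1 < M" by simp
    have "sum_list w \<le> M - 1" if "cf ?u w \<noteq> 0" for w using lt[OF that] by simp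
    then show ?thesis by (rule less.IH[OF M uS nz])
  qed (use less.prems in blast)
qed

text \<open>The vector \<open>u\<close> killed by all raising units need not be a weight vector, and
  its component \<open>h\<close> of one content is not claimed to lie in \<open>S\<close>. But
  \<open>h\<close> is a highest weight vector, its content is dominant and so comes from a
  partition, and \<open>vip u h\<close> equals the squared norm of \<open>h\<close>, which is not
  0.\<close>

lemma HW_separating:
  assumes S: "S \<subseteq> harm_vectors n N m" and stable: "\<And>g u. g \<in> sl n \<Longrightarrow> u \<in> S \<Longrightarrow> current_act N g 1 u \<in> S"
    and ortho: "\<And>u \<mu> h. u \<in> S \<Longrightarrow> \<mu> \<in> partitions N \<Longrightarrow> length \<mu> \<le> n \<Longrightarrow> h \<in> U.HW (partition_weight n \<mu>) \<Longrightarrow> vip u h = 0"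
    and u0: "u0 \<in> S"
  shows "u0 = 0"
proof (rule ccontr)
  assume nz: "u0 \<noteq> 0"
  have SV: "S \<subseteq> V_carrier n N" using S harm_vectors_V_carrier by blast
  have "sum_list w \<le> (\<Sum>w\<in>Poly_Mapping.keys u0. sum_list w)" if "cf u0 w \<noteq> 0" for w
    by (rule member_le_sum) (use that in \<open>simp_all add: in_keys_iff\<close>)
  from exists_killed[OF stable SV u0 nz this]
  obtain u where u: "u \<in> S" "u \<noteq> 0" and kill: "\<And>i j. i < j \<Longrightarrow> j < n \<Longrightarrow> current_act N (Eu n i j) 1 u = 0"
    by blast
  have V: "u \<in> V_carrier n N" using u(1) SV by blast
  have "\<exists>v. cf u v \<noteq> 0"
  proof (rule ccontr)
    assume "\<not> ?thesis"
    then have "u = 0" by (intro poly_mapping_eqI) simp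
    then show False using u(2) by simp
  qed
  then obtain v where v: "cf u v \<noteq> 0" by blast
  obtain k where k: "coeff_fun k u v \<noteq> 0" using v by (rule coeff_fun_nonzero)
  have vw: "v \<in> words n N" using v V by (auto simp: V_carrier_iff)
  define \<kappa> where "\<kappa> = count_list v"
  define h where "h = content_part n N \<kappa> u"
  have cfh: "cf h w = (if has_content n \<kappa> w then cf u w else 0)" for w
    unfolding h_def by (rule cf_content_part[OF V])
  have hi: "highest n N (coeff_fun l h)" for l
    unfolding h_def by (rule highest_content_part[OF V highest_Eu[OF V kill]])
  have vc: "has_content n \<kappa> v" by (simp add: has_content_def \<kappa>_def)
  have dec: "\<kappa> j \<le> \<kappa> i" if "i < j" "j < n" for i j
    by (rule highest_dominant[OF hi[of k] _ vw _ that]) (use k vc in \<open>auto simp: coeff_fun_def cfh split: if_splits\<close>)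
  obtain \<mu> where \<mu>: "\<mu> \<in> partitions N" "length \<mu> \<le> n" and pc: "\<And>j. j < n \<Longrightarrow> pcont \<mu> j = \<kappa> j"
    using exists_partition_of_content[OF dec sum_count_list[OF vw, folded \<kappa>_def]] by blast
  have "h \<in> harm_vectors n N m" unfolding h_def using u(1) S by (intro content_part_harm_vectors n) blast
  moreover have "w \<in> cwords n \<mu>" if "cf h w \<noteq> 0" for w
  proof -
    have c: "has_content n \<kappa> w" "cf u w \<noteq> 0" using that by (simp_all add: cfh split: if_splits)
    have "w \<in> words n N" using c(2) V by (auto simp: V_carrier_iff)
    moreover have "sum_list \<mu> = N" using \<mu>(1) by (simp add: partitions_def)
    ultimately show ?thesis using c(1) by (simp add: cwords_def has_content_def pc)
  qed
  ultimately have "h \<in> U.HW (partition_weight n \<mu>)" unfolding HW_iff[OF \<mu>] using hi by blast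
  then have "vip u h = 0" by (rule ortho[OF u(1) \<mu>])
  moreover have "vip u h = vip h h"
  proof -
    have "vip u h = (\<Sum>w\<in>Poly_Mapping.keys h. pip (cf u w) (cf h w))" by (rule vip_eq) auto
    also have "\<dots> = (\<Sum>w\<in>Poly_Mapping.keys h. pip (cf h w) (cf h w))"
      by (rule sum.cong) (auto simp: cfh in_keys_iff split: if_splits)
    finally show ?thesis by (simp add: vip_def)
  qed
  ultimately have "h = 0" by (intro vhs.ip_definite) simp
  then have "cf h v = 0" by simp
  then show False using v vc by (simp add: cfh)
qed

end

section \<open>Multiplicity spaces as spaces of highest weight vectors\<close>

lemma highest_permute:
  assumes \<sigma>: "\<sigma> permutes {..<N}" and c: "highest n N c"
  shows "highest n N (\<lambda>w. c (permute_list \<sigma> w))"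
  unfolding highest_def
proof (intro allI impI ballI)
  fix i j w assume ij: "i < j" "j < n" and w: "w \<in> words n N"
  note lw = words_length[OF w] and w' = words_permute_list[OF \<sigma> w]
  have "wop n (unit_entry i j) (\<lambda>w. c (permute_list \<sigma> w)) w
    = (\<Sum>p<N. \<Sum>b<n. unit_entry i j (w ! p) b * c (permute_list \<sigma> (w[p := b])))"
    by (simp add: wop_def lw)
  also have "\<dots> = (\<Sum>q<N. \<Sum>b<n. unit_entry i j (w ! \<sigma> q) b * c (permute_list \<sigma> (w[\<sigma> q := b])))"
    by (rule sum.reindex_bij_betw[OF permutes_imp_bij[OF \<sigma>], symmetric])
  also have "\<dots> = (\<Sum>q<N. \<Sum>b<n. unit_entry i j (permute_list \<sigma> w ! q) b * c ((permute_list \<sigma> w)[q := b]))"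
    by (intro sum.cong refl) (simp add: permute_list_update[OF \<sigma> lw] permute_list_nth \<sigma> lw)
  also have "\<dots> = wop n (unit_entry i j) c (permute_list \<sigma> w)"
    by (simp add: wop_def lw)
  also have "\<dots> = 0" using c ij w' by (simp add: highest_def)
  finally show "wop n (unit_entry i j) (\<lambda>w. c (permute_list \<sigma> w)) w = 0" .
qed

lemma highest_cong:
  assumes "highest n N c" and eq: "\<And>w. w \<in> words n N \<Longrightarrow> c w = d w"
  shows "highest n N d"
proof -
  have "wop n x d w = wop n x c w" if "w \<in> words n N" for x w
    by (rule wop_cong) (simp add: eq words_update[OF that])
  then show ?thesis using assms(1) by (simp add: highest_def)
qed

text \<open>The matrix units are real. Conjugates are needed because \<open>tab_pair\<close> is
  bilinear while the form is sesquilinear.\<close>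

lemma highest_cnj: "highest n N c \<Longrightarrow> highest n N (\<lambda>w. cnj (c w))"
proof -
  assume c: "highest n N c"
  have "cnj (unit_entry i j a b) = unit_entry i j a b" for i j a b by (simp add: unit_entry_def)
  then have "wop n (unit_entry i j) (\<lambda>w. cnj (c w)) w = cnj (wop n (unit_entry i j) c w)" for i j w
    by (simp add: wop_def)
  then show ?thesis using c by (simp add: highest_def)
qed

lemma highest_sum: 
  "(\<And>x. x \<in> X \<Longrightarrow> highest n N (f x)) \<Longrightarrow> highest n N (\<lambda>w. \<Sum>x\<in>X. a x * f x w)"
proof (induction X rule: infinite_finite_induct)
  case (insert x X)
  then have "highest n N (\<lambda>w. (\<Sum>x\<in>X. a x * f x w) + a x * f x w)"
    by (intro highest_linear) simp_all
  then show ?case using insert by (simp add: add.commute)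
qed (simp_all add: highest_def wop_def)

section \<open>Graded components of the coinvariant ring through harmonic representatives\<close>

abbreviation coset :: "nat \<Rightarrow> zpoly \<Rightarrow> zpoly set" where
  "coset N \<equiv> fiber (polys N) (rho N)"

lemma zpoly_rep_simps: "carrier (zpoly_rep N) = polys N" "add (zpoly_rep N) = (+)"
  "act (zpoly_rep N) \<sigma> = pact \<sigma>"
  by (simp_all add: zpoly_rep_def mk_rep_def)

lemma linear_quotient_zpoly: "linear_quotient (zpoly_rep N) pscale (rho N) pscale"
proof (rule linear_quotient.intro)
  have "(\<lambda>c p. zconst c * p) = pscale" by (intro ext) (simp add: pscale_eq_mult)
  then show "concrete_space pscale (zpoly_rep N)"
    unfolding zpoly_rep_def using concrete_space_mk_rep[OF vector_space_pscale subspace_polys] by simp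
qed (simp_all add: zpoly_rep_simps rho_add rho_pscale)

lemma J_coset: "J N = coset N 0"
  using J_polys rho_eq_0_iff by (auto simp: fiber_def)

definition hharm :: "nat \<Rightarrow> nat \<Rightarrow> zpoly set" where
  "hharm N m = harm N \<inter> zhom m"

lemma hharm_polys: "r \<in> hharm N m \<Longrightarrow> r \<in> polys N"
  by (simp add: hharm_def harm_def)

lemma hharm_image: "r \<in> hharm N m \<Longrightarrow> r \<in> rho N ` polys N"
  using rho_id[of r N] hharm_polys[of r N m] by (force simp: hharm_def)

lemma subspace_hharm: "free_vs.subspace (hharm N m)"
  by (rule free_vs.subspaceI)
    (auto simp: hharm_def harm_def zhom_add zhom_pscale free_hs.ip_add free_hs.ip_scale polys_add
      free_vs.subspace_scale[OF subspace_polys])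

lemma hharm_pact: "\<sigma> permutes {..<N} \<Longrightarrow> r \<in> hharm N m \<Longrightarrow> pact \<sigma> r \<in> hharm N m"
  using rho_harm[OF polys_pact[of \<sigma> N r]] rho_pact[of \<sigma> N r] rho_id[of r N] hharm_polys[of r N m]
  by (simp add: hharm_def zhom_pact)

text \<open>\<open>rho\<close> preserves the degree and commutes with permutations, so classes of
  degree \<open>m\<close> may be named by harmonic polynomials of degree \<open>m\<close>.\<close>

lemma R_deg_simps:
  shows "carrier (R_deg N m) = coset N ` hharm N m"
    and "\<zero>\<^bsub>R_deg N m\<^esub> = coset N 0"
    and "r \<in> hharm N m \<Longrightarrow> r' \<in> hharm N m \<Longrightarrow> coset N r \<oplus>\<^bsub>R_deg N m\<^esub> coset N r' = coset N (r + r')"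
    and "r \<in> hharm N m \<Longrightarrow> c \<odot>\<^bsub>R_deg N m\<^esub> coset N r = coset N (pscale c r)"
    and "\<sigma> permutes {..<N} \<Longrightarrow> r \<in> hharm N m \<Longrightarrow> act (R_deg N m) \<sigma> (coset N r) = coset N (pact \<sigma> r)"
proof -
  interpret Q: linear_quotient "zpoly_rep N" pscale "rho N" pscale by (rule linear_quotient_zpoly)
  note fib = zpoly_rep_simps
  have R: "R_deg N m = (quot_rep (zpoly_rep N) (coset N 0))\<lparr>carrier := (\<lambda>p. coset N 0 +>\<^bsub>zpoly_ring N\<^esub> p) ` (polys N \<inter> zhom m)\<rparr>"
    by (simp only: R_deg_def J_coset)
  have cos: "coset N 0 +>\<^bsub>zpoly_ring N\<^esub> p = coset N (rho N p)" if "p \<in> polys N" for p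
    using Q.coset_fib[of p "zpoly_ring N"] that by (simp add: fib zpoly_ring_simps)
  have "carrier (R_deg N m) = (\<lambda>p. coset N (rho N p)) ` (polys N \<inter> zhom m)"
    unfolding R by (simp, rule image_cong) (simp_all add: cos)
  also have "\<dots> = coset N ` (rho N ` (polys N \<inter> zhom m))" by (simp only: image_image)
  also have "rho N ` (polys N \<inter> zhom m) = hharm N m"
  proof (intro equalityI subsetI)
    fix r assume "r \<in> hharm N m"
    then show "r \<in> rho N ` (polys N \<inter> zhom m)"
      using rho_id[of r N] hharm_polys[of r N m] by (intro image_eqI[of _ _ r]) (simp_all add: hharm_def)
  qed (auto simp: hharm_def rho_harm rho_zhom)
  finally show "carrier (R_deg N m) = coset N ` hharm N m" .
  show "\<zero>\<^bsub>R_deg N m\<^esub> = coset N 0" unfolding R using Q.zero_quot by (simp add: fib)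
  show "coset N r \<oplus>\<^bsub>R_deg N m\<^esub> coset N r' = coset N (r + r')" if "r \<in> hharm N m" "r' \<in> hharm N m"
    unfolding R using Q.add_quot[of r r'] that[THEN hharm_image] by (simp add: fib)
  show "c \<odot>\<^bsub>R_deg N m\<^esub> coset N r = coset N (pscale c r)" if "r \<in> hharm N m"
    unfolding R using Q.smult_quot[of r c] that[THEN hharm_image] by (simp add: fib)
  show "act (R_deg N m) \<sigma> (coset N r) = coset N (pact \<sigma> r)" if "\<sigma> permutes {..<N}" "r \<in> hharm N m"
    unfolding R using Q.act_quot[of r \<sigma> "pact \<sigma>"] hharm_image[OF that(2)] that(1)
    by (simp add: fib polys_pact rho_pact)
qed

lemma coset_inj: "r \<in> hharm N m \<Longrightarrow> r' \<in> hharm N m \<Longrightarrow> coset N r = coset N r' \<Longrightarrow> r = r'"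
  using linear_quotient.inj_fib[OF linear_quotient_zpoly, of N] hharm_image[of r N m] hharm_image[of r' N m]
  unfolding inj_on_def zpoly_rep_simps by blast

section \<open>Pairing highest weight vectors with Specht modules\<close>

definition hw_space :: "nat \<Rightarrow> nat \<Rightarrow> nat \<Rightarrow> nat list \<Rightarrow> zvec set" where
  "hw_space n N m \<mu> = {h \<in> harm_vectors n N m.
     (\<forall>w. cf h w \<noteq> 0 \<longrightarrow> w \<in> cwords n \<mu>) \<and> (\<forall>k. highest n N (coeff_fun k h))}"

text \<open>Contracts the complex coefficients of a Specht vector with the polynomial coefficients
  of \<open>u\<close>, without conjugation. For a highest weight vector \<open>u\<close> this
  becomes, modulo the ideal, the equivariant map into the coinvariant ring that corresponds to
  \<open>u\<close>.\<close>

definition tab_pair :: "nat \<Rightarrow> nat list \<Rightarrow> zvec \<Rightarrow> (nat set list \<Rightarrow>\<^sub>0 complex) \<Rightarrow> zpoly" where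
  "tab_pair n \<mu> u s = (\<Sum>w\<in>cwords n \<mu>. pscale (cf s (word_tabloid \<mu> w)) (cf u w))"

lemma tab_pair_linear:
  "tab_pair n \<mu> (u + u') s = tab_pair n \<mu> u s + tab_pair n \<mu> u' s"
  "tab_pair n \<mu> (vscale c u) s = pscale c (tab_pair n \<mu> u s)"
  "tab_pair n \<mu> u (s + s') = tab_pair n \<mu> u s + tab_pair n \<mu> u s'"
  "tab_pair n \<mu> u (pscale c s) = pscale c (tab_pair n \<mu> u s)"
  by (simp_all add: tab_pair_def lookup_add sum.distrib pscale_eq_mult zconst_simps algebra_simps sum_distrib_left)

lemma cf_tab_pair: "cf (tab_pair n \<mu> u s) k = (\<Sum>w\<in>cwords n \<mu>. cf s (word_tabloid \<mu> w) * coeff_fun k u w)"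
  by (simp add: tab_pair_def lookup_sum coeff_fun_def)

lemma tab_pair_hharm:
  assumes "\<And>w. cf u w \<in> hharm N m" shows "tab_pair n \<mu> u s \<in> hharm N m"
  unfolding tab_pair_def
  by (intro free_vs.subspace_sum[OF subspace_hharm] free_vs.subspace_scale[OF subspace_hharm] assms)

context
  fixes n N m :: nat and \<mu> :: "nat list"
  assumes n: "2 \<le> n" and \<mu>: "\<mu> \<in> partitions N" and len: "length \<mu> \<le> n"
begin

lemma dec: "sorted_wrt (\<ge>) \<mu>" and sum_\<mu>: "sum_list \<mu> = N"
  using \<mu> by (simp_all add: partitions_def)

private abbreviation "S \<equiv> carrier (specht \<mu>)"
private abbreviation "wt \<equiv> word_tabloid \<mu>"
private abbreviation "tact \<sigma> \<equiv> reindex (map (image \<sigma>))"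

lemma specht_span: "S = free_vs.span (polytabloid \<mu> ` tableaux \<mu>)"
  by (rule carrier_specht[OF len dec])

lemma specht_simps: "add (specht \<mu>) = (+)" "smult (specht \<mu>) = pscale" "act (specht \<mu>) \<sigma> = tact \<sigma>"
  by (simp_all add: specht_def tabloid_rep_def free_rep_def mk_rep_def pscale_def[abs_def])

lemma subspace_specht: "free_vs.subspace S"
  unfolding specht_span by (rule free_vs.subspace_span)

lemma specht_keys: "s \<in> S \<Longrightarrow> Poly_Mapping.keys s \<subseteq> wt ` cwords n \<mu>"
proof -
  assume s: "s \<in> S"
  have "free_vs.subspace (carrier (tabloid_rep \<mu>))"
    unfolding tabloid_rep_def by (rule concrete_space.Vsub[OF concrete_space_free_rep])
  moreover have "polytabloid \<mu> ` tableaux \<mu> \<subseteq> carrier (tabloid_rep \<mu>)"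
    using polytabloid_carrier[OF len dec] by blast
  ultimately have "S \<subseteq> carrier (tabloid_rep \<mu>)" unfolding specht_span by (intro free_vs.span_minimal)
  then show ?thesis using s unfolding carrier_tabloid_rep[OF len dec] by blast
qed

lemma cwords_words: "w \<in> cwords n \<mu> \<Longrightarrow> w \<in> words n N"
  by (simp add: cwords_def sum_\<mu>)

lemma cwords_permute: 
  assumes \<sigma>: "\<sigma> permutes {..<N}" and w: "w \<in> words n N"
  shows "permute_list \<sigma> w \<in> cwords n \<mu> \<longleftrightarrow> w \<in> cwords n \<mu>"
  using w words_permute_list[OF \<sigma> w] permute_list_content[OF \<sigma> w] by (simp add: cwords_def sum_\<mu>)

lemma word_tabloid_permute:
  assumes \<sigma>: "\<sigma> permutes {..<N}" and w: "w \<in> words n N"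
  shows "map (image \<sigma>) (wt (permute_list \<sigma> w)) = wt w"
proof -
  have "\<sigma> ` {p. p < N \<and> permute_list \<sigma> w ! p = i} = {p. p < N \<and> w ! p = i}" for i
  proof (intro equalityI subsetI)
    fix p assume "p \<in> {p. p < N \<and> w ! p = i}"
    then show "p \<in> \<sigma> ` {p. p < N \<and> permute_list \<sigma> w ! p = i}"
      using permutes_in_image[OF permutes_inv[OF \<sigma>], of p] permutes_inverses[OF \<sigma>] words_length[OF w] \<sigma>
      by (intro image_eqI[of _ _ "pinv \<sigma> p"]) (simp_all add: permute_list_nth)
  next
    fix p assume "p \<in> \<sigma> ` {p. p < N \<and> permute_list \<sigma> w ! p = i}"
    then obtain q where q: "q < N" "permute_list \<sigma> w ! q = i" "p = \<sigma> q" by blast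
    then show "p \<in> {p. p < N \<and> w ! p = i}"
      using permutes_in_image[OF \<sigma>, of q] words_length[OF w] \<sigma> by (simp add: permute_list_nth)
  qed
  then show ?thesis by (simp add: word_tabloid_def words_length[OF w])
qed

lemma cf_tact:
  assumes \<sigma>: "\<sigma> permutes {..<N}" and w: "w \<in> words n N"
  shows "cf (tact \<sigma> s) (wt w) = cf s (wt (permute_list \<sigma> w))"
proof -
  have "inj (image \<sigma>)" by (rule injI) (simp add: inj_image_eq_iff[OF permutes_inj[OF \<sigma>]])
  then have "inj (map (image \<sigma>))" by simp
  from cf_reindex_inj[OF this, of s "wt (permute_list \<sigma> w)"] show ?thesis
    unfolding word_tabloid_permute[OF \<sigma> w] .
qed

lemma word_coeff_inj:
  assumes "s \<in> carrier (tabloid_rep \<mu>)" "s' \<in> carrier (tabloid_rep \<mu>)" "word_coeff n \<mu> s = word_coeff n \<mu> s'"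
  shows "s = s'"
proof (rule poly_mapping_eqI)
  fix x show "cf s x = cf s' x"
  proof (cases "x \<in> wt ` cwords n \<mu>")
    case True
    then obtain w where "w \<in> cwords n \<mu>" "x = wt w" by blast
    then show ?thesis using fun_cong[OF assms(3), of w] by (simp add: word_coeff_def[OF len dec])
  next
    case False
    then have "x \<notin> Poly_Mapping.keys s" "x \<notin> Poly_Mapping.keys s'"
      using assms(1,2) unfolding carrier_tabloid_rep[OF len dec] by blast+
    then show ?thesis by (simp add: in_keys_iff)
  qed
qed

lemma specht_carrier: "s \<in> S \<Longrightarrow> s \<in> carrier (tabloid_rep \<mu>)"
  using specht_keys unfolding carrier_tabloid_rep[OF len dec] by blast

text \<open>Being a highest weight function is preserved by permuting positions, so stability
  follows from the kernel description of the Specht module.\<close>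

lemma tact_specht:
  assumes \<sigma>: "\<sigma> permutes {..<N}" and s: "s \<in> S" shows "tact \<sigma> s \<in> S"
proof -
  have keys: "Poly_Mapping.keys (tact \<sigma> s) \<subseteq> wt ` cwords n \<mu>"
  proof
    fix x assume "x \<in> Poly_Mapping.keys (tact \<sigma> s)"
    then obtain w where w: "w \<in> cwords n \<mu>" "x = map (image \<sigma>) (wt w)"
      using keys_reindex[of "map (image \<sigma>)" s] specht_keys[OF s] by blast
    note ww = cwords_words[OF w(1)]
    have v: "permute_list (pinv \<sigma>) w \<in> words n N" by (rule words_permute_list[OF permutes_inv[OF \<sigma>] ww])
    have p: "permute_list \<sigma> (permute_list (pinv \<sigma>) w) = w" by (rule permute_list_pinv[OF \<sigma> words_length[OF ww]])
    have "x = wt (permute_list (pinv \<sigma>) w)" using word_tabloid_permute[OF \<sigma> v] p w(2) by simp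
    moreover have "permute_list (pinv \<sigma>) w \<in> cwords n \<mu>" using cwords_permute[OF \<sigma> v] p w(1) by simp
    ultimately show "x \<in> wt ` cwords n \<mu>" by blast
  qed
  have wc: "word_coeff n \<mu> (tact \<sigma> s) w = word_coeff n \<mu> s (permute_list \<sigma> w)" if "w \<in> words n N" for w
    using cwords_permute[OF \<sigma> that] by (simp add: word_coeff_def[OF len dec] cf_tact[OF \<sigma> that])
  have "highest n N (word_coeff n \<mu> s)"
    using highest_span_polytabloids[OF len dec] s unfolding specht_span sum_\<mu> by blast
  then have "highest n N (word_coeff n \<mu> (tact \<sigma> s))"
    by (rule highest_cong[OF highest_permute[OF \<sigma>]]) (simp add: wc)
  moreover have "w \<in> cwords n \<mu>" if "word_coeff n \<mu> (tact \<sigma> s) w \<noteq> 0" for w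
    using that by (simp add: word_coeff_def[OF len dec] split: if_splits)
  ultimately obtain s' where s': "s' \<in> S" "word_coeff n \<mu> s' = word_coeff n \<mu> (tact \<sigma> s)"
    using highest_in_span_polytabloids[OF len dec, of "word_coeff n \<mu> (tact \<sigma> s)"] unfolding specht_span sum_\<mu> by blast
  have "tact \<sigma> s = s'"
    using keys specht_carrier[OF s'(1)] s'(2) by (intro word_coeff_inj) (simp_all add: carrier_tabloid_rep[OF len dec])
  then show ?thesis using s'(1) by simp
qed

lemma tact_inv:
  fixes s :: "nat set list \<Rightarrow>\<^sub>0 complex"
  shows "\<sigma> permutes {..<N} \<Longrightarrow> tact \<sigma> (tact (pinv \<sigma>) s) = s"
proof -
  assume "\<sigma> permutes {..<N}"
  then have "map (image \<sigma>) (map (image (pinv \<sigma>)) x) = x" for x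
    by (simp add: image_image permutes_inverses map_idI)
  then show ?thesis unfolding reindex_reindex by (intro reindex_id) simp
qed

lemma tab_pair_gact:
  assumes \<sigma>: "\<sigma> permutes {..<N}"
  shows "tab_pair n \<mu> (gact n N \<sigma> u) (tact \<sigma> s) = pact \<sigma> (tab_pair n \<mu> u s)"
proof -
  have bij: "bij_betw (permute_list \<sigma>) (cwords n \<mu>) (cwords n \<mu>)"
  proof (rule bij_betw_byWitness[where f' = "permute_list (pinv \<sigma>)"])
    note words = cwords_words and \<sigma>' = permutes_inv[OF \<sigma>]
    show "\<forall>w\<in>cwords n \<mu>. permute_list (pinv \<sigma>) (permute_list \<sigma> w) = w"
      "\<forall>w\<in>cwords n \<mu>. permute_list \<sigma> (permute_list (pinv \<sigma>) w) = w"
      using permute_list_pinv[OF \<sigma> words_length[OF words]] by auto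
    show "permute_list \<sigma> ` cwords n \<mu> \<subseteq> cwords n \<mu>" "permute_list (pinv \<sigma>) ` cwords n \<mu> \<subseteq> cwords n \<mu>"
      using cwords_permute[OF \<sigma> words] cwords_permute[OF \<sigma>' words] by auto
  qed
  have "tab_pair n \<mu> (gact n N \<sigma> u) (tact \<sigma> s)
    = (\<Sum>w\<in>cwords n \<mu>. pact \<sigma> (pscale (cf s (wt (permute_list \<sigma> w))) (cf u (permute_list \<sigma> w))))"
    unfolding tab_pair_def
    by (intro sum.cong refl) (simp add: cf_tact[OF \<sigma> cwords_words] cf_gact cwords_words reindex_pscale)
  also have "\<dots> = (\<Sum>w\<in>cwords n \<mu>. pact \<sigma> (pscale (cf s (wt w)) (cf u w)))"
    by (rule sum.reindex_bij_betw[OF bij])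
  finally show ?thesis by (simp add: tab_pair_def pact_sum)
qed

text \<open>The conjugated coefficient function of each monomial is again a highest weight function
  supported on \<open>cwords n \<mu>\<close>, hence comes from a Specht vector. Pairing
  \<open>u\<close> with that vector yields, at this monomial, the squared norm of the coefficients
  of \<open>u\<close>.\<close>

lemma tab_pair_eq_0:
  assumes supp: "\<And>w. cf u w \<noteq> 0 \<Longrightarrow> w \<in> cwords n \<mu>" and hi: "\<And>k. highest n N (coeff_fun k u)"
    and 0: "\<And>s. s \<in> S \<Longrightarrow> tab_pair n \<mu> u s = 0"
  shows "u = 0"
proof -
  have "coeff_fun k u w = 0" if w: "w \<in> cwords n \<mu>" for k w
  proof -
    have "\<exists>s\<in>S. word_coeff n \<mu> s = (\<lambda>w. cnj (coeff_fun k u w))"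
      unfolding specht_span
    proof (rule highest_in_span_polytabloids[OF len dec, unfolded sum_\<mu>])
      show "highest n N (\<lambda>w. cnj (coeff_fun k u w))" by (rule highest_cnj[OF hi])
      fix w assume "cnj (coeff_fun k u w) \<noteq> 0"
      then show "w \<in> cwords n \<mu>" using supp[of w] by (cases "cf u w = 0") (simp_all add: coeff_fun_def)
    qed
    then obtain s where s: "s \<in> S" and eq: "word_coeff n \<mu> s = (\<lambda>w. cnj (coeff_fun k u w))" by blast
    have "0 = cf (tab_pair n \<mu> u s) k" by (simp add: 0[OF s])
    also have "\<dots> = (\<Sum>w\<in>cwords n \<mu>. cnj (coeff_fun k u w) * coeff_fun k u w)"
      unfolding cf_tab_pair
    proof (intro sum.cong refl arg_cong2[where f = "(*)"])
      fix w assume "w \<in> cwords n \<mu>"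
      then show "cf s (wt w) = cnj (coeff_fun k u w)"
        using fun_cong[OF eq, of w] by (simp add: word_coeff_def[OF len dec])
    qed
    also have "\<dots> = of_real (\<Sum>w\<in>cwords n \<mu>. (cmod (coeff_fun k u w))\<^sup>2)"
      by (simp add: complex_norm_square mult.commute del: of_real_power)
    finally have "(\<Sum>w\<in>cwords n \<mu>. (cmod (coeff_fun k u w))\<^sup>2) = 0"
      using of_real_eq_0_iff by metis
    then have "\<forall>w\<in>cwords n \<mu>. (cmod (coeff_fun k u w))\<^sup>2 = 0"
      by (subst (asm) sum_nonneg_eq_0_iff) simp_all
    then show ?thesis using w by simp
  qed
  then have "cf u w = 0" if "w \<in> cwords n \<mu>" for w
    using that by (intro poly_mapping_eqI) (simp add: coeff_fun_def)
  then have "cf u w = 0" for w using supp[of w] by blast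
  then show ?thesis by (intro poly_mapping_eqI) simp
qed

lemma hw_space_simps:
  assumes "h \<in> hw_space n N m \<mu>"
  shows "cf h w \<in> hharm N m" "\<sigma> permutes {..<N} \<Longrightarrow> gact n N \<sigma> h = h" "cf h w \<noteq> 0 \<Longrightarrow> w \<in> cwords n \<mu>"
    "highest n N (coeff_fun k h)"
  using assms by (auto simp: hw_space_def harm_vectors_iff[OF n] hharm_def)

lemma subspace_hw_space: "vvs.subspace (hw_space n N m \<mu>)"
proof (rule vvs.subspaceI)
  have c0: "coeff_fun k 0 = (\<lambda>w. 0)" for k by (simp add: coeff_fun_def fun_eq_iff)
  show "0 \<in> hw_space n N m \<mu>"
    using vvs.subspace_0[OF subspace_harm_vectors[OF n]] by (simp add: hw_space_def c0 highest_def wop_def)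
next
  fix x y assume xy: "x \<in> hw_space n N m \<mu>" "y \<in> hw_space n N m \<mu>"
  have "coeff_fun k (x + y) = (\<lambda>w. coeff_fun k x w + 1 * coeff_fun k y w)" for k
    by (simp add: coeff_fun_def fun_eq_iff lookup_add)
  moreover have "highest n N (\<lambda>w. coeff_fun k x w + 1 * coeff_fun k y w)" for k
    by (intro highest_linear hw_space_simps xy)
  moreover have "w \<in> cwords n \<mu>" if "cf (x + y) w \<noteq> 0" for w
    using hw_space_simps(3)[OF xy(1), of w] hw_space_simps(3)[OF xy(2), of w] that by (cases "cf x w = 0") (simp_all add: lookup_add)
  ultimately show "x + y \<in> hw_space n N m \<mu>"
    using vvs.subspace_add[OF subspace_harm_vectors[OF n]] xy by (simp add: hw_space_def)
next
  fix c x assume x: "x \<in> hw_space n N m \<mu>"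
  have "coeff_fun k (vscale c x) = (\<lambda>w. 0 + c * coeff_fun k x w)" for k
    by (simp add: coeff_fun_def fun_eq_iff pscale_eq_mult[symmetric])
  moreover have "highest n N (\<lambda>w. 0 + c * coeff_fun k x w)" for k
    using hw_space_simps(4)[OF x] by (intro highest_linear) (simp_all add: highest_def wop_def)
  moreover have "w \<in> cwords n \<mu>" if "cf (vscale c x) w \<noteq> 0" for w
    using hw_space_simps(3)[OF x, of w] that by (cases "cf x w = 0") simp_all
  ultimately show "vscale c x \<in> hw_space n N m \<mu>"
    using vvs.subspace_scale[OF subspace_harm_vectors[OF n]] x by (simp add: hw_space_def)
qed

lemma specht_basis:
  obtains C where "free_hs.orthogonal_set C" "free_vs.span C = S"
proof -
  let ?B = "(\<lambda>x. Poly_Mapping.single x (1::complex)) ` wt ` cwords n \<mu>"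
  have "s \<in> free_vs.span ?B" if s: "s \<in> S" for s
  proof -
    have "Poly_Mapping.single x c \<in> free_vs.span ?B" if "x \<in> wt ` cwords n \<mu>" for x c
    proof -
      have "pscale c (Poly_Mapping.single x 1) \<in> free_vs.span ?B"
        by (intro free_vs.span_scale free_vs.span_base imageI that)
      moreover have "pscale c (Poly_Mapping.single x 1) = Poly_Mapping.single x c"
        by (rule poly_mapping_eqI) (simp add: lookup_single when_def)
      ultimately show ?thesis by simp
    qed
    then have "(\<Sum>x\<in>Poly_Mapping.keys s. Poly_Mapping.single x (cf s x)) \<in> free_vs.span ?B"
      using specht_keys[OF s] by (intro free_vs.span_sum) blast
    then show ?thesis by (simp only: poly_mapping_sum_single)
  qed
  then have "S \<subseteq> free_vs.span ?B" by blast
  then show thesis by (rule free_hs.exists_orthogonal_basis[OF subspace_specht]) (simp, rule that)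
qed

lemma coeff_gact:
  assumes "\<sigma> permutes {..<N}" "w \<in> words n N"
  shows "coeff_fun k (gact n N \<sigma> u) w = coeff_fun (kact (pinv \<sigma>) k) u (permute_list \<sigma> w)"
  using assms by (simp add: coeff_fun_def cf_gact cf_pact'[OF assms(1)])

text \<open>\<open>h\<close> represents \<open>\<Phi>\<close> by means of the Hermitian form, as in
  the Riesz theorem but with polynomial values; it is highest because conjugates of Specht
  coefficients are. Its invariance follows from uniqueness: since \<open>\<Phi>\<close> is
  equivariant, \<open>gact n N \<sigma> h\<close> pairs with every Specht vector as \<open>h\<close>
  does.\<close>

lemma exists_hw_of_equivariant:
  fixes \<Phi> :: "(nat set list \<Rightarrow>\<^sub>0 complex) \<Rightarrow> zpoly"
  assumes \<Phi>: "\<And>s. s \<in> S \<Longrightarrow> \<Phi> s \<in> hharm N m"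
    and \<Phi>_add: "\<And>s s'. s \<in> S \<Longrightarrow> s' \<in> S \<Longrightarrow> \<Phi> (s + s') = \<Phi> s + \<Phi> s'"
    and \<Phi>_scale: "\<And>c s. s \<in> S \<Longrightarrow> \<Phi> (pscale c s) = pscale c (\<Phi> s)"
    and \<Phi>_act: "\<And>\<sigma> s. \<sigma> permutes {..<N} \<Longrightarrow> s \<in> S \<Longrightarrow> \<Phi> (tact \<sigma> s) = pact \<sigma> (\<Phi> s)"
  shows "\<exists>h\<in>hw_space n N m \<mu>. \<forall>s\<in>S. tab_pair n \<mu> h s = \<Phi> s"
proof -
  obtain C where C: "free_hs.orthogonal_set C" "free_vs.span C = S" by (rule specht_basis)
  have finC: "finite C" using C(1) by (simp add: free_hs.orthogonal_set_def)
  have CS: "c \<in> S" if "c \<in> C" for c using C(2) free_vs.span_base[OF that] by simp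
  \<comment> \<open>Expanding \<open>s\<close> in the basis \<open>C\<close>, applying
    \<open>\<Phi>\<close> and collecting the factor of the coefficient of \<open>s\<close> at
    \<open>w\<close> leaves this polynomial.\<close>
  define hv where "hv w = (\<Sum>c\<in>C. pscale (cnj (cf c (wt w)) / pip c c) (\<Phi> c))" for w
  define h where "h = (\<Sum>w\<in>cwords n \<mu>. Poly_Mapping.single w (hv w))"
  have cfh: "cf h w = (if w \<in> cwords n \<mu> then hv w else 0)" for w
    by (simp add: h_def lookup_sum lookup_single when_def)
  have hv: "hv w \<in> hharm N m" for w
    unfolding hv_def by (intro free_vs.subspace_sum[OF subspace_hharm] free_vs.subspace_scale[OF subspace_hharm] \<Phi> CS)
  have hharm: "cf h w \<in> hharm N m" for w
    by (simp add: cfh hv free_vs.subspace_0[OF subspace_hharm])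
  have \<Phi>_sum: "\<Phi> (\<Sum>c\<in>D. pscale (a c) c) = (\<Sum>c\<in>D. pscale (a c) (\<Phi> c))" if "finite D" "D \<subseteq> C" for a D
    using that
  proof (induction D rule: finite_induct)
    case empty
    show ?case using \<Phi>_scale[OF free_vs.subspace_0[OF subspace_specht], of 0] by simp
  next
    case (insert c D)
    have "(\<Sum>c\<in>D. pscale (a c) c) \<in> S"
      using insert.prems CS by (intro free_vs.subspace_sum[OF subspace_specht] free_vs.subspace_scale[OF subspace_specht]) blast
    then show ?case
      using insert CS[of c] free_vs.subspace_scale[OF subspace_specht CS[of c]] by (simp add: \<Phi>_add \<Phi>_scale)
  qed
  have pair: "tab_pair n \<mu> h s = \<Phi> s" if s: "s \<in> S" for s
  proof (rule poly_mapping_eqI)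
    fix k
    have pip: "pip s c = (\<Sum>w\<in>cwords n \<mu>. cf s (wt w) * cnj (cf c (wt w)))" for c
      using specht_keys[OF s] pip_eq[of "wt ` cwords n \<mu>" s c]
      by (simp add: sum.reindex[OF inj_word_tabloid[OF len dec]])
    have "cf (tab_pair n \<mu> h s) k
      = (\<Sum>w\<in>cwords n \<mu>. \<Sum>c\<in>C. cf s (wt w) * cnj (cf c (wt w)) * (cf (\<Phi> c) k / pip c c))"
      unfolding cf_tab_pair by (intro sum.cong refl) (simp add: coeff_fun_def cfh hv_def lookup_sum sum_distrib_left mult.assoc)
    also have "\<dots> = (\<Sum>c\<in>C. \<Sum>w\<in>cwords n \<mu>. cf s (wt w) * cnj (cf c (wt w)) * (cf (\<Phi> c) k / pip c c))"
      by (rule sum.swap)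
    also have "\<dots> = (\<Sum>c\<in>C. pip s c * (cf (\<Phi> c) k / pip c c))"
      by (simp add: pip sum_distrib_right sum_divide_distrib)
    also have "\<dots> = cf (\<Sum>c\<in>C. pscale (pip s c / pip c c) (\<Phi> c)) k"
      by (simp add: lookup_sum)
    also have "(\<Sum>c\<in>C. pscale (pip s c / pip c c) (\<Phi> c)) = \<Phi> (free_hs.proj C s)"
      unfolding free_hs.proj_def by (rule \<Phi>_sum[OF finC order_refl, symmetric])
    also have "free_hs.proj C s = s"
      using free_hs.span_orthogonal_coeffs[OF C(1), of s] s C(2) by simp
    finally show "cf (tab_pair n \<mu> h s) k = cf (\<Phi> s) k" .
  qed
  have hi: "highest n N (coeff_fun k h)" for k
  proof (rule highest_cong)
    show "highest n N (\<lambda>w. \<Sum>c\<in>C. (cf (\<Phi> c) k / pip c c) * cnj (word_coeff n \<mu> c w))"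
      using highest_span_polytabloids[OF len dec, unfolded sum_\<mu>] CS
      unfolding specht_span by (intro highest_sum highest_cnj) blast
    show "(\<Sum>c\<in>C. (cf (\<Phi> c) k / pip c c) * cnj (word_coeff n \<mu> c w)) = coeff_fun k h w" for w
      by (simp add: coeff_fun_def cfh hv_def lookup_sum word_coeff_def[OF len dec] mult.commute)
  qed
  have supp: "w \<in> cwords n \<mu>" if "cf h w \<noteq> 0" for w using that by (simp add: cfh split: if_splits)
  have inv: "gact n N \<sigma> h = h" if \<sigma>: "\<sigma> permutes {..<N}" for \<sigma>
  proof -
    \<comment> \<open>Written with the scalar -1 so that \<open>highest_linear\<close> and the
      linearity of \<open>tab_pair\<close> apply directly.\<close>
    let ?d = "gact n N \<sigma> h + vscale (- 1) h"
    have "?d = 0"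
    proof (rule tab_pair_eq_0)
      fix w assume nz: "cf ?d w \<noteq> 0"
      show "w \<in> cwords n \<mu>"
      proof (rule ccontr)
        assume w: "w \<notin> cwords n \<mu>"
        then have "cf h w = 0" by (simp add: cfh)
        moreover have "cf (gact n N \<sigma> h) w = 0"
          using w cwords_permute[OF \<sigma>, of w] by (simp add: cf_gact cfh)
        ultimately show False using nz by (simp add: lookup_add lookup_minus)
      qed
    next
      fix k
      show "highest n N (coeff_fun k ?d)"
      proof (rule highest_cong)
        show "highest n N (\<lambda>w. coeff_fun (kact (pinv \<sigma>) k) h (permute_list \<sigma> w) + (- 1) * coeff_fun k h w)"
          by (intro highest_linear highest_permute[OF \<sigma> hi] hi)
        show "coeff_fun (kact (pinv \<sigma>) k) h (permute_list \<sigma> w) + (- 1) * coeff_fun k h w = coeff_fun k ?d w"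
          if "w \<in> words n N" for w
          unfolding coeff_gact[OF \<sigma> that, symmetric]
          by (simp add: coeff_fun_def lookup_add lookup_minus pscale_eq_mult[symmetric])
      qed
    next
      fix s assume s: "s \<in> S"
      have s': "tact (pinv \<sigma>) s \<in> S" by (rule tact_specht[OF permutes_inv[OF \<sigma>] s])
      have "tab_pair n \<mu> (gact n N \<sigma> h) s = pact \<sigma> (\<Phi> (tact (pinv \<sigma>) s))"
        using tab_pair_gact[OF \<sigma>, of h "tact (pinv \<sigma>) s"] by (simp only: tact_inv[OF \<sigma>] pair[OF s'])
      also have "\<dots> = \<Phi> s" using \<Phi>_act[OF \<sigma> s'] by (simp only: tact_inv[OF \<sigma>])
      finally have "tab_pair n \<mu> ?d s = \<Phi> s + pscale (- 1) (\<Phi> s)" by (simp only: tab_pair_linear pair[OF s])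
      also have "\<dots> = 0" by (rule poly_mapping_eqI) (simp add: lookup_add)
      finally show "tab_pair n \<mu> ?d s = 0" .
    qed
    moreover have "?d = gact n N \<sigma> h - h" by (rule poly_mapping_eqI) (simp add: lookup_add lookup_minus zconst_simps)
    ultimately show ?thesis by simp
  qed
  have "h \<in> V_carrier n N"
    unfolding V_carrier_iff using supp cwords_words hharm hharm_polys by blast
  then have "h \<in> hw_space n N m \<mu>"
    using hharm inv hi supp by (simp add: hw_space_def harm_vectors_iff[OF n] hharm_def)
  then show ?thesis using pair by blast
qed

definition hw_hom_of :: "zvec \<Rightarrow> (nat set list \<Rightarrow>\<^sub>0 complex) \<Rightarrow> zpoly set" where
  "hw_hom_of h = (\<lambda>s\<in>S. coset N (tab_pair n \<mu> h s))"

lemma tab_pair_hw: "h \<in> hw_space n N m \<mu> \<Longrightarrow> tab_pair n \<mu> h s \<in> hharm N m"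
  by (rule tab_pair_hharm) (rule hw_space_simps)

lemma multiplicity_space_simps:
  "f \<in> carrier (multiplicity_space N \<mu> m) \<longleftrightarrow> f \<in> extensional S \<and> (\<forall>s\<in>S. f s \<in> coset N ` hharm N m) \<and>
    (\<forall>s\<in>S. \<forall>s'\<in>S. f (s + s') = f s \<oplus>\<^bsub>R_deg N m\<^esub> f s') \<and> (\<forall>c. \<forall>s\<in>S. f (pscale c s) = c \<odot>\<^bsub>R_deg N m\<^esub> f s) \<and>
    (\<forall>\<sigma>\<in>perms N. \<forall>s\<in>S. f (tact \<sigma> s) = act (R_deg N m) \<sigma> (f s))"
  "f \<oplus>\<^bsub>multiplicity_space N \<mu> m\<^esub> g = (\<lambda>s\<in>S. f s \<oplus>\<^bsub>R_deg N m\<^esub> g s)"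
  "c \<odot>\<^bsub>multiplicity_space N \<mu> m\<^esub> f = (\<lambda>s\<in>S. c \<odot>\<^bsub>R_deg N m\<^esub> f s)"
  by (auto simp: multiplicity_space_def hom_space_def LinearCombinations.module_hom_def equivariant_def
      specht_simps R_deg_simps(1))

lemma hw_hom_of_linear:
  assumes h: "h \<in> hw_space n N m \<mu>" and h': "h' \<in> hw_space n N m \<mu>"
  shows "hw_hom_of (h + h') = hw_hom_of h \<oplus>\<^bsub>multiplicity_space N \<mu> m\<^esub> hw_hom_of h'"
    "hw_hom_of (vscale c h) = c \<odot>\<^bsub>multiplicity_space N \<mu> m\<^esub> hw_hom_of h"
  unfolding multiplicity_space_simps hw_hom_of_def
  by (intro restrict_ext, simp add: tab_pair_linear R_deg_simps tab_pair_hw h h')+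

text \<open>Injectivity comes from \<open>tab_pair_eq_0\<close>, surjectivity from
  \<open>exists_hw_of_equivariant\<close> applied to the harmonic representatives of the
  values.\<close>

lemma bij_hw_hom_of: "bij_betw hw_hom_of (hw_space n N m \<mu>) (carrier (multiplicity_space N \<mu> m))"
proof (rule bij_betw_imageI)
  note closed = free_vs.subspace_add[OF subspace_specht] free_vs.subspace_scale[OF subspace_specht]
  show "inj_on hw_hom_of (hw_space n N m \<mu>)"
  proof (rule inj_onI)
    fix h h' assume h: "h \<in> hw_space n N m \<mu>" and h': "h' \<in> hw_space n N m \<mu>" and eq: "hw_hom_of h = hw_hom_of h'"
    have d: "h - h' \<in> hw_space n N m \<mu>" by (rule vvs.subspace_diff[OF subspace_hw_space h h'])
    have "h - h' = 0"
    proof (rule tab_pair_eq_0[OF hw_space_simps(3)[OF d] hw_space_simps(4)[OF d]])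
      fix s assume s: "s \<in> S"
      have "tab_pair n \<mu> h s = tab_pair n \<mu> h' s"
        by (rule coset_inj[OF tab_pair_hw[OF h] tab_pair_hw[OF h']])
          (use fun_cong[OF eq, of s] s in \<open>simp add: hw_hom_of_def\<close>)
      moreover have "tab_pair n \<mu> h s = tab_pair n \<mu> (h - h') s + tab_pair n \<mu> h' s"
        unfolding tab_pair_linear(1)[symmetric] by simp
      ultimately show "tab_pair n \<mu> (h - h') s = 0" by simp
    qed
    then show "h = h'" by simp
  qed
  show "hw_hom_of ` hw_space n N m \<mu> = carrier (multiplicity_space N \<mu> m)"
  proof (intro equalityI subsetI)
    fix f assume "f \<in> hw_hom_of ` hw_space n N m \<mu>"
    then obtain h where h: "h \<in> hw_space n N m \<mu>" and f: "f = hw_hom_of h" by blast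
    have fs: "f s = coset N (tab_pair n \<mu> h s)" if "s \<in> S" for s using that by (simp add: f hw_hom_of_def)
    note th = tab_pair_hw[OF h]
    show "f \<in> carrier (multiplicity_space N \<mu> m)"
      unfolding multiplicity_space_simps(1)
    proof (intro conjI ballI allI)
      show "f \<in> extensional S" by (simp add: f hw_hom_of_def)
      fix s assume s: "s \<in> S"
      show "f s \<in> coset N ` hharm N m" using th by (simp add: fs[OF s])
      show "f (s + s') = f s \<oplus>\<^bsub>R_deg N m\<^esub> f s'" if "s' \<in> S" for s'
        using s that by (simp add: fs closed tab_pair_linear R_deg_simps(3)[OF th th])
      show "f (pscale c s) = c \<odot>\<^bsub>R_deg N m\<^esub> f s" for c
        using s by (simp add: fs closed tab_pair_linear R_deg_simps(4)[OF th])
    next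
      fix \<sigma> s assume "\<sigma> \<in> perms N" and s: "s \<in> S"
      then have \<sigma>: "\<sigma> permutes {..<N}" by simp
      have "tab_pair n \<mu> h (tact \<sigma> s) = pact \<sigma> (tab_pair n \<mu> h s)"
        using tab_pair_gact[OF \<sigma>, of h s] by (simp only: hw_space_simps(2)[OF h \<sigma>])
      then show "f (tact \<sigma> s) = act (R_deg N m) \<sigma> (f s)"
        by (simp add: fs s tact_specht[OF \<sigma> s] R_deg_simps(5)[OF \<sigma> th])
    qed
  next
    fix f assume f: "f \<in> carrier (multiplicity_space N \<mu> m)"
    note f' = f[unfolded multiplicity_space_simps(1)]
    define \<Phi> where "\<Phi> s = inv_into (hharm N m) (coset N) (f s)" for s
    have \<Phi>: "\<Phi> s \<in> hharm N m" "coset N (\<Phi> s) = f s" if "s \<in> S" for s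
      using f'[THEN conjunct2, THEN conjunct1, THEN bspec, OF that] unfolding \<Phi>_def
      by (rule inv_into_into, rule f_inv_into_f)
    have "\<exists>h\<in>hw_space n N m \<mu>. \<forall>s\<in>S. tab_pair n \<mu> h s = \<Phi> s"
    proof (rule exists_hw_of_equivariant)
      fix s assume s: "s \<in> S"
      show "\<Phi> s \<in> hharm N m" by (rule \<Phi>(1)[OF s])
      show "\<Phi> (pscale c s) = pscale c (\<Phi> s)" for c
      proof (rule coset_inj[OF \<Phi>(1)[OF closed(2)[OF s]] free_vs.subspace_scale[OF subspace_hharm \<Phi>(1)[OF s]]])
        have "coset N (\<Phi> (pscale c s)) = c \<odot>\<^bsub>R_deg N m\<^esub> coset N (\<Phi> s)"
          using f' s \<Phi>(2)[OF s] \<Phi>(2)[OF closed(2)[OF s]] by simp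
        then show "coset N (\<Phi> (pscale c s)) = coset N (pscale c (\<Phi> s))" by (simp only: R_deg_simps(4)[OF \<Phi>(1)[OF s]])
      qed
      show "\<Phi> (s + s') = \<Phi> s + \<Phi> s'" if s': "s' \<in> S" for s'
      proof (rule coset_inj[OF \<Phi>(1)[OF closed(1)[OF s s']] free_vs.subspace_add[OF subspace_hharm \<Phi>(1)[OF s] \<Phi>(1)[OF s']]])
        have "coset N (\<Phi> (s + s')) = coset N (\<Phi> s) \<oplus>\<^bsub>R_deg N m\<^esub> coset N (\<Phi> s')"
          using f' s s' \<Phi>(2)[OF s] \<Phi>(2)[OF s'] \<Phi>(2)[OF closed(1)[OF s s']] by simp
        then show "coset N (\<Phi> (s + s')) = coset N (\<Phi> s + \<Phi> s')"
          by (simp only: R_deg_simps(3)[OF \<Phi>(1)[OF s] \<Phi>(1)[OF s']])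
      qed
      show "\<Phi> (tact \<sigma> s) = pact \<sigma> (\<Phi> s)" if \<sigma>: "\<sigma> permutes {..<N}" for \<sigma>
      proof (rule coset_inj[OF \<Phi>(1)[OF tact_specht[OF \<sigma> s]] hharm_pact[OF \<sigma> \<Phi>(1)[OF s]]])
        have "coset N (\<Phi> (tact \<sigma> s)) = act (R_deg N m) \<sigma> (coset N (\<Phi> s))"
          using f' \<sigma> s \<Phi>(2)[OF s] \<Phi>(2)[OF tact_specht[OF \<sigma> s]] by simp
        then show "coset N (\<Phi> (tact \<sigma> s)) = coset N (pact \<sigma> (\<Phi> s))" by (simp only: R_deg_simps(5)[OF \<sigma> \<Phi>(1)[OF s]])
      qed
    qed
    then obtain h where h: "h \<in> hw_space n N m \<mu>" and eq: "\<forall>s\<in>S. tab_pair n \<mu> h s = \<Phi> s" by (rule bexE)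
    have "f s = hw_hom_of h s" if "s \<in> S" for s
      unfolding hw_hom_of_def restrict_apply'[OF that] bspec[OF eq that] \<Phi>(2)[OF that] ..
    moreover have "hw_hom_of h \<in> extensional S" unfolding hw_hom_of_def by (rule restrict_extensional)
    ultimately have "f = hw_hom_of h" by (intro extensionalityI[OF conjunct1[OF f']])
    then show "f \<in> hw_hom_of ` hw_space n N m \<mu>" using h by (rule image_eqI)
  qed
qed

end

lemma finite_partitions: "finite {\<mu> \<in> partitions N. length \<mu> \<le> n}"
proof (rule finite_subset[OF _ finite_lists_length_le[of "{..N}" n]])
  show "{\<mu> \<in> partitions N. length \<mu> \<le> n} \<subseteq> {xs. set xs \<subseteq> {..N} \<and> length xs \<le> n}"
    using member_le_sum_list by (auto simp: partitions_def)
qed simp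

theorem theorem4p4:
  fixes n N :: nat
    and \<pi> :: "nat list \<Rightarrow> (complex mat, 'v) rep"
  assumes "n \<ge> 2" and "N \<ge> 1"
    and "\<And>\<mu>. \<mu> \<in> partitions N \<Longrightarrow> length \<mu> \<le> n \<Longrightarrow>
           irreducible_sl_module n (\<pi> \<mu>) \<and> has_highest_weight n (\<pi> \<mu>) (partition_weight n \<mu>)"
  shows "graded_sl_isomorphic n
           (graded_tensor_product n N)
           (\<lambda>m. direct_sum_rep {\<mu> \<in> partitions N. length \<mu> \<le> n}
                  (\<lambda>\<mu>. tensor_rep (\<pi> \<mu>) (multiplicity_space N \<mu> m)))"
  unfolding graded_sl_isomorphic_def
proof
  fix m
  note n = assms(1)
  let ?I = "{\<mu> \<in> partitions N. length \<mu> \<le> n}"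
  let ?M = "\<lambda>\<mu>. multiplicity_space N \<mu> m"
  let ?A = "\<lambda>g. current_act N g 1"
  interpret U: unitary_sl vscale vip n "harm_vectors n N m" ?A
    by (rule unitary_harm_vectors[OF n])
  have HW: "U.HW (partition_weight n \<mu>) = hw_space n N m \<mu>" if "\<mu> \<in> ?I" for \<mu>
    using HW_iff[OF n] that by (auto simp: hw_space_def)
  have "\<exists>v. hw_mod n (\<pi> \<mu>) v (partition_weight n \<mu>)" if "\<mu> \<in> ?I" for \<mu>
  proof -
    have irr: "irreducible_sl_module n (\<pi> \<mu>)" and hw: "has_highest_weight n (\<pi> \<mu>) (partition_weight n \<mu>)"
      using assms(3)[of \<mu>] that by simp_all
    from hw obtain v where v: "v \<in> carrier (\<pi> \<mu>)" "v \<noteq> \<zero>\<^bsub>\<pi> \<mu>\<^esub>"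
      "\<forall>x\<in>sl_upper n. act (\<pi> \<mu>) x v = \<zero>\<^bsub>\<pi> \<mu>\<^esub>"
      "\<forall>h\<in>sl_diag n. act (\<pi> \<mu>) h v = partition_weight n \<mu> h \<odot>\<^bsub>\<pi> \<mu>\<^esub> v"
      unfolding has_highest_weight_def by blast
    have "sl_mod n (\<pi> \<mu>)" using irr by (intro sl_mod.intro) (simp add: irreducible_sl_module_def)
    then have "hw_mod n (\<pi> \<mu>) v (partition_weight n \<mu>)"
      by (intro hw_mod.intro hw_mod_axioms.intro irr) (simp_all add: v)
    then show ?thesis ..
  qed
  \<comment> \<open>One highest weight vector is chosen for each partition; all homomorphisms out of
    \<open>\<pi> \<mu>\<close> start from it.\<close>
  then obtain v where v: "\<And>\<mu>. \<mu> \<in> ?I \<Longrightarrow> hw_mod n (\<pi> \<mu>) (v \<mu>) (partition_weight n \<mu>)" by metis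
  define B where "B = {zterm a w | a w. a \<in> monoms N \<and> mdeg a = m \<and> w \<in> words n N}"
  note B = harm_vectors_fin_dim[OF n, of N m, folded B_def]
  \<comment> \<open>Equivariant maps from the Specht module are traded for highest weight vectors,
    the form in which \<open>tensor_hw\<close> expects the multiplicity space.\<close>
  define \<eta> where "\<eta> \<mu> = inv_into (hw_space n N m \<mu>) (hw_hom_of n N \<mu>)" for \<mu>
  have tensor: "tensor_hw vscale vip n (harm_vectors n N m) ?A (\<pi> \<mu>) (v \<mu>) (partition_weight n \<mu>) (?M \<mu>) (\<eta> \<mu>) B"
    if \<mu>: "\<mu> \<in> ?I" for \<mu>
  proof -
    have p: "\<mu> \<in> partitions N" "length \<mu> \<le> n" using \<mu> by simp_all
    note bij = bij_hw_hom_of[OF n p] and linear = hw_hom_of_linear[OF n p]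
      and sub = subspace_hw_space[OF n p]
    have \<eta>: "\<eta> \<mu> f \<in> hw_space n N m \<mu>" "hw_hom_of n N \<mu> (\<eta> \<mu> f) = f" if "f \<in> carrier (?M \<mu>)" for f
      using bij_betw_apply[OF bij_betw_inv_into[OF bij] that] bij_betw_inv_into_right[OF bij that]
      by (simp_all add: \<eta>_def)
    have \<eta>_eq: "\<eta> \<mu> (hw_hom_of n N \<mu> h) = h" "hw_hom_of n N \<mu> h \<in> carrier (?M \<mu>)" if "h \<in> hw_space n N m \<mu>" for h
      using bij_betw_inv_into_left[OF bij that] bij_betw_apply[OF bij that] by (simp_all add: \<eta>_def)
    have add: "f \<oplus>\<^bsub>?M \<mu>\<^esub> g \<in> carrier (?M \<mu>) \<and> \<eta> \<mu> (f \<oplus>\<^bsub>?M \<mu>\<^esub> g) = \<eta> \<mu> f + \<eta> \<mu> g"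
      if "f \<in> carrier (?M \<mu>)" "g \<in> carrier (?M \<mu>)" for f g
      using linear(1)[OF \<eta>(1)[OF that(1)] \<eta>(1)[OF that(2)]]
        \<eta>_eq[OF vvs.subspace_add[OF sub \<eta>(1)[OF that(1)] \<eta>(1)[OF that(2)]]] that by (simp add: \<eta>(2))
    have smult: "c \<odot>\<^bsub>?M \<mu>\<^esub> f \<in> carrier (?M \<mu>) \<and> \<eta> \<mu> (c \<odot>\<^bsub>?M \<mu>\<^esub> f) = vscale c (\<eta> \<mu> f)"
      if "f \<in> carrier (?M \<mu>)" for c f
      using linear(2)[OF \<eta>(1)[OF that] \<eta>(1)[OF that], of c] \<eta>_eq[OF vvs.subspace_scale[OF sub \<eta>(1)[OF that], of c]] that
      by (simp add: \<eta>(2))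
    have "bij_betw (\<eta> \<mu>) (carrier (?M \<mu>)) (U.HW (partition_weight n \<mu>))"
      unfolding HW[OF \<mu>] \<eta>_def by (rule bij_betw_inv_into[OF bij])
    then show ?thesis
      using add smult by (intro tensor_hw.intro tensor_hw_axioms.intro U.unitary_sl_axioms v \<mu> B) simp_all
  qed
  have family: "hw_family vscale vip n (harm_vectors n N m) ?A ?I \<pi> v (partition_weight n) ?M \<eta> B"
  proof (intro hw_family.intro hw_family_axioms.intro U.unitary_sl_axioms finite_partitions tensor B)
    show "vip h h' = 0" if "\<mu> \<in> ?I" "\<nu> \<in> ?I" "\<mu> \<noteq> \<nu>" "h \<in> U.HW (partition_weight n \<mu>)" "h' \<in> U.HW (partition_weight n \<nu>)" for \<mu> \<nu> h h'
      using HW_orthogonal[OF n _ _ _ _ that(3-5)] that(1,2) by simp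
    show "u = 0" if "vvs.subspace S" "S \<subseteq> harm_vectors n N m" "\<And>g u. g \<in> sl n \<Longrightarrow> u \<in> S \<Longrightarrow> ?A g u \<in> S"
      "\<And>u \<mu> h. u \<in> S \<Longrightarrow> \<mu> \<in> ?I \<Longrightarrow> h \<in> U.HW (partition_weight n \<mu>) \<Longrightarrow> vip u h = 0" "u \<in> S" for S u
      using HW_separating[OF n that(2,3) _ that(5)] that(4) by simp
  qed
  \<comment> \<open>Both sides are now in linear equivariant bijection with
    \<open>harm_vectors n N m\<close>, one by \<open>tensor_inv\<close> and the other by summing the
    values of its components.\<close>
  note W = graded_tensor_product_harm_vectors[OF n, where N = N and m = m] and D = hw_family.direct_sum_T[OF family]
  show "sl_isomorphic n (graded_tensor_product n N m) (direct_sum_rep ?I (\<lambda>\<mu>. tensor_rep (\<pi> \<mu>) (?M \<mu>)))"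
    by (rule sl_isomorphic_via[OF W(1) D(1) W(2) D(2), where s = vscale and A = ?A]) (assumption | rule W(3-5) D(3-5))+
qed

end
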